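(* Let $\mathcal{P}=(P,d\mu,d\sigma)$ be an $n$-dimensional K-unstable system with $n\ge2$, and let $\mathcal{P}_R=(P_R,d\mu_R,d\sigma_R)$ be a mild K-unstable system. Fix $U\in\mathfrak{U}^*_{\mathcal{P}}$ and $T_R\in[0,\infty)$. For $N\in\mathbb{N}$ let $\tilde{\mathcal{P}}_N:=\mathcal{P}\times\mathcal{P}_R^{\times N}$ and let $\tilde{u}_N$ be the equilibrium of internal $\mu$-energy $U+N\,U^{\mathrm{can}}_{\mathcal{P}_R}(T_R)$ on $\tilde{\mathcal{P}}_N$. Define \[ u_N(x):=\frac{1}{\int_{P_R^{\times N}}d\mu_R^{\times N}}\int_{P_R^{\times N}}\tilde{u}_N(x,y)\,d\mu_R^{\times N}(y)\in\mathcal{M}^1(P). \] Then $u_N$ converges in $L^p(P,d\mu)$ for every $p\in[1,\frac{n}{n-1})$ to the $\mu$-canonical distribution $u^{\mathrm{can}}_{T_R}$ of $\mathcal{P}$ of temperature $T_R$ (in particular the limit is independent of $U$).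
   Context: An $n$-dimensional system is a triple $\mathcal{P}=(P,d\mu,d\sigma)$ where $P$ is a simple polytope in an $n$-dimensional real affine space $V$ (a compact subset with non-empty interior that is a finite intersection of closed half spaces, such that every vertex is the intersection of exactly $n$ facets), $d\mu$ is the restriction to $P$ of a translation-invariant measure on $V$ that is positive and finite on bounded non-empty open sets (i.e. a positive multiple of Lebesgue measure), and $d\sigma$ is a measure on the boundary $\partial P$ whose restriction to each facet is a positive multiple of the Lebesgue measure of the affine hyperplane spanned by that facet. For $p\ge1$, $\mathcal{M}^p(P)$ is the set of lower semicontinuous functions $u:P\to(0,\infty]$ that are log-convex ($u((1-t)x+ty)\le u(x)^{1-t}u(y)^t$ for $x,y\in P$, $t\in[0,1]$) and satisfy $\int_P u\,d\mu=\int_P d\mu$ and $\int_P u^p\,d\mu<\infty$. For $u\in\mathcal{M}^1(P)$: entropy $S_{\mathcal{P}}(u):=-\frac{1}{\int_Pd\mu}\int_P u\log u\,d\mu\in[-\infty,0]$; internal $\mu$-energy $U_{\mathcal{P}}(u):=\frac{1}{\int_Pd\mu}\int_{\partial P}u\,d\sigma\in(0,\infty]$; free $\mu$-energy $F_{\mathcal{P}}(T,u):=U_{\mathcal{P}}(u)-TS_{\mathcal{P}}(u)$ if $S_{\mathcal{P}}(u)>-\infty$, else $+\infty$. The $\mu$-canonical distribution of temperature $T>0$ is the unique minimizer $u^{\mathrm{can}}_T$ of $F_{\mathcal{P}}(T,\cdot)$ on $\mathcal{M}^1(P)$; $u^{\mathrm{can}}_0$ is the unique minimizer of $U_{\mathcal{P}}$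 with maximal entropy among minimizers of $U_{\mathcal{P}}$. The equilibrium of internal $\mu$-energy $U$ is the unique maximizer of $S_{\mathcal{P}}$ on $\{u\in\mathcal{M}^1(P):U_{\mathcal{P}}(u)=U\}$ (it exists for $U\in[\min U_{\mathcal{P}},U_{\mathcal{P}}(1_P)]$). The composite system of $\mathcal{P}_1,\mathcal{P}_2$ is $\mathcal{P}_1\times\mathcal{P}_2:=(P_1\times P_2,d\mu_1\times d\mu_2,d\sigma_1\times d\mu_2+d\mu_1\times d\sigma_2)$, and $\mathcal{P}_R^{\times N}$ is the $N$-fold iterated composite. $\mathcal{P}$ is K-unstable if $\min_{\mathcal{M}^1(P)}U_{\mathcal{P}}<U_{\mathcal{P}}(1_P)$ ($1_P$ the constant $1$), and then $\mathfrak{U}^*_{\mathcal{P}}:=[\min U_{\mathcal{P}},U_{\mathcal{P}}(1_P))$. Let $S^{\mathrm{eq}}_{\mathcal{P}}(U):=\sup\{S_{\mathcal{P}}(u):U_{\mathcal{P}}(u)=U\}$ (concave in $U$), and $\mathbb{T}^{\mathrm{eq}}_{\mathcal{P}}(U):=[1/\partial_{U-}S^{\mathrm{eq}}_{\mathcal{P}}(U),\,1/\partial_{U+}S^{\mathrm{eq}}_{\mathcal{P}}(U)]$ with $1/(+\infty):=0$. A K-unstable system is mild if $\mathbb{T}^{\mathrm{eq}}_{\mathcal{P}}(U)$ is a single point for every $U\in\mathfrak{U}^*_{\mathcal{P}}$. For a K-unstable system and $T\in[0,\infty)$, $U^{\mathrm{can}}_{\mathcal{P}}(T)$ denotes the unique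 $U\in\mathfrak{U}^*_{\mathcal{P}}$ with $T\in\mathbb{T}^{\mathrm{eq}}_{\mathcal{P}}(U)$ (equivalently $U^{\mathrm{can}}_{\mathcal{P}}(T)=U_{\mathcal{P}}(u^{\mathrm{can}}_T)$). *)

theory Defs
  imports "HOL-Analysis.Analysis"
begin

text \<open>Real powers of extended nonnegative reals (used for values in (0,\<infinity>]).\<close>
definition enn_powr :: "ennreal \<Rightarrow> real \<Rightarrow> ennreal" where
  "enn_powr a s = (if a = \<infinity> then (if s = 0 then 1 else \<infinity>) else ennreal (enn2real a powr s))"

definition xlogx :: "ennreal \<Rightarrow> ereal" where
  "xlogx a = (if a = \<infinity> then \<infinity> else ereal (enn2real a * ln (enn2real a)))"

definition cmb_lin :: "real \<Rightarrow> 'x::real_vector \<Rightarrow> 'x \<Rightarrow> 'x" where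
  "cmb_lin t x y = (1 - t) *\<^sub>R x + t *\<^sub>R y"

text \<open>Affine combination in V1 x V2^N, points of V2^N being represented as
  functions nat => V2 (extensional on {..<N}).\<close>
definition cmb_prod :: "real \<Rightarrow> ('x::real_vector \<times> (nat \<Rightarrow> 'y::real_vector))
      \<Rightarrow> ('x \<times> (nat \<Rightarrow> 'y)) \<Rightarrow> ('x \<times> (nat \<Rightarrow> 'y))" where
  "cmb_prod t z w = (cmb_lin t (fst z) (fst w), \<lambda>i. cmb_lin t (snd z i) (snd w i))"

definition lsc_on :: "'x::topological_space set \<Rightarrow> ('x \<Rightarrow> ennreal) \<Rightarrow> bool" where
  "lsc_on P u \<longleftrightarrow> (\<forall>x\<in>P. \<forall>c. c < u x \<longrightarrow> eventually (\<lambda>y. c < u y) (at x within P))"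

definition log_convex_on ::
    "(real \<Rightarrow> 'x \<Rightarrow> 'x \<Rightarrow> 'x) \<Rightarrow> 'x set \<Rightarrow> ('x \<Rightarrow> ennreal) \<Rightarrow> bool" where
  "log_convex_on cmb P u \<longleftrightarrow>
     (\<forall>x\<in>P. \<forall>y\<in>P. \<forall>t\<in>{0..1}. u (cmb t x y) \<le> enn_powr (u x) (1 - t) * enn_powr (u y) t)"

definition total_mass :: "'x measure \<Rightarrow> ennreal" where
  "total_mass M = emeasure M (space M)"

text \<open>The class M^p(P).  mu is a measure on the ambient space supported on P.\<close>
definition M_class :: "(real \<Rightarrow> 'x \<Rightarrow> 'x \<Rightarrow> 'x) \<Rightarrow> 'x::topological_space set \<Rightarrow> 'x measure
     \<Rightarrow> real \<Rightarrow> ('x \<Rightarrow> ennreal) set" where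
  "M_class cmb P mu p = {u. (\<forall>x\<in>P. 0 < u x) \<and> lsc_on P u \<and> log_convex_on cmb P u \<and>
      u \<in> borel_measurable mu \<and> (\<integral>\<^sup>+ x. u x \<partial>mu) = total_mass mu \<and>
      (\<integral>\<^sup>+ x. enn_powr (u x) p \<partial>mu) < \<infinity>}"

definition entropy :: "'x measure \<Rightarrow> ('x \<Rightarrow> ennreal) \<Rightarrow> ereal" where
  "entropy mu u = - (enn2ereal (\<integral>\<^sup>+ x. e2ennreal (xlogx (u x)) \<partial>mu)
                     - enn2ereal (\<integral>\<^sup>+ x. e2ennreal (- xlogx (u x)) \<partial>mu))
                  / enn2ereal (total_mass mu)"

definition int_energy :: "'x measure \<Rightarrow> 'x measure \<Rightarrow> ('x \<Rightarrow> ennreal) \<Rightarrow> ennreal" where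
  "int_energy mu bd u = (\<integral>\<^sup>+ x. u x \<partial>bd) / total_mass mu"

definition free_energy :: "'x measure \<Rightarrow> 'x measure \<Rightarrow> real \<Rightarrow> ('x \<Rightarrow> ennreal) \<Rightarrow> ereal" where
  "free_energy mu bd T u =
     (if entropy mu u = - \<infinity> then \<infinity>
      else enn2ereal (int_energy mu bd u) - ereal T * entropy mu u)"

definition is_canonical :: "(real \<Rightarrow> 'x \<Rightarrow> 'x \<Rightarrow> 'x) \<Rightarrow> 'x::topological_space set \<Rightarrow> 'x measure
     \<Rightarrow> 'x measure \<Rightarrow> real \<Rightarrow> ('x \<Rightarrow> ennreal) \<Rightarrow> bool" where
  "is_canonical cmb P mu bd T u \<longleftrightarrow> u \<in> M_class cmb P mu 1 \<and>
     (if 0 < T then (\<forall>v\<in>M_class cmb P mu 1. free_energy mu bd T u \<le> free_energy mu bd T v)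
      else (\<forall>v\<in>M_class cmb P mu 1. int_energy mu bd u \<le> int_energy mu bd v) \<and>
           (\<forall>v\<in>M_class cmb P mu 1.
               (\<forall>w\<in>M_class cmb P mu 1. int_energy mu bd v \<le> int_energy mu bd w)
               \<longrightarrow> entropy mu v \<le> entropy mu u))"

definition is_equilibrium :: "(real \<Rightarrow> 'x \<Rightarrow> 'x \<Rightarrow> 'x) \<Rightarrow> 'x::topological_space set \<Rightarrow> 'x measure
     \<Rightarrow> 'x measure \<Rightarrow> real \<Rightarrow> ('x \<Rightarrow> ennreal) \<Rightarrow> bool" where
  "is_equilibrium cmb P mu bd E u \<longleftrightarrow> u \<in> M_class cmb P mu 1 \<and>
     int_energy mu bd u = ennreal E \<and>
     (\<forall>v\<in>M_class cmb P mu 1. int_energy mu bd v = ennreal E \<longrightarrow> entropy mu v \<le> entropy mu u)"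

definition min_energy :: "(real \<Rightarrow> 'x \<Rightarrow> 'x \<Rightarrow> 'x) \<Rightarrow> 'x::topological_space set \<Rightarrow> 'x measure
     \<Rightarrow> 'x measure \<Rightarrow> ennreal" where
  "min_energy cmb P mu bd = (INF u\<in>M_class cmb P mu 1. int_energy mu bd u)"

definition K_unstable :: "(real \<Rightarrow> 'x \<Rightarrow> 'x \<Rightarrow> 'x) \<Rightarrow> 'x::topological_space set \<Rightarrow> 'x measure
     \<Rightarrow> 'x measure \<Rightarrow> bool" where
  "K_unstable cmb P mu bd \<longleftrightarrow> min_energy cmb P mu bd < int_energy mu bd (\<lambda>_. 1)"

definition U_star :: "(real \<Rightarrow> 'x \<Rightarrow> 'x \<Rightarrow> 'x) \<Rightarrow> 'x::topological_space set \<Rightarrow> 'x measure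
     \<Rightarrow> 'x measure \<Rightarrow> real set" where
  "U_star cmb P mu bd = {E. 0 \<le> E \<and> min_energy cmb P mu bd \<le> ennreal E \<and>
                               ennreal E < int_energy mu bd (\<lambda>_. 1)}"

definition S_eq :: "(real \<Rightarrow> 'x \<Rightarrow> 'x \<Rightarrow> 'x) \<Rightarrow> 'x::topological_space set \<Rightarrow> 'x measure
     \<Rightarrow> 'x measure \<Rightarrow> real \<Rightarrow> ereal" where
  "S_eq cmb P mu bd E =
     Sup {entropy mu u | u. u \<in> M_class cmb P mu 1 \<and> int_energy mu bd u = ennreal E}"

definition dS_left :: "(real \<Rightarrow> 'x \<Rightarrow> 'x \<Rightarrow> 'x) \<Rightarrow> 'x::topological_space set \<Rightarrow> 'x measure
     \<Rightarrow> 'x measure \<Rightarrow> real \<Rightarrow> ereal" where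
  "dS_left cmb P mu bd E =
     Lim (at_left E) (\<lambda>E'. (S_eq cmb P mu bd E - S_eq cmb P mu bd E') / ereal (E - E'))"

definition dS_right :: "(real \<Rightarrow> 'x \<Rightarrow> 'x \<Rightarrow> 'x) \<Rightarrow> 'x::topological_space set \<Rightarrow> 'x measure
     \<Rightarrow> 'x measure \<Rightarrow> real \<Rightarrow> ereal" where
  "dS_right cmb P mu bd E =
     Lim (at_right E) (\<lambda>E'. (S_eq cmb P mu bd E' - S_eq cmb P mu bd E) / ereal (E' - E))"

text \<open>T^eq(U) = [1/d_- S^eq(U), 1/d_+ S^eq(U)], with 1/(+\<infinity>) = 0 (ereal inverse).\<close>
definition T_eq :: "(real \<Rightarrow> 'x \<Rightarrow> 'x \<Rightarrow> 'x) \<Rightarrow> 'x::topological_space set \<Rightarrow> 'x measure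
     \<Rightarrow> 'x measure \<Rightarrow> real \<Rightarrow> ereal set" where
  "T_eq cmb P mu bd E = {inverse (dS_left cmb P mu bd E) .. inverse (dS_right cmb P mu bd E)}"

definition mild :: "(real \<Rightarrow> 'x \<Rightarrow> 'x \<Rightarrow> 'x) \<Rightarrow> 'x::topological_space set \<Rightarrow> 'x measure
     \<Rightarrow> 'x measure \<Rightarrow> bool" where
  "mild cmb P mu bd \<longleftrightarrow> K_unstable cmb P mu bd \<and>
     (\<forall>E\<in>U_star cmb P mu bd. \<exists>T. T_eq cmb P mu bd E = {T})"

text \<open>A positive multiple of the Lebesgue measure of the affine hyperplane {x. a.x = b}:
  the push-forward, under the orthogonal projection onto the hyperplane, of Lebesgue
  measure restricted to the slab {b <= a.x <= b+1} (of width 1/|a|).\<close>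
definition hyperplane_lebesgue :: "'a::euclidean_space \<Rightarrow> real \<Rightarrow> 'a measure" where
  "hyperplane_lebesgue a b =
     distr (density lborel (indicator {x. b \<le> a \<bullet> x \<and> a \<bullet> x \<le> b + 1})) borel
           (\<lambda>x. x - ((a \<bullet> x - b) / (a \<bullet> a)) *\<^sub>R a)"

definition simple_polytope :: "'a::euclidean_space set \<Rightarrow> bool" where
  "simple_polytope P \<longleftrightarrow> compact P \<and> interior P \<noteq> {} \<and> polyhedron P \<and>
     (\<forall>v. v extreme_point_of P \<longrightarrow> card {F. F facet_of P \<and> v \<in> F} = DIM('a))"

definition is_system :: "'a::euclidean_space set \<Rightarrow> 'a measure \<Rightarrow> 'a measure \<Rightarrow> bool" where
  "is_system P mu bd \<longleftrightarrow> simple_polytope P \<and>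
     (\<exists>c>0. mu = density lborel (\<lambda>x. ennreal c * indicator P x)) \<and>
     sets bd = sets borel \<and> emeasure bd (UNIV - frontier P) = 0 \<and>
     (\<forall>F. F facet_of P \<longrightarrow> (\<exists>c>0. \<exists>a b. a \<noteq> 0 \<and> affine hull F = {x. a \<bullet> x = b} \<and>
         density bd (indicator F) = density (hyperplane_lebesgue a b) (\<lambda>x. ennreal c * indicator F x)))"

definition meas_sum :: "'x measure \<Rightarrow> 'i set \<Rightarrow> ('i \<Rightarrow> 'x measure) \<Rightarrow> 'x measure" where
  "meas_sum S I M = measure_of (space S) (sets S) (\<lambda>A. \<Sum>i\<in>I. emeasure (M i) A)"

definition iter_set :: "'b set \<Rightarrow> nat \<Rightarrow> (nat \<Rightarrow> 'b) set" where
  "iter_set PR N = PiE {..<N} (\<lambda>_. PR)"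

definition iter_mu :: "'b measure \<Rightarrow> nat \<Rightarrow> (nat \<Rightarrow> 'b) measure" where
  "iter_mu muR N = PiM {..<N} (\<lambda>_. muR)"

text \<open>Boundary measure of the N-fold iterated composite (the iterated definition unrolled).\<close>
definition iter_sigma :: "'b measure \<Rightarrow> 'b measure \<Rightarrow> nat \<Rightarrow> (nat \<Rightarrow> 'b) measure" where
  "iter_sigma muR bdR N =
     meas_sum (iter_mu muR N) {..<N} (\<lambda>i. PiM {..<N} (\<lambda>j. if j = i then bdR else muR))"

definition comp_set :: "'a set \<Rightarrow> 'b set \<Rightarrow> nat \<Rightarrow> ('a \<times> (nat \<Rightarrow> 'b)) set" where
  "comp_set P PR N = P \<times> iter_set PR N"

definition comp_mu :: "'a measure \<Rightarrow> 'b measure \<Rightarrow> nat \<Rightarrow> ('a \<times> (nat \<Rightarrow> 'b)) measure" where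
  "comp_mu mu muR N = mu \<Otimes>\<^sub>M iter_mu muR N"

definition comp_sigma :: "'a measure \<Rightarrow> 'a measure \<Rightarrow> 'b measure \<Rightarrow> 'b measure \<Rightarrow> nat
     \<Rightarrow> ('a \<times> (nat \<Rightarrow> 'b)) measure" where
  "comp_sigma mu bd muR bdR N =
     meas_sum (comp_mu mu muR N) {0::nat, 1}
       (\<lambda>i. if i = 0 then bd \<Otimes>\<^sub>M iter_mu muR N else mu \<Otimes>\<^sub>M iter_sigma muR bdR N)"

definition marginal :: "'b measure \<Rightarrow> nat \<Rightarrow> ('a \<times> (nat \<Rightarrow> 'b) \<Rightarrow> ennreal) \<Rightarrow> 'a \<Rightarrow> ennreal" where
  "marginal muR N u x = (\<integral>\<^sup>+ y. u (x, y) \<partial>iter_mu muR N) / total_mass (iter_mu muR N)"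

definition Lp_dist_p :: "'a measure \<Rightarrow> real \<Rightarrow> ('a \<Rightarrow> ennreal) \<Rightarrow> ('a \<Rightarrow> ennreal) \<Rightarrow> ennreal" where
  "Lp_dist_p mu p f g = (\<integral>\<^sup>+ x. ennreal (\<bar>enn2real (f x) - enn2real (g x)\<bar> powr p) \<partial>mu)"

end

(* On the composite system the energy of the equilibrium is exactly the energy of its marginal
   u_N on P plus N times that of the averaged marginal on P_R, and by Gibbs' inequality its
   entropy is at most the corresponding sum of entropies.  Comparison with the product states
   ucan * q^N of the same total energy, together with the fact that the entropy of a mild
   reservoir has slope 1/T_R at U_R, shows that u_N is a minimizing sequence for the free
   energy of temperature T_R.  At T_R = 0 it minimizes the energy, while its entropy is
   asymptotically at least that of ucan, and upper semicontinuity of the entropy at the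
   minimum of the energy takes over.  Strict convexity of x ln x turns both statements into
   L^1 convergence.  A log-convex function is bounded along chords by its boundary values,
   hence bounded energy bounds the L^q norm for q < n/(n-1), and interpolation between
   L^1 and L^q gives convergence in L^p. *)
theory Submission
  imports Defs
begin

subsection \<open>Powers and log-convexity\<close>

text \<open>No limit of the marginals is ever extracted. Since \<open>ucan\<close> is given, each
  marginal is compared with it through their midpoint: the midpoint cannot have smaller free energy
  than \<open>ucan\<close> (at temperature 0: not much larger entropy at nearly minimal energy), so
  the midpoint defect of \<open>x ln x\<close> tends to 0, and an explicit inequality turns this
  defect into an L^1 distance. A limit has to be constructed only at the minimum of the energy.
  There a minimizing sequence is Cauchy by the same inequality; the difficulty is its limit, known
  only almost everywhere on \<open>P\<close>, whereas the energy lives on the null set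
  \<open>frontier P\<close>.

  Mildness gives both one-sided slopes of the reservoir entropy the value 1/T_R. Both are needed,
  because the energy handed to the reservoir may have either sign.

  The exponent n/(n-1) comes from \<open>u \<le> C d powr (1 - n)\<close>, with \<open>d\<close> the
  distance to the facet hyperplanes: a ball of radius \<open>d\<close> has volume of order
  \<open>d^n\<close>, while the integral of \<open>u\<close> over it is only of order
  \<open>d\<close>, because \<open>u\<close> is compared with its boundary values along one fixed
  direction transversal to all facets.\<close>

lemma enn_powr_one [simp]: "enn_powr a 1 = a"
  by (cases a) (auto simp: enn_powr_def)

lemma enn_powr_0 [simp]: "enn_powr 0 s = 0"
  by (simp add: enn_powr_def)

lemma enn_powr_pos: "0 < a \<Longrightarrow> 0 < enn_powr a s"
  by (cases a) (auto simp: enn_powr_def ennreal_less_zero_iff)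

text \<open>Positivity matters here: \<open>0 powr 0 = 0\<close>, so \<open>enn_powr 0 0\<close> is
  0 and not 1. For this reason several proofs of log-convexity split off the weights
  \<open>t = 0\<close> and \<open>t = 1\<close> and have to know beforehand that the function is
  positive.\<close>

lemma enn_powr_exp_0: "0 < a \<Longrightarrow> enn_powr a 0 = 1"
  by (cases a) (auto simp: enn_powr_def ennreal_less_zero_iff)

lemma enn_powr_top: "enn_powr top s = (if s = 0 then 1 else top)"
  by (simp add: enn_powr_def)

lemma enn_powr_ennreal: "0 \<le> r \<Longrightarrow> enn_powr (ennreal r) s = ennreal (r powr s)"
  by (simp add: enn_powr_def)

lemma enn_powr_mult:
  assumes "0 < a" "0 < b" "0 \<le> s"
  shows "enn_powr (a * b) s = enn_powr a s * enn_powr b s"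
proof (cases "s = 0")
  case True
  then show ?thesis using assms by (simp add: enn_powr_exp_0 ennreal_zero_less_mult_iff)
next
  case False
  show ?thesis
  proof (cases "a = \<infinity> \<or> b = \<infinity>")
    case True
    then show ?thesis
      using assms False enn_powr_pos[of a s] enn_powr_pos[of b s]
      by (auto simp: enn_powr_top ennreal_mult_top ennreal_top_mult)
  next
    case F: False
    then obtain r r' where "a = ennreal r" "b = ennreal r'" "0 \<le> r" "0 \<le> r'"
      by (metis ennreal_cases infinity_ennreal_def)
    then show ?thesis
      by (simp add: enn_powr_ennreal powr_mult flip: ennreal_mult)
  qed
qed

lemma enn_powr_mono:
  assumes "a \<le> b" "0 \<le> s"
  shows "enn_powr a s \<le> enn_powr b s"
proof (cases "b = \<infinity>")
  case True
  show ?thesis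
  proof (cases "s = 0")
    case T: True
    then show ?thesis using True
      by (auto simp: enn_powr_def intro!: ennreal_le_1[THEN iffD2] split: if_splits)
  qed (simp add: True enn_powr_top)
next
  case False
  with assms obtain r r' where "a = ennreal r" "b = ennreal r'" "0 \<le> r" "0 \<le> r'"
    by (metis ennreal_cases infinity_ennreal_def top.extremum_uniqueI)
  then show ?thesis using assms by (simp add: enn_powr_ennreal powr_mono2)
qed

lemma borel_measurable_enn_powr [measurable]:
  assumes [measurable]: "f \<in> borel_measurable M"
  shows "(\<lambda>x. enn_powr (f x) s) \<in> borel_measurable M"
  unfolding enn_powr_def by measurable

text \<open>For inner weights an infinite argument makes the right-hand side infinite too; the
  finite case is the weighted inequality between geometric and arithmetic mean.\<close>

lemma enn_powr_Young:
  assumes "0 < t" "t < 1"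
  shows "enn_powr a (1 - t) * enn_powr b t \<le> ennreal (1 - t) * a + ennreal t * b"
proof (cases "a = \<infinity> \<or> b = \<infinity>")
  case True
  then have "ennreal (1 - t) * a + ennreal t * b = \<infinity>"
    using assms by (auto simp: ennreal_mult_top)
  then show ?thesis by (simp only: infinity_ennreal_def top_greatest)
next
  case False
  then obtain r r' where r: "a = ennreal r" "b = ennreal r'" "0 \<le> r" "0 \<le> r'"
    by (metis ennreal_cases infinity_ennreal_def)
  have "r powr (1 - t) * r' powr t \<le> (1 - t) * r + t * r'"
  proof (cases "r = 0 \<or> r' = 0")
    case False
    then show ?thesis using r assms by (intro Youngs_inequality_0) auto
  qed (use r assms in auto)
  then show ?thesis
    using r assms by (simp add: enn_powr_ennreal flip: ennreal_mult ennreal_plus)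
qed

text \<open>The weights in Young's inequality add up to 1. At \<open>t = 0\<close> and
  \<open>t = 1\<close> one factor has exponent 0 and is 0 or 1. In this form bounds at the ends of a
  chord pass to its interior points.\<close>

lemma enn_powr_mult_le:
  assumes "a \<le> c" "b \<le> c" "0 \<le> t" "t \<le> 1"
  shows "enn_powr a (1 - t) * enn_powr b t \<le> c"
proof -
  consider "t = 0" | "t = 1" | "0 < t" "t < 1" using assms by linarith
  then show ?thesis
  proof cases
    case 1
    have "enn_powr b 0 \<le> 1"
      by (cases "b = 0") (auto simp: enn_powr_exp_0 zero_less_iff_neq_zero)
    then have "a * enn_powr b 0 \<le> a * 1" by (intro mult_left_mono) auto
    then show ?thesis using 1 assms by simp
  next
    case 2
    have "enn_powr a 0 \<le> 1"
      by (cases "a = 0") (auto simp: enn_powr_exp_0 zero_less_iff_neq_zero)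
    then have "enn_powr a 0 * b \<le> 1 * b" by (intro mult_right_mono) auto
    then show ?thesis using 2 assms by simp
  next
    case 3
    have "enn_powr a (1 - t) * enn_powr b t \<le> ennreal (1 - t) * a + ennreal t * b"
      by (rule enn_powr_Young) fact+
    also have "\<dots> \<le> ennreal (1 - t) * c + ennreal t * c"
      using assms by (intro add_mono mult_left_mono) auto
    also have "\<dots> = c"
      using 3 by (simp flip: distrib_right ennreal_plus)
    finally show ?thesis .
  qed
qed

lemma enn_powr_inverse:
  assumes "0 < a" "a < \<infinity>"
  shows "enn_powr a s * enn_powr (inverse a) s = 1"
proof -
  obtain r where r: "a = ennreal r" "0 < r"
    using assms by (metis ennreal_cases ennreal_less_zero_iff infinity_ennreal_def less_irrefl)
  then show ?thesis
    by (simp add: inverse_ennreal enn_powr_ennreal powr_mult[symmetric] flip: ennreal_mult)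
qed

text \<open>Hoelder's inequality, from Young's inequality for the normalized functions.\<close>
lemma nn_integral_enn_powr_mult_le:
  assumes [measurable]: "f \<in> borel_measurable M" "g \<in> borel_measurable M"
    and t: "0 < t" "t < 1"
    and pos: "0 < (\<integral>\<^sup>+x. f x \<partial>M)" "0 < (\<integral>\<^sup>+x. g x \<partial>M)"
  shows "(\<integral>\<^sup>+x. enn_powr (f x) (1 - t) * enn_powr (g x) t \<partial>M)
    \<le> enn_powr (\<integral>\<^sup>+x. f x \<partial>M) (1 - t) * enn_powr (\<integral>\<^sup>+x. g x \<partial>M) t"
proof -
  define A B where "A = (\<integral>\<^sup>+x. f x \<partial>M)" and "B = (\<integral>\<^sup>+x. g x \<partial>M)"
  show ?thesis
  proof (cases "A = \<infinity> \<or> B = \<infinity>")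
    case True
    then have "enn_powr A (1 - t) * enn_powr B t = \<infinity>"
      using t pos enn_powr_pos[of A "1 - t"] enn_powr_pos[of B t] unfolding A_def[symmetric] B_def[symmetric]
      by (auto simp: enn_powr_top ennreal_mult_top ennreal_top_mult)
    then show ?thesis by (simp add: A_def B_def)
  next
    case False
    then have AB: "0 < A" "0 < B" "A < \<infinity>" "B < \<infinity>"
      using pos by (auto simp: A_def B_def less_top)
    have inv: "A * inverse A = 1" "B * inverse B = 1" "0 < inverse A" "0 < inverse B"
      using AB by (auto simp: ennreal_inverse_positive intro!: ennreal_divide_self[unfolded divide_ennreal_def])
    \<comment> \<open>Normalizing factor that scales both integrals to 1. It can be cancelled again
      by \<open>one\<close>, because \<open>A\<close> and \<open>B\<close> are positive and finite
      in this case.\<close>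
    let ?c = "enn_powr (inverse A) (1 - t) * enn_powr (inverse B) t"
    have pw: "?c * (enn_powr (f x) (1 - t) * enn_powr (g x) t)
       \<le> ennreal (1 - t) * (inverse A * f x) + ennreal t * (inverse B * g x)" for x
    proof (cases "f x = 0 \<or> g x = 0")
      case True then show ?thesis by auto
    next
      case F: False
      have "?c * (enn_powr (f x) (1 - t) * enn_powr (g x) t)
        = enn_powr (inverse A * f x) (1 - t) * enn_powr (inverse B * g x) t"
        using F inv t by (simp add: enn_powr_mult zero_less_iff_neq_zero mult_ac)
      also have "\<dots> \<le> ennreal (1 - t) * (inverse A * f x) + ennreal t * (inverse B * g x)"
        by (rule enn_powr_Young) fact+
      finally show ?thesis .
    qed
    have "?c * (\<integral>\<^sup>+x. enn_powr (f x) (1 - t) * enn_powr (g x) t \<partial>M)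
       = (\<integral>\<^sup>+x. ?c * (enn_powr (f x) (1 - t) * enn_powr (g x) t) \<partial>M)"
      by (simp add: nn_integral_cmult)
    also have "\<dots> \<le> (\<integral>\<^sup>+x. ennreal (1 - t) * (inverse A * f x) + ennreal t * (inverse B * g x) \<partial>M)"
      by (intro nn_integral_mono pw)
    also have "\<dots> = ennreal (1 - t) * (inverse A * A) + ennreal t * (inverse B * B)"
      by (simp add: nn_integral_add nn_integral_cmult A_def B_def)
    also have "\<dots> = 1"
      using t inv by (simp add: mult.commute flip: ennreal_plus)
    finally have le: "?c * (\<integral>\<^sup>+x. enn_powr (f x) (1 - t) * enn_powr (g x) t \<partial>M) \<le> 1" .
    have one: "(enn_powr A (1 - t) * enn_powr B t) * ?c = 1"
      using enn_powr_inverse[of A "1 - t"] enn_powr_inverse[of B t] AB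
      by (metis (no_types, lifting) mult.assoc mult.commute mult_1)
    have "(\<integral>\<^sup>+x. enn_powr (f x) (1 - t) * enn_powr (g x) t \<partial>M)
      = (enn_powr A (1 - t) * enn_powr B t) * (?c * (\<integral>\<^sup>+x. enn_powr (f x) (1 - t) * enn_powr (g x) t \<partial>M))"
      unfolding mult.assoc[symmetric] one[unfolded mult.assoc[symmetric]] by simp
    also have "\<dots> \<le> (enn_powr A (1 - t) * enn_powr B t) * 1"
      by (intro mult_left_mono le) auto
    finally show ?thesis by (simp add: A_def B_def)
  qed
qed

text \<open>The pointwise conditions of \<open>M_class\<close> without the integral ones. The
  combination map stays a parameter, so that the same closure properties serve \<open>P\<close>,
  \<open>PR\<close> and the composite sets.\<close>

definition plc_on :: "(real \<Rightarrow> 'x \<Rightarrow> 'x \<Rightarrow> 'x) \<Rightarrow> 'x::topological_space set \<Rightarrow> ('x \<Rightarrow> ennreal) \<Rightarrow> bool" where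
  "plc_on cmb P u \<longleftrightarrow> (\<forall>x\<in>P. 0 < u x) \<and> lsc_on P u \<and> log_convex_on cmb P u"

lemma M_class_1_iff:
  "u \<in> M_class cmb P mu 1 \<longleftrightarrow> plc_on cmb P u \<and> u \<in> borel_measurable mu \<and>
     (\<integral>\<^sup>+ x. u x \<partial>mu) = total_mass mu \<and> total_mass mu < \<infinity>"
  by (auto simp: M_class_def plc_on_def)

text \<open>The filter \<open>at x within P\<close> omits \<open>x\<close> itself, where
  \<open>c < u x\<close> holds anyway. The version with \<open>nhds\<close> composes with continuous
  maps.\<close>

lemma lsc_on_alt:
  "lsc_on P u \<longleftrightarrow> (\<forall>x\<in>P. \<forall>c. c < u x \<longrightarrow> eventually (\<lambda>y. y \<in> P \<longrightarrow> c < u y) (nhds x))"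
proof -
  have "eventually (\<lambda>y. c < u y) (at x within P) \<longleftrightarrow> eventually (\<lambda>y. y \<in> P \<longrightarrow> c < u y) (nhds x)"
    if "c < u x" for c x
  proof -
    have "eventually (\<lambda>y. c < u y) (at x within P) \<longleftrightarrow>
        eventually (\<lambda>y. y \<noteq> x \<longrightarrow> y \<in> P \<longrightarrow> c < u y) (nhds x)"
      by (simp add: eventually_at_filter)
    also have "\<dots> \<longleftrightarrow> eventually (\<lambda>y. y \<in> P \<longrightarrow> c < u y) (nhds x)"
      using that by (intro eventually_subst always_eventually) auto
    finally show ?thesis .
  qed
  then show ?thesis by (auto simp: lsc_on_def)
qed

lemma lsc_on_compose:
  assumes "lsc_on P u" "continuous_on UNIV T" "\<And>x. x \<in> Q \<Longrightarrow> T x \<in> P"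
  shows "lsc_on Q (\<lambda>x. u (T x))"
  unfolding lsc_on_alt
proof (intro ballI allI impI)
  fix x c assume x: "x \<in> Q" and c: "c < u (T x)"
  have "filterlim T (nhds (T x)) (nhds x)"
    using assms(2) by (metis UNIV_I continuous_on_def tendsto_at_iff_tendsto_nhds)
  moreover have "eventually (\<lambda>y. y \<in> P \<longrightarrow> c < u y) (nhds (T x))"
    using assms(1) x c assms(3) unfolding lsc_on_alt by blast
  ultimately have "eventually (\<lambda>y. T y \<in> P \<longrightarrow> c < u (T y)) (nhds x)"
    by (rule eventually_compose_filterlim[rotated])
  then show "eventually (\<lambda>y. y \<in> Q \<longrightarrow> c < u (T y)) (nhds x)"
    by eventually_elim (use assms(3) in auto)
qed

text \<open>Every value is the supremum of the smaller ones, and multiplication commutes with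
  suprema. Infinite factors need no separate case, which is the point for products of functions with
  values in (0,\<infinity>].\<close>

lemma ennreal_less_multE:
  fixes c a b :: ennreal
  assumes "c < a * b"
  obtains a' b' where "a' < a" "b' < b" "c \<le> a' * b'"
proof -
  have *: "\<exists>a'<a. c < a' * b" if "c < a * b" for a b :: ennreal
  proof -
    have ne: "0 < a" using that by (cases "a = 0") (auto simp: zero_less_iff_neq_zero)
    have "a * b = (SUP a'\<in>{..<a}. a' * b)"
    proof -
      have "a = Sup {..<a}"
        by (rule Sup_lessThan[symmetric])
      then have "a * b = Sup {..<a} * b" by simp
      also have "\<dots> = (SUP a'\<in>{..<a}. a' * b)"
        using SUP_mult_right_ennreal[of id "{..<a}" b] ne by (simp add: id_def)
      finally show ?thesis .
    qed
    with that show ?thesis by (auto simp: less_SUP_iff)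
  qed
  obtain a' where a': "a' < a" "c < a' * b" using *[OF assms] by blast
  then have "c < b * a'" by (simp add: mult.commute)
  from *[OF this] obtain b' where "b' < b" "c < b' * a'" by blast
  then show ?thesis using a' that[of a' b'] by (simp add: mult.commute less_imp_le)
qed

lemma ennreal_mult_strict_mono_dense:
  fixes c a b :: ennreal
  assumes "c < a * b"
  shows "\<exists>a'<a. \<exists>b'<b. \<forall>x y. a' < x \<longrightarrow> b' < y \<longrightarrow> c < x * y"
proof -
  obtain c' where c': "c < c'" "c' < a * b" using assms dense by blast
  from ennreal_less_multE[OF c'(2)] obtain a' b' where "a' < a" "b' < b" "c' \<le> a' * b'" by blast
  then show ?thesis
    using c'(1) by (meson less_imp_le less_le_trans mult_mono' zero_le)
qed

lemma plc_on_mult: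
  assumes "plc_on cmb P u" "plc_on cmb P v"
    and cl: "\<And>x y t. x \<in> P \<Longrightarrow> y \<in> P \<Longrightarrow> t \<in> {0..1} \<Longrightarrow> cmb t x y \<in> P"
  shows "plc_on cmb P (\<lambda>x. u x * v x)"
  unfolding plc_on_def
proof (intro conjI)
  show "\<forall>x\<in>P. 0 < u x * v x" using assms by (auto simp: plc_on_def ennreal_zero_less_mult_iff)
  show "lsc_on P (\<lambda>x. u x * v x)" unfolding lsc_on_alt
  proof (intro ballI allI impI)
    fix x c assume x: "x \<in> P" and "c < u x * v x"
    from ennreal_mult_strict_mono_dense[OF this(2)] obtain a' b'
      where ab: "a' < u x" "b' < v x" "\<And>x y. a' < x \<Longrightarrow> b' < y \<Longrightarrow> c < x * y"
      by blast
    have "eventually (\<lambda>y. y \<in> P \<longrightarrow> a' < u y) (nhds x)" "eventually (\<lambda>y. y \<in> P \<longrightarrow> b' < v y) (nhds x)"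
      using assms x ab unfolding plc_on_def lsc_on_alt by blast+
    then show "eventually (\<lambda>y. y \<in> P \<longrightarrow> c < u y * v y) (nhds x)"
      by eventually_elim (use ab in auto)
  qed
  show "log_convex_on cmb P (\<lambda>x. u x * v x)" unfolding log_convex_on_def
  proof (intro ballI)
    fix x y and t::real assume *: "x \<in> P" "y \<in> P" "t \<in> {0..1}"
    have "u (cmb t x y) * v (cmb t x y)
      \<le> (enn_powr (u x) (1 - t) * enn_powr (u y) t) * (enn_powr (v x) (1 - t) * enn_powr (v y) t)"
      using assms * by (intro mult_mono) (auto simp: plc_on_def log_convex_on_def)
    also have "\<dots> = enn_powr (u x * v x) (1 - t) * enn_powr (u y * v y) t"
      using assms * by (simp add: enn_powr_mult plc_on_def mult_ac)
    finally show "u (cmb t x y) * v (cmb t x y) \<le> enn_powr (u x * v x) (1 - t) * enn_powr (u y * v y) t" .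
  qed
qed

lemma plc_on_const_1: "plc_on cmb P (\<lambda>_. 1)"
  by (auto simp: plc_on_def lsc_on_def log_convex_on_def enn_powr_def)

lemma plc_on_prod:
  assumes "finite I" "\<And>i. i \<in> I \<Longrightarrow> plc_on cmb P (u i)"
    and "\<And>x y t. x \<in> P \<Longrightarrow> y \<in> P \<Longrightarrow> t \<in> {0..1} \<Longrightarrow> cmb t x y \<in> P"
  shows "plc_on cmb P (\<lambda>x. \<Prod>i\<in>I. u i x)"
  using assms by (induction I rule: finite_induct) (auto intro!: plc_on_mult plc_on_const_1)

lemma plc_on_compose:
  assumes "plc_on cmb P u" "continuous_on UNIV T" "\<And>x. x \<in> Q \<Longrightarrow> T x \<in> P"
    and "\<And>x y t. x \<in> Q \<Longrightarrow> y \<in> Q \<Longrightarrow> t \<in> {0..1} \<Longrightarrow> T (cmb' t x y) = cmb t (T x) (T y)"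
  shows "plc_on cmb' Q (\<lambda>x. u (T x))"
  using assms lsc_on_compose[of P u T Q] by (auto simp: plc_on_def log_convex_on_def)

text \<open>Log-convexity survives integration by Hoelder's inequality, lower semicontinuity by
  Fatou's lemma along sequences (hence first countability), and positivity because the parameter
  measure is not zero. The exceptional null set of parameters must not depend on \<open>x\<close>.
  The end point conditions on \<open>cmb\<close> cover \<open>t = 0\<close> and
  \<open>t = 1\<close>, where Hoelder's inequality is not applied.\<close>

lemma plc_on_nn_integral:
  fixes f :: "'x::first_countable_topology \<Rightarrow> 'w \<Rightarrow> ennreal"
  assumes meas: "\<And>x. x \<in> P \<Longrightarrow> f x \<in> borel_measurable M"
    and ae: "AE w in M. plc_on cmb P (\<lambda>x. f x w)"
    and M: "emeasure M (space M) \<noteq> 0"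
    and cl: "\<And>x y t. x \<in> P \<Longrightarrow> y \<in> P \<Longrightarrow> t \<in> {0..1} \<Longrightarrow> cmb t x y \<in> P"
    and end0: "\<And>x y. x \<in> P \<Longrightarrow> y \<in> P \<Longrightarrow> cmb 0 x y = x"
    and end1: "\<And>x y. x \<in> P \<Longrightarrow> y \<in> P \<Longrightarrow> cmb 1 x y = y"
  shows "plc_on cmb P (\<lambda>x. \<integral>\<^sup>+w. f x w \<partial>M)"
proof -
  have pos: "0 < (\<integral>\<^sup>+w. f x w \<partial>M)" if x: "x \<in> P" for x
  proof (rule ccontr)
    assume "\<not> 0 < (\<integral>\<^sup>+w. f x w \<partial>M)"
    then have "(\<integral>\<^sup>+w. f x w \<partial>M) = 0" by (simp add: zero_less_iff_neq_zero)
    then have "AE w in M. f x w = 0" using nn_integral_0_iff_AE[OF meas[OF x]] by simp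
    with ae have "AE w in M. False"
      by eventually_elim (use x in \<open>auto simp: plc_on_def\<close>)
    then show False using M by (simp add: AE_iff_measurable[where N="space M"])
  qed
  show ?thesis
    unfolding plc_on_def
  proof (intro conjI ballI)
    show "0 < (\<integral>\<^sup>+w. f x w \<partial>M)" if "x \<in> P" for x by (rule pos) fact
    show "lsc_on P (\<lambda>x. \<integral>\<^sup>+w. f x w \<partial>M)"
      unfolding lsc_on_def
    proof (intro ballI allI impI sequentially_imp_eventually_within)
      fix x c and X :: "nat \<Rightarrow> 'x"
      assume x: "x \<in> P" and c: "c < (\<integral>\<^sup>+w. f x w \<partial>M)"
        and X: "(\<forall>n. X n \<in> P \<and> X n \<noteq> x) \<and> X \<longlonglongrightarrow> x"
      have "AE w in M. f x w \<le> liminf (\<lambda>n. f (X n) w)"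
        using ae
      proof eventually_elim
        case (elim w)
        show ?case
        proof (rule le_Liminf_iff[THEN iffD2], intro allI impI)
          fix d assume "d < f x w"
          then have "eventually (\<lambda>y. y \<in> P \<longrightarrow> d < f y w) (nhds x)"
            using elim x by (auto simp: plc_on_def lsc_on_alt)
          then have "eventually (\<lambda>n. X n \<in> P \<longrightarrow> d < f (X n) w) sequentially"
            using eventually_compose_filterlim[of _ "nhds x" X sequentially] X by blast
          then show "eventually (\<lambda>n. d < f (X n) w) sequentially"
            using X by auto
        qed
      qed
      then have "(\<integral>\<^sup>+w. f x w \<partial>M) \<le> (\<integral>\<^sup>+w. liminf (\<lambda>n. f (X n) w) \<partial>M)"
        by (rule nn_integral_mono_AE)
      also have "\<dots> \<le> liminf (\<lambda>n. \<integral>\<^sup>+w. f (X n) w \<partial>M)"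
        by (intro nn_integral_liminf meas) (use X in auto)
      finally show "eventually (\<lambda>n. c < (\<integral>\<^sup>+w. f (X n) w \<partial>M)) sequentially"
        using c less_LiminfD less_le_trans by blast
    qed
    show "log_convex_on cmb P (\<lambda>x. \<integral>\<^sup>+w. f x w \<partial>M)"
      unfolding log_convex_on_def
    proof (intro ballI)
      fix x y and t :: real assume *: "x \<in> P" "y \<in> P" "t \<in> {0..1}"
      consider "t = 0" | "t = 1" | "0 < t" "t < 1" using * by fastforce
      then show "(\<integral>\<^sup>+w. f (cmb t x y) w \<partial>M)
          \<le> enn_powr (\<integral>\<^sup>+w. f x w \<partial>M) (1 - t) * enn_powr (\<integral>\<^sup>+w. f y w \<partial>M) t"
      proof cases
        case 1
        then show ?thesis using * pos end0 by (simp add: enn_powr_exp_0)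
      next
        case 2
        then show ?thesis using * pos end1 by (simp add: enn_powr_exp_0)
      next
        case 3
        have "(\<integral>\<^sup>+w. f (cmb t x y) w \<partial>M) \<le> (\<integral>\<^sup>+w. enn_powr (f x w) (1 - t) * enn_powr (f y w) t \<partial>M)"
          using ae by (intro nn_integral_mono_AE, eventually_elim)
            (use * in \<open>auto simp: plc_on_def log_convex_on_def\<close>)
        also have "\<dots> \<le> enn_powr (\<integral>\<^sup>+w. f x w \<partial>M) (1 - t) * enn_powr (\<integral>\<^sup>+w. f y w \<partial>M) t"
          by (intro nn_integral_enn_powr_mult_le meas pos 3 *)
        finally show ?thesis .
      qed
    qed
  qed
qed

lemma plc_on_cmult:
  assumes "plc_on cmb P u" "0 < c"
    and "\<And>x y t. x \<in> P \<Longrightarrow> y \<in> P \<Longrightarrow> t \<in> {0..1} \<Longrightarrow> cmb t x y \<in> P"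
  shows "plc_on cmb P (\<lambda>x. c * u x)"
proof (rule plc_on_mult[OF _ assms(1,3)])
  show "plc_on cmb P (\<lambda>_. c)"
    unfolding plc_on_def lsc_on_def log_convex_on_def
  proof (intro conjI ballI)
    fix t :: real assume "t \<in> {0..1}"
    show "c \<le> enn_powr c (1 - t) * enn_powr c t"
    proof (cases "c = \<infinity>")
      case True
      then show ?thesis by (auto simp: enn_powr_top)
    next
      case False
      then obtain r where "c = ennreal r" "0 < r"
        using assms(2) by (metis ennreal_cases ennreal_less_zero_iff infinity_ennreal_def)
      then show ?thesis by (simp add: enn_powr_ennreal flip: ennreal_mult powr_add)
    qed
  qed (use assms in auto)
qed auto

text \<open>A finite sum is an integral against a counting measure, so log-convexity of sums is once
  more Hoelder's inequality.\<close>

lemma plc_on_sum: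
  fixes f :: "'i \<Rightarrow> 'x::first_countable_topology \<Rightarrow> ennreal"
  assumes "finite I" "I \<noteq> {}" "\<And>i. i \<in> I \<Longrightarrow> plc_on cmb P (f i)"
    and cl: "\<And>x y t. x \<in> P \<Longrightarrow> y \<in> P \<Longrightarrow> t \<in> {0..1} \<Longrightarrow> cmb t x y \<in> P"
    and end0: "\<And>x y. x \<in> P \<Longrightarrow> y \<in> P \<Longrightarrow> cmb 0 x y = x"
    and end1: "\<And>x y. x \<in> P \<Longrightarrow> y \<in> P \<Longrightarrow> cmb 1 x y = y"
  shows "plc_on cmb P (\<lambda>x. \<Sum>i\<in>I. f i x)"
proof -
  have "plc_on cmb P (\<lambda>x. \<integral>\<^sup>+i. f i x \<partial>count_space I)"
    using assms by (intro plc_on_nn_integral) (auto simp: AE_count_space emeasure_count_space)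
  then show ?thesis using assms by (simp add: nn_integral_count_space_finite)
qed

lemma cmb_lin_closed: "convex P \<Longrightarrow> x \<in> P \<Longrightarrow> y \<in> P \<Longrightarrow> t \<in> {0..1} \<Longrightarrow> cmb_lin t x y \<in> P"
  by (auto simp: cmb_lin_def convex_alt)

lemma cmb_lin_0 [simp]: "cmb_lin 0 x y = x" and cmb_lin_1 [simp]: "cmb_lin 1 x y = y"
  by (auto simp: cmb_lin_def)

lemma plc_on_mix:
  fixes u v :: "'x::euclidean_space \<Rightarrow> ennreal"
  assumes "plc_on cmb_lin P u" "plc_on cmb_lin P v" "convex P" "0 \<le> t" "t \<le> 1"
  shows "plc_on cmb_lin P (\<lambda>x. ennreal (1 - t) * u x + ennreal t * v x)"
proof -
  consider "t = 0" | "t = 1" | "0 < t" "t < 1" using assms by fastforce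
  then show ?thesis
  proof cases
    case 3
    have "plc_on cmb_lin P (\<lambda>x. if i then ennreal t * v x else ennreal (1 - t) * u x)" for i
      using assms 3 by (cases i) (auto intro!: plc_on_cmult cmb_lin_closed)
    \<comment> \<open>The two terms of the mixture are indexed by \<open>bool\<close> to fit
      \<open>plc_on_sum\<close>.\<close>
    then have "plc_on cmb_lin P (\<lambda>x. \<Sum>i\<in>UNIV. if i then ennreal t * v x else ennreal (1 - t) * u x)"
      by (intro plc_on_sum) (use assms in \<open>auto intro!: cmb_lin_closed\<close>)
    then show ?thesis by (simp add: UNIV_bool add.commute)
  qed (use assms in auto)
qed

subsection \<open>Entropy\<close>

text \<open>The tangent line of \<open>x ln x\<close> at \<open>y\<close>, of slope
  \<open>ln y + 1\<close>. The lower bound -1, convexity, nonnegativity of \<open>H_int\<close> and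
  Gibbs' inequality are all derived from it.\<close>

lemma x_ln_x_ge: "x * ln y + x - y \<le> x * ln x" if "0 \<le> x" "0 < y" for x y :: real
proof (cases "x = 0")
  case False
  then have x: "0 < x" using that by simp
  have "ln (y / x) \<le> y / x - 1"
    using x that by (intro ln_le_minus_one) auto
  then have "x * ln (y / x) \<le> x * (y / x - 1)" using x by (intro mult_left_mono) auto
  then show ?thesis using x that by (simp add: ln_div algebra_simps)
qed (use that in auto)

lemma x_ln_x_ge_minus_1: "-1 \<le> x * ln x" if "0 \<le> x" for x :: real
  using x_ln_x_ge[of x 1] that by simp

text \<open>Since \<open>(q - 1) * ln x\<close> is the logarithm of \<open>x powr (q - 1)\<close>,
  it is at most \<open>x powr (q - 1) - 1\<close>; so an L^q bound with \<open>q > 1\<close>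
  controls the entropy integrand. The summand 1 takes care of its negative part.\<close>

lemma abs_x_ln_x_le:
  fixes x q :: real
  assumes "0 \<le> x" "1 < q"
  shows "\<bar>x * ln x\<bar> \<le> 1 + x powr q / (q - 1)"
proof (cases "x = 0")
  case False
  then have x: "0 < x" using assms by simp
  have "(q - 1) * ln x = ln (x powr (q - 1))" using x by (simp add: ln_powr)
  also have "\<dots> \<le> x powr (q - 1) - 1" using x by (intro ln_le_minus_one) auto
  finally have "ln x \<le> x powr (q - 1) / (q - 1)" using assms by (simp add: field_simps)
  then have "x * ln x \<le> x * (x powr (q - 1) / (q - 1))" using x by (intro mult_left_mono) auto
  also have "\<dots> = x powr q / (q - 1)"
    using x by (metis assms(1) mult.commute powr_mult_base times_divide_eq_right diff_add_cancel add.commute)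
  finally have "x * ln x \<le> x powr q / (q - 1)" .
  moreover have "0 \<le> x powr q / (q - 1)" using assms by simp
  ultimately show ?thesis using x_ln_x_ge_minus_1[of x] x by (simp add: abs_le_iff)
qed (use assms in auto)

lemma x_ln_x_convex:
  fixes a b t :: real
  assumes "0 \<le> a" "0 \<le> b" "0 \<le> t" "t \<le> 1"
  shows "((1 - t) * a + t * b) * ln ((1 - t) * a + t * b) \<le> (1 - t) * (a * ln a) + t * (b * ln b)"
proof -
  define m where "m = (1 - t) * a + t * b"
  have m0: "0 \<le> m" using assms by (simp add: m_def)
  show ?thesis
  proof (cases "m = 0")
    case True
    then have "(1 - t) * a = 0" "t * b = 0"
      using assms add_nonneg_eq_0_iff[of "(1 - t) * a" "t * b"] by (auto simp: m_def)
    then have "(1 - t) * (a * ln a) = 0" "t * (b * ln b) = 0" by auto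
    with True show ?thesis unfolding m_def by (metis add_0 mult_zero_left order_refl)
  next
    case False
    then have m: "0 < m" using m0 by simp
    have "(1 - t) * (a * ln m + a - m) + t * (b * ln m + b - m) \<le> (1 - t) * (a * ln a) + t * (b * ln b)"
      using assms m by (intro add_mono mult_left_mono x_ln_x_ge) auto
    moreover have "(1 - t) * (a * ln m + a - m) + t * (b * ln m + b - m) = m * ln m"
    proof -
      have "(1 - t) * (a * ln m + a - m) + t * (b * ln m + b - m) = m * ln m + (m - m)"
        unfolding m_def by (simp add: algebra_simps)
      then show ?thesis by simp
    qed
    ultimately show ?thesis by (simp add: m_def)
  qed
qed

text \<open>The pointwise Jensen-Shannon divergence: the midpoint defect in the convexity of
  \<open>x ln x\<close>.\<close>

definition jensen_gap :: "real \<Rightarrow> real \<Rightarrow> real" where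
  "jensen_gap a b = (a * ln a + b * ln b) / 2 - ((a + b) / 2) * ln ((a + b) / 2)"

text \<open>Relative entropy dominates the squared Hellinger distance, by
  \<open>ln (sqrt (m / x)) \<le> sqrt (m / x) - 1\<close>. This is applied to \<open>a\<close> and
  to \<open>b\<close> against their mean \<open>m\<close>, where the linear terms cancel; the two
  distances to \<open>sqrt m\<close> are then combined at the cost of a factor 2.\<close>

lemma sqrt_diff_sq_le_jensen_gap:
  assumes "0 \<le> a" "0 \<le> b"
  shows "(sqrt a - sqrt b)\<^sup>2 \<le> 4 * jensen_gap a b"
proof (cases "a + b = 0")
  case True
  then have "a = 0" "b = 0" using assms by auto
  then show ?thesis by (simp add: jensen_gap_def)
next
  case False
  define m where "m = (a + b) / 2"
  have m: "0 < m" using False assms by (simp add: m_def)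
  have half: "x * ln m + (sqrt x - sqrt m)\<^sup>2 + x - m \<le> x * ln x" if x: "0 \<le> x" for x
  proof (cases "x = 0")
    case True
    then show ?thesis using m by simp
  next
    case False
    then have x: "0 < x" using x by simp
    have "ln (sqrt (m / x)) \<le> sqrt (m / x) - 1" using x m by (intro ln_le_minus_one) auto
    then have "(ln m - ln x) / 2 \<le> sqrt (m / x) - 1" using x m by (simp add: ln_sqrt ln_div)
    then have "x * ((ln m - ln x) / 2) \<le> x * (sqrt (m / x) - 1)"
      using x by (intro mult_left_mono) auto
    then have "x * ln m / 2 - x * ln x / 2 \<le> x * sqrt (m / x) - x"
      by (simp add: right_diff_distrib diff_divide_distrib)
    moreover have "x * sqrt (m / x) = sqrt x * sqrt m"
      using x m by (simp add: real_sqrt_divide field_simps)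
    moreover have "(sqrt x - sqrt m)\<^sup>2 = x + m - 2 * (sqrt x * sqrt m)"
      using x m by (simp add: power2_diff)
    ultimately show ?thesis by linarith
  qed
  have "2 * (m * ln m) = a * ln m + b * ln m" by (simp add: m_def algebra_simps)
  then have "(sqrt a - sqrt m)\<^sup>2 + (sqrt b - sqrt m)\<^sup>2 \<le> 2 * jensen_gap a b"
    using half[OF assms(1)] half[OF assms(2)] unfolding jensen_gap_def m_def[symmetric]
    by (simp add: m_def field_simps)
  moreover have "(sqrt a - sqrt b)\<^sup>2 \<le> 2 * (sqrt a - sqrt m)\<^sup>2 + 2 * (sqrt b - sqrt m)\<^sup>2"
  proof -
    have "(p - r)\<^sup>2 \<le> 2 * (p - k)\<^sup>2 + 2 * (r - k)\<^sup>2" for p r k :: real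
      using zero_le_power2[of "(p - k) + (r - k)"] by (simp add: power2_eq_square algebra_simps)
    then show ?thesis .
  qed
  ultimately show ?thesis by simp
qed

text \<open>Factor \<open>a - b\<close> into difference and sum of square roots and apply the
  inequality of the means with weight \<open>\<eta>\<close>. The outcome is linear in the defect, a
  substitute for Pinsker's inequality that can be integrated term by term.\<close>

lemma abs_diff_le_jensen_gap:
  assumes "0 \<le> a" "0 \<le> b" "0 < \<eta>"
  shows "\<bar>a - b\<bar> \<le> (2 / \<eta>) * jensen_gap a b + \<eta> * (a + b)"
proof -
  define d s where "d = \<bar>sqrt a - sqrt b\<bar>" and "s = sqrt a + sqrt b"
  have "\<bar>a - b\<bar> = d * s"
  proof -
    have "a - b = (sqrt a - sqrt b) * (sqrt a + sqrt b)" using assms by (simp add: algebra_simps)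
    then show ?thesis using assms by (simp add: d_def s_def abs_mult)
  qed
  also have "\<dots> \<le> d\<^sup>2 / (2 * \<eta>) + (\<eta> / 2) * s\<^sup>2"
    using zero_le_power2[of "d - \<eta> * s"] assms
    by (simp add: field_simps power2_eq_square)
  also have "d\<^sup>2 / (2 * \<eta>) \<le> (2 / \<eta>) * jensen_gap a b"
    using sqrt_diff_sq_le_jensen_gap[OF assms(1,2)] assms(3) by (simp add: d_def field_simps)
  also have "(\<eta> / 2) * s\<^sup>2 \<le> \<eta> * (a + b)"
  proof -
    have "s\<^sup>2 \<le> 2 * (a + b)"
      using zero_le_power2[of "sqrt a - sqrt b"] assms
      by (simp add: s_def power2_sum power2_diff)
    then show ?thesis using assms(3) by simp
  qed
  finally show ?thesis by simp
qed

lemma L1_dist_le_jensen_gap: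
  fixes f g :: "'a \<Rightarrow> real"
  assumes int: "integrable M f" "integrable M g"
    and H: "integrable M (\<lambda>x. f x * ln (f x))" "integrable M (\<lambda>x. g x * ln (g x))"
      "integrable M (\<lambda>x. (f x + g x) / 2 * ln ((f x + g x) / 2))"
    and nn: "\<And>x. 0 \<le> f x" "\<And>x. 0 \<le> g x" and eta: "0 < \<eta>"
  shows "(\<integral>x. \<bar>f x - g x\<bar> \<partial>M) \<le> (2 / \<eta>) * (((\<integral>x. f x * ln (f x) \<partial>M) + (\<integral>x. g x * ln (g x) \<partial>M)) / 2
     - (\<integral>x. (f x + g x) / 2 * ln ((f x + g x) / 2) \<partial>M)) + \<eta> * ((\<integral>x. f x \<partial>M) + (\<integral>x. g x \<partial>M))"
proof -
  \<comment> \<open>Linearity of the integral is separated from the concrete integrands, so that no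
    logarithm is rewritten.\<close>
  have lin: "(\<integral>x. c * ((F x + G x) / 2 - K x) + e * (f x + g x) \<partial>M)
      = c * (((\<integral>x. F x \<partial>M) + (\<integral>x. G x \<partial>M)) / 2 - (\<integral>x. K x \<partial>M)) + e * ((\<integral>x. f x \<partial>M) + (\<integral>x. g x \<partial>M))"
    if "integrable M F" "integrable M G" "integrable M K" "integrable M f" "integrable M g"
    for F G K f g :: "'a \<Rightarrow> real" and c e
    using that by simp
  have "(\<integral>x. \<bar>f x - g x\<bar> \<partial>M) \<le> (\<integral>x. (2 / \<eta>) * ((f x * ln (f x) + g x * ln (g x)) / 2
       - (f x + g x) / 2 * ln ((f x + g x) / 2)) + \<eta> * (f x + g x) \<partial>M)"
  proof (rule integral_mono)
    show "integrable M (\<lambda>x. (2 / \<eta>) * ((f x * ln (f x) + g x * ln (g x)) / 2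
       - (f x + g x) / 2 * ln ((f x + g x) / 2)) + \<eta> * (f x + g x))"
      using int H by (intro Bochner_Integration.integrable_add integrable_mult_right
         Bochner_Integration.integrable_diff integrable_divide) auto
  qed (use int nn abs_diff_le_jensen_gap[OF _ _ eta] in \<open>auto simp: jensen_gap_def\<close>)
  also have "\<dots> = (2 / \<eta>) * (((\<integral>x. f x * ln (f x) \<partial>M) + (\<integral>x. g x * ln (g x) \<partial>M)) / 2
     - (\<integral>x. (f x + g x) / 2 * ln ((f x + g x) / 2) \<partial>M)) + \<eta> * ((\<integral>x. f x \<partial>M) + (\<integral>x. g x \<partial>M))"
    by (rule lin) fact+
  finally show ?thesis .
qed

text \<open>The tangent line of \<open>x ln x\<close> at \<open>g x\<close>, evaluated at
  \<open>f x\<close> and integrated. The linear terms leave the difference of the two masses, which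
  \<open>le\<close> makes nonnegative.\<close>

lemma Gibbs_inequality:
  fixes f g :: "'a \<Rightarrow> real"
  assumes int: "integrable M f" "integrable M g" "integrable M (\<lambda>x. f x * ln (f x))"
      "integrable M (\<lambda>x. f x * ln (g x))"
    and nn: "AE x in M. 0 \<le> f x" "AE x in M. 0 < g x"
    and le: "(\<integral>x. g x \<partial>M) \<le> (\<integral>x. f x \<partial>M)"
  shows "(\<integral>x. f x * ln (g x) \<partial>M) \<le> (\<integral>x. f x * ln (f x) \<partial>M)"
proof -
  have "(\<integral>x. f x * ln (g x) + f x - g x \<partial>M) \<le> (\<integral>x. f x * ln (f x) \<partial>M)"
  proof (rule integral_mono_AE)
    show "AE x in M. f x * ln (g x) + f x - g x \<le> f x * ln (f x)"
      using nn by eventually_elim (rule x_ln_x_ge)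
  qed (use int in auto)
  then show ?thesis using int le by simp
qed

text \<open>Boltzmann's H functional, which is minus the entropy times the total mass. A Bochner
  integral is 0 when it does not exist, so integrability is tracked separately by
  \<open>H_fin\<close>.\<close>

definition H_int :: "'x measure \<Rightarrow> ('x \<Rightarrow> ennreal) \<Rightarrow> real" where
  "H_int M u = (\<integral>x. enn2real (u x) * ln (enn2real (u x)) \<partial>M)"

definition H_fin :: "'x measure \<Rightarrow> ('x \<Rightarrow> ennreal) \<Rightarrow> bool" where
  "H_fin M u \<longleftrightarrow> integrable M (\<lambda>x. enn2real (u x) * ln (enn2real (u x)))"

context
  fixes M :: "'x measure" and m :: real and u :: "'x \<Rightarrow> ennreal"
  assumes mass: "total_mass M = ennreal m" "0 < m"
    and u [measurable]: "u \<in> borel_measurable M" and int_u: "(\<integral>\<^sup>+x. u x \<partial>M) = total_mass M"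
begin

lemma finite_measure_mass: "finite_measure M"
  using mass by (intro finite_measureI) (auto simp: total_mass_def)

lemma AE_finite_density: "AE x in M. u x < \<infinity>"
  using int_u mass nn_integral_PInf_AE[of u M] by (auto simp: less_top)

lemma density_integrable: "integrable M (\<lambda>x. enn2real (u x))"
  and density_integral: "(\<integral>x. enn2real (u x) \<partial>M) = m"
proof -
  have "(\<integral>\<^sup>+x. ennreal (enn2real (u x)) \<partial>M) = (\<integral>\<^sup>+x. u x \<partial>M)"
    using AE_finite_density by (intro nn_integral_cong_AE, eventually_elim) auto
  then have eq: "(\<integral>\<^sup>+x. ennreal (enn2real (u x)) \<partial>M) = ennreal m" using int_u mass by simp
  then show "integrable M (\<lambda>x. enn2real (u x))"
    by (intro integrableI_nn_integral_finite[OF _ _ eq]) auto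
  show "(\<integral>x. enn2real (u x) \<partial>M) = m"
    using mass by (intro integral_eq_nn_integral[THEN trans]) (auto simp: eq)
qed

text \<open>The negative part of \<open>u ln u\<close> is bounded by 1 and so has a finite integral.
  The difference in \<open>entropy\<close> is therefore never of the form infinity minus infinity,
  and failure of integrability means exactly entropy minus infinity.\<close>

lemma
  shows entropy_eq: "H_fin M u \<Longrightarrow> entropy M u = ereal (- H_int M u / m)"
    and entropy_eq_minus_infty: "\<not> H_fin M u \<Longrightarrow> entropy M u = - \<infinity>"
proof -
  interpret finite_measure M by (rule finite_measure_mass)
  let ?h = "\<lambda>x. enn2real (u x) * ln (enn2real (u x))"
  have e2: "e2ennreal (ereal r) = ennreal r" for r
    by (cases "0 \<le> r") (simp_all add: ennreal_neg e2ennreal_neg ennreal_def e2ennreal_def)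
  have A: "(\<integral>\<^sup>+ x. e2ennreal (xlogx (u x)) \<partial>M) = (\<integral>\<^sup>+ x. ennreal (?h x) \<partial>M)"
    using AE_finite_density by (intro nn_integral_cong_AE, eventually_elim) (auto simp: xlogx_def e2)
  have B: "(\<integral>\<^sup>+ x. e2ennreal (- xlogx (u x)) \<partial>M) = (\<integral>\<^sup>+ x. ennreal (- ?h x) \<partial>M)"
    using AE_finite_density by (intro nn_integral_cong_AE, eventually_elim) (auto simp: xlogx_def e2)
  have "(\<integral>\<^sup>+ x. ennreal (- ?h x) \<partial>M) \<le> (\<integral>\<^sup>+ x. 1 \<partial>M)"
  proof (intro nn_integral_mono)
    fix x have "- ?h x \<le> 1" using x_ln_x_ge_minus_1[of "enn2real (u x)"] by simp
    then show "ennreal (- ?h x) \<le> 1" by (metis ennreal_1 ennreal_leI)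
  qed
  also have "\<dots> < \<infinity>" using emeasure_finite[of "space M"] by (simp add: less_top[symmetric])
  finally have Bfin: "(\<integral>\<^sup>+ x. ennreal (- ?h x) \<partial>M) < \<infinity>" .
  have T: "enn2ereal (total_mass M) = ereal m" using mass by (simp add: enn2ereal_ennreal)
  show "entropy M u = ereal (- H_int M u / m)" if "H_fin M u"
  proof -
    have i: "integrable M ?h" using that by (simp add: H_fin_def)
    then have Afin: "(\<integral>\<^sup>+ x. ennreal (?h x) \<partial>M) < \<infinity>"
      by (auto simp: real_integrable_def less_top)
    obtain a where a: "(\<integral>\<^sup>+ x. ennreal (?h x) \<partial>M) = ennreal a" "0 \<le> a"
      using Afin by (metis ennreal_cases infinity_ennreal_def less_irrefl)
    obtain b where b: "(\<integral>\<^sup>+ x. ennreal (- ?h x) \<partial>M) = ennreal b" "0 \<le> b"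
      using Bfin by (metis ennreal_cases infinity_ennreal_def less_irrefl)
    have "H_int M u = a - b"
      unfolding H_int_def using real_lebesgue_integral_def[OF i] a b by simp
    then show ?thesis
      using mass by (simp add: entropy_def A B a b T enn2ereal_ennreal)
  qed
  show "entropy M u = - \<infinity>" if "\<not> H_fin M u"
  proof -
    have "(\<integral>\<^sup>+ x. ennreal (?h x) \<partial>M) = \<infinity>"
      using that Bfin by (auto simp: H_fin_def real_integrable_def)
    moreover obtain b where b: "(\<integral>\<^sup>+ x. ennreal (- ?h x) \<partial>M) = ennreal b" "0 \<le> b"
      using Bfin by (metis ennreal_cases infinity_ennreal_def less_irrefl)
    ultimately show ?thesis
      using mass by (simp add: entropy_def A B T enn2ereal_ennreal)
  qed
qed

text \<open>The tangent line at 1 gives the lower bound \<open>u - 1\<close>, whose integral is 0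
  because \<open>u\<close> has the same mass as the constant 1.\<close>

lemma H_int_nonneg: assumes "H_fin M u" shows "0 \<le> H_int M u"
proof -
  interpret finite_measure M by (rule finite_measure_mass)
  have "(\<integral>x. enn2real (u x) - 1 \<partial>M) \<le> H_int M u"
    unfolding H_int_def
  proof (rule integral_mono)
    fix x show "enn2real (u x) - 1 \<le> enn2real (u x) * ln (enn2real (u x))"
      using x_ln_x_ge[of "enn2real (u x)" 1] by simp
  qed (use assms density_integrable in \<open>auto simp: H_fin_def\<close>)
  moreover have "measure M (space M) = m"
    using mass by (simp add: total_mass_def measure_def)
  ultimately show ?thesis using density_integrable density_integral by simp
qed

lemma H_fin_of_powr:
  assumes q: "1 < q" and fin: "(\<integral>\<^sup>+x. ennreal (enn2real (u x) powr q) \<partial>M) \<le> ennreal C"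
    and C: "0 \<le> C"
  shows "H_fin M u" "H_int M u \<le> m + C / (q - 1)"
proof -
  interpret finite_measure M by (rule finite_measure_mass)
  have "integrable M (\<lambda>x. enn2real (u x) powr q)"
    by (intro integrableI_bounded) (use fin in \<open>auto simp: less_top[symmetric] top_unique intro: le_less_trans\<close>)
  then have i: "integrable M (\<lambda>x. 1 + enn2real (u x) powr q / (q - 1))" by auto
  show fin': "H_fin M u" unfolding H_fin_def
    by (rule Bochner_Integration.integrable_bound[OF i])
      (use abs_x_ln_x_le[OF _ q] in \<open>auto intro!: AE_I2 order_trans[OF _ abs_ge_self]\<close>)
  have "H_int M u \<le> (\<integral>x. 1 + enn2real (u x) powr q / (q - 1) \<partial>M)"
    unfolding H_int_def
    by (rule integral_mono[OF fin'[unfolded H_fin_def] i])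
      (rule order_trans[OF abs_ge_self abs_x_ln_x_le[OF enn2real_nonneg q]])
  also have "\<dots> = m + (\<integral>x. enn2real (u x) powr q \<partial>M) / (q - 1)"
    using mass \<open>integrable M (\<lambda>x. enn2real (u x) powr q)\<close> by (simp add: total_mass_def measure_def)
  also have "(\<integral>x. enn2real (u x) powr q \<partial>M) \<le> C"
  proof -
    have "ennreal (\<integral>x. enn2real (u x) powr q \<partial>M) = (\<integral>\<^sup>+x. ennreal (enn2real (u x) powr q) \<partial>M)"
      using \<open>integrable M (\<lambda>x. enn2real (u x) powr q)\<close> by (intro nn_integral_eq_integral[symmetric]) auto
    then show ?thesis using fin C by (metis ennreal_le_iff)
  qed
  finally show "H_int M u \<le> m + C / (q - 1)" using q by (simp add: divide_right_mono)
qed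

end

lemma H_mix:
  assumes mass: "total_mass M = ennreal m" "0 < m"
    and u [measurable]: "u \<in> borel_measurable M" and int_u: "(\<integral>\<^sup>+x. u x \<partial>M) = total_mass M"
    and v [measurable]: "v \<in> borel_measurable M" and int_v: "(\<integral>\<^sup>+x. v x \<partial>M) = total_mass M"
    and H: "H_fin M u" "H_fin M v" and t: "0 \<le> t" "t \<le> 1"
  defines "w \<equiv> \<lambda>x. ennreal (1 - t) * u x + ennreal t * v x"
  shows "(\<integral>\<^sup>+x. w x \<partial>M) = total_mass M"
    and "AE x in M. enn2real (w x) = (1 - t) * enn2real (u x) + t * enn2real (v x)"
    and "H_fin M w" and "H_int M w \<le> (1 - t) * H_int M u + t * H_int M v"
proof -
  interpret finite_measure M by (rule finite_measure_mass[OF mass u int_u])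
  have [measurable]: "w \<in> borel_measurable M" unfolding w_def by measurable
  show int_w: "(\<integral>\<^sup>+x. w x \<partial>M) = total_mass M"
    using t by (simp add: w_def nn_integral_add nn_integral_cmult int_u int_v flip: distrib_right ennreal_plus)
  show ae: "AE x in M. enn2real (w x) = (1 - t) * enn2real (u x) + t * enn2real (v x)"
    using AE_finite_density[OF mass u int_u] AE_finite_density[OF mass v int_v]
  proof eventually_elim
    case (elim x)
    then obtain a b where "u x = ennreal a" "v x = ennreal b" "0 \<le> a" "0 \<le> b"
      by (metis ennreal_cases infinity_ennreal_def less_irrefl)
    then show ?case using t by (simp add: w_def flip: ennreal_mult ennreal_plus)
  qed
  let ?h = "\<lambda>u x. enn2real (u x) * ln (enn2real (u x))"
  have le: "AE x in M. ?h w x \<le> (1 - t) * ?h u x + t * ?h v x"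
    using ae by eventually_elim (simp add: x_ln_x_convex t)
  have i: "integrable M (\<lambda>x. (1 - t) * ?h u x + t * ?h v x)"
    using H by (auto simp: H_fin_def)
  \<comment> \<open>Convexity bounds \<open>?h w\<close> only from above; from below the bound is
    -1, hence the 1 added to the majorant.\<close>
  have "integrable M (\<lambda>x. 1 + \<bar>(1 - t) * ?h u x + t * ?h v x\<bar>)"
    using i by auto
  then show "H_fin M w"
    unfolding H_fin_def
  proof (rule Bochner_Integration.integrable_bound)
    show "AE x in M. norm (?h w x) \<le> norm (1 + \<bar>(1 - t) * ?h u x + t * ?h v x\<bar>)"
      using le
    proof eventually_elim
      case (elim x)
      have "\<bar>a\<bar> \<le> \<bar>1 + \<bar>b\<bar>\<bar>" if "a \<le> b" "-1 \<le> a" for a b :: real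
        using that by linarith
      from this[OF elim x_ln_x_ge_minus_1] show ?case by simp
    qed
  qed measurable
  then have "H_int M w \<le> (\<integral>x. (1 - t) * ?h u x + t * ?h v x \<partial>M)"
    unfolding H_int_def by (intro integral_mono_AE le i) (simp add: H_fin_def)
  also have "\<dots> = (1 - t) * H_int M u + t * H_int M v"
    using H by (simp add: H_int_def H_fin_def)
  finally show "H_int M w \<le> (1 - t) * H_int M u + t * H_int M v" .
qed

text \<open>Strict convexity in quantitative form, for states instead of numbers. The weight is kept
  as \<open>1 - 1/2\<close> so that the midpoint is literally the mixture of \<open>H_mix\<close> at
  \<open>t = 1/2\<close>.\<close>

lemma L1_dist_le_H_gap:
  assumes mass: "total_mass M = ennreal m" "0 < m"
    and u [measurable]: "u \<in> borel_measurable M" and int_u: "(\<integral>\<^sup>+x. u x \<partial>M) = total_mass M"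
    and v [measurable]: "v \<in> borel_measurable M" and int_v: "(\<integral>\<^sup>+x. v x \<partial>M) = total_mass M"
    and H: "H_fin M u" "H_fin M v" and eta: "0 < \<eta>"
  shows "(\<integral>x. \<bar>enn2real (u x) - enn2real (v x)\<bar> \<partial>M)
    \<le> (2 / \<eta>) * ((H_int M u + H_int M v) / 2 - H_int M (\<lambda>x. ennreal (1 - 1/2) * u x + ennreal (1/2) * v x)) + 2 * \<eta> * m"
proof -
  define w where "w = (\<lambda>x. ennreal (1 - 1/2) * u x + ennreal (1/2) * v x)"
  have [measurable]: "w \<in> borel_measurable M" unfolding w_def by measurable
  note mix = H_mix[OF mass u int_u v int_v H, of "1/2", folded w_def]
  have ae: "AE x in M. enn2real (w x) * ln (enn2real (w x)) =
      (enn2real (u x) + enn2real (v x)) / 2 * ln ((enn2real (u x) + enn2real (v x)) / 2)"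
  proof -
    have "AE x in M. enn2real (w x) = (enn2real (u x) + enn2real (v x)) / 2"
      using mix(2) by (simp add: add_divide_distrib w_def)
    then show ?thesis
    proof eventually_elim
      case (elim x)
      show ?case unfolding elim ..
    qed
  qed
  have "integrable M (\<lambda>x. enn2real (w x) * ln (enn2real (w x)))" using mix(3) by (simp add: H_fin_def)
  then have i: "integrable M (\<lambda>x. (enn2real (u x) + enn2real (v x)) / 2 * ln ((enn2real (u x) + enn2real (v x)) / 2))"
    by (subst integrable_cong_AE[symmetric, OF _ _ ae]) measurable
  have eq: "H_int M w = (\<integral>x. (enn2real (u x) + enn2real (v x)) / 2 * ln ((enn2real (u x) + enn2real (v x)) / 2) \<partial>M)"
    unfolding H_int_def by (rule integral_cong_AE[OF _ _ ae]) measurable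
  have "(\<integral>x. \<bar>enn2real (u x) - enn2real (v x)\<bar> \<partial>M)
     \<le> (2 / \<eta>) * ((H_int M u + H_int M v) / 2 - H_int M w) + \<eta> * (m + m)"
    using L1_dist_le_jensen_gap[OF density_integrable[OF mass u int_u] density_integrable[OF mass v int_v]
       H[unfolded H_fin_def] i _ _ eta]
    unfolding density_integral[OF mass u int_u] density_integral[OF mass v int_v] eq
    unfolding H_int_def by simp
  also have "\<eta> * (m + m) = 2 * \<eta> * m" by simp
  finally show ?thesis unfolding w_def .
qed

text \<open>Split at the level \<open>K\<close>: below it use
  \<open>d powr (p - 1) \<le> K powr (p - 1)\<close>, above it
  \<open>d powr (p - q) \<le> K powr (p - q)\<close>, where the exponent is negative.\<close>

lemma powr_le_interpolation:
  fixes d K p q :: real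
  assumes "0 \<le> d" "0 < K" "1 \<le> p" "p < q"
  shows "d powr p \<le> K powr (p - 1) * d + K powr (p - q) * d powr q"
proof (cases "d \<le> K")
  case True
  have "d powr p = d powr (p - 1) * d"
    using assms by (cases "d = 0") (auto simp: powr_diff field_simps)
  also have "\<dots> \<le> K powr (p - 1) * d"
    using True assms by (intro mult_right_mono powr_mono2) auto
  finally show ?thesis by (simp add: add_increasing2)
next
  case False
  have "d powr p = d powr (p - q) * d powr q" using False assms by (simp flip: powr_add)
  also have "\<dots> \<le> K powr (p - q) * d powr q"
    using False assms by (intro mult_right_mono powr_mono2') auto
  finally show ?thesis using assms by (simp add: add_increasing)
qed

lemma Lp_dist_tendsto_interpolation:
  fixes f :: "nat \<Rightarrow> 'x \<Rightarrow> real"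
  assumes [measurable]: "\<And>n. f n \<in> borel_measurable M" "g \<in> borel_measurable M"
    and nn: "\<And>n x. 0 \<le> f n x" "\<And>x. 0 \<le> g x"
    and p: "1 \<le> p" "p < q"
    and C: "eventually (\<lambda>n. (\<integral>\<^sup>+x. ennreal (f n x powr q) \<partial>M) \<le> ennreal C) sequentially"
      "(\<integral>\<^sup>+x. ennreal (g x powr q) \<partial>M) \<le> ennreal C"
    and L1: "(\<lambda>n. \<integral>\<^sup>+x. ennreal \<bar>f n x - g x\<bar> \<partial>M) \<longlonglongrightarrow> 0"
  shows "(\<lambda>n. \<integral>\<^sup>+x. ennreal (\<bar>f n x - g x\<bar> powr p) \<partial>M) \<longlonglongrightarrow> 0"
proof -
  have bound: "(\<integral>\<^sup>+x. ennreal (\<bar>f n x - g x\<bar> powr p) \<partial>M)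
     \<le> ennreal (K powr (p - 1)) * (\<integral>\<^sup>+x. ennreal \<bar>f n x - g x\<bar> \<partial>M) + ennreal (K powr (p - q)) * (ennreal C + ennreal C)"
    if K: "0 < K" and n: "(\<integral>\<^sup>+x. ennreal (f n x powr q) \<partial>M) \<le> ennreal C" for n K
  proof -
    have pw: "\<bar>f n x - g x\<bar> powr p \<le> K powr (p - 1) * \<bar>f n x - g x\<bar> + K powr (p - q) * (f n x powr q + g x powr q)" for x
    proof -
      have "\<bar>f n x - g x\<bar> powr q \<le> max (f n x) (g x) powr q"
        using nn(1)[of n x] nn(2)[of x] p by (intro powr_mono2) auto
      also have "\<dots> \<le> f n x powr q + g x powr q" by (auto simp: max_def)
      finally have "K powr (p - q) * \<bar>f n x - g x\<bar> powr q \<le> K powr (p - q) * (f n x powr q + g x powr q)"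
        by (intro mult_left_mono) auto
      with powr_le_interpolation[of "\<bar>f n x - g x\<bar>" K p q] K p show ?thesis by linarith
    qed
    have "(\<integral>\<^sup>+x. ennreal (\<bar>f n x - g x\<bar> powr p) \<partial>M)
      \<le> (\<integral>\<^sup>+x. ennreal (K powr (p - 1)) * ennreal \<bar>f n x - g x\<bar>
           + ennreal (K powr (p - q)) * (ennreal (f n x powr q) + ennreal (g x powr q)) \<partial>M)"
      using pw by (intro nn_integral_mono) (simp flip: ennreal_plus ennreal_mult)
    also have "\<dots> = ennreal (K powr (p - 1)) * (\<integral>\<^sup>+x. ennreal \<bar>f n x - g x\<bar> \<partial>M)
       + ennreal (K powr (p - q)) * ((\<integral>\<^sup>+x. ennreal (f n x powr q) \<partial>M) + (\<integral>\<^sup>+x. ennreal (g x powr q) \<partial>M))"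
      by (simp add: nn_integral_add nn_integral_cmult)
    also have "\<dots> \<le> ennreal (K powr (p - 1)) * (\<integral>\<^sup>+x. ennreal \<bar>f n x - g x\<bar> \<partial>M)
       + ennreal (K powr (p - q)) * (ennreal C + ennreal C)"
      by (intro add_mono mult_left_mono n C(2)) auto
    finally show ?thesis .
  qed
  show ?thesis
  proof (rule order_tendstoI)
    fix e :: ennreal assume "0 < e"
    then obtain r where r: "0 < r" "ennreal r < e"
      by (metis dense ennreal_cases ennreal_less_zero_iff infinity_ennreal_def less_irrefl not_less top_greatest)
    \<comment> \<open>\<open>C\<close> is not assumed nonnegative, and \<open>ennreal\<close>
      truncates negative values to 0.\<close>
    define C' where "C' = max C 0"
    have C': "ennreal C = ennreal C'" "0 \<le> C'" by (auto simp: C'_def max_def ennreal_neg)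
    have "((\<lambda>K. K powr (p - q) * (2 * C')) \<longlongrightarrow> 0 * (2 * C')) at_top"
      using p by (intro tendsto_mult tendsto_const tendsto_neg_powr filterlim_ident) auto
    then have "eventually (\<lambda>K. K powr (p - q) * (2 * C') < r / 2) at_top"
      using r by (intro order_tendstoD) auto
    \<comment> \<open>The level \<open>K\<close> is fixed first, so large that the L^q term is below
      \<open>r / 2\<close> for all \<open>n\<close>; only then does the L^1 convergence determine
      how large \<open>n\<close> must be.\<close>
    then obtain K where K: "0 < K" "K powr (p - q) * (2 * C') < r / 2"
      by (metis (mono_tags, lifting) eventually_at_top_linorder eventually_gt_at_top eventually_conj order_refl)
    have "(\<lambda>n. ennreal (K powr (p - 1)) * (\<integral>\<^sup>+x. ennreal \<bar>f n x - g x\<bar> \<partial>M)) \<longlonglongrightarrow> ennreal (K powr (p - 1)) * 0"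
      by (intro tendsto_mult_ennreal tendsto_const L1) (auto)
    then have "eventually (\<lambda>n. ennreal (K powr (p - 1)) * (\<integral>\<^sup>+x. ennreal \<bar>f n x - g x\<bar> \<partial>M) < ennreal (r / 2)) sequentially"
      using r by (intro order_tendstoD) auto
    with C(1) show "eventually (\<lambda>n. (\<integral>\<^sup>+x. ennreal (\<bar>f n x - g x\<bar> powr p) \<partial>M) < e) sequentially"
    proof eventually_elim
      case (elim n)
      have "(\<integral>\<^sup>+x. ennreal (\<bar>f n x - g x\<bar> powr p) \<partial>M) \<le> ennreal (r / 2) + ennreal (r / 2)"
      proof (rule order_trans[OF bound[OF K(1) elim(1)]], rule add_mono)
        show "ennreal (K powr (p - q)) * (ennreal C + ennreal C) \<le> ennreal (r / 2)"
          using K C' by (simp add: ennreal_leI flip: ennreal_plus ennreal_mult)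
      qed (use elim in simp)
      also have "\<dots> = ennreal r" using r by (simp flip: ennreal_plus)
      finally show ?case using r by simp
    qed
  qed auto
qed

subsection \<open>Integrals along a fixed direction\<close>

lemma ennreal_finiteE:
  fixes x :: ennreal
  assumes "x < \<infinity>" obtains r where "x = ennreal r" "0 \<le> r"
  using assms by (cases x) auto

lemma nn_integral_lborel_shift:
  fixes f :: "'a::euclidean_space \<Rightarrow> ennreal"
  assumes [measurable]: "f \<in> borel_measurable borel"
  shows "(\<integral>\<^sup>+x. f (x + k) \<partial>lborel) = (\<integral>\<^sup>+x. f x \<partial>lborel)"
proof -
  have "(\<integral>\<^sup>+x. f x \<partial>lborel) = (\<integral>\<^sup>+x. f x \<partial>distr lborel borel ((+) k))"
    by (simp add: lborel_distr_plus)
  also have "\<dots> = (\<integral>\<^sup>+x. f (x + k) \<partial>lborel)"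
    by (subst nn_integral_distr) (auto simp: add.commute)
  finally show ?thesis by simp
qed

lemma nn_integral_lborel_reflect:
  fixes f :: "'a::euclidean_space \<Rightarrow> ennreal"
  assumes [measurable]: "f \<in> borel_measurable borel"
  shows "(\<integral>\<^sup>+x. f (k - x) \<partial>lborel) = (\<integral>\<^sup>+x. f x \<partial>lborel)"
proof -
  have "(\<integral>\<^sup>+x. f x \<partial>lborel) = (\<integral>\<^sup>+x. f x \<partial>density (distr lborel borel (\<lambda>x. k + (-1) *\<^sub>R x)) (\<lambda>_. ennreal (\<bar>-1\<bar>^DIM('a))))"
    by (subst lborel_affine[of "-1" k]) simp_all
  also have "\<dots> = (\<integral>\<^sup>+x. f (k - x) \<partial>lborel)"
    by (simp add: nn_integral_density nn_integral_distr)
  finally show ?thesis by simp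
qed

text \<open>The image of Lebesgue measure under the shear is again translation invariant, hence
  proportional to Lebesgue measure (Fubini on \<open>f (T w + y) * g y\<close>).\<close>
lemma nn_integral_shear_le:
  fixes a e :: "'a::euclidean_space" and b :: real
  assumes ae: "a \<bullet> e = 0"
  defines "T \<equiv> \<lambda>w. w + (a \<bullet> w - b) *\<^sub>R e"
  shows "\<exists>C\<ge>0. \<forall>f \<in> borel_measurable borel.
    (\<integral>\<^sup>+w. f (T w) \<partial>lborel) \<le> ennreal C * (\<integral>\<^sup>+w. f w \<partial>lborel)"
proof -
  have [measurable]: "T \<in> borel_measurable borel" unfolding T_def by measurable
  have shift: "(\<integral>\<^sup>+w. h (T w + k) \<partial>lborel) = (\<integral>\<^sup>+w. h (T w) \<partial>lborel)"
    if [measurable]: "h \<in> borel_measurable borel" for h :: "'a \<Rightarrow> ennreal" and k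
  proof -
    \<comment> \<open>\<open>e\<close> is orthogonal to \<open>a\<close>, so
      \<open>k - (a \<bullet> k) *\<^sub>R e\<close> has the same inner product with
      \<open>a\<close> as \<open>k\<close>, and the extra shear it causes restores the missing
      multiple of \<open>e\<close>.\<close>
    have "T w + k = T (w + (k - (a \<bullet> k) *\<^sub>R e))" for w
      using ae by (simp add: T_def inner_simps algebra_simps)
    then have "(\<integral>\<^sup>+w. h (T w + k) \<partial>lborel) = (\<integral>\<^sup>+w. h (T (w + (k - (a \<bullet> k) *\<^sub>R e))) \<partial>lborel)" by simp
    also have "\<dots> = (\<integral>\<^sup>+w. h (T w) \<partial>lborel)"
      by (rule nn_integral_lborel_shift[of "\<lambda>w. h (T w)"]) measurable
    finally show ?thesis .
  qed
  \<comment> \<open>The unit ball is the test function: \<open>B\<close> is its volume,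
    \<open>D\<close> is finite because the inverse of \<open>T\<close> is again an affine shear, and
    \<open>D / B\<close> is the constant of proportionality.\<close>
  define g :: "'a \<Rightarrow> ennreal" where "g = indicator (ball 0 1)"
  have g [measurable]: "g \<in> borel_measurable borel" unfolding g_def by (intro borel_measurable_indicator) simp
  define D where "D = (\<integral>\<^sup>+w. g (- T w) \<partial>lborel)"
  define B where "B = (\<integral>\<^sup>+w. g w \<partial>lborel)"
  have B: "B = ennreal (unit_ball_vol DIM('a))"
    unfolding B_def g_def by (simp add: emeasure_ball)
  have Dfin: "D < \<infinity>"
  proof -
    have "norm w \<le> 1 + (norm a + \<bar>b\<bar>) * norm e" if "norm (T w) < 1" for w
    proof -
      have "w = T w - (a \<bullet> T w - b) *\<^sub>R e"
        using ae by (simp add: T_def inner_simps)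
      then have "norm w \<le> norm (T w) + \<bar>a \<bullet> T w - b\<bar> * norm e"
        by (metis norm_scaleR norm_triangle_ineq4)
      also have "\<bar>a \<bullet> T w - b\<bar> \<le> norm a + \<bar>b\<bar>"
      proof -
        have "\<bar>a \<bullet> T w\<bar> \<le> norm a * norm (T w)" by (rule Cauchy_Schwarz_ineq2)
        also have "\<dots> \<le> norm a * 1" using that by (intro mult_left_mono) auto
        finally show ?thesis by linarith
      qed
      finally show ?thesis using that by (smt (verit) mult_right_mono norm_ge_zero)
    qed
    then have "{w. norm (T w) < 1} \<subseteq> cball 0 (1 + (norm a + \<bar>b\<bar>) * norm e)" by auto
    then have "bounded {w. norm (T w) < 1}" using bounded_subset bounded_cball by blast
    then have "emeasure lborel {w. norm (T w) < 1} < \<infinity>" by (rule emeasure_bounded_finite)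
    moreover have "D = (\<integral>\<^sup>+w. indicator {w. norm (T w) < 1} w \<partial>lborel)"
      unfolding D_def g_def by (intro nn_integral_cong) (auto split: split_indicator)
    ultimately show ?thesis by simp
  qed
  have eq: "B * (\<integral>\<^sup>+w. f (T w) \<partial>lborel) = D * (\<integral>\<^sup>+w. f w \<partial>lborel)"
    if f [measurable]: "f \<in> borel_measurable borel" for f :: "'a \<Rightarrow> ennreal"
  proof -
    have "B * (\<integral>\<^sup>+w. f (T w) \<partial>lborel) = (\<integral>\<^sup>+y. g y * (\<integral>\<^sup>+w. f (T w + y) \<partial>lborel) \<partial>lborel)"
      by (simp add: shift B_def nn_integral_multc)
    also have "\<dots> = (\<integral>\<^sup>+y. (\<integral>\<^sup>+w. g y * f (T w + y) \<partial>lborel) \<partial>lborel)"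
      by (simp add: nn_integral_cmult)
    also have "\<dots> = (\<integral>\<^sup>+w. (\<integral>\<^sup>+y. g y * f (T w + y) \<partial>lborel) \<partial>lborel)"
      by (rule lborel_pair.Fubini') measurable
    also have "\<dots> = (\<integral>\<^sup>+w. (\<integral>\<^sup>+y. g (y - T w) * f y \<partial>lborel) \<partial>lborel)"
    proof (rule nn_integral_cong)
      fix w
      have "(\<integral>\<^sup>+y. g y * f (T w + y) \<partial>lborel) = (\<integral>\<^sup>+y. g ((y + T w) - T w) * f (y + T w) \<partial>lborel)"
        by (simp add: add.commute)
      also have "\<dots> = (\<integral>\<^sup>+y. g (y - T w) * f y \<partial>lborel)"
        by (rule nn_integral_lborel_shift[of "\<lambda>y. g (y - T w) * f y"]) measurable
      finally show "(\<integral>\<^sup>+y. g y * f (T w + y) \<partial>lborel) = (\<integral>\<^sup>+y. g (y - T w) * f y \<partial>lborel)" .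
    qed
    also have "\<dots> = (\<integral>\<^sup>+y. (\<integral>\<^sup>+w. g (y - T w) * f y \<partial>lborel) \<partial>lborel)"
      by (rule lborel_pair.Fubini') measurable
    also have "\<dots> = (\<integral>\<^sup>+y. D * f y \<partial>lborel)"
    proof (rule nn_integral_cong)
      fix y
      have "(\<integral>\<^sup>+w. g (y - T w) \<partial>lborel) = (\<integral>\<^sup>+w. g (- (T w + (- y))) \<partial>lborel)" by simp
      also have "\<dots> = D" unfolding D_def by (rule shift[of "\<lambda>z. g (- z)"]) measurable
      finally show "(\<integral>\<^sup>+w. g (y - T w) * f y \<partial>lborel) = D * f y" by (simp add: nn_integral_multc)
    qed
    also have "\<dots> = D * (\<integral>\<^sup>+w. f w \<partial>lborel)" by (simp add: nn_integral_cmult)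
    finally show ?thesis .
  qed
  obtain d where d: "D = ennreal d" "0 \<le> d" using Dfin by (metis ennreal_cases infinity_ennreal_def less_irrefl)
  let ?\<beta> = "unit_ball_vol DIM('a)"
  have bp: "0 < ?\<beta>" "?\<beta> \<noteq> 0" by (auto simp: less_imp_neq[symmetric])
  show ?thesis
  proof (intro exI[of _ "d / ?\<beta>"] conjI ballI)
    fix f :: "'a \<Rightarrow> ennreal" assume f: "f \<in> borel_measurable borel"
    have "(\<integral>\<^sup>+w. f (T w) \<partial>lborel) = ennreal (1 / ?\<beta>) * (B * (\<integral>\<^sup>+w. f (T w) \<partial>lborel))"
      using bp by (simp add: B mult.assoc[symmetric] flip: ennreal_mult)
    also have "\<dots> = ennreal (d / ?\<beta>) * (\<integral>\<^sup>+w. f w \<partial>lborel)"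
      using bp d by (simp add: eq[OF f] mult.assoc[symmetric] flip: ennreal_mult)
    finally show "(\<integral>\<^sup>+w. f (T w) \<partial>lborel) \<le> ennreal (d / ?\<beta>) * (\<integral>\<^sup>+w. f w \<partial>lborel)" by simp
  qed (use d bp in simp)
qed

lemma nn_integral_hyperplane_lebesgue:
  fixes a :: "'a::euclidean_space"
  assumes [measurable]: "f \<in> borel_measurable borel"
  shows "(\<integral>\<^sup>+y. f y \<partial>hyperplane_lebesgue a b) =
    (\<integral>\<^sup>+w. indicator {b..b+1} (a \<bullet> w) * f (w - ((a \<bullet> w - b) / (a \<bullet> a)) *\<^sub>R a) \<partial>lborel)"
proof -
  have i: "indicator {x. b \<le> a \<bullet> x \<and> a \<bullet> x \<le> b + 1} w = (indicator {b..b+1} (a \<bullet> w) :: ennreal)" for w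
    by (auto split: split_indicator)
  show ?thesis
    unfolding hyperplane_lebesgue_def
    by (subst nn_integral_distr) (simp_all add: nn_integral_density i)
qed

text \<open>For \<open>v\<close> transversal to the hyperplane \<open>a \<bullet> x = b\<close>,
  this is the oblique projection onto it parallel to \<open>v\<close>.\<close>

definition proj_along :: "'a::euclidean_space \<Rightarrow> real \<Rightarrow> 'a \<Rightarrow> 'a \<Rightarrow> 'a" where
  "proj_along a b v z = z + ((b - a \<bullet> z) / (a \<bullet> v)) *\<^sub>R v"

lemma borel_measurable_proj_along [measurable]: "proj_along a b v \<in> borel_measurable borel"
  unfolding proj_along_def[abs_def] by measurable

text \<open>Fubini for the lines parallel to \<open>v\<close> over the hyperplane. To reach the slab
  in \<open>hyperplane_lebesgue\<close>, a factor 1 is written as an integral over translations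
  along \<open>v\<close> that bring the point into the slab; after exchanging integrals and
  shifting, the slab condition no longer involves the translation parameter. What remains is the
  oblique projection in place of the orthogonal one, which a shear corrects.\<close>

lemma nn_integral_fibration_le:
  fixes a v :: "'a::euclidean_space"
  assumes av: "a \<bullet> v \<noteq> 0"
  shows "\<exists>C\<ge>0. \<forall>f\<in>borel_measurable borel. \<forall>G\<in>borel_measurable borel.
     (\<integral>\<^sup>+z. G z * f (proj_along a b v z) \<partial>lborel)
       \<le> ennreal C * (\<integral>\<^sup>+y. f y * (\<integral>\<^sup>+t. G (y + t *\<^sub>R v) \<partial>lborel) \<partial>hyperplane_lebesgue a b)"
proof -
  have a0: "a \<bullet> a \<noteq> 0" using av by auto
  \<comment> \<open>With this direction, orthogonal projection after the shear is projection along
    \<open>v\<close> (\<open>oT\<close>), while the shear preserves the slab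
    (\<open>aT\<close>).\<close>
  define e where "e = (1 / (a \<bullet> a)) *\<^sub>R a - (1 / (a \<bullet> v)) *\<^sub>R v"
  have ae: "a \<bullet> e = 0" using a0 av by (simp add: e_def inner_simps)
  define T where "T = (\<lambda>w. w + (a \<bullet> w - b) *\<^sub>R e)"
  obtain C where C: "0 \<le> C" "\<And>f. f \<in> borel_measurable borel \<Longrightarrow>
    (\<integral>\<^sup>+w. f (T w) \<partial>lborel) \<le> ennreal C * (\<integral>\<^sup>+w. f w \<partial>lborel)"
    using nn_integral_shear_le[OF ae, of b] unfolding T_def by blast
  define po where "po = (\<lambda>w. w - ((a \<bullet> w - b) / (a \<bullet> a)) *\<^sub>R a)"
  have [measurable]: "po \<in> borel_measurable borel" "T \<in> borel_measurable borel"
    unfolding po_def T_def by measurable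
  have oT: "po (T w) = proj_along a b v w" and aT: "a \<bullet> T w = a \<bullet> w" for w
  proof -
    show aT: "a \<bullet> T w = a \<bullet> w" by (simp add: T_def inner_simps ae)
    have "po (T w) = T w - ((a \<bullet> w - b) / (a \<bullet> a)) *\<^sub>R a" by (simp add: po_def aT)
    also have "\<dots> = w - ((a \<bullet> w - b) / (a \<bullet> v)) *\<^sub>R v"
      by (simp add: T_def e_def scaleR_diff_right)
    also have "\<dots> = proj_along a b v w"
      by (simp add: proj_along_def diff_divide_distrib scaleR_diff_left)
    finally show "po (T w) = proj_along a b v w" .
  qed
  \<comment> \<open>The coefficient is chosen so that \<open>a \<bullet> z + c * r\<close> becomes
    \<open>a \<bullet> w\<close> when \<open>z = w + r *\<^sub>R v\<close>.\<close>
  define c where "c = - (a \<bullet> v)"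
  have c0: "c \<noteq> 0" using av by (simp add: c_def)
  show ?thesis
  proof (intro exI[of _ "\<bar>c\<bar> * C"] conjI ballI)
    fix f G :: "'a \<Rightarrow> ennreal"
    assume [measurable]: "f \<in> borel_measurable borel" "G \<in> borel_measurable borel"
    let ?p = "proj_along a b v"
    let ?I = "indicator {b..b+1} :: real \<Rightarrow> ennreal"
    have one: "ennreal \<bar>c\<bar> * (\<integral>\<^sup>+r. ?I (a \<bullet> z + c * r) \<partial>lborel) = 1" for z
      using nn_integral_real_affine[of ?I c "a \<bullet> z"] c0 by simp
    define \<Phi> where "\<Phi> = (\<lambda>y. f y * (\<integral>\<^sup>+t. G (y + t *\<^sub>R v) \<partial>lborel))"
    have [measurable]: "\<Phi> \<in> borel_measurable borel" unfolding \<Phi>_def by measurable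
    have "(\<integral>\<^sup>+z. G z * f (?p z) \<partial>lborel)
      = (\<integral>\<^sup>+z. (ennreal \<bar>c\<bar> * (\<integral>\<^sup>+r. ?I (a \<bullet> z + c * r) \<partial>lborel)) * (G z * f (?p z)) \<partial>lborel)"
      by (simp add: one)
    also have "\<dots> = (\<integral>\<^sup>+z. ennreal \<bar>c\<bar> * (\<integral>\<^sup>+r. ?I (a \<bullet> z + c * r) * (G z * f (?p z)) \<partial>lborel) \<partial>lborel)"
      by (simp add: nn_integral_multc mult.assoc)
    also have "\<dots> = ennreal \<bar>c\<bar> * (\<integral>\<^sup>+z. (\<integral>\<^sup>+r. ?I (a \<bullet> z + c * r) * (G z * f (?p z)) \<partial>lborel) \<partial>lborel)"
      by (rule nn_integral_cmult) measurable
    also have "(\<integral>\<^sup>+z. (\<integral>\<^sup>+r. ?I (a \<bullet> z + c * r) * (G z * f (?p z)) \<partial>lborel) \<partial>lborel)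
      = (\<integral>\<^sup>+r. (\<integral>\<^sup>+z. ?I (a \<bullet> z + c * r) * (G z * f (?p z)) \<partial>lborel) \<partial>lborel)"
      by (rule lborel_pair.Fubini') measurable
    also have "\<dots> = (\<integral>\<^sup>+r. (\<integral>\<^sup>+w. ?I (a \<bullet> w) * (G (w + r *\<^sub>R v) * f (?p w)) \<partial>lborel) \<partial>lborel)"
    proof (rule nn_integral_cong)
      fix r
      have "?p (w + r *\<^sub>R v) = ?p w" for w
        using av by (simp add: proj_along_def inner_simps diff_divide_distrib add_divide_distrib algebra_simps)
      then have "(\<integral>\<^sup>+w. ?I (a \<bullet> w) * (G (w + r *\<^sub>R v) * f (?p w)) \<partial>lborel)
        = (\<integral>\<^sup>+w. ?I (a \<bullet> (w + r *\<^sub>R v) + c * r) * (G (w + r *\<^sub>R v) * f (?p (w + r *\<^sub>R v))) \<partial>lborel)"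
        by (simp add: inner_simps c_def)
      also have "\<dots> = (\<integral>\<^sup>+z. ?I (a \<bullet> z + c * r) * (G z * f (?p z)) \<partial>lborel)"
        by (rule nn_integral_lborel_shift[of "\<lambda>z. ?I (a \<bullet> z + c * r) * (G z * f (?p z))"]) measurable
      finally show "(\<integral>\<^sup>+z. ?I (a \<bullet> z + c * r) * (G z * f (?p z)) \<partial>lborel)
         = (\<integral>\<^sup>+w. ?I (a \<bullet> w) * (G (w + r *\<^sub>R v) * f (?p w)) \<partial>lborel)" by simp
    qed
    also have "\<dots> = (\<integral>\<^sup>+w. (\<integral>\<^sup>+r. ?I (a \<bullet> w) * (G (w + r *\<^sub>R v) * f (?p w)) \<partial>lborel) \<partial>lborel)"
      by (rule lborel_pair.Fubini') measurable
    also have "\<dots> = (\<integral>\<^sup>+w. ?I (a \<bullet> w) * \<Phi> (?p w) \<partial>lborel)"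
    proof (rule nn_integral_cong)
      fix w
      define \<tau> where "\<tau> = (b - a \<bullet> w) / (a \<bullet> v)"
      have "(\<integral>\<^sup>+r. G (w + r *\<^sub>R v) \<partial>lborel) = (\<integral>\<^sup>+r. G (w + (r + \<tau>) *\<^sub>R v) \<partial>lborel)"
        by (rule nn_integral_lborel_shift[symmetric, of "\<lambda>r. G (w + r *\<^sub>R v)"]) measurable
      also have "\<dots> = (\<integral>\<^sup>+r. G (?p w + r *\<^sub>R v) \<partial>lborel)"
        by (simp add: proj_along_def \<tau>_def scaleR_add_left add_ac)
      finally have "(\<integral>\<^sup>+r. G (w + r *\<^sub>R v) \<partial>lborel) = (\<integral>\<^sup>+r. G (?p w + r *\<^sub>R v) \<partial>lborel)" .
      then show "(\<integral>\<^sup>+r. ?I (a \<bullet> w) * (G (w + r *\<^sub>R v) * f (?p w)) \<partial>lborel) = ?I (a \<bullet> w) * \<Phi> (?p w)"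
        by (simp add: \<Phi>_def nn_integral_cmult nn_integral_multc mult.commute)
    qed
    also have "\<dots> = (\<integral>\<^sup>+w. (\<lambda>w. ?I (a \<bullet> w) * \<Phi> (po w)) (T w) \<partial>lborel)"
      by (simp add: oT aT)
    also have "\<dots> \<le> ennreal C * (\<integral>\<^sup>+w. ?I (a \<bullet> w) * \<Phi> (po w) \<partial>lborel)"
      by (rule C(2)) measurable
    also have "(\<integral>\<^sup>+w. ?I (a \<bullet> w) * \<Phi> (po w) \<partial>lborel) = (\<integral>\<^sup>+y. \<Phi> y \<partial>hyperplane_lebesgue a b)"
      by (subst nn_integral_hyperplane_lebesgue) (simp_all add: po_def)
    finally have "(\<integral>\<^sup>+z. G z * f (?p z) \<partial>lborel) \<le> ennreal \<bar>c\<bar> * (ennreal C * (\<integral>\<^sup>+y. \<Phi> y \<partial>hyperplane_lebesgue a b))"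
      by (simp add: mult_left_mono)
    then show "(\<integral>\<^sup>+z. G z * f (?p z) \<partial>lborel)
       \<le> ennreal (\<bar>c\<bar> * C) * (\<integral>\<^sup>+y. f y * (\<integral>\<^sup>+t. G (y + t *\<^sub>R v) \<partial>lborel) \<partial>hyperplane_lebesgue a b)"
      using C(1) by (simp add: \<Phi>_def ennreal_mult mult.assoc)
  qed (use C in simp)
qed

lemma ex_transversal_direction:
  assumes "finite A" "\<And>a. a \<in> A \<Longrightarrow> a \<noteq> (0::'a::euclidean_space)"
  shows "\<exists>v. v \<noteq> 0 \<and> (\<forall>a\<in>A. a \<bullet> v \<noteq> 0)"
proof -
  \<comment> \<open>A basis vector is added to the normals, so that avoiding all hyperplanes forces
    \<open>v\<close> to be nonzero even for empty \<open>A\<close>.\<close>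
  have "negligible (\<Union>a\<in>insert (SOME i. i \<in> Basis) A. {x. a \<bullet> x = 0})"
    using assms nonzero_Basis[OF SOME_Basis, where ?'a='a]
    by (intro negligible_Union) (auto intro!: negligible_hyperplane)
  moreover have "\<not> negligible (UNIV::'a set)" by (simp add: open_not_negligible)
  ultimately obtain v where v: "v \<notin> (\<Union>a\<in>insert (SOME i. i \<in> Basis) A. {x. a \<bullet> x = 0})"
    by (metis UNIV_eq_I)
  then have "v \<noteq> 0" by auto
  with v show ?thesis by auto
qed

text \<open>Two points of the line in the ball are less than \<open>2 * d\<close> apart, so all
  admissible parameters lie within \<open>2 * d / norm v\<close> of any one of them.\<close>

lemma nn_integral_line_ball_le:
  fixes v :: "'a::euclidean_space"
  assumes "v \<noteq> 0" "0 < d"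
  shows "(\<integral>\<^sup>+t. indicator (ball x d) (y + t *\<^sub>R v) \<partial>lborel) \<le> ennreal (4 * d / norm v)"
proof (cases "\<exists>t0. y + t0 *\<^sub>R v \<in> ball x d")
  case False
  then show ?thesis by (simp add: indicator_def)
next
  case True
  then obtain t0 where t0: "y + t0 *\<^sub>R v \<in> ball x d" by blast
  have "\<bar>t - t0\<bar> \<le> 2 * d / norm v" if "y + t *\<^sub>R v \<in> ball x d" for t
  proof -
    have "dist (y + t *\<^sub>R v) (y + t0 *\<^sub>R v) < d + d"
      using that t0 by (metis add_strict_mono dist_commute dist_triangle_le less_imp_le mem_ball order_le_less_trans dist_triangle3)
    moreover have "dist (y + t *\<^sub>R v) (y + t0 *\<^sub>R v) = \<bar>t - t0\<bar> * norm v"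
      by (simp add: dist_norm flip: scaleR_diff_left)
    ultimately show ?thesis using assms by (simp add: field_simps)
  qed
  then have "(\<integral>\<^sup>+t. indicator (ball x d) (y + t *\<^sub>R v) \<partial>lborel)
     \<le> (\<integral>\<^sup>+t. indicator {t0 - 2 * d / norm v .. t0 + 2 * d / norm v} t \<partial>lborel)"
    by (intro nn_integral_mono) (fastforce split: split_indicator simp: abs_le_iff)
  also have "\<dots> = ennreal (4 * d / norm v)"
    using assms by (simp add: field_simps)
  finally show ?thesis .
qed

lemma nn_integral_abs_powr_finite:
  fixes \<alpha> R :: real
  assumes "\<alpha> < 1" "0 \<le> R"
  shows "(\<integral>\<^sup>+s. ennreal (\<bar>s\<bar> powr - \<alpha>) * indicator {-R..R} s \<partial>lborel) < \<infinity>"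
proof -
  define h :: "real \<Rightarrow> real" where "h = (\<lambda>s. s powr - \<alpha> * indicator {0..R} s)"
  have [measurable]: "h \<in> borel_measurable borel" unfolding h_def by measurable
  have "(\<lambda>s. s powr - \<alpha>) integrable_on {0..R}"
    using assms by (intro integrable_on_powr_from_0) auto
  then obtain I where "((\<lambda>s. s powr - \<alpha>) has_integral I) {0..R}" by (auto simp: integrable_on_def)
  then have "(h has_integral I) UNIV"
    unfolding h_def indicator_def of_bool_def by (subst (asm) has_integral_restrict_UNIV[symmetric]) (simp add: if_distrib cong: if_cong)
  then have h: "(\<integral>\<^sup>+s. ennreal (h s) \<partial>lborel) = ennreal I"
    by (intro nn_integral_has_integral_lborel) (auto simp: h_def)
  have "(\<integral>\<^sup>+s. ennreal (\<bar>s\<bar> powr - \<alpha>) * indicator {-R..R} s \<partial>lborel)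
    \<le> (\<integral>\<^sup>+s. ennreal (h s) + ennreal (h (0 - s)) \<partial>lborel)"
    by (intro nn_integral_mono) (auto simp: h_def split: split_indicator)
  also have "\<dots> = ennreal I + ennreal I"
    using nn_integral_lborel_reflect[of "\<lambda>s. ennreal (h s)" 0] by (simp add: nn_integral_add h)
  finally show ?thesis by (simp add: order_le_less_trans)
qed

text \<open>Along the line the signed distance to the hyperplane is affine in \<open>t\<close> with
  slope \<open>\<kappa>\<close>, which does not depend on \<open>y\<close>. Substituting it for
  \<open>t\<close> yields one bound for all parallel lines.\<close>

lemma nn_integral_line_powr_le:
  fixes a v :: "'a::euclidean_space"
  assumes \<alpha>: "\<alpha> < 1" and av: "a \<bullet> v \<noteq> 0" and P: "bounded P" "P \<in> sets borel"
  shows "\<exists>L\<ge>0. \<forall>y. (\<integral>\<^sup>+t. ennreal ((\<bar>a \<bullet> (y + t *\<^sub>R v) - b\<bar> / norm a) powr - \<alpha>) * indicator P (y + t *\<^sub>R v) \<partial>lborel)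
     \<le> ennreal L"
proof -
  have [measurable]: "P \<in> sets borel" by fact
  have na: "0 < norm a" using av by auto
  obtain R where R: "\<And>z. z \<in> P \<Longrightarrow> norm z \<le> R" "0 < R" using P(1) bounded_pos by blast
  define R' where "R' = R + \<bar>b\<bar> / norm a"
  have R': "\<bar>a \<bullet> z - b\<bar> / norm a \<le> R'" if "z \<in> P" for z
  proof -
    have "\<bar>a \<bullet> z - b\<bar> \<le> norm a * norm z + \<bar>b\<bar>"
      using Cauchy_Schwarz_ineq2[of a z] by linarith
    also have "\<dots> \<le> norm a * R + \<bar>b\<bar>" using R(1)[OF that] by (simp add: mult_left_mono)
    finally show ?thesis using na by (simp add: R'_def field_simps)
  qed
  have R'0: "0 \<le> R'" using R na by (simp add: R'_def)
  define \<kappa> where "\<kappa> = (a \<bullet> v) / norm a"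
  have k0: "\<kappa> \<noteq> 0" using av na by (simp add: \<kappa>_def)
  define h :: "real \<Rightarrow> ennreal" where "h s = ennreal (\<bar>s\<bar> powr - \<alpha>) * indicator {-R'..R'} s" for s
  have [measurable]: "h \<in> borel_measurable borel" unfolding h_def[abs_def] by measurable
  obtain I where I: "(\<integral>\<^sup>+s. h s \<partial>lborel) = ennreal I" "0 \<le> I"
    using ennreal_finiteE[OF nn_integral_abs_powr_finite[OF \<alpha> R'0, folded h_def]] by blast
  show ?thesis
  proof (intro exI[of _ "I / \<bar>\<kappa>\<bar>"] conjI allI)
    fix y
    have eq: "(a \<bullet> y - b) / norm a + \<kappa> * t = (a \<bullet> (y + t *\<^sub>R v) - b) / norm a" for t
    proof -
      have "a \<bullet> (y + t *\<^sub>R v) - b = (a \<bullet> y - b) + (a \<bullet> v) * t" by (simp add: inner_add_right)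
      then show ?thesis by (simp only: \<kappa>_def add_divide_distrib times_divide_eq_left)
    qed
    have "ennreal ((\<bar>a \<bullet> (y + t *\<^sub>R v) - b\<bar> / norm a) powr - \<alpha>) * indicator P (y + t *\<^sub>R v)
        \<le> h ((a \<bullet> y - b) / norm a + \<kappa> * t)" for t
    proof (cases "y + t *\<^sub>R v \<in> P")
      case True
      have "\<bar>(a \<bullet> (y + t *\<^sub>R v) - b) / norm a\<bar> \<le> R'" using R'[OF True] by (simp add: abs_divide)
      then have "(a \<bullet> (y + t *\<^sub>R v) - b) / norm a \<in> {-R'..R'}"
        unfolding abs_le_iff atLeastAtMost_iff by linarith
      then show ?thesis using True by (simp add: eq h_def abs_divide)
    qed simp
    then have "(\<integral>\<^sup>+t. ennreal ((\<bar>a \<bullet> (y + t *\<^sub>R v) - b\<bar> / norm a) powr - \<alpha>) * indicator P (y + t *\<^sub>R v) \<partial>lborel)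
       \<le> (\<integral>\<^sup>+t. h ((a \<bullet> y - b) / norm a + \<kappa> * t) \<partial>lborel)"
      by (rule nn_integral_mono)
    also have "\<dots> = ennreal (1 / \<bar>\<kappa>\<bar>) * (ennreal \<bar>\<kappa>\<bar> * (\<integral>\<^sup>+t. h ((a \<bullet> y - b) / norm a + \<kappa> * t) \<partial>lborel))"
      using k0 by (simp add: mult.assoc[symmetric] flip: ennreal_mult)
    also have "\<dots> = ennreal (1 / \<bar>\<kappa>\<bar>) * ennreal I"
      using nn_integral_real_affine[of h \<kappa> "(a \<bullet> y - b) / norm a"] k0 I by simp
    also have "\<dots> = ennreal (I / \<bar>\<kappa>\<bar>)" using I by (simp flip: ennreal_mult)
    finally show "(\<integral>\<^sup>+t. ennreal ((\<bar>a \<bullet> (y + t *\<^sub>R v) - b\<bar> / norm a) powr - \<alpha>) * indicator P (y + t *\<^sub>R v) \<partial>lborel)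
      \<le> ennreal (I / \<bar>\<kappa>\<bar>)" .
  qed (use I in simp)
qed

subsection \<open>Integrability of log-convex functions with finite energy\<close>

text \<open>A point of the slab is its projection plus a multiple of \<open>a\<close> with
  coefficient at most \<open>1 / (a \<bullet> a)\<close>, so the part of the slab over a bounded set
  is bounded.\<close>

lemma hyperplane_lebesgue_bounded_finite:
  fixes a :: "'a::euclidean_space"
  assumes "a \<noteq> 0" "bounded F" "F \<in> sets borel"
  shows "emeasure (hyperplane_lebesgue a b) F < \<infinity>"
proof -
  have [measurable]: "F \<in> sets borel" by fact
  obtain R where R: "\<And>z. z \<in> F \<Longrightarrow> norm z \<le> R" using assms(2) bounded_pos by blast
  let ?S = "{w. a \<bullet> w \<in> {b..b+1} \<and> w - ((a \<bullet> w - b) / (a \<bullet> a)) *\<^sub>R a \<in> F}"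
  have "norm w \<le> R + (1 / (a \<bullet> a)) * norm a" if "w \<in> ?S" for w
  proof -
    define c where "c = (a \<bullet> w - b) / (a \<bullet> a)"
    have aa: "0 < a \<bullet> a" using assms by simp
    have c: "\<bar>c\<bar> \<le> 1 / (a \<bullet> a)" using that aa by (auto simp: c_def abs_divide divide_right_mono)
    have "norm w \<le> norm (w - c *\<^sub>R a) + norm (c *\<^sub>R a)"
      by (metis diff_add_cancel norm_triangle_ineq)
    also have "\<dots> \<le> R + (1 / (a \<bullet> a)) * norm a"
    proof (rule add_mono)
      show "norm (w - c *\<^sub>R a) \<le> R" using R that by (auto simp: c_def)
      show "norm (c *\<^sub>R a) \<le> (1 / (a \<bullet> a)) * norm a"
        unfolding norm_scaleR by (rule mult_right_mono[OF c norm_ge_zero])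
    qed
    finally show ?thesis .
  qed
  then have "?S \<subseteq> cball 0 (R + (1 / (a \<bullet> a)) * norm a)" by auto
  then have "emeasure lborel ?S < \<infinity>"
    by (meson bounded_cball bounded_subset emeasure_bounded_finite)
  moreover have S: "?S \<in> sets borel" by measurable
  moreover have "emeasure (hyperplane_lebesgue a b) F = (\<integral>\<^sup>+y. indicator F y \<partial>hyperplane_lebesgue a b)"
    by (simp add: hyperplane_lebesgue_def)
  moreover have "\<dots> = (\<integral>\<^sup>+w. indicator ?S w \<partial>lborel)"
  proof (subst nn_integral_hyperplane_lebesgue)
    show "indicator F \<in> borel_measurable borel" by (intro borel_measurable_indicator) fact
    show "(\<integral>\<^sup>+w. indicator {b..b+1} (a \<bullet> w) * indicator F (w - ((a \<bullet> w - b) / (a \<bullet> a)) *\<^sub>R a) \<partial>lborel)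
      = (\<integral>\<^sup>+w. indicator ?S w \<partial>lborel)"
      by (intro nn_integral_cong) (auto simp del: nn_integral_indicator split: split_indicator)
  qed
  moreover have "(\<integral>\<^sup>+w. indicator ?S w \<partial>lborel) = emeasure lborel ?S"
    using S by simp
  ultimately show ?thesis by simp
qed

section \<open>Masses, facets and the boundary measure of a system\<close>

locale system =
  fixes P :: "'a::euclidean_space set" and mu bd :: "'a measure"
  assumes sys: "is_system P mu bd"
begin

lemma compact_P: "compact P" and interior_ne: "interior P \<noteq> {}" and polyhedron_P: "polyhedron P"
  using sys by (auto simp: is_system_def simple_polytope_def)

lemma closed_P: "closed P" and bounded_P: "bounded P" and convex_P: "convex P"
  using compact_P polyhedron_P by (auto simp: compact_imp_closed compact_imp_bounded polyhedron_imp_convex)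

lemma P_borel [measurable, simp]: "P \<in> sets borel"
  using closed_P by auto

lemma sets_bd [measurable_cong, simp]: "sets bd = sets borel"
  using sys by (simp add: is_system_def)

definition mc :: real where
  "mc = (SOME c. c > 0 \<and> mu = density lborel (\<lambda>x. ennreal c * indicator P x))"

lemma mc_pos: "0 < mc" and mu_eq: "mu = density lborel (\<lambda>x. ennreal mc * indicator P x)"
proof -
  have "\<exists>c. c > 0 \<and> mu = density lborel (\<lambda>x. ennreal c * indicator P x)"
    using sys by (auto simp: is_system_def)
  from someI_ex[OF this] show "0 < mc" "mu = density lborel (\<lambda>x. ennreal mc * indicator P x)"
    by (auto simp: mc_def)
qed

lemma sets_mu [measurable_cong, simp]: "sets mu = sets borel" and space_mu [simp]: "space mu = UNIV"
  by (subst mu_eq, simp)+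

lemma space_bd [simp]: "space bd = UNIV"
  using sets_eq_imp_space_eq[OF sets_bd] by simp

lemma nn_integral_mu:
  assumes [measurable]: "f \<in> borel_measurable borel"
  shows "(\<integral>\<^sup>+x. f x \<partial>mu) = ennreal mc * (\<integral>\<^sup>+x. indicator P x * f x \<partial>lborel)"
  by (subst mu_eq) (simp add: nn_integral_density mult.assoc nn_integral_cmult)

lemma AE_mu_iff: "(AE x in mu. Q x) \<longleftrightarrow> (AE x in lborel. x \<in> P \<longrightarrow> Q x)"
  by (subst mu_eq, subst AE_density) (use mc_pos in \<open>auto simp: ennreal_zero_less_mult_iff indicator_def\<close>)

lemma AE_mu_P: "AE x in mu. x \<in> P"
  by (simp add: AE_mu_iff)

lemma total_mass_mu: "total_mass mu = ennreal (mc * measure lborel P)"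
  and measure_P_pos: "0 < measure lborel P"
proof -
  have fin: "emeasure lborel P < \<infinity>" by (rule emeasure_bounded_finite[OF bounded_P])
  have "total_mass mu = (\<integral>\<^sup>+x. 1 \<partial>mu)" by (simp add: total_mass_def)
  also have "\<dots> = ennreal mc * emeasure lborel P" using nn_integral_mu[of "\<lambda>_. 1"] by simp
  finally show "total_mass mu = ennreal (mc * measure lborel P)"
    using fin mc_pos by (simp add: ennreal_mult emeasure_eq_ennreal_measure)
  have "\<not> negligible P"
    using interior_ne open_not_negligible[of "interior P"] negligible_subset interior_subset open_interior by metis
  then have "emeasure lborel P \<noteq> 0"
    by (auto simp: negligible_iff_null_sets null_sets_completion_iff null_sets_def)
  then show "0 < measure lborel P"
    using fin by (simp add: measure_def enn2real_positive_iff zero_less_iff_neq_zero)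
qed

definition mass :: real where "mass = mc * measure lborel P"

lemma mass_pos: "0 < mass" and total_mass_eq: "total_mass mu = ennreal mass"
  using total_mass_mu measure_P_pos mc_pos by (auto simp: mass_def)

sublocale finite_measure mu
  by (intro finite_measureI) (use total_mass_eq in \<open>simp add: total_mass_def\<close>)

abbreviation "facets \<equiv> {F. F facet_of P}"

lemma finite_facets: "finite facets" by (rule finite_polyhedron_facets[OF polyhedron_P])

lemma frontier_eq: "frontier P = \<Union>facets"
  using rel_boundary_of_polyhedron[OF polyhedron_P] interior_ne closed_P
  by (simp add: frontier_def rel_interior_interior affine_hull_nonempty_interior)

lemma facet_closed: "F \<in> facets \<Longrightarrow> closed F" and facet_subset: "F \<in> facets \<Longrightarrow> F \<subseteq> P"
  by (metis closed_P convex_P face_of_imp_closed facet_of_imp_face_of mem_Collect_eq, metis facet_of_imp_subset mem_Collect_eq)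

text \<open>Chooses the data of all facets simultaneously and turns the equality of restricted
  measures into a formula for integrals.\<close>

lemma facet_data:
  obtains c a b where "\<And>F. F \<in> facets \<Longrightarrow> c F > (0::real)" "\<And>F. F \<in> facets \<Longrightarrow> a F \<noteq> (0::'a)"
    "\<And>F x. F \<in> facets \<Longrightarrow> x \<in> F \<Longrightarrow> a F \<bullet> x = b F"
    "\<And>F f. F \<in> facets \<Longrightarrow> f \<in> borel_measurable borel \<Longrightarrow>
       (\<integral>\<^sup>+x. indicator F x * f x \<partial>bd) = ennreal (c F) * (\<integral>\<^sup>+x. indicator F x * f x \<partial>hyperplane_lebesgue (a F) (b F))"
proof -
  have "\<forall>F. \<exists>c a b. F \<in> facets \<longrightarrow> c > (0::real) \<and> a \<noteq> 0 \<and> affine hull F = {x. a \<bullet> x = b} \<and>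
      density bd (indicator F) = density (hyperplane_lebesgue a b) (\<lambda>x. ennreal c * indicator F x)"
    using sys by (auto simp: is_system_def)
  then obtain c a b where *: "\<And>F. F \<in> facets \<Longrightarrow> c F > (0::real)" "\<And>F. F \<in> facets \<Longrightarrow> a F \<noteq> (0::'a)"
    "\<And>F. F \<in> facets \<Longrightarrow> affine hull F = {x. a F \<bullet> x = b F}"
    "\<And>F. F \<in> facets \<Longrightarrow> density bd (indicator F) = density (hyperplane_lebesgue (a F) (b F)) (\<lambda>x. ennreal (c F) * indicator F x)"
    by metis
  show ?thesis
  proof (rule that[OF *(1,2)])
    fix F x assume "F \<in> facets" "x \<in> F"
    then show "a F \<bullet> x = b F" using *(3)[of F] hull_subset[of F affine] by auto
  next
    fix F and f :: "'a \<Rightarrow> ennreal" assume F: "F \<in> facets" and [measurable]: "f \<in> borel_measurable borel"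
    have [measurable]: "F \<in> sets borel" using facet_closed[OF F] by auto
    have [measurable_cong]: "sets (hyperplane_lebesgue (a F) (b F)) = sets borel"
      by (simp add: hyperplane_lebesgue_def)
    have "(\<integral>\<^sup>+x. indicator F x * f x \<partial>bd) = (\<integral>\<^sup>+x. f x \<partial>density bd (indicator F))"
      by (simp add: nn_integral_density)
    also have "\<dots> = ennreal (c F) * (\<integral>\<^sup>+x. indicator F x * f x \<partial>hyperplane_lebesgue (a F) (b F))"
      unfolding *(4)[OF F] by (simp add: nn_integral_density mult.assoc nn_integral_cmult)
    finally show "(\<integral>\<^sup>+x. indicator F x * f x \<partial>bd) =
       ennreal (c F) * (\<integral>\<^sup>+x. indicator F x * f x \<partial>hyperplane_lebesgue (a F) (b F))" .
  qed
qed

lemma AE_bd_frontier: "AE x in bd. x \<in> frontier P"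
  using sys by (intro AE_I[of _ _ "UNIV - frontier P"]) (auto simp: is_system_def)

lemma AE_bd_P: "AE x in bd. x \<in> P"
  using AE_bd_frontier by eventually_elim (use frontier_subset_closed[OF closed_P] in auto)

text \<open>\<open>bd\<close> is carried by finitely many facets, each a bounded set of finite
  hyperplane measure. Overlaps of facets do no harm, since subadditivity is enough.\<close>

lemma bd_finite: "emeasure bd UNIV < \<infinity>"
proof -
  obtain c a b where d: "\<And>F. F \<in> facets \<Longrightarrow> c F > (0::real)" "\<And>F. F \<in> facets \<Longrightarrow> a F \<noteq> (0::'a)"
    "\<And>F x. F \<in> facets \<Longrightarrow> x \<in> F \<Longrightarrow> a F \<bullet> x = b F"
    "\<And>F f. F \<in> facets \<Longrightarrow> f \<in> borel_measurable borel \<Longrightarrow>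
       (\<integral>\<^sup>+x. indicator F x * f x \<partial>bd) = ennreal (c F) * (\<integral>\<^sup>+x. indicator F x * f x \<partial>hyperplane_lebesgue (a F) (b F))"
    by (fact facet_data)
  have [simp]: "F \<in> sets borel" if "F \<in> facets" for F using facet_closed[OF that] by auto
  have "emeasure bd F < \<infinity>" if F: "F \<in> facets" for F
  proof -
    have "F \<in> sets (hyperplane_lebesgue (a F) (b F))" using F by (simp add: hyperplane_lebesgue_def)
    then have "emeasure bd F = ennreal (c F) * emeasure (hyperplane_lebesgue (a F) (b F)) F"
      using d(4)[OF F, of "\<lambda>_. 1"] F by simp
    also have "\<dots> < \<infinity>"
      using hyperplane_lebesgue_bounded_finite[OF d(2)[OF F], of F] F facet_subset[OF F] bounded_P
      by (simp add: ennreal_mult_less_top bounded_subset)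
    finally show ?thesis .
  qed
  then have "(\<Sum>F\<in>facets. emeasure bd F) < \<infinity>" using finite_facets by simp
  moreover have "emeasure bd UNIV = emeasure bd (\<Union>facets)"
    using AE_bd_frontier unfolding frontier_eq
    by (intro emeasure_eq_AE) (auto simp: finite_facets intro!: sets.finite_Union)
  moreover have "emeasure bd (\<Union>facets) \<le> (\<Sum>F\<in>facets. emeasure bd F)"
  proof -
    have "(\<lambda>F. F) ` facets \<subseteq> sets bd" using facet_closed by (auto intro: borel_closed)
    from emeasure_subadditive_finite[OF finite_facets this] show ?thesis by simp
  qed
  ultimately show ?thesis by simp
qed

text \<open>On a chord in a direction \<open>v\<close> transversal to all facets, a log-convex function is bounded by
  its values at the end points, which are the projections of \<open>z\<close> along \<open>v\<close> to two of the facets.\<close>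
lemma chord_bound:
  assumes lc: "log_convex_on cmb_lin P u" and z: "z \<in> P" and v: "v \<noteq> 0"
    and ab: "\<And>F x. F \<in> facets \<Longrightarrow> x \<in> F \<Longrightarrow> a F \<bullet> x = b F" "\<And>F. F \<in> facets \<Longrightarrow> a F \<bullet> v \<noteq> 0"
  shows "u z \<le> (\<Sum>F\<in>facets. indicator F (proj_along (a F) (b F) v z) * u (proj_along (a F) (b F) v z))"
    (is "_ \<le> ?S")
proof -
  \<comment> \<open>A frontier point on the line through \<open>z\<close> lies on some facet
    \<open>F\<close>, so it is the projection of \<open>z\<close> along \<open>v\<close> to the
    hyperplane of \<open>F\<close>. The sum over all facets thus dominates \<open>u\<close> at
    either end of the chord.\<close>
  have end_le: "u y \<le> ?S" if y: "y \<in> frontier P" "y = z + s *\<^sub>R v" for y s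
  proof -
    obtain F where F: "F \<in> facets" "y \<in> F" using y frontier_eq by auto
    have "a F \<bullet> y = b F" by (rule ab(1)) fact+
    then have "b F - a F \<bullet> z = s * (a F \<bullet> v)" by (simp add: y(2) inner_simps)
    then have p: "proj_along (a F) (b F) v z = y" using ab(2)[OF F(1)] by (simp add: proj_along_def y(2))
    have "u y = indicator F (proj_along (a F) (b F) v z) * u (proj_along (a F) (b F) v z)"
      using F by (simp add: p)
    also have "\<dots> \<le> ?S"
      using finite_facets F by (intro member_le_sum[of F facets "\<lambda>F. indicator F (proj_along (a F) (b F) v z) * u (proj_along (a F) (b F) v z)"]) auto
    finally show ?thesis .
  qed
  show ?thesis
  proof (cases "z \<in> interior P")
    case False
    then have "z \<in> frontier P" using z closed_P by (simp add: frontier_def)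
    from end_le[OF this, of 0] show ?thesis by simp
  next
    case True
    obtain d where d: "0 < d" "z + d *\<^sub>R v \<in> frontier P"
      using ray_to_frontier[OF bounded_P True v] by metis
    obtain d' where d': "0 < d'" "z + d' *\<^sub>R (- v) \<in> frontier P"
      using ray_to_frontier[OF bounded_P True, of "- v"] v by auto
    define t where "t = d' / (d + d')"
    have t: "0 \<le> t" "t \<le> 1" using d d' by (auto simp: t_def)
    have eq: "z = cmb_lin t (z + d' *\<^sub>R (- v)) (z + d *\<^sub>R v)"
    proof -
      have "(1 - t) * d' = t * d" using d d' by (simp add: t_def field_simps)
      then have "cmb_lin t (z + d' *\<^sub>R (- v)) (z + d *\<^sub>R v) = ((1 - t) + t) *\<^sub>R z"
        unfolding cmb_lin_def scaleR_add_right scaleR_scaleR scaleR_minus_right scaleR_add_left by simp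
      then show ?thesis by simp
    qed
    have fP: "frontier P \<subseteq> P" by (rule frontier_subset_closed[OF closed_P])
    have "u z \<le> enn_powr (u (z + d' *\<^sub>R (- v))) (1 - t) * enn_powr (u (z + d *\<^sub>R v)) t"
    proof -
      have "z + d' *\<^sub>R (- v) \<in> P" "z + d *\<^sub>R v \<in> P" "t \<in> {0..1}" using fP d d' t by auto
      then show ?thesis using lc eq unfolding log_convex_on_def by metis
    qed
    also have "\<dots> \<le> ?S"
      using end_le[OF d(2), of d] end_le[OF d'(2), of "- d'"] t by (intro enn_powr_mult_le) auto
    finally show ?thesis .
  qed
qed

text \<open>Chord bound and fibration combined: the integral of \<open>u\<close> against a weight
  \<open>G\<close> is at most the boundary integral times the largest integral of \<open>G\<close>
  along a line of direction \<open>v\<close>. Two weights will be used, the indicator of a ball for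
  pointwise bounds and a sum of negative powers of distances for L^q bounds.\<close>

lemma energy_fibration:
  obtains v C a b where "v \<noteq> (0::'a)" "0 \<le> (C::real)"
    "\<And>F. F \<in> facets \<Longrightarrow> a F \<bullet> v \<noteq> 0" "\<And>F x. F \<in> facets \<Longrightarrow> x \<in> F \<Longrightarrow> a F \<bullet> x = b F"
    "\<And>u G L. u \<in> borel_measurable borel \<Longrightarrow> G \<in> borel_measurable borel \<Longrightarrow> log_convex_on cmb_lin P u \<Longrightarrow>
       (\<And>y. (\<integral>\<^sup>+t. indicator P (y + t *\<^sub>R v) * G (y + t *\<^sub>R v) \<partial>lborel) \<le> L) \<Longrightarrow>
       (\<integral>\<^sup>+z. indicator P z * G z * u z \<partial>lborel) \<le> ennreal C * L * (\<integral>\<^sup>+y. u y \<partial>bd)"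
proof -
  obtain c a b where d: "\<And>F. F \<in> facets \<Longrightarrow> c F > (0::real)" "\<And>F. F \<in> facets \<Longrightarrow> a F \<noteq> (0::'a)"
    "\<And>F x. F \<in> facets \<Longrightarrow> x \<in> F \<Longrightarrow> a F \<bullet> x = b F"
    "\<And>F f. F \<in> facets \<Longrightarrow> f \<in> borel_measurable borel \<Longrightarrow>
       (\<integral>\<^sup>+x. indicator F x * f x \<partial>bd) = ennreal (c F) * (\<integral>\<^sup>+x. indicator F x * f x \<partial>hyperplane_lebesgue (a F) (b F))"
    by (fact facet_data)
  have "\<exists>v. v \<noteq> 0 \<and> (\<forall>x\<in>a ` facets. x \<bullet> v \<noteq> 0)"
    using finite_facets d(2) by (intro ex_transversal_direction) auto
  then obtain v where v0: "v \<noteq> 0" and va: "\<forall>x\<in>a ` facets. x \<bullet> v \<noteq> 0" by blast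
  have v2: "a F \<bullet> v \<noteq> 0" if "F \<in> facets" for F using va that by blast
  note v = v0 v2
  have "\<forall>F\<in>facets. \<exists>C\<ge>0. \<forall>f\<in>borel_measurable borel. \<forall>G\<in>borel_measurable borel.
     (\<integral>\<^sup>+z. G z * f (proj_along (a F) (b F) v z) \<partial>lborel)
       \<le> ennreal C * (\<integral>\<^sup>+y. f y * (\<integral>\<^sup>+t. G (y + t *\<^sub>R v) \<partial>lborel) \<partial>hyperplane_lebesgue (a F) (b F))"
    (is "\<forall>F\<in>facets. \<exists>C\<ge>0. ?Q F C")
  proof
    fix F assume "F \<in> facets"
    show "\<exists>C\<ge>0. ?Q F C" by (rule nn_integral_fibration_le[OF v2]) fact
  qed
  from bchoice[OF this] obtain C where C0: "\<forall>F\<in>facets. 0 \<le> C F \<and> ?Q F (C F)" by blast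
  have C: "\<And>F. F \<in> facets \<Longrightarrow> C F \<ge> 0"
    "\<And>F f G. F \<in> facets \<Longrightarrow> f \<in> borel_measurable borel \<Longrightarrow> G \<in> borel_measurable borel \<Longrightarrow>
     (\<integral>\<^sup>+z. G z * f (proj_along (a F) (b F) v z) \<partial>lborel)
       \<le> ennreal (C F) * (\<integral>\<^sup>+y. f y * (\<integral>\<^sup>+t. G (y + t *\<^sub>R v) \<partial>lborel) \<partial>hyperplane_lebesgue (a F) (b F))"
    using C0 by blast+
  show ?thesis
  proof (rule that[OF v(1) _ v(2) d(3)])
    \<comment> \<open>\<open>C F\<close> is the fibration constant and \<open>c F\<close> the
      density of \<open>bd\<close> on the facet; the quotient leads back from hyperplane integrals
      to \<open>bd\<close>.\<close>
    show "0 \<le> (\<Sum>F\<in>facets. C F / c F)"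
      using C(1) d(1) by (intro sum_nonneg) (auto intro!: divide_nonneg_pos)
    fix u G :: "'a \<Rightarrow> ennreal" and L
    assume [measurable]: "u \<in> borel_measurable borel" "G \<in> borel_measurable borel"
      and lc: "log_convex_on cmb_lin P u"
      and L: "\<And>y. (\<integral>\<^sup>+t. indicator P (y + t *\<^sub>R v) * G (y + t *\<^sub>R v) \<partial>lborel) \<le> L"
    define K where "K = (\<integral>\<^sup>+y. u y \<partial>bd)"
    let ?p = "\<lambda>F. proj_along (a F) (b F) v"
    have Fb: "F \<in> sets borel" if "F \<in> facets" for F using facet_closed[OF that] by auto
    have pm: "?p F \<in> borel_measurable borel" for F by (rule borel_measurable_proj_along)
    have "(\<integral>\<^sup>+z. indicator P z * G z * u z \<partial>lborel)
       \<le> (\<integral>\<^sup>+z. (\<Sum>F\<in>facets. (indicator P z * G z) * (indicator F (?p F z) * u (?p F z))) \<partial>lborel)"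
    proof (rule nn_integral_mono)
      fix z
      show "indicator P z * G z * u z \<le> (\<Sum>F\<in>facets. (indicator P z * G z) * (indicator F (?p F z) * u (?p F z)))"
        unfolding sum_distrib_left[symmetric]
        using chord_bound[OF lc _ v(1) d(3) v(2)] by (cases "z \<in> P") (auto intro!: mult_left_mono)
    qed
    also have "\<dots> = (\<Sum>F\<in>facets. \<integral>\<^sup>+z. (indicator P z * G z) * (indicator F (?p F z) * u (?p F z)) \<partial>lborel)"
    proof (rule nn_integral_sum)
      fix F assume F: "F \<in> facets"
      note [measurable] = Fb[OF F] pm[of F]
      show "(\<lambda>z. (indicator P z * G z) * (indicator F (?p F z) * u (?p F z))) \<in> borel_measurable lborel"
        by measurable
    qed
    also have "\<dots> \<le> (\<Sum>F\<in>facets. ennreal (C F / c F) * L * K)"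
    proof (rule sum_mono)
      fix F assume F: "F \<in> facets"
      note [measurable] = Fb[OF F] pm[of F]
      have [measurable_cong]: "sets (hyperplane_lebesgue (a F) (b F)) = sets borel"
        by (simp add: hyperplane_lebesgue_def)
      have "(\<integral>\<^sup>+z. (indicator P z * G z) * (indicator F (?p F z) * u (?p F z)) \<partial>lborel)
        \<le> ennreal (C F) * (\<integral>\<^sup>+y. (indicator F y * u y) * (\<integral>\<^sup>+t. indicator P (y + t *\<^sub>R v) * G (y + t *\<^sub>R v) \<partial>lborel) \<partial>hyperplane_lebesgue (a F) (b F))"
        by (rule C(2)[OF F, of "\<lambda>y. indicator F y * u y" "\<lambda>z. indicator P z * G z"]) measurable
      also have "\<dots> \<le> ennreal (C F) * (\<integral>\<^sup>+y. (indicator F y * u y) * L \<partial>hyperplane_lebesgue (a F) (b F))"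
        by (intro mult_left_mono nn_integral_mono L) auto
      also have "\<dots> = ennreal (C F) * ((\<integral>\<^sup>+y. indicator F y * u y \<partial>hyperplane_lebesgue (a F) (b F)) * L)"
        by (simp add: nn_integral_multc)
      also have "(\<integral>\<^sup>+y. indicator F y * u y \<partial>hyperplane_lebesgue (a F) (b F))
        = ennreal (1 / c F) * (ennreal (c F) * (\<integral>\<^sup>+y. indicator F y * u y \<partial>hyperplane_lebesgue (a F) (b F)))"
        using d(1)[OF F] by (simp add: mult.assoc[symmetric] flip: ennreal_mult)
      also have "ennreal (c F) * (\<integral>\<^sup>+y. indicator F y * u y \<partial>hyperplane_lebesgue (a F) (b F)) = (\<integral>\<^sup>+y. indicator F y * u y \<partial>bd)"
        by (rule d(4)[OF F, symmetric]) measurable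
      also have "ennreal (C F) * (ennreal (1 / c F) * (\<integral>\<^sup>+y. indicator F y * u y \<partial>bd) * L)
         \<le> ennreal (C F) * (ennreal (1 / c F) * K * L)"
        unfolding K_def by (intro mult_left_mono mult_right_mono nn_integral_mono) (auto split: split_indicator)
      also have "\<dots> = ennreal (C F / c F) * L * K"
      proof -
        have "ennreal (C F / c F) = ennreal (C F) * ennreal (1 / c F)"
          using C(1)[OF F] d(1)[OF F] by (subst ennreal_mult[symmetric]) auto
        then show ?thesis by (simp only: mult_ac)
      qed
      finally show "(\<integral>\<^sup>+z. (indicator P z * G z) * (indicator F (?p F z) * u (?p F z)) \<partial>lborel)
        \<le> ennreal (C F / c F) * L * K" .
    qed
    also have "\<dots> = ennreal (\<Sum>F\<in>facets. C F / c F) * L * K"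
    proof -
      have "(\<Sum>F\<in>facets. ennreal (C F / c F)) = ennreal (\<Sum>F\<in>facets. C F / c F)"
        using C(1) d(1) by (intro sum_ennreal divide_nonneg_pos) auto
      then show ?thesis by (simp only: sum_distrib_right[symmetric])
    qed
    finally show "(\<integral>\<^sup>+z. indicator P z * G z * u z \<partial>lborel) \<le> ennreal (\<Sum>F\<in>facets. C F / c F) * L * (\<integral>\<^sup>+y. u y \<partial>bd)"
      unfolding K_def .
  qed
qed

text \<open>Log-convexity at the midpoint of \<open>z\<close> and \<open>2 *\<^sub>R x - z\<close>
  gives \<open>u x \<le> u z + u (2 *\<^sub>R x - z)\<close>; averaging over the ball bounds
  \<open>u x\<close> by twice its mean. Lines meet the ball in length of order \<open>d\<close>, so
  the integral of \<open>u\<close> over it is at most a multiple of \<open>d\<close> times the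
  boundary integral. Division by the volume of order \<open>d ^ DIM('a)\<close> leaves the exponent
  \<open>DIM('a) - 1\<close>.\<close>

lemma interior_bound:
  obtains C where "0 \<le> C" "\<And>u x d. u \<in> borel_measurable borel \<Longrightarrow> log_convex_on cmb_lin P u \<Longrightarrow> 0 < d \<Longrightarrow>
      ball x d \<subseteq> P \<Longrightarrow> u x \<le> ennreal (C / d ^ (DIM('a) - 1)) * (\<integral>\<^sup>+y. u y \<partial>bd)"
proof -
  obtain v C a b where v: "v \<noteq> (0::'a)" and Cp: "0 \<le> (C::real)"
    and va: "\<And>F. F \<in> facets \<Longrightarrow> a F \<bullet> v \<noteq> 0" and vb: "\<And>F x. F \<in> facets \<Longrightarrow> x \<in> F \<Longrightarrow> a F \<bullet> x = b F"
    and Cb: "\<And>u G L. u \<in> borel_measurable borel \<Longrightarrow> G \<in> borel_measurable borel \<Longrightarrow> log_convex_on cmb_lin P u \<Longrightarrow>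
       (\<And>y. (\<integral>\<^sup>+t. indicator P (y + t *\<^sub>R v) * G (y + t *\<^sub>R v) \<partial>lborel) \<le> L) \<Longrightarrow>
       (\<integral>\<^sup>+z. indicator P z * G z * u z \<partial>lborel) \<le> ennreal C * L * (\<integral>\<^sup>+y. u y \<partial>bd)"
    by (fact energy_fibration)
  note C = Cp Cb
  let ?\<beta> = "unit_ball_vol (real DIM('a))"
  have beta: "0 < ?\<beta>" by simp
  define C' where "C' = 8 * C / (norm v * ?\<beta>)"
  show ?thesis
  proof (rule that[of C'])
    show "0 \<le> C'" using C beta by (simp add: C'_def)
    fix u :: "'a \<Rightarrow> ennreal" and x :: 'a and d :: real
    assume u [measurable]: "u \<in> borel_measurable borel" and lc: "log_convex_on cmb_lin P u"
      and d: "0 < d" and B: "ball x d \<subseteq> P"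
    let ?I = "indicator (ball x d) :: 'a \<Rightarrow> ennreal"
    let ?K = "\<integral>\<^sup>+y. u y \<partial>bd"
    have I: "?I \<in> borel_measurable borel" by (intro borel_measurable_indicator) simp
    note [measurable] = I
    have "ennreal (?\<beta> * d ^ DIM('a)) * u x = (\<integral>\<^sup>+z. ?I z * u x \<partial>lborel)"
      using d by (simp add: nn_integral_multc emeasure_ball)
    also have "\<dots> \<le> (\<integral>\<^sup>+z. ?I z * u z + ?I (2 *\<^sub>R x - z) * u (2 *\<^sub>R x - z) \<partial>lborel)"
    proof (rule nn_integral_mono)
      fix z
      show "?I z * u x \<le> ?I z * u z + ?I (2 *\<^sub>R x - z) * u (2 *\<^sub>R x - z)"
      proof (cases "z \<in> ball x d")
        case True
        have z': "2 *\<^sub>R x - z \<in> ball x d" using True by (simp add: dist_norm norm_minus_commute scaleR_2)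
        have "x = cmb_lin (1/2) z (2 *\<^sub>R x - z)" by (simp add: cmb_lin_def scaleR_diff_right)
        then have "u x \<le> enn_powr (u z) (1 - 1/2) * enn_powr (u (2 *\<^sub>R x - z)) (1/2)"
          using lc True z' B unfolding log_convex_on_def
          by (metis (no_types, lifting) atLeastAtMost_iff divide_le_eq_1_pos divide_nonneg_nonneg one_le_numeral subsetD zero_le_numeral zero_less_numeral zero_le_one)
        also have "\<dots> \<le> u z + u (2 *\<^sub>R x - z)"
          by (rule enn_powr_mult_le) (auto simp: add_increasing add_increasing2)
        finally show ?thesis using True z' by simp
      qed simp
    qed
    also have "\<dots> = 2 * (\<integral>\<^sup>+z. ?I z * u z \<partial>lborel)"
      using nn_integral_lborel_reflect[of "\<lambda>z. ?I z * u z" "2 *\<^sub>R x"] by (simp add: nn_integral_add mult_2)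
    also have "(\<integral>\<^sup>+z. ?I z * u z \<partial>lborel) = (\<integral>\<^sup>+z. indicator P z * ?I z * u z \<partial>lborel)"
      using B by (intro nn_integral_cong) (auto split: split_indicator)
    also have "\<dots> \<le> ennreal C * ennreal (4 * d / norm v) * ?K"
    proof (rule C(2))
      fix y
      have "(\<integral>\<^sup>+t. indicator P (y + t *\<^sub>R v) * ?I (y + t *\<^sub>R v) \<partial>lborel) \<le> (\<integral>\<^sup>+t. ?I (y + t *\<^sub>R v) \<partial>lborel)"
        by (intro nn_integral_mono) (auto split: split_indicator)
      also have "\<dots> \<le> ennreal (4 * d / norm v)" by (rule nn_integral_line_ball_le[OF v d])
      finally show "(\<integral>\<^sup>+t. indicator P (y + t *\<^sub>R v) * ?I (y + t *\<^sub>R v) \<partial>lborel) \<le> ennreal (4 * d / norm v)" .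
    qed (use I u lc in auto)
    finally have le: "ennreal (?\<beta> * d ^ DIM('a)) * u x \<le> 2 * (ennreal C * ennreal (4 * d / norm v) * ?K)"
      by (simp add: mult_left_mono)
    have pos: "0 < ?\<beta> * d ^ DIM('a)" using beta d by (intro mult_pos_pos) auto
    have "u x = ennreal (1 / (?\<beta> * d ^ DIM('a))) * (ennreal (?\<beta> * d ^ DIM('a)) * u x)"
    proof -
      have "1 / (?\<beta> * d ^ DIM('a)) * (?\<beta> * d ^ DIM('a)) = 1" using pos by (simp only: times_divide_eq_left mult_1 divide_self_if if_False less_imp_neq[symmetric])
      then have "ennreal (1 / (?\<beta> * d ^ DIM('a))) * ennreal (?\<beta> * d ^ DIM('a)) = 1"
        using pos by (subst ennreal_mult[symmetric]) (auto simp del: times_divide_eq_left)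
      then show ?thesis by (simp only: mult.assoc[symmetric] mult_1)
    qed
    also have "\<dots> \<le> ennreal (1 / (?\<beta> * d ^ DIM('a))) * (2 * (ennreal C * ennreal (4 * d / norm v) * ?K))"
      by (intro mult_left_mono le) auto
    also have "\<dots> = ennreal (1 / (?\<beta> * d ^ DIM('a)) * (2 * (C * (4 * d / norm v)))) * ?K"
    proof -
      have "(2::ennreal) = ennreal 2" by simp
      then show ?thesis
        using pos C(1) d by (simp only: ennreal_mult mult.assoc mult_nonneg_nonneg divide_nonneg_nonneg
          zero_le_numeral norm_ge_zero less_imp_le zero_le_one)
    qed
    also have "1 / (?\<beta> * d ^ DIM('a)) * (2 * (C * (4 * d / norm v))) = C' / d ^ (DIM('a) - 1)"
    proof -
      have "d ^ DIM('a) = d * d ^ (DIM('a) - 1)"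
        by (metis DIM_positive Suc_diff_1 power_Suc)
      then show ?thesis using d beta v by (simp add: C'_def field_simps)
    qed
    finally show "u x \<le> ennreal (C' / d ^ (DIM('a) - 1)) * ?K" .
  qed
qed

text \<open>If the connected ball left \<open>P\<close>, it would meet the frontier in a point of
  some facet, closer to \<open>z\<close> than the hyperplane of that facet.\<close>

lemma ball_subset_of_facet_distance:
  assumes z: "z \<in> P" and d: "\<And>F. F \<in> facets \<Longrightarrow> d \<le> \<bar>a F \<bullet> z - b F\<bar> / norm (a F)"
    and ab: "\<And>F x. F \<in> facets \<Longrightarrow> x \<in> F \<Longrightarrow> a F \<bullet> x = b F"
  shows "ball z d \<subseteq> P"
proof (rule ccontr)
  assume "\<not> ball z d \<subseteq> P"
  then obtain w where w: "w \<in> ball z d" "w \<notin> P" by blast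
  have "0 < d" using w(1) zero_le_dist[of z w] unfolding mem_ball by linarith
  have "ball z d \<inter> frontier P \<noteq> {}"
    using w z \<open>0 < d\<close> by (intro connected_Int_frontier) (auto intro: centre_in_ball[THEN iffD2])
  then obtain p F where p: "p \<in> ball z d" "F \<in> facets" "p \<in> F" unfolding frontier_eq by blast
  have "\<bar>a F \<bullet> z - b F\<bar> = \<bar>a F \<bullet> (z - p)\<bar>" using ab[OF p(2,3)] by (simp add: inner_simps)
  also have "\<dots> \<le> norm (a F) * norm (z - p)" by (rule Cauchy_Schwarz_ineq2)
  finally have "\<bar>a F \<bullet> z - b F\<bar> / norm (a F) \<le> norm (z - p)"
    by (cases "a F = 0") (auto simp: field_simps)
  also have "\<dots> < d" using p(1) by (simp add: dist_norm)
  finally show False using d[OF p(2)] by simp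
qed

text \<open>With \<open>d\<close> the distance to the nearest facet hyperplane, \<open>u \<le> C d powr (1 - n)\<close>; the power \<open>u powr q\<close> is
  \<open>u powr (q - 1) * u\<close>, and the first factor is integrable along the direction \<open>v\<close>, uniformly in the line, as long
  as \<open>(n - 1) * (q - 1) < 1\<close>.\<close>
theorem energy_Lq_bound:
  assumes q: "1 < q" "(real DIM('a) - 1) * (q - 1) < 1" and k: "0 \<le> k"
  obtains C where "0 \<le> C" "\<And>u. u \<in> borel_measurable borel \<Longrightarrow> log_convex_on cmb_lin P u \<Longrightarrow>
     (\<integral>\<^sup>+y. u y \<partial>bd) \<le> ennreal k \<Longrightarrow> (\<integral>\<^sup>+x. ennreal (enn2real (u x) powr q) \<partial>mu) \<le> ennreal C"
proof -
  obtain v C0 a b where v0: "v \<noteq> (0::'a)" and Cp: "0 \<le> (C0::real)"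
    and va: "\<And>F. F \<in> facets \<Longrightarrow> a F \<bullet> v \<noteq> 0" and vb: "\<And>F x. F \<in> facets \<Longrightarrow> x \<in> F \<Longrightarrow> a F \<bullet> x = b F"
    and Cb: "\<And>u G L. u \<in> borel_measurable borel \<Longrightarrow> G \<in> borel_measurable borel \<Longrightarrow> log_convex_on cmb_lin P u \<Longrightarrow>
       (\<And>y. (\<integral>\<^sup>+t. indicator P (y + t *\<^sub>R v) * G (y + t *\<^sub>R v) \<partial>lborel) \<le> L) \<Longrightarrow>
       (\<integral>\<^sup>+z. indicator P z * G z * u z \<partial>lborel) \<le> ennreal C0 * L * (\<integral>\<^sup>+y. u y \<partial>bd)"
    by (fact energy_fibration)
  note v = v0 va vb and C0 = Cp Cb
  obtain C1 where C1: "0 \<le> C1" "\<And>u x d. u \<in> borel_measurable borel \<Longrightarrow> log_convex_on cmb_lin P u \<Longrightarrow> 0 < d \<Longrightarrow>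
      ball x d \<subseteq> P \<Longrightarrow> u x \<le> ennreal (C1 / d ^ (DIM('a) - 1)) * (\<integral>\<^sup>+y. u y \<partial>bd)"
    by (fact interior_bound)
  define n where "n = DIM('a) - 1"
  have n: "real DIM('a) - 1 = real n" by (simp add: n_def of_nat_diff)
  define \<alpha> where "\<alpha> = real n * (q - 1)"
  have \<alpha>: "0 \<le> \<alpha>" "\<alpha> < 1" using q n by (auto simp: \<alpha>_def)
  define \<delta> where "\<delta> F z = \<bar>a F \<bullet> z - b F\<bar> / norm (a F)" for F z
  have dm: "\<delta> F \<in> borel_measurable borel" for F unfolding \<delta>_def[abs_def] by measurable
  have "\<forall>F\<in>facets. \<exists>L\<ge>0. \<forall>y. (\<integral>\<^sup>+t. ennreal (\<delta> F (y + t *\<^sub>R v) powr - \<alpha>) * indicator P (y + t *\<^sub>R v) \<partial>lborel) \<le> ennreal L"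
  proof
    fix F assume "F \<in> facets"
    then show "\<exists>L\<ge>0. \<forall>y. (\<integral>\<^sup>+t. ennreal (\<delta> F (y + t *\<^sub>R v) powr - \<alpha>) * indicator P (y + t *\<^sub>R v) \<partial>lborel) \<le> ennreal L"
      unfolding \<delta>_def by (intro nn_integral_line_powr_le[OF \<alpha>(2) v(2) bounded_P P_borel])
  qed
  from bchoice[OF this] obtain L where L: "\<And>F. F \<in> facets \<Longrightarrow> L F \<ge> 0" "\<And>F y. F \<in> facets \<Longrightarrow>
     (\<integral>\<^sup>+t. ennreal (\<delta> F (y + t *\<^sub>R v) powr - \<alpha>) * indicator P (y + t *\<^sub>R v) \<partial>lborel) \<le> ennreal (L F)"
    by blast
  obtain R where R: "0 < R" "P \<subseteq> ball 0 R"
    using bounded_P bounded_subset_ballD[of P 0] by blast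
  define L0 where "L0 = 4 * R / norm v + (\<Sum>F\<in>facets. L F)"
  have L0: "0 \<le> L0" using R L(1) by (auto simp: L0_def intro!: add_nonneg_nonneg sum_nonneg)
  \<comment> \<open>The sum over facets replaces the power of the smallest distance, so that lines
    are estimated for one hyperplane at a time. The 1 serves the points whose distance is cut off at
    1.\<close>
  define G where "G z = ennreal (1 + (\<Sum>F\<in>facets. \<delta> F z powr - \<alpha>))" for z
  have Gm [measurable]: "G \<in> borel_measurable borel" unfolding G_def[abs_def] using dm by measurable
  have GL: "(\<integral>\<^sup>+t. indicator P (y + t *\<^sub>R v) * G (y + t *\<^sub>R v) \<partial>lborel) \<le> ennreal L0" for y
  proof -
    have [measurable]: "(\<lambda>t. \<delta> F (y + t *\<^sub>R v)) \<in> borel_measurable borel" for F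
      unfolding \<delta>_def by measurable
    have "(\<integral>\<^sup>+t. indicator P (y + t *\<^sub>R v) * G (y + t *\<^sub>R v) \<partial>lborel)
       = (\<integral>\<^sup>+t. indicator P (y + t *\<^sub>R v) + (\<Sum>F\<in>facets. ennreal (\<delta> F (y + t *\<^sub>R v) powr - \<alpha>) * indicator P (y + t *\<^sub>R v)) \<partial>lborel)"
    proof (rule nn_integral_cong)
      fix t
      have "G z = 1 + (\<Sum>F\<in>facets. ennreal (\<delta> F z powr - \<alpha>))" for z
      proof -
        have "(\<Sum>F\<in>facets. ennreal (\<delta> F z powr - \<alpha>)) = ennreal (\<Sum>F\<in>facets. \<delta> F z powr - \<alpha>)"
          by (rule sum_ennreal) simp
        then show ?thesis unfolding G_def by (simp add: ennreal_plus sum_nonneg)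
      qed
      then show "indicator P (y + t *\<^sub>R v) * G (y + t *\<^sub>R v) = indicator P (y + t *\<^sub>R v)
         + (\<Sum>F\<in>facets. ennreal (\<delta> F (y + t *\<^sub>R v) powr - \<alpha>) * indicator P (y + t *\<^sub>R v))"
        by (cases "y + t *\<^sub>R v \<in> P") auto
    qed
    also have "\<dots> = (\<integral>\<^sup>+t. indicator P (y + t *\<^sub>R v) \<partial>lborel)
        + (\<Sum>F\<in>facets. \<integral>\<^sup>+t. ennreal (\<delta> F (y + t *\<^sub>R v) powr - \<alpha>) * indicator P (y + t *\<^sub>R v) \<partial>lborel)"
      by (subst nn_integral_add) (simp_all add: nn_integral_sum)
    also have "\<dots> \<le> ennreal (4 * R / norm v) + (\<Sum>F\<in>facets. ennreal (L F))"
    proof (intro add_mono sum_mono L(2))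
      have "(\<integral>\<^sup>+t. indicator P (y + t *\<^sub>R v) \<partial>lborel) \<le> (\<integral>\<^sup>+t. indicator (ball 0 R) (y + t *\<^sub>R v) \<partial>lborel)"
        using R by (intro nn_integral_mono) (auto split: split_indicator)
      also have "\<dots> \<le> ennreal (4 * R / norm v)" by (rule nn_integral_line_ball_le[OF v(1) R(1)])
      finally show "(\<integral>\<^sup>+t. indicator P (y + t *\<^sub>R v) \<partial>lborel) \<le> ennreal (4 * R / norm v)" .
    qed auto
    also have "\<dots> = ennreal L0"
    proof -
      have "(\<Sum>F\<in>facets. ennreal (L F)) = ennreal (\<Sum>F\<in>facets. L F)"
        using L(1) by (intro sum_ennreal) auto
      moreover have "0 \<le> (\<Sum>F\<in>facets. L F)" using L(1) by (intro sum_nonneg) auto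
      ultimately show ?thesis using R by (simp add: L0_def ennreal_plus)
    qed
    finally show ?thesis .
  qed
  define A where "A = (C1 * k) powr (q - 1)"
  show ?thesis
  proof (rule that[of "mc * (A * (C0 * L0 * k))"])
    show "0 \<le> mc * (A * (C0 * L0 * k))" using mc_pos C0(1) L0 k by (simp add: A_def)
    fix u :: "'a \<Rightarrow> ennreal" assume u [measurable]: "u \<in> borel_measurable borel" and lc: "log_convex_on cmb_lin P u"
      and K: "(\<integral>\<^sup>+y. u y \<partial>bd) \<le> ennreal k"
    \<comment> \<open>On a facet hyperplane \<open>0 powr - \<alpha>\<close> is 0 instead of
      infinite, and the distance \<open>d\<close> below would vanish; these points form a null
      set.\<close>
    have null: "AE z in lborel. \<forall>F\<in>facets. \<delta> F z \<noteq> 0"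
    proof (rule AE_finite_allI[OF finite_facets])
      fix F assume F: "F \<in> facets"
      have a0: "a F \<noteq> 0" using v(2)[OF F] by auto
      have "negligible {z. a F \<bullet> z = b F}" using a0 by (intro negligible_hyperplane) auto
      then have "{z. a F \<bullet> z = b F} \<in> null_sets lborel"
        unfolding negligible_iff_null_sets by (subst (asm) null_sets_completion_iff) auto
      from AE_not_in[OF this] show "AE z in lborel. \<delta> F z \<noteq> 0"
        by eventually_elim (use a0 in \<open>simp add: \<delta>_def\<close>)
    qed
    have pw: "AE z in lborel. indicator P z * ennreal (enn2real (u z) powr q) \<le> ennreal A * (indicator P z * G z * u z)"
      using null
    proof eventually_elim
      case (elim z)
      show ?case
      proof (cases "z \<in> P")
        case True
        \<comment> \<open>The inserted 1 makes \<open>Min\<close> meaningful without an appeal to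
          the existence of facets; the case \<open>d = 1\<close> is matched by the 1 in
          \<open>G\<close>.\<close>
        define d where "d = Min (insert 1 ((\<lambda>F. \<delta> F z) ` facets))"
        have fin: "finite (insert 1 ((\<lambda>F. \<delta> F z) ` facets))" using finite_facets by simp
        have dpos: "0 < d"
          unfolding d_def using elim fin by (subst Min_gr_iff) (auto simp: \<delta>_def)
        have dle: "d \<le> \<delta> F z" if "F \<in> facets" for F
          unfolding d_def using that fin by (intro Min_le) auto
        have din: "d \<in> insert 1 ((\<lambda>F. \<delta> F z) ` facets)"
          unfolding d_def using fin by (intro Min_in) auto
        have "ball z d \<subseteq> P"
          using dle v(3) by (intro ball_subset_of_facet_distance[OF True, of d a b]) (auto simp: \<delta>_def)
        then have "u z \<le> ennreal (C1 / d ^ n) * (\<integral>\<^sup>+y. u y \<partial>bd)"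
          unfolding n_def by (intro C1(2) u lc dpos)
        also have "\<dots> \<le> ennreal (C1 / d ^ n) * ennreal k"
          by (intro mult_left_mono K) auto
        also have "\<dots> = ennreal (C1 * k / d ^ n)"
          using C1(1) k dpos by (simp flip: ennreal_mult)
        finally have uz: "u z \<le> ennreal (C1 * k / d ^ n)" .
        then obtain r where r: "u z = ennreal r" "0 \<le> r"
          by (metis ennreal_cases ennreal_neq_top infinity_ennreal_def top.extremum_unique)
        have r_le: "r \<le> C1 * k / d ^ n"
          using uz r C1(1) k dpos by simp
        have "r powr q = r powr (q - 1) * r"
          using r q by (cases "r = 0") (auto simp: powr_diff)
        also have "\<dots> \<le> (C1 * k / d ^ n) powr (q - 1) * r"
          using r r_le q by (intro mult_right_mono powr_mono2) auto
        also have "(C1 * k / d ^ n) powr (q - 1) = A * d powr - \<alpha>"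
          using C1(1) k dpos by (simp add: A_def \<alpha>_def powr_divide powr_minus_divide powr_powr flip: powr_realpow)
        also have "d powr - \<alpha> \<le> 1 + (\<Sum>F\<in>facets. \<delta> F z powr - \<alpha>)"
        proof (cases "d = 1")
          case False
          then obtain F where F: "F \<in> facets" "d = \<delta> F z" using din by auto
          have "\<delta> F z powr - \<alpha> \<le> (\<Sum>F\<in>facets. \<delta> F z powr - \<alpha>)"
            using finite_facets F by (intro member_le_sum[of F facets "\<lambda>F. \<delta> F z powr - \<alpha>"]) auto
          then show ?thesis using F by simp
        qed (simp add: sum_nonneg)
        finally have "r powr q \<le> A * (1 + (\<Sum>F\<in>facets. \<delta> F z powr - \<alpha>)) * r"
          using r by (simp add: A_def mult_left_mono mult_right_mono)
        then have "ennreal (r powr q) \<le> ennreal (A * (1 + (\<Sum>F\<in>facets. \<delta> F z powr - \<alpha>)) * r)"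
          by (rule ennreal_leI)
        also have "\<dots> = ennreal A * (G z * ennreal r)"
        proof -
          have "0 \<le> A" "0 \<le> 1 + (\<Sum>F\<in>facets. \<delta> F z powr - \<alpha>)"
            by (auto simp: A_def intro!: add_nonneg_nonneg sum_nonneg)
          then show ?thesis unfolding G_def using r by (simp only: mult.assoc ennreal_mult mult_nonneg_nonneg)
        qed
        finally show ?thesis using True r by simp
      qed simp
    qed
    have "(\<integral>\<^sup>+x. ennreal (enn2real (u x) powr q) \<partial>mu)
      = ennreal mc * (\<integral>\<^sup>+x. indicator P x * ennreal (enn2real (u x) powr q) \<partial>lborel)"
      by (rule nn_integral_mu) measurable
    also have "\<dots> \<le> ennreal mc * (\<integral>\<^sup>+z. ennreal A * (indicator P z * G z * u z) \<partial>lborel)"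
      by (intro mult_left_mono nn_integral_mono_AE pw) auto
    also have "\<dots> = ennreal mc * (ennreal A * (\<integral>\<^sup>+z. indicator P z * G z * u z \<partial>lborel))"
      by (simp add: nn_integral_cmult)
    also have "\<dots> \<le> ennreal mc * (ennreal A * (ennreal C0 * ennreal L0 * (\<integral>\<^sup>+y. u y \<partial>bd)))"
      by (intro mult_left_mono C0(2) u Gm lc GL) auto
    also have "\<dots> \<le> ennreal mc * (ennreal A * (ennreal C0 * ennreal L0 * ennreal k))"
      by (intro mult_left_mono K) auto
    also have "\<dots> = ennreal (mc * (A * (C0 * L0 * k)))"
      using mc_pos C0(1) L0 k by (simp add: A_def ennreal_mult)
    finally show "(\<integral>\<^sup>+x. ennreal (enn2real (u x) powr q) \<partial>mu) \<le> ennreal (mc * (A * (C0 * L0 * k)))" .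
  qed
qed

end

subsection \<open>Lower semicontinuous hulls\<close>

text \<open>The largest lower semicontinuous minorant. The balls are balls of the whole space, so a
  function living on a subset has to be extended by infinity first.\<close>

definition lsc_hull :: "('x::metric_space \<Rightarrow> ennreal) \<Rightarrow> 'x \<Rightarrow> ennreal" where
  "lsc_hull v x = (SUP e\<in>{0::real<..}. INF z\<in>ball x e. v z)"

lemma lsc_hull_le: "lsc_hull v x \<le> v x"
  unfolding lsc_hull_def by (intro SUP_least INF_lower) auto

lemma lsc_hull_leI:
  assumes "\<And>e. 0 < e \<Longrightarrow> \<exists>z\<in>ball x e. v z \<le> c"
  shows "lsc_hull v x \<le> c"
  unfolding lsc_hull_def
proof (rule SUP_least)
  fix e :: real assume "e \<in> {0<..}"
  with assms obtain z where "z \<in> ball x e" "v z \<le> c" by fastforce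
  then show "(INF z\<in>ball x e. v z) \<le> c" by (meson INF_lower2)
qed

lemma le_lsc_hullI:
  assumes "0 < e" "\<And>z. z \<in> ball x e \<Longrightarrow> c \<le> v z"
  shows "c \<le> lsc_hull v x"
  unfolding lsc_hull_def using assms by (intro SUP_upper2[of e]) (auto intro: INF_greatest)

lemma lsc_hull_lessD:
  assumes "lsc_hull v x < c" "0 < e"
  obtains z where "z \<in> ball x e" "v z < c"
proof -
  have "(INF z\<in>ball x e. v z) \<le> lsc_hull v x"
    unfolding lsc_hull_def using assms by (intro SUP_upper) auto
  then have "(INF z\<in>ball x e. v z) < c" using assms by simp
  then show ?thesis using that by (auto simp: INF_less_iff)
qed

lemma lsc_hull_open: "open {x. c < lsc_hull v x}"
proof (rule openI)
  fix x assume "x \<in> {x. c < lsc_hull v x}"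
  then obtain e where e: "0 < e" "c < (INF z\<in>ball x e. v z)"
    by (auto simp: lsc_hull_def less_SUP_iff)
  have "c < lsc_hull v w" if w: "w \<in> ball x (e/2)" for w
  proof -
    have "ball w (e/2) \<subseteq> ball x e"
    proof
      fix z assume "z \<in> ball w (e/2)"
      then show "z \<in> ball x e" using w dist_triangle[of x z w] by auto
    qed
    then have "(INF z\<in>ball x e. v z) \<le> lsc_hull v w"
      using e by (intro le_lsc_hullI[of "e/2"]) (auto intro: INF_lower)
    with e show ?thesis by simp
  qed
  then show "\<exists>e>0. ball x e \<subseteq> {x. c < lsc_hull v x}" using e by (intro exI[of _ "e/2"]) auto
qed

lemma borel_measurable_lsc_hull [measurable]: "lsc_hull v \<in> borel_measurable borel"
  by (rule borel_measurableI_greater) (simp add: lsc_hull_open)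

lemma lsc_on_lsc_hull: "lsc_on P (lsc_hull v)"
  unfolding lsc_on_alt
proof (intro ballI allI impI)
  fix x c assume "c < lsc_hull v x"
  then have "eventually (\<lambda>y. y \<in> {x. c < lsc_hull v x}) (nhds x)"
    by (intro eventually_nhds_in_open lsc_hull_open) simp
  then show "eventually (\<lambda>y. y \<in> P \<longrightarrow> c < lsc_hull v y) (nhds x)"
    by (rule eventually_mono) simp
qed

lemma dist_cmb_lin_less:
  fixes x y :: "'x::real_normed_vector"
  assumes "dist x x' < e" "dist y y' < e" "0 \<le> t" "t \<le> 1"
  shows "dist (cmb_lin t x y) (cmb_lin t x' y') < e"
proof -
  have "cmb_lin t x y - cmb_lin t x' y' = (1 - t) *\<^sub>R (x - x') + t *\<^sub>R (y - y')"
    by (simp add: cmb_lin_def algebra_simps)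
  then have "dist (cmb_lin t x y) (cmb_lin t x' y') \<le> (1 - t) * norm (x - x') + t * norm (y - y')"
    unfolding dist_norm using assms norm_triangle_ineq[of "(1 - t) *\<^sub>R (x - x')" "t *\<^sub>R (y - y')"] by simp
  also have "\<dots> < e"
    using assms by (intro convex_bound_lt) (auto simp: dist_norm)
  finally show ?thesis .
qed

text \<open>By continuity of powers with positive exponent it is enough to consider strict majorants
  of \<open>a\<close> and \<open>b\<close>. Limits superior and infima, for which log-convexity is
  shown below, provide exactly such strict estimates.\<close>

lemma enn_powr_mult_le_limit:
  assumes t: "0 < t" "t < 1" and a: "a < \<infinity>" and b: "b < \<infinity>"
    and le: "\<And>a' b'. a < a' \<Longrightarrow> b < b' \<Longrightarrow> a' < \<infinity> \<Longrightarrow> b' < \<infinity> \<Longrightarrow> z \<le> enn_powr a' (1 - t) * enn_powr b' t"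
  shows "z \<le> enn_powr a (1 - t) * enn_powr b t"
proof -
  obtain r where r: "a = ennreal r" "0 \<le> r" by (rule ennreal_finiteE[OF a])
  obtain s where s: "b = ennreal s" "0 \<le> s" by (rule ennreal_finiteE[OF b])
  have lim: "(\<lambda>n. ennreal ((r + 1 / real (Suc n)) powr (1 - t) * (s + 1 / real (Suc n)) powr t))
     \<longlonglongrightarrow> ennreal ((r + 0) powr (1 - t) * (s + 0) powr t)"
    using t r s
    by (intro tendsto_ennrealI tendsto_mult tendsto_powr2 tendsto_add tendsto_const LIMSEQ_Suc lim_1_over_n) (auto intro!: always_eventually)
  have "z \<le> ennreal ((r + 1 / real (Suc n)) powr (1 - t) * (s + 1 / real (Suc n)) powr t)" for n
  proof -
    define h where "h = 1 / real (Suc n)"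
    have h: "0 < h" by (simp add: h_def)
    have "z \<le> enn_powr (ennreal (r + h)) (1 - t) * enn_powr (ennreal (s + h)) t"
      using h r s by (intro le) (simp_all only: ennreal_less_iff r s infinity_ennreal_def ennreal_less_top)
    then show ?thesis using r s h
      by (simp only: h_def[symmetric] enn_powr_ennreal add_nonneg_nonneg less_imp_le ennreal_mult powr_ge_zero)
  qed
  then have "z \<le> ennreal ((r + 0) powr (1 - t) * (s + 0) powr t)"
    by (intro LIMSEQ_le_const[OF lim]) auto
  then show ?thesis using r s by (simp add: enn_powr_ennreal ennreal_mult)
qed

lemma log_convex_onD:
  "log_convex_on cmb P u \<Longrightarrow> x \<in> P \<Longrightarrow> y \<in> P \<Longrightarrow> 0 \<le> t \<Longrightarrow> t \<le> 1 \<Longrightarrow>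
    u (cmb t x y) \<le> enn_powr (u x) (1 - t) * enn_powr (u y) t"
  by (simp add: log_convex_on_def)

text \<open>Hull values are nearly attained at points \<open>x'\<close>, \<open>y'\<close> close to
  \<open>x\<close>, \<open>y\<close>, and their combination is equally close to that of
  \<open>x\<close> and \<open>y\<close>. The condition \<open>off\<close> puts these points into
  \<open>Q\<close>; \<open>pos\<close> excludes products of 0 and infinity and settles
  \<open>t = 0\<close> and \<open>t = 1\<close>.\<close>

lemma log_convex_lsc_hull:
  fixes v :: "'x::real_normed_vector \<Rightarrow> ennreal"
  assumes lc: "\<And>x y t. x \<in> Q \<Longrightarrow> y \<in> Q \<Longrightarrow> 0 < t \<Longrightarrow> t < 1 \<Longrightarrow>
      v (cmb_lin t x y) \<le> enn_powr (v x) (1 - t) * enn_powr (v y) t"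
    and off: "\<And>x. x \<notin> Q \<Longrightarrow> v x = \<infinity>"
    and pos: "\<And>x. x \<in> P \<Longrightarrow> 0 < lsc_hull v x"
  shows "log_convex_on cmb_lin P (lsc_hull v)"
  unfolding log_convex_on_def
proof (intro ballI)
  fix x y and t :: real assume x: "x \<in> P" and y: "y \<in> P" and "t \<in> {0..1}"
  then consider "t = 0" | "t = 1" | "0 < t" "t < 1" by fastforce
  then show "lsc_hull v (cmb_lin t x y) \<le> enn_powr (lsc_hull v x) (1 - t) * enn_powr (lsc_hull v y) t"
  proof cases
    case 1 then show ?thesis using pos[OF y] by (simp add: enn_powr_exp_0)
  next
    case 2 then show ?thesis using pos[OF x] by (simp add: enn_powr_exp_0)
  next
    case 3
    show ?thesis
    proof (cases "lsc_hull v x = \<infinity> \<or> lsc_hull v y = \<infinity>")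
      case True
      then have "enn_powr (lsc_hull v x) (1 - t) * enn_powr (lsc_hull v y) t = \<infinity>"
        using 3 enn_powr_pos[OF pos[OF x], of "1 - t"] enn_powr_pos[OF pos[OF y], of t]
        by (auto simp: enn_powr_top ennreal_mult_top ennreal_top_mult)
      then show ?thesis by (simp only: infinity_ennreal_def top_greatest)
    next
      case False
      show ?thesis
      proof (rule enn_powr_mult_le_limit[OF 3])
        fix a b assume a: "lsc_hull v x < a" "a < \<infinity>" and b: "lsc_hull v y < b" "b < \<infinity>"
        show "lsc_hull v (cmb_lin t x y) \<le> enn_powr a (1 - t) * enn_powr b t"
        proof (rule lsc_hull_leI)
          fix e :: real assume e: "0 < e"
          obtain x' where x': "x' \<in> ball x e" "v x' < a" by (rule lsc_hull_lessD[OF a(1) e])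
          obtain y' where y': "y' \<in> ball y e" "v y' < b" by (rule lsc_hull_lessD[OF b(1) e])
          have Q: "x' \<in> Q" "y' \<in> Q" using off[of x'] off[of y'] x'(2) y'(2) by (metis infinity_ennreal_def top.extremum_strict)+
          show "\<exists>z\<in>ball (cmb_lin t x y) e. v z \<le> enn_powr a (1 - t) * enn_powr b t"
          proof (rule bexI[of _ "cmb_lin t x' y'"])
            have "v (cmb_lin t x' y') \<le> enn_powr (v x') (1 - t) * enn_powr (v y') t"
              by (rule lc[OF Q 3])
            also have "\<dots> \<le> enn_powr a (1 - t) * enn_powr b t"
              using x' y' 3 by (intro mult_mono enn_powr_mono) auto
            finally show "v (cmb_lin t x' y') \<le> enn_powr a (1 - t) * enn_powr b t" .
            show "cmb_lin t x' y' \<in> ball (cmb_lin t x y) e"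
              using x' y' 3 by (simp add: dist_cmb_lin_less)
          qed
        qed
      qed (use False in \<open>auto simp: less_top\<close>)
    qed
  qed
qed

subsection \<open>States of a system and their limits\<close>

context system
begin

abbreviation "MP \<equiv> M_class cmb_lin P mu 1"

lemma MP_iff: "u \<in> MP \<longleftrightarrow> plc_on cmb_lin P u \<and> u \<in> borel_measurable borel \<and> (\<integral>\<^sup>+x. u x \<partial>mu) = total_mass mu"
proof -
  have "(borel_measurable mu :: ('a \<Rightarrow> ennreal) set) = borel_measurable borel"
    by (rule measurable_cong_sets) simp_all
  then show ?thesis using total_mass_eq by (simp add: M_class_1_iff)
qed

lemma MP_D:
  assumes "u \<in> MP"
  shows "plc_on cmb_lin P u" "log_convex_on cmb_lin P u" "u \<in> borel_measurable borel"
    "u \<in> borel_measurable mu" "(\<integral>\<^sup>+x. u x \<partial>mu) = total_mass mu" "\<And>x. x \<in> P \<Longrightarrow> 0 < u x" "u \<in> borel_measurable bd"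
  using assms by (auto simp: MP_iff plc_on_def)

lemma boundary_integral_eq: "(\<integral>\<^sup>+x. u x \<partial>bd) = int_energy mu bd u * ennreal mass"
proof -
  have "inverse (ennreal mass) * ennreal mass = 1"
    using mass_pos by (simp add: inverse_ennreal flip: ennreal_mult)
  then show ?thesis
    by (simp add: int_energy_def total_mass_eq divide_ennreal_def mult.assoc)
qed

lemma AE_mu_interior: "AE x in mu. x \<in> interior P"
proof -
  have "negligible (frontier P)" by (rule negligible_convex_frontier[OF convex_P])
  then have "frontier P \<in> null_sets lborel"
    unfolding negligible_iff_null_sets by (subst (asm) null_sets_completion_iff) auto
  from AE_not_in[OF this] show ?thesis
    unfolding AE_mu_iff using closed_P by (auto simp: frontier_def)
qed

text \<open>Some exponent above 1 admissible in \<open>energy_Lq_bound\<close>; it serves only to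
  make entropies finite.\<close>

definition q0 :: real where "q0 = 1 + 1 / (2 * real DIM('a))"

lemma q0: "1 < q0" "(real DIM('a) - 1) * (q0 - 1) < 1"
  by (auto simp: q0_def field_simps DIM_positive)

text \<open>Through the L^q bound at \<open>q0\<close>, finite energy excludes entropy minus
  infinity, with an estimate depending on the energy alone.\<close>

lemma bounded_energy_H:
  assumes "0 \<le> k"
  obtains B where "\<And>u. u \<in> MP \<Longrightarrow> int_energy mu bd u \<le> ennreal k \<Longrightarrow> H_fin mu u \<and> H_int mu u \<le> B"
proof -
  have k: "0 \<le> k * mass" using assms mass_pos by simp
  obtain C where C: "0 \<le> C" "\<And>u. u \<in> borel_measurable borel \<Longrightarrow> log_convex_on cmb_lin P u \<Longrightarrow>
     (\<integral>\<^sup>+y. u y \<partial>bd) \<le> ennreal (k * mass) \<Longrightarrow> (\<integral>\<^sup>+x. ennreal (enn2real (u x) powr q0) \<partial>mu) \<le> ennreal C"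
    by (fact energy_Lq_bound[OF q0 k])
  show ?thesis
  proof (rule that[of "mass + C / (q0 - 1)"])
    fix u assume u: "u \<in> MP" and e: "int_energy mu bd u \<le> ennreal k"
    have "(\<integral>\<^sup>+y. u y \<partial>bd) \<le> ennreal (k * mass)"
      unfolding boundary_integral_eq using e assms mass_pos by (simp add: ennreal_mult mult_right_mono)
    then have "(\<integral>\<^sup>+x. ennreal (enn2real (u x) powr q0) \<partial>mu) \<le> ennreal C"
      by (intro C(2) MP_D(2,3) u)
    then show "H_fin mu u \<and> H_int mu u \<le> mass + C / (q0 - 1)"
      using H_fin_of_powr[OF total_mass_eq mass_pos MP_D(4,5)[OF u] q0(1) _ C(1)] by blast
  qed
qed

lemma MP_mix:
  assumes u: "u \<in> MP" and v: "v \<in> MP" and t: "0 \<le> t" "t \<le> 1"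
  shows "(\<lambda>x. ennreal (1 - t) * u x + ennreal t * v x) \<in> MP"
    and "int_energy mu bd (\<lambda>x. ennreal (1 - t) * u x + ennreal t * v x)
      = ennreal (1 - t) * int_energy mu bd u + ennreal t * int_energy mu bd v"
proof -
  note [measurable] = MP_D(3,4,7)[OF u] MP_D(3,4,7)[OF v]
  have 1: "ennreal (1 - t) + ennreal t = 1" using t by (simp flip: ennreal_plus)
  have "(\<integral>\<^sup>+x. ennreal (1 - t) * u x + ennreal t * v x \<partial>mu) = (ennreal (1 - t) + ennreal t) * total_mass mu"
    by (simp add: nn_integral_add nn_integral_cmult MP_D(5)[OF u] MP_D(5)[OF v] distrib_right)
  then show "(\<lambda>x. ennreal (1 - t) * u x + ennreal t * v x) \<in> MP"
    using 1 plc_on_mix[OF MP_D(1)[OF u] MP_D(1)[OF v] convex_P t] by (simp add: MP_iff)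
  have "(\<integral>\<^sup>+x. ennreal (1 - t) * u x + ennreal t * v x \<partial>bd)
      = ennreal (1 - t) * (\<integral>\<^sup>+x. u x \<partial>bd) + ennreal t * (\<integral>\<^sup>+x. v x \<partial>bd)"
    by (simp add: nn_integral_add nn_integral_cmult)
  then show "int_energy mu bd (\<lambda>x. ennreal (1 - t) * u x + ennreal t * v x)
      = ennreal (1 - t) * int_energy mu bd u + ennreal t * int_energy mu bd v"
    by (simp add: int_energy_def divide_ennreal_def distrib_right mult.assoc)
qed

lemma one_MP: "(\<lambda>_. 1) \<in> MP"
  by (simp add: MP_iff plc_on_const_1 total_mass_def)

lemma int_energy_one_finite: "int_energy mu bd (\<lambda>_. 1) < \<infinity>"
  using bd_finite mass_pos by (simp add: int_energy_def total_mass_eq ennreal_divide_eq_top_iff less_top[symmetric])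

lemma min_energy_le: "u \<in> MP \<Longrightarrow> min_energy cmb_lin P mu bd \<le> int_energy mu bd u"
  unfolding min_energy_def by (rule INF_lower)

text \<open>The limit is taken as the lower semicontinuous hull of the limes superior on the interior:
  it is the pointwise limit there, and on the boundary it lies below the limes inferior, because \<open>u k\<close> is
  uniformly bounded near an interior point and log-convex along segments to the boundary.\<close>
lemma L1_Cauchy_limit:
  fixes u :: "nat \<Rightarrow> 'a \<Rightarrow> ennreal"
  assumes u: "\<And>k. u k \<in> MP" and en: "\<And>k. int_energy mu bd (u k) \<le> ennreal e0" and e0: "0 \<le> e0"
    and ae: "AE x in mu. Cauchy (\<lambda>k. enn2real (u k x))"
    and L1: "\<And>e. 0 < e \<Longrightarrow> \<exists>N. \<forall>i\<ge>N. \<forall>j\<ge>N. (\<integral>x. \<bar>enn2real (u i x) - enn2real (u j x)\<bar> \<partial>mu) < e"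
  obtains w where "w \<in> MP" "\<And>y. y \<in> P \<Longrightarrow> w y \<le> liminf (\<lambda>k. u k y)"
    "AE x in mu. (\<lambda>k. enn2real (u k x)) \<longlonglongrightarrow> enn2real (w x)"
proof -
  define Q where "Q = interior P"
  have Qo: "open Q" and Qc: "convex Q" and QP: "Q \<subseteq> P"
    using convex_P interior_subset by (auto simp: Q_def convex_interior)
  note [measurable] = MP_D(3,4)[OF u]
  have [measurable]: "Q \<in> sets borel" using Qo by simp
  \<comment> \<open>Being infinite off the interior, \<open>v\<close> enters its hull at a boundary
    point only through interior values.\<close>
  define v where "v x = (if x \<in> Q then limsup (\<lambda>k. u k x) else \<infinity>)" for x
  have v_off: "v x = \<infinity>" if "x \<notin> Q" for x using that by (simp add: v_def)
  obtain C where C: "0 \<le> C" "\<And>u x d. u \<in> borel_measurable borel \<Longrightarrow> log_convex_on cmb_lin P u \<Longrightarrow> 0 < d \<Longrightarrow>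
      ball x d \<subseteq> P \<Longrightarrow> u x \<le> ennreal (C / d ^ (DIM('a) - 1)) * (\<integral>\<^sup>+y. u y \<partial>bd)"
    by (fact interior_bound)
  have ub: "u k x \<le> ennreal (C / d ^ (DIM('a) - 1) * (e0 * mass))" if "0 < d" "ball x d \<subseteq> P" for k x d
  proof -
    have "u k x \<le> ennreal (C / d ^ (DIM('a) - 1)) * (\<integral>\<^sup>+y. u k y \<partial>bd)"
      by (intro C(2) MP_D(2,3) u that)
    also have "\<dots> \<le> ennreal (C / d ^ (DIM('a) - 1)) * (ennreal e0 * ennreal mass)"
      unfolding boundary_integral_eq by (intro mult_left_mono mult_right_mono en) auto
    also have "\<dots> = ennreal (C / d ^ (DIM('a) - 1) * (e0 * mass))"
      using C(1) e0 mass_pos that by (simp only: ennreal_mult divide_nonneg_pos zero_less_power mult_nonneg_nonneg less_imp_le)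
    finally show ?thesis .
  qed
  have Qball: "\<exists>d>0. ball x d \<subseteq> P" if "x \<in> Q" for x
    using that by (simp add: Q_def mem_interior)
  have u_fin: "u k x < \<infinity>" if "x \<in> Q" for k x
    using Qball[OF that] ub by (metis ennreal_less_top infinity_ennreal_def order_le_less_trans)
  have v_fin: "v x < \<infinity>" if x: "x \<in> Q" for x
  proof -
    obtain d where d: "0 < d" "ball x d \<subseteq> P" using Qball[OF x] by blast
    have "limsup (\<lambda>k. u k x) \<le> ennreal (C / d ^ (DIM('a) - 1) * (e0 * mass))"
      by (rule Limsup_bounded) (use ub[OF d] in auto)
    then show ?thesis using x by (simp add: v_def order_le_less_trans)
  qed
  have v_lc: "v (cmb_lin t x y) \<le> enn_powr (v x) (1 - t) * enn_powr (v y) t"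
    if x: "x \<in> Q" and y: "y \<in> Q" and t: "0 < t" "t < 1" for x y t
  proof (rule enn_powr_mult_le_limit[OF t v_fin[OF x] v_fin[OF y]])
    fix a b assume a: "v x < a" and b: "v y < b"
    have z: "cmb_lin t x y \<in> Q" using cmb_lin_closed[OF Qc x y, of t] t by simp
    have "eventually (\<lambda>k. u k x < a) sequentially" "eventually (\<lambda>k. u k y < b) sequentially"
      using a b x y by (auto simp: v_def dest: Limsup_lessD)
    then have "eventually (\<lambda>k. u k (cmb_lin t x y) \<le> enn_powr a (1 - t) * enn_powr b t) sequentially"
    proof eventually_elim
      case (elim k)
      have "u k (cmb_lin t x y) \<le> enn_powr (u k x) (1 - t) * enn_powr (u k y) t"
        using x y t QP by (intro log_convex_onD[OF MP_D(2)[OF u[of k]]]) auto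
      also have "\<dots> \<le> enn_powr a (1 - t) * enn_powr b t"
        using elim t by (intro mult_mono enn_powr_mono) auto
      finally show ?case .
    qed
    then show "v (cmb_lin t x y) \<le> enn_powr a (1 - t) * enn_powr b t"
      using z by (simp add: v_def Limsup_bounded)
  qed
  have conv: "AE x in mu. x \<in> Q \<and> (\<lambda>k. u k x) \<longlonglongrightarrow> v x"
    using ae AE_mu_interior
  proof eventually_elim
    case (elim x)
    then have x: "x \<in> Q" by (simp add: Q_def)
    obtain r where r: "(\<lambda>k. enn2real (u k x)) \<longlonglongrightarrow> r" using elim(1) Cauchy_convergent convergent_def by blast
    then have "(\<lambda>k. ennreal (enn2real (u k x))) \<longlonglongrightarrow> ennreal r" by (rule tendsto_ennrealI)
    then have *: "(\<lambda>k. u k x) \<longlonglongrightarrow> ennreal r" using u_fin[OF x] by simp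
    then have "limsup (\<lambda>k. u k x) = ennreal r" by (intro lim_imp_Limsup) auto
    with * x show ?case by (simp add: v_def)
  qed
  have [measurable]: "v \<in> borel_measurable borel" unfolding v_def[abs_def] by measurable
  define f where "f x = enn2real (v x)" for x
  have [measurable]: "f \<in> borel_measurable borel" unfolding f_def[abs_def] by measurable
  have convr: "AE x in mu. (\<lambda>k. enn2real (u k x)) \<longlonglongrightarrow> f x"
    using conv
  proof eventually_elim
    case (elim x)
    then show ?case unfolding f_def using v_fin[of x] by (intro tendsto_enn2real) auto
  qed
  have int_u: "integrable mu (\<lambda>x. enn2real (u k x))" "(\<integral>x. enn2real (u k x) \<partial>mu) = mass" for k
    using density_integrable[OF total_mass_eq mass_pos MP_D(4,5)[OF u]]
      density_integral[OF total_mass_eq mass_pos MP_D(4,5)[OF u]] by auto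
  \<comment> \<open>Fatou's lemma in the second index: a member of the sequence that is L^1 close to
    all later ones is as close to the limit.\<close>
  have fL1: "\<exists>k. (\<integral>\<^sup>+x. ennreal \<bar>enn2real (u k x) - f x\<bar> \<partial>mu) \<le> ennreal e" if e: "0 < e" for e
  proof -
    obtain N where N: "\<And>i j. i \<ge> N \<Longrightarrow> j \<ge> N \<Longrightarrow> (\<integral>x. \<bar>enn2real (u i x) - enn2real (u j x)\<bar> \<partial>mu) < e"
      using L1[OF e] by blast
    have "(\<integral>\<^sup>+x. ennreal \<bar>enn2real (u N x) - f x\<bar> \<partial>mu)
      = (\<integral>\<^sup>+x. liminf (\<lambda>j. ennreal \<bar>enn2real (u N x) - enn2real (u j x)\<bar>) \<partial>mu)"
      using convr
    proof (intro nn_integral_cong_AE, eventually_elim)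
      case (elim x)
      then have "liminf (\<lambda>j. ennreal \<bar>enn2real (u N x) - enn2real (u j x)\<bar>) = ennreal \<bar>enn2real (u N x) - f x\<bar>"
        by (intro lim_imp_Liminf tendsto_ennrealI tendsto_rabs tendsto_diff tendsto_const) auto
      then show ?case by simp
    qed
    also have "\<dots> \<le> liminf (\<lambda>j. \<integral>\<^sup>+x. ennreal \<bar>enn2real (u N x) - enn2real (u j x)\<bar> \<partial>mu)"
      by (rule nn_integral_liminf) measurable
    also have "\<dots> \<le> ennreal e"
    proof (rule Liminf_le[OF _ eventually_sequentiallyI])
      fix j assume j: "N \<le> j"
      have "(\<integral>\<^sup>+x. ennreal \<bar>enn2real (u N x) - enn2real (u j x)\<bar> \<partial>mu) = ennreal (\<integral>x. \<bar>enn2real (u N x) - enn2real (u j x)\<bar> \<partial>mu)"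
        using int_u(1) by (intro nn_integral_eq_integral) auto
      also have "\<dots> \<le> ennreal e" using N[of N j] j by (intro ennreal_leI) simp
      finally show "(\<integral>\<^sup>+x. ennreal \<bar>enn2real (u N x) - enn2real (u j x)\<bar> \<partial>mu) \<le> ennreal e" .
    qed simp
    finally show ?thesis by blast
  qed
  have f_int: "integrable mu f"
  proof -
    obtain k where k: "(\<integral>\<^sup>+x. ennreal \<bar>enn2real (u k x) - f x\<bar> \<partial>mu) \<le> ennreal 1" using fL1[of 1] by auto
    have "integrable mu (\<lambda>x. enn2real (u k x) - f x)"
      by (intro integrableI_bounded) (use k in \<open>auto intro: order_le_less_trans\<close>)
    from Bochner_Integration.integrable_diff[OF int_u(1)[of k] this] show ?thesis by simp
  qed
  have f_mass: "(\<integral>x. f x \<partial>mu) = mass"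
  proof (rule ccontr)
    assume ne: "(\<integral>x. f x \<partial>mu) \<noteq> mass"
    define e where "e = \<bar>mass - (\<integral>x. f x \<partial>mu)\<bar> / 2"
    have e: "0 < e" using ne by (simp add: e_def)
    obtain k where k: "(\<integral>\<^sup>+x. ennreal \<bar>enn2real (u k x) - f x\<bar> \<partial>mu) \<le> ennreal e" using fL1[OF e] by blast
    have "\<bar>mass - (\<integral>x. f x \<partial>mu)\<bar> = \<bar>\<integral>x. enn2real (u k x) - f x \<partial>mu\<bar>"
      using int_u f_int by simp
    also have "\<dots> \<le> (\<integral>x. \<bar>enn2real (u k x) - f x\<bar> \<partial>mu)" by (rule integral_abs_bound)
    also have "\<dots> \<le> e"
    proof -
      have "ennreal (\<integral>x. \<bar>enn2real (u k x) - f x\<bar> \<partial>mu) = (\<integral>\<^sup>+x. ennreal \<bar>enn2real (u k x) - f x\<bar> \<partial>mu)"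
        using int_u(1) f_int by (intro nn_integral_eq_integral[symmetric]) auto
      with k e show ?thesis by (metis ennreal_le_iff less_imp_le)
    qed
    finally show False using e by (simp add: e_def)
  qed
  have v_total: "(\<integral>\<^sup>+x. v x \<partial>mu) = total_mass mu"
  proof -
    have "(\<integral>\<^sup>+x. v x \<partial>mu) = (\<integral>\<^sup>+x. ennreal (f x) \<partial>mu)"
      using conv by (intro nn_integral_cong_AE, eventually_elim) (use v_fin in \<open>auto simp: f_def\<close>)
    also have "\<dots> = ennreal (\<integral>x. f x \<partial>mu)" by (intro nn_integral_eq_integral f_int AE_I2) (simp add: f_def)
    finally show ?thesis using f_mass total_mass_eq by simp
  qed
  \<comment> \<open>A zero at one interior point \<open>x\<close> would spread: every
    \<open>y\<close> in \<open>Q\<close> lies strictly between \<open>x\<close> and a slightly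
    farther point of \<open>Q\<close>, where \<open>v\<close> is finite, so log-convexity gives
    \<open>v y = 0\<close>. That contradicts the total mass.\<close>
  have v_pos: "0 < v x" if x: "x \<in> Q" for x
  proof (rule ccontr)
    assume "\<not> 0 < v x"
    then have vx: "v x = 0" by (simp add: zero_less_iff_neq_zero)
    have "v y = 0" if y: "y \<in> Q" for y
    proof -
      have "((\<lambda>s. y + s *\<^sub>R (y - x)) \<longlongrightarrow> y + 0 *\<^sub>R (y - x)) (at_right 0)"
        by (intro tendsto_intros)
      then have "eventually (\<lambda>s. y + s *\<^sub>R (y - x) \<in> Q) (at_right 0)"
        using Qo y by (auto elim: topological_tendstoD)
      then have "eventually (\<lambda>s. y + s *\<^sub>R (y - x) \<in> Q \<and> 0 < s) (at_right (0::real))"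
        using eventually_at_right_less eventually_conj by blast
      then obtain s where s: "y + s *\<^sub>R (y - x) \<in> Q" "0 < s"
        using eventually_happens'[OF trivial_limit_at_right_real] by blast
      define t where "t = 1 / (1 + s)"
      have t: "0 < t" "t < 1" using s by (auto simp: t_def)
      have ts: "t * (1 + s) = 1" using s by (simp add: t_def)
      have "cmb_lin t x (y + s *\<^sub>R (y - x)) = (1 - t * (1 + s)) *\<^sub>R x + (t * (1 + s)) *\<^sub>R y"
        by (simp add: cmb_lin_def algebra_simps)
      then have "y = cmb_lin t x (y + s *\<^sub>R (y - x))" by (simp add: ts)
      then have "v y \<le> enn_powr (v x) (1 - t) * enn_powr (v (y + s *\<^sub>R (y - x))) t"
        using v_lc[OF x s(1) t] by simp
      then show ?thesis by (simp add: vx)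
    qed
    then have "AE x in mu. v x = 0" using conv by auto
    then have "(\<integral>\<^sup>+x. v x \<partial>mu) = 0" by (subst nn_integral_0_iff_AE) auto
    then show False using v_total total_mass_eq mass_pos by simp
  qed
  \<comment> \<open>Young's inequality turns log-convexity into convexity, and finite convex
    functions on open sets are continuous. Hence taking the hull changes nothing on
    \<open>Q\<close>.\<close>
  have f_cont: "continuous_on Q f"
  proof (rule convex_on_continuous[OF Qo], rule convex_onI)
    fix t x y assume t: "0 < (t::real)" "t < 1" and x: "x \<in> Q" and y: "y \<in> Q"
    have z: "cmb_lin t x y \<in> Q" using cmb_lin_closed[OF Qc x y, of t] t by simp
    have "ennreal (f (cmb_lin t x y)) = v (cmb_lin t x y)" using v_fin[OF z] by (simp add: f_def)
    also have "\<dots> \<le> enn_powr (v x) (1 - t) * enn_powr (v y) t" by (rule v_lc[OF x y t])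
    also have "\<dots> \<le> ennreal (1 - t) * v x + ennreal t * v y" by (rule enn_powr_Young[OF t])
    also have "\<dots> = ennreal (1 - t) * ennreal (f x) + ennreal t * ennreal (f y)"
      using v_fin[OF x] v_fin[OF y] by (simp add: f_def)
    also have "\<dots> = ennreal ((1 - t) * f x + t * f y)"
      using t by (simp add: f_def flip: ennreal_mult ennreal_plus)
    finally have le: "ennreal (f (cmb_lin t x y)) \<le> ennreal ((1 - t) * f x + t * f y)" .
    have nn: "0 \<le> (1 - t) * f x + t * f y" using t by (simp add: f_def)
    show "f ((1 - t) *\<^sub>R x + t *\<^sub>R y) \<le> (1 - t) * f x + t * f y"
      using ennreal_le_iff[OF nn, THEN iffD1, OF le] unfolding cmb_lin_def .
  qed (rule Qc)
  have vf: "v x = ennreal (f x)" if "x \<in> Q" for x using v_fin[OF that] by (simp add: f_def)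
  have f_pos: "0 < f x" if "x \<in> Q" for x using v_pos[OF that] vf[OF that] by (simp add: ennreal_less_zero_iff)
  have near: "\<exists>e>0. ball x e \<subseteq> Q \<and> (\<forall>z\<in>ball x e. c < f z)" if x: "x \<in> Q" and c: "c < f x" for x c
  proof -
    have "open {z\<in>Q. c < f z}"
      using continuous_openin_preimage_gen[OF f_cont, of "{c<..}"] Qo
      by (simp add: openin_open_eq vimage_def Int_def)
    moreover have "x \<in> {z\<in>Q. c < f z}" using x c by simp
    ultimately obtain e where "0 < e" "ball x e \<subseteq> {z\<in>Q. c < f z}" by (meson openE)
    then show ?thesis by blast
  qed
  define w where "w = lsc_hull v"
  have w_eq: "w x = v x" if x: "x \<in> Q" for x
  proof (rule antisym)
    show "w x \<le> v x" unfolding w_def by (rule lsc_hull_le)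
    show "v x \<le> w x"
    proof (rule dense_le)
      fix c assume c: "c < v x"
      then obtain r where r: "c = ennreal r" "0 \<le> r" using v_fin[OF x] ennreal_finiteE[of c] by (metis less_trans)
      then have "r < f x" using c vf[OF x] by (simp add: ennreal_less_iff)
      from near[OF x this] obtain e where e: "e > 0" "ball x e \<subseteq> Q" "\<And>z. z \<in> ball x e \<Longrightarrow> r < f z" by blast
      show "c \<le> w x" unfolding w_def
      proof (rule le_lsc_hullI[OF e(1)])
        fix z assume z: "z \<in> ball x e"
        then have "z \<in> Q" using e(2) by blast
        then show "c \<le> v z" using e(3)[OF z] vf[of z] r by (simp add: ennreal_leI)
      qed
    qed
  qed
  obtain p where p: "p \<in> Q" using interior_ne by (auto simp: Q_def)
  \<comment> \<open>For \<open>z\<close> near a possibly frontier point \<open>x\<close>, the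
    midpoint of \<open>z\<close> and the interior point \<open>p\<close> is near \<open>m\<close>,
    where \<open>f\<close> exceeds \<open>c\<close>. Log-convexity gives
    \<open>c\<^sup>2 \<le> f z * f p\<close>, a lower bound for \<open>f z\<close> that does not
    depend on \<open>z\<close>.\<close>
  have w_pos: "0 < w x" if x: "x \<in> P" for x
  proof -
    define m where "m = cmb_lin (1/2) x p"
    have m: "m \<in> Q"
    proof -
      have "m = x - (1/2) *\<^sub>R (x - p)" by (simp add: m_def cmb_lin_def algebra_simps flip: scaleR_add_left)
      then show ?thesis
        using mem_interior_convex_shrink[OF convex_P, of p x "1/2"] p x by (simp add: Q_def)
    qed
    define c where "c = f m / 2"
    have c: "0 < c" "c < f m" using f_pos[OF m] by (auto simp: c_def)
    obtain e where e: "e > 0" "\<And>z. z \<in> ball m e \<Longrightarrow> c < f z" using near[OF m c(2)] by blast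
    have "ennreal (c\<^sup>2 / f p) \<le> w x" unfolding w_def
    proof (rule le_lsc_hullI[OF e(1)])
      fix z assume z: "z \<in> ball x e"
      show "ennreal (c\<^sup>2 / f p) \<le> v z"
      proof (cases "z \<in> Q")
        case True
        define y where "y = cmb_lin (1/2) z p"
        have y: "y \<in> Q" using cmb_lin_closed[OF Qc True p, of "1/2"] by (simp add: y_def)
        have "y \<in> ball m e" unfolding y_def m_def using z e(1) by (auto intro!: dist_cmb_lin_less)
        then have "c < f y" by (rule e(2))
        moreover have "ennreal (f y) \<le> ennreal (f z powr (1/2) * f p powr (1/2))"
          using v_lc[OF True p, of "1/2"] vf[OF y] vf[OF True] vf[OF p] f_pos[OF True] f_pos[OF p]
          by (simp add: y_def enn_powr_ennreal flip: ennreal_mult)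
        then have "f y \<le> f z powr (1/2) * f p powr (1/2)" by (simp add: ennreal_le_iff)
        then have "f y \<le> sqrt (f z) * sqrt (f p)"
          using f_pos[OF True] f_pos[OF p] by (simp add: powr_half_sqrt)
        ultimately have "c \<le> sqrt (f z * f p)" by (simp add: real_sqrt_mult)
        then have "c\<^sup>2 \<le> f z * f p"
          using c f_pos[OF True] f_pos[OF p] by (metis less_imp_le mult_pos_pos power_mono real_sqrt_pow2)
        then have "c\<^sup>2 / f p \<le> f z" using f_pos[OF p] by (simp add: field_simps)
        then show ?thesis using vf[OF True] by (simp add: ennreal_leI)
      qed (simp add: v_off)
    qed
    moreover have "0 < ennreal (c\<^sup>2 / f p)" using c f_pos[OF p] by (simp add: ennreal_less_zero_iff)
    ultimately show ?thesis by (rule less_le_trans[rotated])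
  qed
  have w_v: "AE x in mu. w x = v x" using conv by eventually_elim (simp add: w_eq)
  have w_meas: "w \<in> borel_measurable borel" unfolding w_def by measurable
  have wMP: "w \<in> MP"
    unfolding MP_iff plc_on_def
  proof (intro conjI ballI w_pos w_meas)
    show "lsc_on P w" unfolding w_def by (rule lsc_on_lsc_hull)
    show "log_convex_on cmb_lin P w" unfolding w_def
      using log_convex_lsc_hull[of Q v P] v_lc v_off w_pos unfolding w_def by blast
    have "(\<integral>\<^sup>+x. w x \<partial>mu) = (\<integral>\<^sup>+x. v x \<partial>mu)" by (rule nn_integral_cong_AE[OF w_v])
    then show "(\<integral>\<^sup>+x. w x \<partial>mu) = total_mass mu" by (simp add: v_total)
  qed
  have w_lim: "AE x in mu. (\<lambda>k. enn2real (u k x)) \<longlonglongrightarrow> enn2real (w x)"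
    using w_v convr by eventually_elim (simp add: f_def)
  obtain d0 where d0: "0 < d0" "ball p d0 \<subseteq> P" using Qball[OF p] by blast
  \<comment> \<open>Half the radius: every point of \<open>ball p \<rho>\<close> is then the centre
    of a ball of radius \<open>\<rho>\<close> inside \<open>P\<close>, so that
    \<open>interior_bound\<close> yields one constant \<open>K\<close> for all
    \<open>k\<close>.\<close>
  define \<rho> where "\<rho> = d0 / 2"
  have rho: "0 < \<rho>" using d0 by (simp add: \<rho>_def)
  define K where "K = C / \<rho> ^ (DIM('a) - 1) * (e0 * mass) + 1"
  have K: "u k x \<le> ennreal K" "x \<in> P" if x: "x \<in> ball p \<rho>" for k x
  proof -
    have sub: "ball x \<rho> \<subseteq> P"
    proof
      fix z assume "z \<in> ball x \<rho>"
      then have "z \<in> ball p d0" using x dist_triangle[of p z x] by (auto simp: \<rho>_def)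
      then show "z \<in> P" using d0 by blast
    qed
    have "u k x \<le> ennreal (C / \<rho> ^ (DIM('a) - 1) * (e0 * mass))" by (rule ub[OF rho sub])
    also have "\<dots> \<le> ennreal K" by (intro ennreal_leI) (simp add: K_def)
    finally show "u k x \<le> ennreal K" .
    show "x \<in> P" using sub rho by auto
  qed
  have K1: "1 \<le> K" using C(1) e0 mass_pos rho by (simp add: K_def)
  \<comment> \<open>If \<open>u k y < r\<close> for infinitely many \<open>k\<close>, log-convexity
    between \<open>y\<close> and points near \<open>p\<close> bounds \<open>u k\<close> at parameter
    \<open>s\<close> by \<open>r powr (1 - s) * K powr s\<close>, which tends to \<open>r\<close> as
    \<open>s\<close> tends to 0. So \<open>v\<close> takes values barely above \<open>r\<close>
    arbitrarily close to \<open>y\<close>, and the hull at \<open>y\<close> is no larger.\<close>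
  have w_le: "w y \<le> liminf (\<lambda>k. u k y)" if y: "y \<in> P" for y
  proof (rule dense_ge)
    fix c assume c: "liminf (\<lambda>k. u k y) < c"
    then obtain c1 where c1: "liminf (\<lambda>k. u k y) < c1" "c1 < c" using dense by blast
    have "c1 < \<infinity>" using c1(2) by (metis infinity_ennreal_def less_top less_le_trans top_greatest)
    then obtain r where r0: "c1 = ennreal r" "0 \<le> r" by (rule ennreal_finiteE)
    have "c1 \<noteq> 0" using c1(1) by auto
    then have r: "c1 = ennreal r" "0 < r" using r0 by (auto simp: less_le)
    have "frequently (\<lambda>k. u k y < c1) sequentially"
    proof (rule ccontr)
      assume "\<not> frequently (\<lambda>k. u k y < c1) sequentially"
      then have "eventually (\<lambda>k. c1 \<le> u k y) sequentially" by (simp add: not_frequently not_less)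
      then have "c1 \<le> liminf (\<lambda>k. u k y)" by (rule Liminf_bounded)
      then show False using c1 by simp
    qed
    have lim: "((\<lambda>s. r powr (1 - s) * K powr s) \<longlongrightarrow> r powr (1 - 0) * K powr 0) (at_right 0)"
      using r K1 by (intro tendsto_intros) auto
    have "ennreal r < c" using c1 r by simp
    then obtain r2 where r2: "r < r2" "ennreal r2 \<le> c"
    proof (cases c)
      case (real s)
      then show ?thesis using \<open>ennreal r < c\<close> r that[of s] by (simp add: ennreal_less_iff)
    next
      case top
      then show ?thesis using that[of "r + 1"] by simp
    qed
    have small: "eventually (\<lambda>s. r powr (1 - s) * K powr s < r2) (at_right 0)"
      using lim r r2 K1 by (intro order_tendstoD(2)[OF lim]) auto
    show "w y \<le> c" unfolding w_def
    proof (rule lsc_hull_leI)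
      fix e :: real assume e: "0 < e"
      have "eventually (\<lambda>s::real. s < min 1 (e / (dist y p + \<rho> + 1))) (at_right 0)"
        using e rho by (intro order_tendstoD(2)[OF tendsto_ident_at]) (auto intro!: divide_pos_pos add_nonneg_pos add_nonneg_nonneg)
      with small have "eventually (\<lambda>s. r powr (1 - s) * K powr s < r2 \<and> s < min 1 (e / (dist y p + \<rho> + 1)) \<and> 0 < s) (at_right 0)"
        using eventually_at_right_less by eventually_elim auto
      then obtain s where s: "r powr (1 - s) * K powr s < r2" "s < 1" "s < e / (dist y p + \<rho> + 1)" "0 < s"
        using eventually_happens'[OF trivial_limit_at_right_real] by fastforce
      have in_ball: "cmb_lin s y x \<in> ball y e" if x: "x \<in> ball p \<rho>" for x
      proof -
        have "dist y (cmb_lin s y x) = s * dist y x"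
        proof -
          have "y - cmb_lin s y x = s *\<^sub>R (y - x)" by (simp add: cmb_lin_def algebra_simps)
          then show ?thesis using s by (simp add: dist_norm)
        qed
        also have "dist y x \<le> dist y p + \<rho> + 1" using x dist_triangle[of y x p] by simp
        then have "s * dist y x \<le> s * (dist y p + \<rho> + 1)" using s by (intro mult_left_mono) auto
        also have "s * (dist y p + \<rho> + 1) < e"
        proof -
          have "0 < dist y p + \<rho> + 1" using rho by (simp add: add_nonneg_pos)
          then show ?thesis using s by (simp add: field_simps)
        qed
        finally show ?thesis by simp
      qed
      \<comment> \<open>Convergence to \<open>v\<close> holds only almost everywhere, so a whole
        ball of points is moved toward \<open>y\<close>; its image is open and nonempty, hence not
        null, and contains a point of convergence.\<close>
      define Oz where "Oz = (\<lambda>x. (1 - s) *\<^sub>R y + s *\<^sub>R x) ` ball p \<rho>"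
      have "open Oz" unfolding Oz_def 
        using open_affinity[OF open_ball, of s "(1 - s) *\<^sub>R y" p \<rho>] s by simp
      have "Oz \<noteq> {}" using rho by (auto simp: Oz_def)
      have "\<exists>z\<in>Oz. (\<lambda>k. u k z) \<longlonglongrightarrow> v z"
      proof (rule ccontr)
        assume no: "\<not> (\<exists>z\<in>Oz. (\<lambda>k. u k z) \<longlonglongrightarrow> v z)"
        have OzP: "Oz \<subseteq> P"
        proof
          fix z assume "z \<in> Oz"
          then obtain x where x: "x \<in> ball p \<rho>" "z = cmb_lin s y x" by (auto simp: Oz_def cmb_lin_def)
          have "s \<in> {0..1}" using s by simp
          then show "z \<in> P" unfolding x(2) by (rule cmb_lin_closed[OF convex_P y K(2)[OF x(1)]])
        qed
        have "AE x in lborel. x \<in> P \<longrightarrow> x \<in> Q \<and> (\<lambda>k. u k x) \<longlonglongrightarrow> v x"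
          using conv unfolding AE_mu_iff .
        then have "AE x in lborel. x \<notin> Oz"
          by (rule eventually_mono) (use no OzP in blast)
        then have "Oz \<in> null_sets lborel"
          using AE_iff_null_sets[of Oz lborel] \<open>open Oz\<close> by simp
        then have "negligible Oz"
          unfolding negligible_iff_null_sets using null_sets_completion_iff[of Oz lborel] \<open>open Oz\<close> by simp
        then show False using open_not_negligible \<open>open Oz\<close> \<open>Oz \<noteq> {}\<close> by blast
      qed
      then obtain x where x: "x \<in> ball p \<rho>" "(\<lambda>k. u k (cmb_lin s y x)) \<longlonglongrightarrow> v (cmb_lin s y x)"
        by (auto simp: Oz_def cmb_lin_def)
      have "v (cmb_lin s y x) \<le> ennreal r2"
      proof (rule ccontr)
        assume "\<not> v (cmb_lin s y x) \<le> ennreal r2"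
        then have "eventually (\<lambda>k. ennreal r2 < u k (cmb_lin s y x)) sequentially"
          using x(2) by (intro order_tendstoD(1)) auto
        then have "frequently (\<lambda>k. u k y < c1 \<and> ennreal r2 < u k (cmb_lin s y x)) sequentially"
          by (rule frequently_eventually_frequently[OF \<open>frequently (\<lambda>k. u k y < c1) sequentially\<close>])
        then obtain k where k: "u k y < c1" "ennreal r2 < u k (cmb_lin s y x)"
          using frequently_ex by blast
        have "u k (cmb_lin s y x) \<le> enn_powr (u k y) (1 - s) * enn_powr (u k x) s"
          using y K(2)[OF x(1)] s by (intro log_convex_onD[OF MP_D(2)[OF u[of k]]]) auto
        also have "\<dots> \<le> enn_powr (ennreal r) (1 - s) * enn_powr (ennreal K) s"
          using k r K(1)[OF x(1)] s by (intro mult_mono enn_powr_mono) auto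
        also have "\<dots> = ennreal (r powr (1 - s) * K powr s)"
          using r K1 by (simp add: enn_powr_ennreal ennreal_mult)
        also have "\<dots> \<le> ennreal r2" using s by (intro ennreal_leI) simp
        finally show False using k by simp
      qed
      then show "\<exists>z\<in>ball y e. v z \<le> c"
        using in_ball[OF x(1)] r2 by (intro bexI[of _ "cmb_lin s y x"]) auto
    qed
  qed
  show ?thesis by (rule that[OF wMP w_le w_lim])
qed

end

context system
begin

subsection \<open>Minimizers of the energy\<close>

lemma min_energy_finite: "min_energy cmb_lin P mu bd < \<infinity>"
  using min_energy_le[OF one_MP] int_energy_one_finite by (rule order_le_less_trans)

lemma H_int_mid_gap:
  assumes u: "u \<in> MP" "H_fin mu u" and v: "v \<in> MP" "H_fin mu v" and eta: "0 < \<eta>"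
    and h: "h \<le> H_int mu (\<lambda>x. ennreal (1 - 1/2) * u x + ennreal (1/2) * v x)"
  shows "(\<integral>x. \<bar>enn2real (u x) - enn2real (v x)\<bar> \<partial>mu)
    \<le> (2 / \<eta>) * ((H_int mu u + H_int mu v) / 2 - h) + 2 * \<eta> * mass"
proof -
  have "(2 / \<eta>) * ((H_int mu u + H_int mu v) / 2 - H_int mu (\<lambda>x. ennreal (1 - 1/2) * u x + ennreal (1/2) * v x))
     \<le> (2 / \<eta>) * ((H_int mu u + H_int mu v) / 2 - h)"
    using h eta by (intro mult_left_mono) auto
  then show ?thesis
    using L1_dist_le_H_gap[OF total_mass_eq mass_pos MP_D(4,5)[OF u(1)] MP_D(4,5)[OF v(1)] u(2) v(2) eta]
    by linarith
qed

text \<open>Adding 1 makes the integrands nonnegative, as Fatou's lemma requires. The limit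
  \<open>w\<close> is positive on \<open>P\<close>, which lets \<open>ln\<close> pass to the
  limit.\<close>

lemma H_int_Fatou:
  assumes u: "\<And>k. u k \<in> MP" "\<And>k. H_fin mu (u k)" and w: "w \<in> MP" "H_fin mu w"
    and lim: "AE x in mu. (\<lambda>k. enn2real (u k x)) \<longlonglongrightarrow> enn2real (w x)"
    and le: "\<And>k. H_int mu (u k) \<le> h + c k" and c: "c \<longlonglongrightarrow> 0"
  shows "H_int mu w \<le> h"
proof -
  let ?h = "\<lambda>u x. enn2real (u x) * ln (enn2real (u x)) + 1"
  have nn: "0 \<le> ?h u x" for u :: "'a \<Rightarrow> ennreal" and x using x_ln_x_ge_minus_1[of "enn2real (u x)"] by simp
  note [measurable] = MP_D(3,4)[OF u(1)] MP_D(3,4)[OF w(1)]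
  have int: "(\<integral>\<^sup>+x. ennreal (?h u x) \<partial>mu) = ennreal (H_int mu u + mass)" if "H_fin mu u" "u \<in> MP" for u
  proof -
    have i: "integrable mu (?h u)" using that(1) by (auto simp: H_fin_def)
    have "measure mu (space mu) = mass" using total_mass_eq mass_pos by (simp add: total_mass_def measure_def)
    then have "(\<integral>x. ?h u x \<partial>mu) = H_int mu u + mass"
      using that(1) by (simp add: H_int_def H_fin_def)
    then show ?thesis using nn_integral_eq_integral[OF i] nn by simp
  qed
  have pos: "0 \<le> H_int mu w" by (rule H_int_nonneg[OF total_mass_eq mass_pos MP_D(4,5)[OF w(1)] w(2)])
  have posk: "0 \<le> H_int mu (u k)" for k by (rule H_int_nonneg[OF total_mass_eq mass_pos MP_D(4,5)[OF u(1)] u(2)])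
  have "ennreal (H_int mu w + mass) = (\<integral>\<^sup>+x. ennreal (?h w x) \<partial>mu)" by (simp add: int w)
  also have "\<dots> = (\<integral>\<^sup>+x. liminf (\<lambda>k. ennreal (?h (u k) x)) \<partial>mu)"
    using lim AE_mu_P AE_finite_density[OF total_mass_eq mass_pos MP_D(4,5)[OF w(1)]]
  proof (intro nn_integral_cong_AE, eventually_elim)
    case (elim x)
    have "0 < enn2real (w x)" using elim MP_D(6)[OF w(1)] by (simp add: enn2real_positive_iff)
    then have "liminf (\<lambda>k. ennreal (?h (u k) x)) = ennreal (?h w x)"
      using elim by (intro lim_imp_Liminf tendsto_ennrealI tendsto_add tendsto_mult tendsto_ln tendsto_const) auto
    then show ?case by simp
  qed
  also have "\<dots> \<le> liminf (\<lambda>k. \<integral>\<^sup>+x. ennreal (?h (u k) x) \<partial>mu)"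
    by (rule nn_integral_liminf) measurable
  also have "\<dots> = liminf (\<lambda>k. ennreal (H_int mu (u k) + mass))" by (simp add: int u)
  also have "\<dots> \<le> liminf (\<lambda>k. ennreal (h + c k + mass))"
    using le by (intro Liminf_mono always_eventually) (auto intro!: ennreal_leI)
  also have "\<dots> = ennreal (h + 0 + mass)"
    by (intro lim_imp_Liminf tendsto_ennrealI tendsto_add tendsto_const c) auto
  finally have *: "ennreal (H_int mu w + mass) \<le> ennreal (h + mass)" by simp
  have hc: "(\<lambda>k. h + c k) \<longlonglongrightarrow> h + 0" by (intro tendsto_intros c)
  have "0 \<le> h + c k" for k using posk[of k] le[of k] by linarith
  then have "0 \<le> h + 0" by (intro LIMSEQ_le_const[OF hc]) auto
  then have "0 \<le> h + mass" using mass_pos by simp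
  from ennreal_le_iff[OF this, THEN iffD1, OF *] show ?thesis by simp
qed

text \<open>The entropy is upper semicontinuous at the minimum of the energy: by strict convexity, nearly optimal
  states of nearly minimal energy form an \<open>L\<^sup>1\<close> Cauchy sequence.\<close>
theorem usc_at_min:
  shows "\<exists>w\<in>MP. int_energy mu bd w = min_energy cmb_lin P mu bd \<and>
    (\<forall>\<epsilon>>0. \<exists>\<eta>>0. \<forall>u\<in>MP. int_energy mu bd u \<le> min_energy cmb_lin P mu bd + ennreal \<eta>
      \<longrightarrow> H_int mu w \<le> H_int mu u + \<epsilon>)"
proof -
  obtain m where m: "min_energy cmb_lin P mu bd = ennreal m" "0 \<le> m"
    by (rule ennreal_finiteE[OF min_energy_finite])
  define d where "d n = 1 / real (Suc n)" for n
  have d: "0 < d n" "d n \<le> 1" for n by (auto simp: d_def)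
  have d_mono: "d j \<le> d i" if "i \<le> j" for i j using that by (simp add: d_def frac_le)
  have d0: "d \<longlonglongrightarrow> 0" unfolding d_def[abs_def] by (rule LIMSEQ_Suc[OF lim_1_over_n])
  have m1: "0 \<le> m + 1" using m by simp
  obtain B where B: "\<And>u. u \<in> MP \<Longrightarrow> int_energy mu bd u \<le> ennreal (m + 1) \<Longrightarrow> H_fin mu u \<and> H_int mu u \<le> B"
    by (fact bounded_energy_H[OF m1])
  define A where "A n = {u \<in> MP. int_energy mu bd u \<le> ennreal (m + d n)}" for n
  have A_sub: "u \<in> MP" "H_fin mu u" "H_int mu u \<le> B" "0 \<le> H_int mu u" "int_energy mu bd u \<le> ennreal (m + d n)"
    if "u \<in> A n" for u n
  proof -
    show u: "u \<in> MP" and e: "int_energy mu bd u \<le> ennreal (m + d n)" using that by (auto simp: A_def)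
    have "int_energy mu bd u \<le> ennreal (m + 1)"
      using e d(2)[of n] by (meson add_left_mono ennreal_leI order_trans)
    with B[OF u] show "H_fin mu u" "H_int mu u \<le> B" by auto
    then show "0 \<le> H_int mu u" by (intro H_int_nonneg[OF total_mass_eq mass_pos MP_D(4,5)[OF u]])
  qed
  have A_mono: "A j \<subseteq> A i" if "i \<le> j" for i j
  proof -
    have "ennreal (m + d j) \<le> ennreal (m + d i)" using d_mono[OF that] by (intro ennreal_leI) simp
    then show ?thesis unfolding A_def by (auto intro: order_trans)
  qed
  have A_ne: "A n \<noteq> {}" for n
  proof -
    have "min_energy cmb_lin P mu bd < ennreal (m + d n)" using m d(1)[of n] by (simp add: ennreal_less_iff)
    then obtain u where "u \<in> MP" "int_energy mu bd u < ennreal (m + d n)"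
      unfolding min_energy_def by (auto simp: INF_less_iff)
    then show ?thesis by (auto simp: A_def intro: less_imp_le)
  qed
  \<comment> \<open>The best value of \<open>H_int\<close> at energies within \<open>d n\<close> of
    the minimum. Its limit \<open>h0\<close> is defined through nearby energies, not at the minimum
    itself; that a state of minimal energy attains it is what has to be shown.\<close>
  define h where "h n = (INF u\<in>A n. H_int mu u)" for n
  have bdd: "bdd_below (H_int mu ` A n)" for n using A_sub(4) by (auto intro!: bdd_belowI[of _ 0])
  have h_le: "h n \<le> H_int mu u" if "u \<in> A n" for u n
    unfolding h_def by (rule cINF_lower[OF bdd that])
  have h_B: "h n \<le> B" for n using A_ne[of n] h_le A_sub(3) by (meson all_not_in_conv order_trans)
  have h_mono: "h i \<le> h j" if "i \<le> j" for i j
    unfolding h_def[of j] by (rule cINF_greatest[OF A_ne]) (use A_mono[OF that] h_le in blast)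
  define h0 where "h0 = (SUP n. h n)"
  have bdd': "bdd_above (range h)" using h_B by (auto intro!: bdd_aboveI[of _ B])
  have h_h0: "h n \<le> h0" for n unfolding h0_def by (rule cSUP_upper[OF _ bdd']) simp
  have h_lim: "h \<longlonglongrightarrow> h0" unfolding h0_def by (rule LIMSEQ_incseq_SUP[OF bdd']) (auto intro: incseq_def[THEN iffD2] h_mono)
  have "\<exists>u. u \<in> A n \<and> H_int mu u \<le> h0 + d n" for n
  proof -
    have "(INF u\<in>A n. H_int mu u) < h0 + d n" using h_h0[of n] d(1)[of n] by (simp add: h_def)
    then obtain u where "u \<in> A n" "H_int mu u < h0 + d n"
      using cINF_less_iff[OF A_ne bdd] by blast
    then show ?thesis by (auto intro: less_imp_le)
  qed
  then obtain u where u: "\<And>n. u n \<in> A n" "\<And>n. H_int mu (u n) \<le> h0 + d n" by metis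
  have uMP: "u n \<in> MP" and uH: "H_fin mu (u n)" for n using A_sub u by blast+
  \<comment> \<open>Energy is affine along mixtures, so midpoints remain in \<open>A N\<close> and
    their \<open>H_int\<close> is at least \<open>h N\<close>. The defect is then at most
    \<open>h0 + d N - h N\<close>, which tends to 0.\<close>
  have gap: "(\<integral>x. \<bar>enn2real (u i x) - enn2real (u j x)\<bar> \<partial>mu) \<le> (2 / \<eta>) * (h0 + d N - h N) + 2 * \<eta> * mass"
    if ij: "N \<le> i" "N \<le> j" and eta: "0 < \<eta>" for i j N \<eta>
  proof -
    let ?w = "\<lambda>x. ennreal (1 - 1/2) * u i x + ennreal (1/2) * u j x"
    have uN: "u i \<in> A N" "u j \<in> A N" using u(1) A_mono ij by blast+
    have "int_energy mu bd ?w = ennreal (1 - 1/2) * int_energy mu bd (u i) + ennreal (1/2) * int_energy mu bd (u j)"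
      by (intro MP_mix uMP) auto
    also have "\<dots> \<le> ennreal (1 - 1/2) * ennreal (m + d N) + ennreal (1/2) * ennreal (m + d N)"
      using uN by (intro add_mono mult_left_mono A_sub(5)) auto
    also have "\<dots> = ennreal (m + d N)"
    proof -
      have "ennreal (1 - 1/2) + ennreal (1/2) = ennreal 1" by (subst ennreal_plus[symmetric]) auto
      then show ?thesis by (simp only: distrib_right[symmetric] ennreal_1 mult_1)
    qed
    finally have "?w \<in> A N" using MP_mix(1)[OF uMP uMP, of "1/2"] by (simp add: A_def)
    then have hw: "h N \<le> H_int mu ?w" by (rule h_le)
    have "H_int mu (u i) \<le> h0 + d N" "H_int mu (u j) \<le> h0 + d N"
      using u(2)[of i] u(2)[of j] d_mono[OF ij(1)] d_mono[OF ij(2)] by linarith+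
    then have "(2 / \<eta>) * ((H_int mu (u i) + H_int mu (u j)) / 2 - h N) \<le> (2 / \<eta>) * (h0 + d N - h N)"
      using eta by (intro mult_left_mono) auto
    with H_int_mid_gap[OF uMP uH uMP uH eta hw] show ?thesis by linarith
  qed
  have L1: "\<exists>N. \<forall>i\<ge>N. \<forall>j\<ge>N. (\<integral>x. \<bar>enn2real (u i x) - enn2real (u j x)\<bar> \<partial>mu) < e" if e: "0 < e" for e
  proof -
    define \<eta> where "\<eta> = e / (4 * mass)"
    have eta: "0 < \<eta>" using e mass_pos by (simp add: \<eta>_def)
    have "(\<lambda>N. (2 / \<eta>) * (h0 + d N - h N)) \<longlonglongrightarrow> (2 / \<eta>) * (h0 + 0 - h0)"
      by (intro tendsto_intros d0 h_lim)
    then have "eventually (\<lambda>N. (2 / \<eta>) * (h0 + d N - h N) < e / 2) sequentially"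
      using e by (intro order_tendstoD) auto
    then obtain N where N: "(2 / \<eta>) * (h0 + d N - h N) < e / 2" by (auto simp: eventually_sequentially)
    have "2 * \<eta> * mass = e / 2" using mass_pos by (simp add: \<eta>_def)
    have "(\<integral>x. \<bar>enn2real (u i x) - enn2real (u j x)\<bar> \<partial>mu) < e" if "N \<le> i" "N \<le> j" for i j
      using gap[OF that eta] N \<open>2 * \<eta> * mass = e / 2\<close> by linarith
    then show ?thesis by blast
  qed
  have int_u: "integrable mu (\<lambda>x. enn2real (u k x))" for k
    by (rule density_integrable[OF total_mass_eq mass_pos MP_D(4,5)[OF uMP]])
  obtain r where r: "strict_mono r" "AE x in mu. Cauchy (\<lambda>i. enn2real (u (r i) x))"
    using cauchy_L1_AE_cauchy_subseq[of mu "\<lambda>n x. enn2real (u n x)"] int_u L1 by (auto simp: real_norm_def)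
  have r_ge: "n \<le> r n" for n by (rule strict_mono_imp_increasing[OF r(1)])
  have en_r: "int_energy mu bd (u (r k)) \<le> ennreal (m + 1)" for k
    using A_sub(5)[OF u(1)[of "r k"]] d(2)[of "r k"] by (meson add_left_mono ennreal_leI order_trans)
  have L1r: "\<exists>N. \<forall>i\<ge>N. \<forall>j\<ge>N. (\<integral>x. \<bar>enn2real (u (r i) x) - enn2real (u (r j) x)\<bar> \<partial>mu) < e" if e: "0 < e" for e
    using L1[OF e] r_ge by (meson order_trans)
  obtain w where w: "w \<in> MP" "\<And>y. y \<in> P \<Longrightarrow> w y \<le> liminf (\<lambda>k. u (r k) y)"
    "AE x in mu. (\<lambda>k. enn2real (u (r k) x)) \<longlonglongrightarrow> enn2real (w x)"
    by (rule L1_Cauchy_limit[of "\<lambda>k. u (r k)" "m + 1", OF uMP en_r _ r(2) L1r]) (use m in auto)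
  note [measurable] = MP_D(7)[OF uMP]
  \<comment> \<open>The boundary is a null set of \<open>mu\<close>, so almost everywhere
    convergence says nothing about it. The bound \<open>w \<le> liminf\<close> at every point of
    \<open>P\<close> is what permits Fatou's lemma for \<open>bd\<close>.\<close>
  have en_w: "int_energy mu bd w = min_energy cmb_lin P mu bd"
  proof (rule antisym)
    have "(\<integral>\<^sup>+x. w x \<partial>bd) \<le> (\<integral>\<^sup>+x. liminf (\<lambda>k. u (r k) x) \<partial>bd)"
      using AE_bd_P by (intro nn_integral_mono_AE, eventually_elim) (rule w(2))
    also have "\<dots> \<le> liminf (\<lambda>k. \<integral>\<^sup>+x. u (r k) x \<partial>bd)" by (rule nn_integral_liminf) measurable
    also have "\<dots> \<le> liminf (\<lambda>k. ennreal ((m + d (r k)) * mass))"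
    proof (intro Liminf_mono always_eventually allI)
      fix k
      have "(\<integral>\<^sup>+x. u (r k) x \<partial>bd) \<le> ennreal (m + d (r k)) * ennreal mass"
        unfolding boundary_integral_eq by (intro mult_right_mono A_sub(5) u) simp
      then show "(\<integral>\<^sup>+x. u (r k) x \<partial>bd) \<le> ennreal ((m + d (r k)) * mass)"
        using m d(1)[of "r k"] mass_pos by (simp only: ennreal_mult add_nonneg_nonneg less_imp_le)
    qed
    also have "\<dots> = ennreal ((m + 0) * mass)"
      using LIMSEQ_subseq_LIMSEQ[OF d0 r(1)]
      by (intro lim_imp_Liminf tendsto_ennrealI tendsto_mult tendsto_add tendsto_const) (auto simp: o_def)
    finally have "int_energy mu bd w * ennreal mass \<le> ennreal m * ennreal mass"
      unfolding boundary_integral_eq using m mass_pos by (simp add: ennreal_mult)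
    then show "int_energy mu bd w \<le> min_energy cmb_lin P mu bd"
      unfolding m(1) using mass_pos by (subst (asm) (1 2) mult.commute, subst (asm) ennreal_mult_le_mult_iff) auto
    show "min_energy cmb_lin P mu bd \<le> int_energy mu bd w" by (rule min_energy_le[OF w(1)])
  qed
  have wA: "w \<in> A n" for n using w(1) en_w m d(1)[of n] by (simp add: A_def ennreal_leI)
  have Hw: "H_int mu w \<le> h0"
  proof (rule H_int_Fatou[OF uMP uH w(1) _ w(3)])
    show "H_fin mu w" using A_sub(2)[OF wA[of 0]] .
    show "H_int mu (u (r k)) \<le> h0 + d (r k)" for k by (rule u(2))
    show "(\<lambda>k. d (r k)) \<longlonglongrightarrow> 0" using LIMSEQ_subseq_LIMSEQ[OF d0 r(1)] by (simp add: o_def)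
  qed
  show ?thesis
  proof (intro bexI[OF _ w(1)] conjI en_w allI impI)
    fix \<epsilon> :: real assume e: "0 < \<epsilon>"
    have "eventually (\<lambda>n. h0 - \<epsilon> < h n) sequentially" using h_lim e by (intro order_tendstoD) auto
    then obtain n where n: "h0 - \<epsilon> < h n" by (auto simp: eventually_sequentially)
    show "\<exists>\<eta>>0. \<forall>u\<in>MP. int_energy mu bd u \<le> min_energy cmb_lin P mu bd + ennreal \<eta> \<longrightarrow> H_int mu w \<le> H_int mu u + \<epsilon>"
    proof (intro exI[of _ "d n"] conjI ballI impI d(1))
      fix v assume v: "v \<in> MP" "int_energy mu bd v \<le> min_energy cmb_lin P mu bd + ennreal (d n)"
      then have "v \<in> A n" using m d(1)[of n] by (simp add: A_def less_imp_le)
      from h_le[OF this] n Hw show "H_int mu w \<le> H_int mu v + \<epsilon>" by linarith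
    qed
  qed
qed

end

subsection \<open>The entropy as a function of the energy\<close>

lemma divide_le_divide_cross:
  fixes p q b d :: real
  assumes "0 < b" "0 < d" "p * d \<le> q * b"
  shows "p / b \<le> q / d"
  using assms by (simp add: field_simps)

text \<open>\<open>dS_right\<close> is given by \<open>Lim\<close>, so convergence of the difference
  quotients has to be proved; for a concave function they are monotone, which also identifies the
  limit.\<close>

lemma tendsto_at_right_antimono_SUP:
  fixes g :: "real \<Rightarrow> ereal"
  assumes ab: "a < b" and anti: "\<And>x y. a < x \<Longrightarrow> x \<le> y \<Longrightarrow> y < b \<Longrightarrow> g y \<le> g x"
  shows "(g \<longlongrightarrow> (SUP x\<in>{a<..<b}. g x)) (at_right a)"
proof (rule order_tendstoI)
  fix c assume "c < (SUP x\<in>{a<..<b}. g x)"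
  then obtain x where x: "a < x" "x < b" "c < g x" by (auto simp: less_SUP_iff)
  have "eventually (\<lambda>y. y \<in> {a<..<x}) (at_right a)" using x by (intro eventually_at_right_real)
  then show "eventually (\<lambda>y. c < g y) (at_right a)"
  proof eventually_elim
    case (elim y)
    then have "g x \<le> g y" using x by (intro anti) auto
    with x(3) show ?case by (rule less_le_trans)
  qed
next
  fix c assume c: "(SUP x\<in>{a<..<b}. g x) < c"
  have "eventually (\<lambda>y. y \<in> {a<..<b}) (at_right a)" using ab by (intro eventually_at_right_real)
  then show "eventually (\<lambda>y. g y < c) (at_right a)"
  proof eventually_elim
    case (elim y)
    then have "g y \<le> (SUP x\<in>{a<..<b}. g x)" by (rule SUP_upper)
    then show ?case using c by (rule le_less_trans)
  qed
qed

lemma tendsto_at_left_antimono_INF: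
  fixes g :: "real \<Rightarrow> ereal"
  assumes ab: "a < b" and anti: "\<And>x y. a < x \<Longrightarrow> x \<le> y \<Longrightarrow> y < b \<Longrightarrow> g y \<le> g x"
  shows "(g \<longlongrightarrow> (INF x\<in>{a<..<b}. g x)) (at_left b)"
proof (rule order_tendstoI)
  fix c assume "(INF x\<in>{a<..<b}. g x) < c"
  then obtain x where x: "a < x" "x < b" "g x < c" by (auto simp: INF_less_iff)
  have "eventually (\<lambda>y. y \<in> {x<..<b}) (at_left b)" using x by (intro eventually_at_left_real)
  then show "eventually (\<lambda>y. g y < c) (at_left b)"
  proof eventually_elim
    case (elim y)
    then have "g y \<le> g x" using x by (intro anti) auto
    then show ?case using x(3) by (rule le_less_trans)
  qed
next
  fix c assume c: "c < (INF x\<in>{a<..<b}. g x)"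
  have "eventually (\<lambda>y. y \<in> {a<..<b}) (at_left b)" using ab by (intro eventually_at_left_real)
  then show "eventually (\<lambda>y. c < g y) (at_left b)"
  proof eventually_elim
    case (elim y)
    then have "(INF x\<in>{a<..<b}. g x) \<le> g y" by (rule INF_lower)
    with c show ?case by (rule less_le_trans)
  qed
qed

context system
begin

text \<open>The attainable pairs of energy and entropy, as real numbers: by
  \<open>bounded_energy_H\<close> entropies at finite energy are finite, and extended reals can be
  avoided from here on. The set need not be convex, but mixtures lie on or below it.\<close>

definition ES :: "(real \<times> real) set" where
  "ES = {(e, s). 0 \<le> e \<and> (\<exists>u\<in>MP. int_energy mu bd u = ennreal e \<and> s = - H_int mu u / mass)}"

lemma finite_energy_H:
  assumes "u \<in> MP" "int_energy mu bd u < \<infinity>"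
  shows "H_fin mu u" "0 \<le> H_int mu u" "entropy mu u = ereal (- H_int mu u / mass)"
proof -
  obtain e where e: "int_energy mu bd u = ennreal e" "0 \<le> e" by (rule ennreal_finiteE[OF assms(2)])
  obtain B where B: "\<And>u. u \<in> MP \<Longrightarrow> int_energy mu bd u \<le> ennreal e \<Longrightarrow> H_fin mu u \<and> H_int mu u \<le> B"
    by (fact bounded_energy_H[OF e(2)])
  show f: "H_fin mu u" using B[OF assms(1)] e by simp
  show "0 \<le> H_int mu u" by (rule H_int_nonneg[OF total_mass_eq mass_pos MP_D(4,5)[OF assms(1)] f])
  show "entropy mu u = ereal (- H_int mu u / mass)"
    by (rule entropy_eq[OF total_mass_eq mass_pos MP_D(4,5)[OF assms(1)] f])
qed

lemma ES_I: "u \<in> MP \<Longrightarrow> 0 \<le> e \<Longrightarrow> int_energy mu bd u = ennreal e \<Longrightarrow> (e, - H_int mu u / mass) \<in> ES"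
  by (auto simp: ES_def)

lemma ES_entropy_nonpos: "(e, s) \<in> ES \<Longrightarrow> s \<le> 0"
  using finite_energy_H mass_pos by (auto simp: ES_def)

lemma ES_mix:
  assumes "(e1, s1) \<in> ES" "(e2, s2) \<in> ES" "0 \<le> t" "t \<le> 1"
  shows "\<exists>s. ((1 - t) * e1 + t * e2, s) \<in> ES \<and> (1 - t) * s1 + t * s2 \<le> s"
proof -
  obtain u where u: "u \<in> MP" "int_energy mu bd u = ennreal e1" "s1 = - H_int mu u / mass" "0 \<le> e1"
    using assms by (auto simp: ES_def)
  obtain v where v: "v \<in> MP" "int_energy mu bd v = ennreal e2" "s2 = - H_int mu v / mass" "0 \<le> e2"
    using assms by (auto simp: ES_def)
  define w where "w = (\<lambda>x. ennreal (1 - t) * u x + ennreal t * v x)"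
  have w: "w \<in> MP" unfolding w_def by (rule MP_mix(1)[OF u(1) v(1) assms(3,4)])
  have "int_energy mu bd w = ennreal (1 - t) * ennreal e1 + ennreal t * ennreal e2"
    unfolding w_def MP_mix(2)[OF u(1) v(1) assms(3,4)] u v ..
  also have "\<dots> = ennreal ((1 - t) * e1 + t * e2)"
    using u(4) v(4) assms by (simp add: ennreal_mult ennreal_plus)
  finally have e: "int_energy mu bd w = ennreal ((1 - t) * e1 + t * e2)" .
  have H: "H_int mu w \<le> (1 - t) * H_int mu u + t * H_int mu v"
    unfolding w_def
    by (rule H_mix(4)[OF total_mass_eq mass_pos MP_D(4,5)[OF u(1)] MP_D(4,5)[OF v(1)] _ _ assms(3,4)])
      (use finite_energy_H(1) u v in auto)
  show ?thesis
  proof (intro exI conjI)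
    show "((1 - t) * e1 + t * e2, - H_int mu w / mass) \<in> ES"
      using u(4) v(4) assms e w by (intro ES_I) auto
    have "(1 - t) * s1 + t * s2 = - ((1 - t) * H_int mu u + t * H_int mu v) / mass"
      by (simp add: u v add_divide_distrib diff_divide_distrib algebra_simps)
    also have "\<dots> \<le> - H_int mu w / mass" using H mass_pos by (intro divide_right_mono) auto
    finally show "(1 - t) * s1 + t * s2 \<le> - H_int mu w / mass" .
  qed
qed

lemma S_eq_ES: "0 \<le> e \<Longrightarrow> S_eq cmb_lin P mu bd e = Sup {ereal s | s. (e, s) \<in> ES}"
  unfolding S_eq_def
proof (rule arg_cong[of _ _ Sup], rule set_eqI, rule iffI)
  fix x assume e: "0 \<le> e" and "x \<in> {entropy mu u |u. u \<in> MP \<and> int_energy mu bd u = ennreal e}"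
  then obtain u where u: "x = entropy mu u" "u \<in> MP" "int_energy mu bd u = ennreal e" by blast
  then have "x = ereal (- H_int mu u / mass)" using finite_energy_H(3) by simp
  then show "x \<in> {ereal s |s. (e, s) \<in> ES}" using ES_I[OF u(2) e u(3)] by blast
next
  fix x assume "x \<in> {ereal s |s. (e, s) \<in> ES}"
  then obtain u where u: "u \<in> MP" "int_energy mu bd u = ennreal e" "x = ereal (- H_int mu u / mass)"
    by (auto simp: ES_def)
  then have "x = entropy mu u" using finite_energy_H(3) by simp
  then show "x \<in> {entropy mu u |u. u \<in> MP \<and> int_energy mu bd u = ennreal e}" using u by blast
qed

definition Edom :: "real set" where "Edom = fst ` ES"

text \<open>The real-valued version of \<open>S_eq\<close>, meaningful on \<open>Edom\<close>, where
  the set of entropies is nonempty; it is bounded above by 0.\<close>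

definition sv :: "real \<Rightarrow> real" where "sv e = Sup {s. (e, s) \<in> ES}"

lemma sv_bdd: "bdd_above {s. (e, s) \<in> ES}"
  using ES_entropy_nonpos by (auto intro!: bdd_aboveI[of _ 0])

lemma sv_upper: "(e, s) \<in> ES \<Longrightarrow> s \<le> sv e"
  unfolding sv_def by (rule cSup_upper[OF _ sv_bdd]) simp

lemma sv_approx:
  assumes "e \<in> Edom" "c < sv e"
  shows "\<exists>s. (e, s) \<in> ES \<and> c < s"
proof -
  have "{s. (e, s) \<in> ES} \<noteq> {}" using assms(1) by (auto simp: Edom_def)
  from less_cSup_iff[OF this sv_bdd] assms(2) show ?thesis unfolding sv_def by blast
qed

lemma S_eq_sv:
  assumes e: "e \<in> Edom"
  shows "S_eq cmb_lin P mu bd e = ereal (sv e)"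
proof -
  obtain s0 where "(e, s0) \<in> ES" using e by (auto simp: Edom_def)
  then have ne: "{s. (e, s) \<in> ES} \<noteq> {}" and e0: "0 \<le> e" by (blast, simp add: ES_def)
  have "S_eq cmb_lin P mu bd e = (SUP s\<in>{s. (e, s) \<in> ES}. ereal s)"
    unfolding S_eq_ES[OF e0] by (rule arg_cong[of _ _ Sup]) auto
  also have "\<dots> = ereal (sv e)"
  proof (rule antisym)
    show "(SUP s\<in>{s. (e, s) \<in> ES}. ereal s) \<le> ereal (sv e)"
      by (rule SUP_least) (auto intro: sv_upper)
    show "ereal (sv e) \<le> (SUP s\<in>{s. (e, s) \<in> ES}. ereal s)"
    proof (rule dense_le)
      fix c assume "c < ereal (sv e)"
      show "c \<le> (SUP s\<in>{s. (e, s) \<in> ES}. ereal s)"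
      proof (cases c)
        case (real r)
        then obtain s where "(e, s) \<in> ES" "r < s" using \<open>c < ereal (sv e)\<close> sv_approx[OF e, of r] by auto
        then show ?thesis using real by (intro SUP_upper2[of s]) auto
      qed (use \<open>c < ereal (sv e)\<close> in auto)
    qed
  qed
  finally show ?thesis .
qed

lemma Edom_mix:
  assumes "e1 \<in> Edom" "e2 \<in> Edom" "0 \<le> t" "t \<le> 1"
  shows "(1 - t) * e1 + t * e2 \<in> Edom" "(1 - t) * sv e1 + t * sv e2 \<le> sv ((1 - t) * e1 + t * e2)"
proof -
  obtain s1 s2 where "(e1, s1) \<in> ES" "(e2, s2) \<in> ES" using assms by (auto simp: Edom_def)
  from ES_mix[OF this assms(3,4)] obtain s where "((1 - t) * e1 + t * e2, s) \<in> ES" by blast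
  then show "(1 - t) * e1 + t * e2 \<in> Edom" unfolding Edom_def by (metis fst_conv imageI)
  show "(1 - t) * sv e1 + t * sv e2 \<le> sv ((1 - t) * e1 + t * e2)"
  proof (rule field_le_epsilon)
    fix \<epsilon> :: real assume e: "0 < \<epsilon>"
    obtain s1 where s1: "(e1, s1) \<in> ES" "sv e1 - \<epsilon> < s1" using sv_approx[OF assms(1), of "sv e1 - \<epsilon>"] e by auto
    obtain s2 where s2: "(e2, s2) \<in> ES" "sv e2 - \<epsilon> < s2" using sv_approx[OF assms(2), of "sv e2 - \<epsilon>"] e by auto
    obtain s where s: "((1 - t) * e1 + t * e2, s) \<in> ES" "(1 - t) * s1 + t * s2 \<le> s"
      using ES_mix[OF s1(1) s2(1) assms(3,4)] by blast
    have "(1 - t) * (sv e1 - \<epsilon>) + t * (sv e2 - \<epsilon>) \<le> (1 - t) * s1 + t * s2"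
      using s1 s2 assms by (intro add_mono mult_left_mono) auto
    moreover have "(1 - t) * (sv e1 - \<epsilon>) + t * (sv e2 - \<epsilon>) = (1 - t) * sv e1 + t * sv e2 - \<epsilon>"
      by (simp add: algebra_simps)
    ultimately show "(1 - t) * sv e1 + t * sv e2 \<le> sv ((1 - t) * e1 + t * e2) + \<epsilon>"
      using sv_upper[OF s(1)] s(2) by linarith
  qed
qed

text \<open>Concavity at three points with denominators cleared, the form from which all slope
  comparisons follow by rearranging.\<close>

lemma Edom_between:
  assumes "e1 \<in> Edom" "e3 \<in> Edom" "e1 < e2" "e2 < e3"
  shows "e2 \<in> Edom" "(e3 - e2) * sv e1 + (e2 - e1) * sv e3 \<le> (e3 - e1) * sv e2"
proof -
  define t where "t = (e2 - e1) / (e3 - e1)"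
  have t: "0 \<le> t" "t \<le> 1" using assms by (auto simp: t_def)
  have e31: "e3 - e1 \<noteq> 0" using assms by simp
  have te: "t * (e3 - e1) = e2 - e1" using e31 by (simp add: t_def)
  then have eq: "(1 - t) * e1 + t * e3 = e2" by (simp add: algebra_simps)
  from Edom_mix(1)[OF assms(1,2) t] show "e2 \<in> Edom" unfolding eq .
  have "(e3 - e1) * ((1 - t) * sv e1 + t * sv e3) \<le> (e3 - e1) * sv e2"
    using Edom_mix(2)[OF assms(1,2) t] assms unfolding eq by (intro mult_left_mono) auto
  moreover have "(e3 - e1) * ((1 - t) * sv e1 + t * sv e3) = (e3 - e1 - t * (e3 - e1)) * sv e1 + (t * (e3 - e1)) * sv e3"
    by (simp add: algebra_simps)
  ultimately show "(e3 - e2) * sv e1 + (e2 - e1) * sv e3 \<le> (e3 - e1) * sv e2"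
    unfolding te by simp
qed

lemma slope_right_antimono:
  assumes "a \<in> Edom" "y \<in> Edom" "a < x" "x \<le> y"
  shows "(sv y - sv a) / (y - a) \<le> (sv x - sv a) / (x - a)"
proof (cases "x = y")
  case False
  then have "(y - x) * sv a + (x - a) * sv y \<le> (y - a) * sv x"
    using assms by (intro Edom_between(2)) auto
  then have "(sv y - sv a) * (x - a) \<le> (sv x - sv a) * (y - a)" by (simp add: algebra_simps)
  then show ?thesis using assms by (intro divide_le_divide_cross) auto
qed simp

lemma slope_left_antimono:
  assumes "b \<in> Edom" "x \<in> Edom" "x \<le> y" "y < b"
  shows "(sv b - sv y) / (b - y) \<le> (sv b - sv x) / (b - x)"
proof (cases "x = y")
  case False
  then have "(b - y) * sv x + (y - x) * sv b \<le> (b - x) * sv y"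
    using assms by (intro Edom_between(2)) auto
  then have "(sv b - sv y) * (b - x) \<le> (sv b - sv x) * (b - y)" by (simp add: algebra_simps)
  then show ?thesis using assms by (intro divide_le_divide_cross) auto
qed simp

lemma slope_middle:
  assumes "x \<in> Edom" "y \<in> Edom" "x < b" "b < y"
  shows "(sv y - sv b) / (y - b) \<le> (sv b - sv x) / (b - x)"
proof -
  have "(y - b) * sv x + (b - x) * sv y \<le> (y - x) * sv b"
    using assms by (intro Edom_between(2)) auto
  then have "(sv y - sv b) * (b - x) \<le> (sv b - sv x) * (y - b)" by (simp add: algebra_simps)
  then show ?thesis using assms by (intro divide_le_divide_cross) auto
qed

lemma dS_right_eq:
  assumes a: "a \<in> Edom" and b: "b \<in> Edom" and ab: "a < b"
  shows "dS_right cmb_lin P mu bd a = (SUP x\<in>{a<..<b}. ereal ((sv x - sv a) / (x - a)))"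
proof -
  have "((\<lambda>x. ereal ((sv x - sv a) / (x - a))) \<longlongrightarrow> (SUP x\<in>{a<..<b}. ereal ((sv x - sv a) / (x - a)))) (at_right a)"
    using Edom_between(1)[OF a b] slope_right_antimono[OF a]
    by (intro tendsto_at_right_antimono_SUP ab) auto
  moreover have "eventually (\<lambda>x. x \<in> {a<..<b}) (at_right a)" using ab by (intro eventually_at_right_real)
  then have "eventually (\<lambda>x. ereal ((sv x - sv a) / (x - a)) =
     (S_eq cmb_lin P mu bd x - S_eq cmb_lin P mu bd a) / ereal (x - a)) (at_right a)"
    by eventually_elim (use Edom_between(1)[OF a b] a in \<open>simp add: S_eq_sv\<close>)
  ultimately have "((\<lambda>x. (S_eq cmb_lin P mu bd x - S_eq cmb_lin P mu bd a) / ereal (x - a)) \<longlongrightarrow>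
      (SUP x\<in>{a<..<b}. ereal ((sv x - sv a) / (x - a)))) (at_right a)"
    by (rule Lim_transform_eventually)
  then show ?thesis unfolding dS_right_def by (intro tendsto_Lim) auto
qed

lemma dS_left_eq:
  assumes a: "a \<in> Edom" and b: "b \<in> Edom" and ab: "a < b"
  shows "dS_left cmb_lin P mu bd b = (INF x\<in>{a<..<b}. ereal ((sv b - sv x) / (b - x)))"
proof -
  have "((\<lambda>x. ereal ((sv b - sv x) / (b - x))) \<longlongrightarrow> (INF x\<in>{a<..<b}. ereal ((sv b - sv x) / (b - x)))) (at_left b)"
    using Edom_between(1)[OF a b] slope_left_antimono[OF b]
    by (intro tendsto_at_left_antimono_INF ab) auto
  moreover have "eventually (\<lambda>x. x \<in> {a<..<b}) (at_left b)" using ab by (intro eventually_at_left_real)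
  then have "eventually (\<lambda>x. ereal ((sv b - sv x) / (b - x)) =
     (S_eq cmb_lin P mu bd b - S_eq cmb_lin P mu bd x) / ereal (b - x)) (at_left b)"
    by eventually_elim (use Edom_between(1)[OF a b] b in \<open>simp add: S_eq_sv\<close>)
  ultimately have "((\<lambda>x. (S_eq cmb_lin P mu bd b - S_eq cmb_lin P mu bd x) / ereal (b - x)) \<longlongrightarrow>
      (INF x\<in>{a<..<b}. ereal ((sv b - sv x) / (b - x)))) (at_left b)"
    by (rule Lim_transform_eventually)
  then show ?thesis unfolding dS_left_def by (intro tendsto_Lim) auto
qed

end

section \<open>The entropy of a mild reservoir near the energy of temperature T\<close>

locale mild_system = system +
  fixes T UR :: real
  assumes mild: "mild cmb_lin P mu bd" and T: "0 \<le> T"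
    and UR: "UR \<in> U_star cmb_lin P mu bd" and T_UR: "ereal T \<in> T_eq cmb_lin P mu bd UR"
begin

definition emin :: real where "emin = enn2real (min_energy cmb_lin P mu bd)"
definition eone :: real where "eone = enn2real (int_energy mu bd (\<lambda>_. 1))"

lemma emin: "min_energy cmb_lin P mu bd = ennreal emin" "0 \<le> emin"
  using min_energy_finite by (auto simp: emin_def)

lemma eone: "int_energy mu bd (\<lambda>_. 1) = ennreal eone" "0 \<le> eone"
  using int_energy_one_finite by (auto simp: eone_def)

lemma UR_bounds: "0 \<le> UR" "emin \<le> UR" "UR < eone"
  using UR emin eone by (auto simp: U_star_def ennreal_less_iff)

lemma ES_emin_le: "(e, s) \<in> ES \<Longrightarrow> emin \<le> e"
  using min_energy_le emin by (auto simp: ES_def) (metis ennreal_le_iff)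

lemma Edom_emin_le: "e \<in> Edom \<Longrightarrow> emin \<le> e"
  using ES_emin_le by (auto simp: Edom_def)

lemma emin_Edom: "emin \<in> Edom"
proof -
  obtain w where "w \<in> MP" "int_energy mu bd w = ennreal emin" using usc_at_min emin(1) by auto
  from ES_I[OF this(1) emin(2) this(2)] show ?thesis unfolding Edom_def by (metis fst_conv imageI)
qed

lemma eone_Edom: "eone \<in> Edom"
  using ES_I[OF one_MP eone(2,1)] unfolding Edom_def by (metis fst_conv imageI)

lemma UR_Edom: "UR \<in> Edom"
  using UR_bounds emin_Edom Edom_between(1)[OF emin_Edom eone_Edom, of UR] by (cases "emin = UR") auto

text \<open>A state of energy 0 would vanish \<open>bd\<close>-almost everywhere although states are
  positive on \<open>P\<close>. Positivity of the minimum leaves room on its left: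
  \<open>S_eq\<close> reads energies through \<open>ennreal\<close>, which would identify negative
  energies with 0.\<close>

lemma emin_pos: "0 < emin"
proof (rule ccontr)
  assume "\<not> 0 < emin"
  then have z: "emin = 0" using emin(2) by simp
  obtain w where w: "w \<in> MP" "int_energy mu bd w = min_energy cmb_lin P mu bd" using usc_at_min by blast
  have "(\<integral>\<^sup>+x. w x \<partial>bd) = 0" unfolding boundary_integral_eq w emin z by simp
  then have "AE x in bd. w x = 0" using nn_integral_0_iff_AE[OF MP_D(7)[OF w(1)]] by simp
  with AE_bd_P have "AE x in bd. False"
    by eventually_elim (use MP_D(6)[OF w(1)] in fastforce)
  then have "emeasure bd (space bd) = 0" by (simp add: AE_iff_measurable[of "space bd"])
  then have "int_energy mu bd (\<lambda>_. 1) = 0" by (simp add: int_energy_def)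
  then show False using UR_bounds eone by (simp add: emin(2))
qed

text \<open>Mildness shrinks the interval to one point and \<open>T\<close> belongs to it, so both
  of its ends are \<open>T\<close>.\<close>

lemma T_eq_single:
  shows "inverse (dS_left cmb_lin P mu bd UR) = ereal T" "inverse (dS_right cmb_lin P mu bd UR) = ereal T"
proof -
  obtain T' where T': "T_eq cmb_lin P mu bd UR = {T'}" using mild UR by (auto simp: mild_def)
  with T_UR have *: "{inverse (dS_left cmb_lin P mu bd UR) .. inverse (dS_right cmb_lin P mu bd UR)} = {ereal T}"
    by (auto simp: T_eq_def)
  then show "inverse (dS_left cmb_lin P mu bd UR) = ereal T" "inverse (dS_right cmb_lin P mu bd UR) = ereal T"
    unfolding atLeastAtMost_singleton_iff by auto
qed

text \<open>There are no states below the minimal energy, so at the minimum the left difference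
  quotients are infinite and their inverse is 0.\<close>

lemma emin_less_UR: assumes "0 < T" shows "emin < UR"
proof (rule ccontr)
  assume "\<not> emin < UR"
  then have eq: "UR = emin" using UR_bounds by simp
  have "eventually (\<lambda>x. x \<in> {0<..<UR}) (at_left UR)" using emin_pos eq by (intro eventually_at_left_real) simp
  then have "eventually (\<lambda>x. \<infinity> = (S_eq cmb_lin P mu bd UR - S_eq cmb_lin P mu bd x) / ereal (UR - x)) (at_left UR)"
  proof eventually_elim
    case (elim x)
    then have "{ereal s |s. (x, s) \<in> ES} = {}" using ES_emin_le eq by force
    then have "S_eq cmb_lin P mu bd x = - \<infinity>" using elim by (simp add: S_eq_ES bot_ereal_def)
    then show ?case using elim by (simp add: S_eq_sv[OF UR_Edom])
  qed
  then have "((\<lambda>x. (S_eq cmb_lin P mu bd UR - S_eq cmb_lin P mu bd x) / ereal (UR - x)) \<longlongrightarrow> \<infinity>) (at_left UR)"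
    by (rule Lim_transform_eventually[OF tendsto_const])
  then have "dS_left cmb_lin P mu bd UR = \<infinity>" unfolding dS_left_def by (intro tendsto_Lim) auto
  then show False using T_eq_single(1) assms by simp
qed

text \<open>Both one-sided slopes at \<open>UR\<close> are \<open>1 / T\<close>, so the graph lies
  below this tangent line. Conversely \<open>N\<close> copies that share the energy
  \<open>\<delta>\<close> change their total entropy by about \<open>\<delta> / T\<close>, and this
  is realized by states up to \<open>\<epsilon>\<close>.\<close>

lemma tangent:
  assumes "0 < T"
  shows "(e, s) \<in> ES \<Longrightarrow> s \<le> sv UR + (e - UR) / T"
    and "0 < \<epsilon> \<Longrightarrow> eventually (\<lambda>N. \<exists>s. (UR + \<delta> / real N, s) \<in> ES \<and> \<delta> / T - \<epsilon> \<le> real N * (s - sv UR)) sequentially"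
proof -
  have m: "emin < UR" by (rule emin_less_UR) fact
  have inv: "d = ereal (1 / T)" if "inverse d = ereal T" for d
    using that assms by (cases d) (auto simp: field_simps split: if_splits)
  have dr: "(SUP x\<in>{UR<..<eone}. ereal ((sv x - sv UR) / (x - UR))) = ereal (1 / T)"
    using inv[OF T_eq_single(2)] dS_right_eq[OF UR_Edom eone_Edom] UR_bounds by simp
  have dl: "(INF x\<in>{emin<..<UR}. ereal ((sv UR - sv x) / (UR - x))) = ereal (1 / T)"
    using inv[OF T_eq_single(1)] dS_left_eq[OF emin_Edom UR_Edom m] by simp
  have R: "sv e \<le> sv UR + (e - UR) / T" if e: "e \<in> Edom" for e
  proof -
    consider "e = UR" | "UR < e" | "e < UR" by linarith
    then show ?thesis
    proof cases
      case 2
      define x where "x = min e ((UR + eone) / 2)"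
      have x: "UR < x" "x \<le> e" "x < eone" using 2 UR_bounds by (auto simp: x_def min_def field_simps)
      have "(sv e - sv UR) / (e - UR) \<le> (sv x - sv UR) / (x - UR)"
        by (rule slope_right_antimono[OF UR_Edom e x(1,2)])
      also have "\<dots> \<le> 1 / T"
      proof -
        have "ereal ((sv x - sv UR) / (x - UR)) \<le> ereal (1 / T)"
          unfolding dr[symmetric] using x by (intro SUP_upper) auto
        then show ?thesis by simp
      qed
      finally show ?thesis using 2 by (simp add: field_simps)
    next
      case 3
      define x where "x = (e + UR) / 2"
      have x: "e \<le> x" "x < UR" "emin < x" using 3 Edom_emin_le[OF e] by (auto simp: x_def)
      have "1 / T \<le> (sv UR - sv x) / (UR - x)"
      proof -
        have "ereal (1 / T) \<le> ereal ((sv UR - sv x) / (UR - x))"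
          unfolding dl[symmetric] using x by (intro INF_lower) auto
        then show ?thesis by simp
      qed
      also have "\<dots> \<le> (sv UR - sv e) / (UR - e)"
        by (rule slope_left_antimono[OF UR_Edom e x(1,2)])
      finally show ?thesis using 3 assms by (simp add: field_simps)
    qed simp
  qed
  show "s \<le> sv UR + (e - UR) / T" if "(e, s) \<in> ES"
  proof -
    have "e \<in> Edom" using that unfolding Edom_def by (metis fst_conv imageI)
    from R[OF this] sv_upper[OF that] show ?thesis by linarith
  qed
  \<comment> \<open>A single energy on the same side of \<open>UR\<close> as
    \<open>\<delta>\<close>, with slope within \<open>c\<close> of \<open>1 / T\<close>; concavity
    then carries the estimate over to all energies between.\<close>
  have near: "\<exists>E\<in>Edom. 0 < (E - UR) * \<delta> \<and> sv UR + (E - UR) / T - c * \<bar>E - UR\<bar> \<le> sv E" if c: "0 < c" and d: "\<delta> \<noteq> 0" for c \<delta>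
  proof (cases "0 < \<delta>")
    case True
    have "ereal (1 / T - c) < (SUP x\<in>{UR<..<eone}. ereal ((sv x - sv UR) / (x - UR)))" unfolding dr using c by simp
    then obtain x where x: "UR < x" "x < eone" "1 / T - c < (sv x - sv UR) / (x - UR)" by (auto simp: less_SUP_iff)
    then have "(1 / T - c) * (x - UR) \<le> sv x - sv UR" by (simp add: pos_less_divide_eq)
    then show ?thesis using x True Edom_between(1)[OF UR_Edom eone_Edom x(1,2)]
      by (intro bexI[of _ x]) (auto simp: algebra_simps)
  next
    case False
    have "(INF x\<in>{emin<..<UR}. ereal ((sv UR - sv x) / (UR - x))) < ereal (1 / T + c)" unfolding dl using c by simp
    then obtain x where x: "emin < x" "x < UR" "(sv UR - sv x) / (UR - x) < 1 / T + c" by (auto simp: INF_less_iff)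
    then have "sv UR - sv x \<le> (1 / T + c) * (UR - x)" by (simp add: pos_divide_less_eq)
    then show ?thesis using x False d Edom_between(1)[OF emin_Edom UR_Edom x(1,2)]
      by (intro bexI[of _ x]) (auto simp: algebra_simps diff_divide_distrib intro: mult_strict_right_mono_neg)
  qed
  show "eventually (\<lambda>N. \<exists>s. (UR + \<delta> / real N, s) \<in> ES \<and> \<delta> / T - \<epsilon> \<le> real N * (s - sv UR)) sequentially"
    if eps: "0 < \<epsilon>" for \<epsilon> \<delta>
  proof -
    have "eventually (\<lambda>N. UR + \<delta> / real N \<in> Edom \<and> \<delta> / T - \<epsilon> / 2 \<le> real N * (sv (UR + \<delta> / real N) - sv UR)) sequentially"
    proof (cases "\<delta> = 0")
      case True
      then show ?thesis using UR_Edom eps by simp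
    next
      case False
      define c where "c = \<epsilon> / (2 * \<bar>\<delta>\<bar>)"
      have c: "0 < c" using False eps by (simp add: c_def)
      obtain E where E: "E \<in> Edom" "0 < (E - UR) * \<delta>" "sv UR + (E - UR) / T - c * \<bar>E - UR\<bar> \<le> sv E"
        using near[OF c False] by blast
      \<comment> \<open>With weight \<open>k / N\<close> toward \<open>E\<close> the energy moves
        from \<open>UR\<close> by exactly \<open>\<delta> / N\<close>; it is a convex weight as soon
        as \<open>k \<le> N\<close>.\<close>
      define k where "k = \<delta> / (E - UR)"
      have EU: "E - UR \<noteq> 0" using E(2) by auto
      have k: "0 < k" "k * (E - UR) = \<delta>" using E(2) EU by (auto simp: k_def zero_less_divide_iff zero_less_mult_iff)
      have kabs: "k * \<bar>E - UR\<bar> = \<bar>\<delta>\<bar>" using k by (metis abs_mult abs_of_pos)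
      have "eventually (\<lambda>N. max 1 k \<le> real N) sequentially"
        by (rule eventually_compose_filterlim[OF eventually_ge_at_top filterlim_real_sequentially])
      then show ?thesis
      proof eventually_elim
        case (elim N)
        then have N: "1 \<le> real N" "k \<le> real N" by auto
        define t where "t = k / real N"
        have t: "0 \<le> t" "t \<le> 1" using k N by (auto simp: t_def)
        have Nt: "real N * t = k" using N by (simp add: t_def)
        have "t * (E - UR) = \<delta> / real N" using k(2) by (simp add: t_def)
        then have eq: "(1 - t) * UR + t * E = UR + \<delta> / real N" by (simp add: algebra_simps)
        have in_dom: "UR + \<delta> / real N \<in> Edom" using Edom_mix(1)[OF UR_Edom E(1) t] unfolding eq .
        have "(1 - t) * sv UR + t * sv E \<le> sv (UR + \<delta> / real N)"
          using Edom_mix(2)[OF UR_Edom E(1) t] unfolding eq .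
        then have "t * (sv E - sv UR) \<le> sv (UR + \<delta> / real N) - sv UR" by (simp add: algebra_simps)
        then have "real N * (t * (sv E - sv UR)) \<le> real N * (sv (UR + \<delta> / real N) - sv UR)"
          by (intro mult_left_mono) auto
        then have le: "k * (sv E - sv UR) \<le> real N * (sv (UR + \<delta> / real N) - sv UR)"
          by (simp add: Nt flip: mult.assoc)
        have "k * ((E - UR) / T - c * \<bar>E - UR\<bar>) \<le> k * (sv E - sv UR)"
          using E(3) k by (intro mult_left_mono) auto
        moreover have "k * ((E - UR) / T - c * \<bar>E - UR\<bar>) = \<delta> / T - c * \<bar>\<delta>\<bar>"
          using k(2) kabs by (metis (no_types, opaque_lifting) mult.left_commute right_diff_distrib times_divide_eq_right)
        moreover have "c * \<bar>\<delta>\<bar> = \<epsilon> / 2" using False by (simp add: c_def)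
        ultimately show ?case using in_dom le by simp
      qed
    qed
    moreover have "eventually (\<lambda>N. 0 < N) sequentially" by (rule eventually_gt_at_top)
    ultimately show ?thesis
    proof eventually_elim
      case (elim N)
      \<comment> \<open>The second half of \<open>\<epsilon>\<close>, divided among the
        \<open>N\<close> copies, pays for the supremum \<open>sv\<close> possibly not being
        attained.\<close>
      have "sv (UR + \<delta> / real N) - \<epsilon> / (2 * real N) < sv (UR + \<delta> / real N)" using elim eps by simp
      then obtain s where s: "(UR + \<delta> / real N, s) \<in> ES" "sv (UR + \<delta> / real N) - \<epsilon> / (2 * real N) < s"
        using sv_approx[OF elim(1)[THEN conjunct1]] by blast
      have "real N * (sv (UR + \<delta> / real N) - \<epsilon> / (2 * real N) - sv UR) \<le> real N * (s - sv UR)"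
        using s by (intro mult_left_mono) auto
      moreover have "real N * (sv (UR + \<delta> / real N) - \<epsilon> / (2 * real N) - sv UR)
         = real N * (sv (UR + \<delta> / real N) - sv UR) - \<epsilon> / 2"
        using elim by (simp add: algebra_simps)
      ultimately show ?case using s(1) elim by (intro exI[of _ s]) auto
    qed
  qed
qed

text \<open>At temperature 0 the right slope is infinite, and a concave function has such a slope
  only at the left end of its domain. Beyond that, all chords from pairs of nearly minimal energy to
  one fixed pair have slope at least \<open>K\<close>. Concavity alone does not give this: entropies
  just above the minimum must not exceed \<open>sv emin\<close> by much, which is where
  \<open>usc_at_min\<close> enters.\<close>

lemma zero_temperature:
  assumes "T = 0"
  shows "UR = emin"
    and "0 < K \<Longrightarrow> \<exists>h>0. \<exists>\<eta>>0. \<exists>s3. (emin + h, s3) \<in> ES \<and>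
      (\<forall>(e, s)\<in>ES. e \<le> emin + \<eta> \<longrightarrow> K * (emin + h - e) \<le> s3 - s)"
proof -
  have dr: "dS_right cmb_lin P mu bd UR = (SUP x\<in>{UR<..<eone}. ereal ((sv x - sv UR) / (x - UR)))"
    using UR_bounds by (intro dS_right_eq UR_Edom eone_Edom)
  have mid: "(UR + eone) / 2 \<in> {UR<..<eone}" using UR_bounds by simp
  have infty: "dS_right cmb_lin P mu bd UR = \<infinity>"
  proof -
    have "ereal ((sv ((UR + eone) / 2) - sv UR) / ((UR + eone) / 2 - UR)) \<le> dS_right cmb_lin P mu bd UR"
      unfolding dr using mid by (rule SUP_upper)
    then show ?thesis using T_eq_single(2) assms
      by (cases "dS_right cmb_lin P mu bd UR") (auto split: if_splits simp: zero_ereal_def)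
  qed
  show eq: "UR = emin"
  proof (rule ccontr)
    assume "UR \<noteq> emin"
    then have m: "emin < UR" using UR_bounds by simp
    have "dS_right cmb_lin P mu bd UR \<le> ereal ((sv UR - sv emin) / (UR - emin))"
      unfolding dr
    proof (rule SUP_least)
      fix x assume "x \<in> {UR<..<eone}"
      then have "x \<in> Edom" "UR < x" using Edom_between(1)[OF UR_Edom eone_Edom] by auto
      then show "ereal ((sv x - sv UR) / (x - UR)) \<le> ereal ((sv UR - sv emin) / (UR - emin))"
        using slope_middle[OF emin_Edom _ m] by simp
    qed
    then show False using infty by simp
  qed
  show "\<exists>h>0. \<exists>\<eta>>0. \<exists>s3. (emin + h, s3) \<in> ES \<and>
      (\<forall>(e, s)\<in>ES. e \<le> emin + \<eta> \<longrightarrow> K * (emin + h - e) \<le> s3 - s)" if K: "0 < K" for K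
  proof -
    \<comment> \<open>Slope \<open>2 * K\<close>, to be spent in two halves: one for the desired
      slope \<open>K\<close>, the other for the excess \<open>K * h\<close> that semicontinuity
      leaves to entropies at energies up to \<open>emin + \<eta>\<close>.\<close>
    have "ereal (2 * K) < (SUP x\<in>{UR<..<eone}. ereal ((sv x - sv UR) / (x - UR)))"
      using infty unfolding dr by simp
    then obtain x where x: "emin < x" "x < eone" "2 * K < (sv x - sv emin) / (x - emin)"
      unfolding eq by (auto simp: less_SUP_iff)
    define h where "h = x - emin"
    have h: "0 < h" "x = emin + h" using x by (auto simp: h_def)
    have "2 * K * h < sv x - sv emin" using x(3) h(1) unfolding h_def[symmetric] by (simp only: pos_less_divide_eq)
    then have "sv emin + 2 * K * h < sv x" by simp
    then obtain s3 where s3: "(x, s3) \<in> ES" "sv emin + 2 * K * h < s3"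
      using sv_approx[OF Edom_between(1)[OF emin_Edom eone_Edom x(1,2)]] by blast
    obtain w where w: "w \<in> MP" "int_energy mu bd w = min_energy cmb_lin P mu bd"
      "\<forall>\<epsilon>>0. \<exists>\<eta>>0. \<forall>u\<in>MP. int_energy mu bd u \<le> min_energy cmb_lin P mu bd + ennreal \<eta>
        \<longrightarrow> H_int mu w \<le> H_int mu u + \<epsilon>"
      by (rule bexE[OF usc_at_min], elim conjE, rule that)
    have sw: "- H_int mu w / mass \<le> sv emin"
      using w(2) emin by (intro sv_upper ES_I[OF w(1)]) auto
    have "0 < K * h * mass" using K h mass_pos by simp
    from w(3)[rule_format, OF this] obtain \<eta> where eta: "0 < \<eta>" "\<And>u. u \<in> MP \<Longrightarrow>
        int_energy mu bd u \<le> min_energy cmb_lin P mu bd + ennreal \<eta> \<Longrightarrow> H_int mu w \<le> H_int mu u + K * h * mass" by blast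
    have "K * (emin + h - e) \<le> s3 - s" if es: "(e, s) \<in> ES" "e \<le> emin + \<eta>" for e s
    proof -
      obtain u where u: "u \<in> MP" "int_energy mu bd u = ennreal e" "s = - H_int mu u / mass"
        using es by (auto simp: ES_def)
      have "int_energy mu bd u \<le> min_energy cmb_lin P mu bd + ennreal \<eta>"
        using es(2) u(2) emin eta(1) by (simp add: ennreal_leI flip: ennreal_plus)
      then have "H_int mu w \<le> H_int mu u + K * h * mass" by (rule eta(2)[OF u(1)])
      then have "s \<le> - H_int mu w / mass + K * h" using mass_pos unfolding u(3) by (simp add: field_simps)
      then have "s \<le> sv emin + K * h" using sw by simp
      moreover have "K * (emin + h - e) \<le> K * h" using ES_emin_le[OF es(1)] K by (intro mult_left_mono) auto
      ultimately show ?thesis using s3(2) by linarith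
    qed
    then show ?thesis using h eta(1) s3(1) by (intro exI[of _ h] exI[of _ \<eta>] exI[of _ s3] conjI) auto
  qed
qed

end

subsection \<open>Composite systems\<close>

lemma measurable_change_sets:
  assumes "f \<in> measurable N K" "sets M = sets N"
  shows "f \<in> measurable M K"
  using assms(1) by (subst measurable_cong_sets[OF assms(2) refl])

lemma
  assumes I: "finite I" and S: "\<And>i. i \<in> I \<Longrightarrow> sets (M i) = sets S"
  shows emeasure_meas_sum: "A \<in> sets S \<Longrightarrow> emeasure (meas_sum S I M) A = (\<Sum>i\<in>I. emeasure (M i) A)"
    and sets_meas_sum: "sets (meas_sum S I M) = sets S"
    and space_meas_sum: "space (meas_sum S I M) = space S"
proof -
  show sets: "sets (meas_sum S I M) = sets S" and "space (meas_sum S I M) = space S"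
    unfolding meas_sum_def by (auto simp: sets.sets_measure_of_eq sets.space_measure_of_eq)
  show "emeasure (meas_sum S I M) A = (\<Sum>i\<in>I. emeasure (M i) A)" if A: "A \<in> sets S" for A
  proof (rule emeasure_measure_of[OF meas_sum_def])
    show "sets S \<subseteq> Pow (space S)" by (rule sets.space_closed)
    show "A \<in> sets (meas_sum S I M)" using A sets by simp
    show "positive (sets (meas_sum S I M)) (\<lambda>A. \<Sum>i\<in>I. emeasure (M i) A)" by (simp add: positive_def)
    show "countably_additive (sets (meas_sum S I M)) (\<lambda>A. \<Sum>i\<in>I. emeasure (M i) A)"
      unfolding sets countably_additive_def
    proof (intro allI impI)
      fix B :: "nat \<Rightarrow> _ set" assume B: "range B \<subseteq> sets S" "disjoint_family B"
      have "(\<Sum>n. \<Sum>i\<in>I. emeasure (M i) (B n)) = (\<Sum>i\<in>I. \<Sum>n. emeasure (M i) (B n))"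
        by (rule suminf_sum) (rule summableI)
      also have "\<dots> = (\<Sum>i\<in>I. emeasure (M i) (\<Union>(range B)))"
        by (intro sum.cong refl suminf_emeasure) (use B S in auto)
      finally show "(\<Sum>n. \<Sum>i\<in>I. emeasure (M i) (B n)) = (\<Sum>i\<in>I. emeasure (M i) (\<Union>(range B)))" .
    qed
  qed
qed

lemma nn_integral_meas_sum:
  assumes I: "finite I" and S: "\<And>i. i \<in> I \<Longrightarrow> sets (M i) = sets S" and f: "f \<in> borel_measurable S"
  shows "(\<integral>\<^sup>+x. f x \<partial>meas_sum S I M) = (\<Sum>i\<in>I. \<integral>\<^sup>+x. f x \<partial>M i)"
proof -
  let ?M = "meas_sum S I M"
  have sets: "sets ?M = sets S" by (rule sets_meas_sum[OF I S])
  note sp = sets_eq_imp_space_eq[OF sets] sets_eq_imp_space_eq[OF S]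
  have mb: "g \<in> borel_measurable ?M \<longleftrightarrow> g \<in> borel_measurable S" "i \<in> I \<Longrightarrow> g \<in> borel_measurable (M i) \<longleftrightarrow> g \<in> borel_measurable S"
    for g :: "_ \<Rightarrow> ennreal" and i
    using measurable_cong_sets[OF sets refl] measurable_cong_sets[OF S refl] by blast+
  show ?thesis
    using f
  proof (induction rule: borel_measurable_induct)
    case (cong f g)
    have "(\<integral>\<^sup>+x. f x \<partial>?M) = (\<integral>\<^sup>+x. g x \<partial>?M)" using cong(3) sp by (intro nn_integral_cong) auto
    moreover have "(\<integral>\<^sup>+x. f x \<partial>M i) = (\<integral>\<^sup>+x. g x \<partial>M i)" if "i \<in> I" for i
      using cong(3) sp(2)[OF that] by (intro nn_integral_cong) auto
    ultimately show ?case using cong(4) by simp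
  next
    case (set A)
    then show ?case using S sets by (simp add: emeasure_meas_sum[OF I S])
  next
    case (mult u c)
    then show ?case using mb by (simp add: nn_integral_cmult sum_distrib_left)
  next
    case (add u v)
    then show ?case using mb by (simp add: nn_integral_add sum.distrib)
  next
    case (seq U)
    have "(\<integral>\<^sup>+x. (SUP n. U n x) \<partial>?M) = (SUP n. \<integral>\<^sup>+x. U n x \<partial>?M)"
      using seq mb by (intro nn_integral_monotone_convergence_SUP) auto
    also have "\<dots> = (SUP n. \<Sum>i\<in>I. \<integral>\<^sup>+x. U n x \<partial>M i)" using seq by simp
    also have "\<dots> = (\<Sum>i\<in>I. SUP n. \<integral>\<^sup>+x. U n x \<partial>M i)"
      using seq(3) by (intro ennreal_SUP_sum) (auto simp: incseq_def le_fun_def intro!: nn_integral_mono)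
    also have "\<dots> = (\<Sum>i\<in>I. \<integral>\<^sup>+x. (SUP n. U n x) \<partial>M i)"
      using seq mb by (intro sum.cong refl nn_integral_monotone_convergence_SUP[symmetric]) auto
    finally show ?case by (simp add: image_comp)
  qed
qed

text \<open>If the images of the density \<open>w\<close> under the maps \<open>\<tau> i\<close> add
  up to \<open>\<kappa>\<close> times the density \<open>q\<close>, then integrating the logarithms
  of \<open>q\<close> against \<open>w\<close> reproduces \<open>H_int\<close>. The assumption
  \<open>tr\<close> speaks of nonnegative functions, so it is applied to the two parts of the
  logarithm, both finite because \<open>H_fin\<close> bounds its absolute value. The maps are the
  projection to \<open>P\<close>, or all coordinates in \<open>PR\<close> at once.\<close>

lemma integral_ln_transfer:
  fixes w :: "'p \<Rightarrow> ennreal" and q :: "'y \<Rightarrow> ennreal"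
  assumes I: "finite I" and \<tau>: "\<And>i. i \<in> I \<Longrightarrow> \<tau> i \<in> measurable Z \<nu>"
    and w [measurable]: "w \<in> borel_measurable Z" and q [measurable]: "q \<in> borel_measurable \<nu>"
    and wfin: "AE p in Z. w p < \<infinity>" and qfin: "AE y in \<nu>. q y < \<infinity>"
    and tr: "\<And>\<phi>. \<phi> \<in> borel_measurable \<nu> \<Longrightarrow> (\<Sum>i\<in>I. \<integral>\<^sup>+p. w p * \<phi> (\<tau> i p) \<partial>Z) = ennreal \<kappa> * (\<integral>\<^sup>+y. q y * \<phi> y \<partial>\<nu>)"
    and \<kappa>: "0 \<le> \<kappa>" and H: "H_fin \<nu> q"
  shows "integrable Z (\<lambda>p. enn2real (w p) * (\<Sum>i\<in>I. ln (enn2real (q (\<tau> i p)))))"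
    and "(\<integral>p. enn2real (w p) * (\<Sum>i\<in>I. ln (enn2real (q (\<tau> i p)))) \<partial>Z) = \<kappa> * H_int \<nu> q"
proof -
  define l where "l y = ln (enn2real (q y))" for y
  have l [measurable]: "l \<in> borel_measurable \<nu>" unfolding l_def[abs_def] by measurable
  have iH: "integrable \<nu> (\<lambda>y. enn2real (q y) * l y)" using H by (simp add: H_fin_def l_def)
  have wl: "(\<integral>\<^sup>+p. ennreal (enn2real (w p) * g (\<tau> i p)) \<partial>Z) = (\<integral>\<^sup>+p. w p * ennreal (g (\<tau> i p)) \<partial>Z)" for i and g :: "'y \<Rightarrow> real"
    using wfin by (intro nn_integral_cong_AE, eventually_elim) (simp add: ennreal_mult')
  have ql: "(\<integral>\<^sup>+y. q y * ennreal (g y) \<partial>\<nu>) = (\<integral>\<^sup>+y. ennreal (enn2real (q y) * g y) \<partial>\<nu>)" for g :: "'y \<Rightarrow> real"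
    using qfin by (intro nn_integral_cong_AE, eventually_elim) (simp add: ennreal_mult')
  have tr': "(\<Sum>i\<in>I. \<integral>\<^sup>+p. ennreal (enn2real (w p) * g (\<tau> i p)) \<partial>Z) = ennreal \<kappa> * (\<integral>\<^sup>+y. ennreal (enn2real (q y) * g y) \<partial>\<nu>)"
    if [measurable]: "g \<in> borel_measurable \<nu>" for g :: "'y \<Rightarrow> real"
    unfolding wl ql[symmetric] by (rule tr) measurable
  have fin: "(\<integral>\<^sup>+y. ennreal (enn2real (q y) * \<bar>l y\<bar>) \<partial>\<nu>) < \<infinity>"
    using integrable_abs[OF iH] unfolding integrable_iff_bounded by (simp add: abs_mult)
  have \<tau>l: "(\<lambda>p. l (\<tau> i p)) \<in> borel_measurable Z" if "i \<in> I" for i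
    using \<tau>[OF that] by measurable
  have int_i: "integrable Z (\<lambda>p. enn2real (w p) * l (\<tau> i p))" if i: "i \<in> I" for i
  proof (rule integrableI_bounded)
    note [measurable] = \<tau>l[OF i]
    show "(\<lambda>p. enn2real (w p) * l (\<tau> i p)) \<in> borel_measurable Z" by measurable
    have "(\<integral>\<^sup>+p. ennreal (norm (enn2real (w p) * l (\<tau> i p))) \<partial>Z) = (\<integral>\<^sup>+p. ennreal (enn2real (w p) * \<bar>l (\<tau> i p)\<bar>) \<partial>Z)"
      by (simp add: abs_mult)
    also have "\<dots> \<le> (\<Sum>i\<in>I. \<integral>\<^sup>+p. ennreal (enn2real (w p) * \<bar>l (\<tau> i p)\<bar>) \<partial>Z)"
      using I i by (intro member_le_sum[of i I "\<lambda>i. \<integral>\<^sup>+p. ennreal (enn2real (w p) * \<bar>l (\<tau> i p)\<bar>) \<partial>Z"]) auto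
    also have "\<dots> = ennreal \<kappa> * (\<integral>\<^sup>+y. ennreal (enn2real (q y) * \<bar>l y\<bar>) \<partial>\<nu>)"
      by (rule tr'[of "\<lambda>y. \<bar>l y\<bar>"]) measurable
    also have "\<dots> < \<infinity>" using fin by (simp add: ennreal_mult_less_top)
    finally show "(\<integral>\<^sup>+p. ennreal (norm (enn2real (w p) * l (\<tau> i p))) \<partial>Z) < \<infinity>" .
  qed
  have eq: "enn2real (w p) * (\<Sum>i\<in>I. ln (enn2real (q (\<tau> i p)))) = (\<Sum>i\<in>I. enn2real (w p) * l (\<tau> i p))" for p
    by (simp add: l_def sum_distrib_left)
  show "integrable Z (\<lambda>p. enn2real (w p) * (\<Sum>i\<in>I. ln (enn2real (q (\<tau> i p)))))"
    unfolding eq by (intro Bochner_Integration.integrable_sum int_i)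
  have part: "(\<Sum>i\<in>I. enn2real (\<integral>\<^sup>+p. ennreal (enn2real (w p) * g (\<tau> i p)) \<partial>Z))
      = \<kappa> * enn2real (\<integral>\<^sup>+y. ennreal (enn2real (q y) * g y) \<partial>\<nu>)"
    if [measurable]: "g \<in> borel_measurable \<nu>" and le: "\<And>y. \<bar>g y\<bar> \<le> \<bar>l y\<bar>" for g :: "'y \<Rightarrow> real"
  proof -
    have "(\<integral>\<^sup>+p. ennreal (enn2real (w p) * g (\<tau> i p)) \<partial>Z) < top" if i: "i \<in> I" for i
    proof -
      have "(\<integral>\<^sup>+p. ennreal (enn2real (w p) * g (\<tau> i p)) \<partial>Z) \<le> (\<integral>\<^sup>+p. ennreal (norm (enn2real (w p) * l (\<tau> i p))) \<partial>Z)"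
      proof (intro nn_integral_mono ennreal_leI)
        fix p
        have "enn2real (w p) * g (\<tau> i p) \<le> enn2real (w p) * \<bar>l (\<tau> i p)\<bar>"
          using le[of "\<tau> i p"] by (intro mult_left_mono) auto
        then show "enn2real (w p) * g (\<tau> i p) \<le> norm (enn2real (w p) * l (\<tau> i p))" by (simp add: abs_mult)
      qed
      also have "\<dots> < top" using int_i[OF i] unfolding integrable_iff_bounded by simp
      finally show ?thesis .
    qed
    then have "(\<Sum>i\<in>I. enn2real (\<integral>\<^sup>+p. ennreal (enn2real (w p) * g (\<tau> i p)) \<partial>Z))
        = enn2real (\<Sum>i\<in>I. \<integral>\<^sup>+p. ennreal (enn2real (w p) * g (\<tau> i p)) \<partial>Z)"
      by (subst enn2real_sum) (auto simp: o_def)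
    also have "\<dots> = \<kappa> * enn2real (\<integral>\<^sup>+y. ennreal (enn2real (q y) * g y) \<partial>\<nu>)"
      using \<kappa> by (subst tr') (auto simp: enn2real_mult)
    finally show ?thesis .
  qed
  have "(\<integral>p. enn2real (w p) * (\<Sum>i\<in>I. ln (enn2real (q (\<tau> i p)))) \<partial>Z) = (\<Sum>i\<in>I. \<integral>p. enn2real (w p) * l (\<tau> i p) \<partial>Z)"
    unfolding eq by (rule Bochner_Integration.integral_sum) (rule int_i)
  also have "\<dots> = (\<Sum>i\<in>I. enn2real (\<integral>\<^sup>+p. ennreal (enn2real (w p) * l (\<tau> i p)) \<partial>Z)
      - enn2real (\<integral>\<^sup>+p. ennreal (enn2real (w p) * (- l (\<tau> i p))) \<partial>Z))"
    using int_i by (intro sum.cong refl) (simp add: real_lebesgue_integral_def)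
  also have "\<dots> = \<kappa> * enn2real (\<integral>\<^sup>+y. ennreal (enn2real (q y) * l y) \<partial>\<nu>)
      - \<kappa> * enn2real (\<integral>\<^sup>+y. ennreal (enn2real (q y) * (- l y)) \<partial>\<nu>)"
    unfolding sum_subtractf by (intro arg_cong2[where f="(-)"] part) auto
  also have "\<dots> = \<kappa> * H_int \<nu> q"
    using real_lebesgue_integral_def[OF iH] unfolding H_int_def l_def[symmetric] by (simp add: right_diff_distrib)
  finally show "(\<integral>p. enn2real (w p) * (\<Sum>i\<in>I. ln (enn2real (q (\<tau> i p)))) \<partial>Z) = \<kappa> * H_int \<nu> q" .
qed

lemma cmb_lin_same [simp]: "cmb_lin t x x = x"
  by (simp add: cmb_lin_def flip: scaleR_add_left)

lemma cmb_prod_closed: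
  assumes "convex P" "convex PR" "p \<in> comp_set P PR N" "p' \<in> comp_set P PR N" "t \<in> {0..1}"
  shows "cmb_prod t p p' \<in> comp_set P PR N"
proof -
  have f: "fst p \<in> P" "fst p' \<in> P" and g: "snd p \<in> PiE {..<N} (\<lambda>_. PR)" "snd p' \<in> PiE {..<N} (\<lambda>_. PR)"
    using assms(3,4) unfolding comp_set_def iter_set_def mem_Times_iff by blast+
  show ?thesis
    unfolding comp_set_def iter_set_def mem_Times_iff cmb_prod_def fst_conv snd_conv
  proof (intro conjI PiE_I)
    show "cmb_lin t (fst p) (fst p') \<in> P" by (rule cmb_lin_closed[OF assms(1) f assms(5)])
    fix i
    show "cmb_lin t (snd p i) (snd p' i) \<in> PR" if "i \<in> {..<N}"
      by (rule cmb_lin_closed[OF assms(2) PiE_mem[OF g(1) that] PiE_mem[OF g(2) that] assms(5)])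
    \<comment> \<open>Outside \<open>{..<N}\<close> both points have the value
      \<open>undefined\<close>, and combining a vector with itself returns it.\<close>
    show "cmb_lin t (snd p i) (snd p' i) = undefined" if "i \<notin> {..<N}"
      unfolding PiE_arb[OF g(1) that] PiE_arb[OF g(2) that] by (rule cmb_lin_same)
  qed
qed

section \<open>Marginals of states of a composite system\<close>

locale product_system = P: system P mu bd + R: system PR muR bdR
  for P :: "'a::euclidean_space set" and mu bd and PR :: "'b::euclidean_space set" and muR bdR
begin

lemma finite_bd: "finite_measure bd" and finite_bdR: "finite_measure bdR"
  using P.bd_finite R.bd_finite by (auto intro!: finite_measureI)

lemma sigma_finite_of_finite: "finite_measure M \<Longrightarrow> sigma_finite_measure M"
  by (simp add: finite_measure.axioms(1))

text \<open>For \<open>\<nu> = bdR\<close> this is the \<open>i\<close>-th summand of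
  \<open>iter_sigma\<close>, for \<open>\<nu> = muR\<close> it is \<open>iter_mu\<close>. Keeping
  \<open>\<nu>\<close> free lets one computation serve both energy and mass.\<close>

abbreviation coord_measure :: "nat \<Rightarrow> nat \<Rightarrow> 'b measure \<Rightarrow> (nat \<Rightarrow> 'b) measure" where
  "coord_measure N i \<nu> \<equiv> PiM {..<N} (\<lambda>j. if j = i then \<nu> else muR)"

lemma product_sigma_finite_coord: "finite_measure \<nu> \<Longrightarrow> product_sigma_finite (\<lambda>j. if j = i then \<nu> else muR)"
  using sigma_finite_of_finite R.finite_measure_axioms by (auto simp: product_sigma_finite_def)

lemma product_sigma_finite_muR: "product_sigma_finite (\<lambda>_::nat. muR)"
  using sigma_finite_of_finite R.finite_measure_axioms by (auto simp: product_sigma_finite_def)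

lemma sets_coord: "sets \<nu> = sets borel \<Longrightarrow> sets (coord_measure N i \<nu>) = sets (PiM {..<N} (\<lambda>_. borel))"
  by (intro sets_PiM_cong) auto

lemma sets_iter [measurable_cong]: "sets (iter_mu muR N) = sets (PiM {..<N} (\<lambda>_. borel))"
  unfolding iter_mu_def by (intro sets_PiM_cong) auto

lemma sets_comp [measurable_cong]: "sets (comp_mu mu muR N) = sets (borel \<Otimes>\<^sub>M PiM {..<N} (\<lambda>_. borel))"
  unfolding comp_mu_def by (intro sets_pair_measure_cong sets_iter P.sets_mu)

lemma space_iter: "space (iter_mu muR N) = PiE {..<N} (\<lambda>_. UNIV)"
  by (simp add: iter_mu_def space_PiM)

lemma nn_integral_iter_prod:
  assumes "\<And>j. j < N \<Longrightarrow> f j \<in> borel_measurable borel"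
  shows "(\<integral>\<^sup>+z. (\<Prod>j<N. f j (z j)) \<partial>iter_mu muR N) = (\<Prod>j<N. \<integral>\<^sup>+y. f j y \<partial>muR)"
  unfolding iter_mu_def using assms
  by (intro product_sigma_finite.product_nn_integral_prod[OF product_sigma_finite_muR]) (auto simp: measurable_cong_sets[OF R.sets_mu refl])

lemma mass_iter: "total_mass (iter_mu muR N) = ennreal (R.mass ^ N)"
proof -
  have "total_mass (iter_mu muR N) = (\<integral>\<^sup>+z. (\<Prod>j<N. 1) \<partial>iter_mu muR N)" by (simp add: total_mass_def)
  also have "\<dots> = (\<Prod>j<N. total_mass muR)" by (subst nn_integral_iter_prod) (auto simp: total_mass_def)
  also have "\<dots> = ennreal (R.mass ^ N)" using R.mass_pos by (simp add: R.total_mass_eq ennreal_power)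
  finally show ?thesis .
qed

lemma finite_iter: "finite_measure (iter_mu muR N)"
  by (intro finite_measureI) (use mass_iter in \<open>simp add: total_mass_def\<close>)

definition zmass :: "nat \<Rightarrow> real" where "zmass N = P.mass * R.mass ^ N"

lemma zmass_pos: "0 < zmass N"
  using P.mass_pos R.mass_pos by (simp add: zmass_def)

lemma mass_comp: "total_mass (comp_mu mu muR N) = ennreal (zmass N)"
proof -
  interpret B: sigma_finite_measure "iter_mu muR N" by (rule sigma_finite_of_finite[OF finite_iter])
  have "total_mass (comp_mu mu muR N) = total_mass mu * total_mass (iter_mu muR N)"
    unfolding total_mass_def comp_mu_def space_pair_measure by (rule B.emeasure_pair_measure_Times) auto
  then show ?thesis
    using P.mass_pos R.mass_pos by (simp add: P.total_mass_eq mass_iter zmass_def ennreal_mult)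
qed

lemma finite_comp: "finite_measure (comp_mu mu muR N)"
  by (intro finite_measureI) (use mass_comp in \<open>simp add: total_mass_def\<close>)

lemma measurable_upd:
  assumes "i < N"
  shows "(\<lambda>(p, y). (fst p, (snd p)(i := y))) \<in>
    measurable ((borel \<Otimes>\<^sub>M PiM {..<N} (\<lambda>_. borel)) \<Otimes>\<^sub>M borel) (borel \<Otimes>\<^sub>M PiM {..<N} (\<lambda>_. borel))"
proof -
  have "(\<lambda>p. (snd (fst p))(i := snd p)) \<in>
    measurable ((borel \<Otimes>\<^sub>M PiM {..<N} (\<lambda>_. borel)) \<Otimes>\<^sub>M borel) (PiM {..<N} (\<lambda>_. borel))"
    using assms by (intro measurable_fun_upd[of _ "{..<N}"]) auto
  moreover have "(\<lambda>p. fst (fst p)) \<in> measurable ((borel \<Otimes>\<^sub>M PiM {..<N} (\<lambda>_. borel)) \<Otimes>\<^sub>M borel) borel"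
    by measurable
  ultimately show ?thesis unfolding case_prod_beta' by (intro measurable_Pair)
qed

text \<open>Overwriting coordinate \<open>i\<close> makes the integrand independent of the old
  coordinate, which integrates to the factor \<open>R.mass\<close>, while the new value runs through
  \<open>\<nu>\<close>.\<close>

lemma nn_integral_coordinate:
  assumes i: "i < N" and \<nu>: "finite_measure \<nu>" "sets \<nu> = sets borel"
    and h: "h \<in> borel_measurable (PiM {..<N} (\<lambda>_. borel))"
  shows "(\<integral>\<^sup>+z. \<integral>\<^sup>+y. h (z(i := y)) \<partial>\<nu> \<partial>iter_mu muR N) = ennreal R.mass * (\<integral>\<^sup>+z. h z \<partial>coord_measure N i \<nu>)"
proof -
  define J where "J = {..<N} - {i}"
  have J: "finite J" "i \<notin> J" "insert i J = {..<N}" using i by (auto simp: J_def)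
  interpret A: product_sigma_finite "\<lambda>_::nat. muR" by (rule product_sigma_finite_muR)
  interpret C: product_sigma_finite "\<lambda>j. if j = i then \<nu> else muR" by (rule product_sigma_finite_coord[OF \<nu>(1)])
  interpret V: sigma_finite_measure \<nu> by (rule sigma_finite_of_finite[OF \<nu>(1)])
  have [measurable_cong]: "sets \<nu> = sets borel" by fact
  have sJ [measurable_cong]: "sets (PiM J (\<lambda>_. muR)) = sets (PiM J (\<lambda>_. borel))" by (intro sets_PiM_cong) auto
  have h1: "h \<in> borel_measurable (PiM (insert i J) (\<lambda>j. if j = i then \<nu> else muR))"
    unfolding J by (rule measurable_change_sets[OF h sets_coord[OF \<nu>(2)]])
  have h2 [measurable]: "h \<in> borel_measurable (PiM (insert i J) (\<lambda>_. borel))" using h unfolding J .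
  define g where "g z = (\<integral>\<^sup>+y. h (z(i := y)) \<partial>\<nu>)" for z
  have upd: "(\<lambda>(z, y). h (z(i := y))) \<in> borel_measurable (PiM I (\<lambda>_. borel) \<Otimes>\<^sub>M borel)"
    if I: "insert i I = insert i J" for I
  proof -
    have "(\<lambda>p. (fst p)(i := snd p)) \<in> measurable (PiM I (\<lambda>_. borel) \<Otimes>\<^sub>M borel) (PiM (insert i J) (\<lambda>_. borel))"
      using I by (intro measurable_fun_upd[of _ I]) auto
    from measurable_compose[OF this h2] show ?thesis by (simp add: case_prod_beta')
  qed
  have g_meas: "g \<in> borel_measurable (PiM I (\<lambda>_. borel))" if "insert i I = insert i J" for I
  proof -
    have "(\<lambda>(z, y). h (z(i := y))) \<in> borel_measurable (PiM I (\<lambda>_. borel) \<Otimes>\<^sub>M \<nu>)"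
      by (rule measurable_change_sets[OF upd[OF that] sets_pair_measure_cong[OF refl \<nu>(2)]])
    then show ?thesis unfolding g_def[abs_def] by (rule V.borel_measurable_nn_integral)
  qed
  have "(\<integral>\<^sup>+z. g z \<partial>iter_mu muR N) = (\<integral>\<^sup>+z. g z \<partial>PiM (insert i J) (\<lambda>_. muR))"
    by (simp add: iter_mu_def J)
  also have "\<dots> = (\<integral>\<^sup>+z. (\<integral>\<^sup>+y'. g (z(i := y')) \<partial>muR) \<partial>PiM J (\<lambda>_. muR))"
  proof (rule A.product_nn_integral_insert[OF J(1,2)])
    have "sets (PiM (insert i J) (\<lambda>_. muR)) = sets (PiM (insert i J) (\<lambda>_. borel))" by (intro sets_PiM_cong) auto
    then show "g \<in> borel_measurable (PiM (insert i J) (\<lambda>_. muR))"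
      by (rule measurable_change_sets[OF g_meas, rotated]) simp
  qed
  also have "\<dots> = (\<integral>\<^sup>+z. g z * ennreal R.mass \<partial>PiM J (\<lambda>_. muR))"
    using R.total_mass_eq by (simp add: g_def total_mass_def)
  also have "\<dots> = ennreal R.mass * (\<integral>\<^sup>+z. g z \<partial>PiM J (\<lambda>_. muR))"
    by (subst nn_integral_multc[OF measurable_change_sets[OF g_meas[OF refl] sJ]]) (rule mult.commute)
  also have "PiM J (\<lambda>_. muR) = PiM J (\<lambda>j. if j = i then \<nu> else muR)"
    using J(2) by (intro PiM_cong) auto
  also have "(\<integral>\<^sup>+z. g z \<partial>PiM J (\<lambda>j. if j = i then \<nu> else muR)) = (\<integral>\<^sup>+z. h z \<partial>PiM (insert i J) (\<lambda>j. if j = i then \<nu> else muR))"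
    using C.product_nn_integral_insert[OF J(1,2) h1] by (simp add: g_def)
  finally show ?thesis by (simp add: g_def J)
qed

lemma nn_integral_coordinate_pair:
  assumes i: "i < N" and \<nu>: "finite_measure \<nu>" "sets \<nu> = sets borel"
    and h: "h \<in> borel_measurable (borel \<Otimes>\<^sub>M PiM {..<N} (\<lambda>_. borel))"
  shows "(\<integral>\<^sup>+p. \<integral>\<^sup>+y. h (fst p, (snd p)(i := y)) \<partial>\<nu> \<partial>comp_mu mu muR N)
    = ennreal R.mass * (\<integral>\<^sup>+p. h p \<partial>(mu \<Otimes>\<^sub>M coord_measure N i \<nu>))"
proof -
  interpret B: sigma_finite_measure "iter_mu muR N" by (rule sigma_finite_of_finite[OF finite_iter])
  interpret V: sigma_finite_measure \<nu> by (rule sigma_finite_of_finite[OF \<nu>(1)])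
  interpret C0: product_sigma_finite "\<lambda>j. if j = i then \<nu> else muR" by (rule product_sigma_finite_coord[OF \<nu>(1)])
  interpret C: sigma_finite_measure "coord_measure N i \<nu>" by (rule C0.sigma_finite) simp
  have [measurable_cong]: "sets \<nu> = sets borel" by fact
  note [measurable_cong] = sets_coord[OF \<nu>(2)]
  note [measurable] = h
  have upd: "(\<lambda>(p, y). h (fst p, (snd p)(i := y))) \<in> borel_measurable ((borel \<Otimes>\<^sub>M PiM {..<N} (\<lambda>_. borel)) \<Otimes>\<^sub>M \<nu>)"
  proof -
    have "(\<lambda>(p, y). h (fst p, (snd p)(i := y))) \<in> borel_measurable ((borel \<Otimes>\<^sub>M PiM {..<N} (\<lambda>_. borel)) \<Otimes>\<^sub>M borel)"
      using measurable_compose[OF measurable_upd[OF i] h] by (simp add: case_prod_beta')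
    then show ?thesis by (rule measurable_change_sets[OF _ sets_pair_measure_cong[OF refl \<nu>(2)]])
  qed
  have "(\<lambda>p. \<integral>\<^sup>+y. h (fst p, (snd p)(i := y)) \<partial>\<nu>) \<in> borel_measurable (borel \<Otimes>\<^sub>M PiM {..<N} (\<lambda>_. borel))"
    by (rule V.borel_measurable_nn_integral[OF upd])
  then have g: "(\<lambda>p. \<integral>\<^sup>+y. h (fst p, (snd p)(i := y)) \<partial>\<nu>) \<in> borel_measurable (mu \<Otimes>\<^sub>M iter_mu muR N)"
    by (rule measurable_change_sets[OF _ sets_comp[unfolded comp_mu_def]])
  have "(\<integral>\<^sup>+p. \<integral>\<^sup>+y. h (fst p, (snd p)(i := y)) \<partial>\<nu> \<partial>comp_mu mu muR N)
     = (\<integral>\<^sup>+x. \<integral>\<^sup>+z. \<integral>\<^sup>+y. h (x, z(i := y)) \<partial>\<nu> \<partial>iter_mu muR N \<partial>mu)"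
    unfolding comp_mu_def using B.nn_integral_fst[OF g] by simp
  also have "\<dots> = (\<integral>\<^sup>+x. ennreal R.mass * (\<integral>\<^sup>+z. h (x, z) \<partial>coord_measure N i \<nu>) \<partial>mu)"
    by (intro nn_integral_cong nn_integral_coordinate[OF i \<nu>]) measurable
  also have "\<dots> = ennreal R.mass * (\<integral>\<^sup>+x. (\<integral>\<^sup>+z. h (x, z) \<partial>coord_measure N i \<nu>) \<partial>mu)"
    by (rule nn_integral_cmult) measurable
  also have "(\<integral>\<^sup>+x. (\<integral>\<^sup>+z. h (x, z) \<partial>coord_measure N i \<nu>) \<partial>mu) = (\<integral>\<^sup>+p. h p \<partial>(mu \<Otimes>\<^sub>M coord_measure N i \<nu>))"
    by (rule C.nn_integral_fst) measurable
  finally show ?thesis .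
qed

definition margi :: "nat \<Rightarrow> nat \<Rightarrow> ('a \<times> (nat \<Rightarrow> 'b) \<Rightarrow> ennreal) \<Rightarrow> 'b \<Rightarrow> ennreal" where
  "margi N i w y = ennreal (1 / zmass N) * (\<integral>\<^sup>+p. w (fst p, (snd p)(i := y)) \<partial>comp_mu mu muR N)"

lemma margi_measurable [measurable]:
  assumes "i < N" "w \<in> borel_measurable (borel \<Otimes>\<^sub>M PiM {..<N} (\<lambda>_. borel))"
  shows "margi N i w \<in> borel_measurable borel"
    and "(\<lambda>p. w (fst p, (snd p)(i := y))) \<in> borel_measurable (comp_mu mu muR N)"
proof -
  interpret Z: sigma_finite_measure "comp_mu mu muR N" by (rule sigma_finite_of_finite[OF finite_comp])
  have m: "(\<lambda>(p, y). w (fst p, (snd p)(i := y))) \<in> borel_measurable (comp_mu mu muR N \<Otimes>\<^sub>M borel)"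
    by (rule measurable_change_sets[OF _ sets_pair_measure_cong[OF sets_comp refl]])
      (use measurable_compose[OF measurable_upd[OF assms(1)] assms(2)] in \<open>simp add: case_prod_beta'\<close>)
  then have "(\<lambda>(y, p). w (fst p, (snd p)(i := y))) \<in> borel_measurable (borel \<Otimes>\<^sub>M comp_mu mu muR N)"
    using measurable_compose[OF measurable_pair_swap', OF m] by (simp add: case_prod_beta')
  from Z.borel_measurable_nn_integral[OF this] show "margi N i w \<in> borel_measurable borel"
    unfolding margi_def[abs_def] by measurable
  show "(\<lambda>p. w (fst p, (snd p)(i := y))) \<in> borel_measurable (comp_mu mu muR N)"
    using measurable_compose[OF measurable_Pair2'[of y borel] m] by (simp add: measurable_compose_Pair1)
qed

text \<open>One marginal density serves every measure \<open>\<nu>\<close> on the coordinate. With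
  \<open>muR\<close> this yields mass and entropy, with \<open>bdR\<close> the boundary
  energy.\<close>

lemma margi_transfer:
  assumes i: "i < N" and \<nu>: "finite_measure \<nu>" "sets \<nu> = sets borel"
    and w: "w \<in> borel_measurable (borel \<Otimes>\<^sub>M PiM {..<N} (\<lambda>_. borel))" and \<phi>: "\<phi> \<in> borel_measurable borel"
  shows "(\<integral>\<^sup>+p. w p * \<phi> (snd p i) \<partial>(mu \<Otimes>\<^sub>M coord_measure N i \<nu>)) = ennreal (zmass N / R.mass) * (\<integral>\<^sup>+y. margi N i w y * \<phi> y \<partial>\<nu>)"
proof -
  interpret Z: sigma_finite_measure "comp_mu mu muR N" by (rule sigma_finite_of_finite[OF finite_comp])
  interpret V: sigma_finite_measure \<nu> by (rule sigma_finite_of_finite[OF \<nu>(1)])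
  interpret ZV: pair_sigma_finite "comp_mu mu muR N" \<nu> ..
  have [measurable_cong]: "sets \<nu> = sets borel" by fact
  note [measurable] = w \<phi>
  have ci [measurable]: "(\<lambda>p. snd p i) \<in> borel_measurable (borel \<Otimes>\<^sub>M PiM {..<N} (\<lambda>_. borel))"
    using i by (intro measurable_compose[OF measurable_snd]) (auto intro: measurable_component_singleton)
  let ?K = "\<integral>\<^sup>+p. w p * \<phi> (snd p i) \<partial>(mu \<Otimes>\<^sub>M coord_measure N i \<nu>)"
  have m: "(\<lambda>(p, y). w (fst p, (snd p)(i := y)) * \<phi> y) \<in> borel_measurable (comp_mu mu muR N \<Otimes>\<^sub>M \<nu>)"
  proof -
    have "(\<lambda>q. w ((\<lambda>(p, y). (fst p, (snd p)(i := y))) q) * \<phi> (snd q)) \<in> borel_measurable ((borel \<Otimes>\<^sub>M PiM {..<N} (\<lambda>_. borel)) \<Otimes>\<^sub>M borel)"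
      by (intro borel_measurable_times_ennreal measurable_compose[OF measurable_upd[OF i] w] measurable_compose[OF measurable_snd \<phi>])
    then show ?thesis unfolding case_prod_beta' fst_conv snd_conv
      by (rule measurable_change_sets[OF _ sets_pair_measure_cong[OF sets_comp \<nu>(2)]])
  qed
  have "ennreal R.mass * ?K = (\<integral>\<^sup>+p. \<integral>\<^sup>+y. w (fst p, (snd p)(i := y)) * \<phi> y \<partial>\<nu> \<partial>comp_mu mu muR N)"
    using nn_integral_coordinate_pair[OF i \<nu>, of "\<lambda>p. w p * \<phi> (snd p i)"] by simp
  also have "\<dots> = (\<integral>\<^sup>+y. \<integral>\<^sup>+p. w (fst p, (snd p)(i := y)) * \<phi> y \<partial>comp_mu mu muR N \<partial>\<nu>)"
    by (rule ZV.Fubini'[symmetric, OF m])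
  also have "\<dots> = (\<integral>\<^sup>+y. ennreal (zmass N) * (margi N i w y * \<phi> y) \<partial>\<nu>)"
  proof (intro nn_integral_cong)
    fix y
    have "(\<integral>\<^sup>+p. w (fst p, (snd p)(i := y)) * \<phi> y \<partial>comp_mu mu muR N) = (\<integral>\<^sup>+p. w (fst p, (snd p)(i := y)) \<partial>comp_mu mu muR N) * \<phi> y"
      by (rule nn_integral_multc) (rule margi_measurable(2)[OF i w])
    also have "\<dots> = (ennreal (zmass N) * ennreal (1 / zmass N)) * ((\<integral>\<^sup>+p. w (fst p, (snd p)(i := y)) \<partial>comp_mu mu muR N) * \<phi> y)"
      using zmass_pos[of N] by (simp flip: ennreal_mult)
    also have "\<dots> = ennreal (zmass N) * (margi N i w y * \<phi> y)" by (simp only: margi_def mult_ac)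
    finally show "(\<integral>\<^sup>+p. w (fst p, (snd p)(i := y)) * \<phi> y \<partial>comp_mu mu muR N) = ennreal (zmass N) * (margi N i w y * \<phi> y)" .
  qed
  also have "\<dots> = ennreal (zmass N) * (\<integral>\<^sup>+y. margi N i w y * \<phi> y \<partial>\<nu>)"
  proof (rule nn_integral_cmult)
    note [measurable] = margi_measurable(1)[OF i w]
    show "(\<lambda>y. margi N i w y * \<phi> y) \<in> borel_measurable \<nu>" by measurable
  qed
  finally have eq: "ennreal R.mass * ?K = ennreal (zmass N) * (\<integral>\<^sup>+y. margi N i w y * \<phi> y \<partial>\<nu>)" .
  have "?K = ennreal (1 / R.mass) * (ennreal R.mass * ?K)"
    using R.mass_pos by (simp add: mult.assoc[symmetric] flip: ennreal_mult)
  also have "\<dots> = ennreal (1 / R.mass) * ennreal (zmass N) * (\<integral>\<^sup>+y. margi N i w y * \<phi> y \<partial>\<nu>)"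
    unfolding eq by (simp only: mult.assoc)
  also have "ennreal (1 / R.mass) * ennreal (zmass N) = ennreal (zmass N / R.mass)"
    using R.mass_pos zmass_pos[of N] by (simp flip: ennreal_mult)
  finally show ?thesis .
qed

lemma marginal_eq: "marginal muR N w x = ennreal (1 / R.mass ^ N) * (\<integral>\<^sup>+z. w (x, z) \<partial>iter_mu muR N)"
  using R.mass_pos
  by (simp add: marginal_def mass_iter divide_ennreal_def inverse_ennreal mult.commute inverse_eq_divide)

lemma marginal_measurable [measurable]:
  assumes [measurable]: "w \<in> borel_measurable (borel \<Otimes>\<^sub>M PiM {..<N} (\<lambda>_. borel))"
  shows "marginal muR N w \<in> borel_measurable borel"
proof -
  interpret B: sigma_finite_measure "iter_mu muR N" by (rule sigma_finite_of_finite[OF finite_iter])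
  show ?thesis unfolding marginal_eq[abs_def] by measurable
qed

lemma marginal_transfer:
  assumes \<nu>: "finite_measure \<nu>" "sets \<nu> = sets borel"
    and w [measurable]: "w \<in> borel_measurable (borel \<Otimes>\<^sub>M PiM {..<N} (\<lambda>_. borel))" and \<phi> [measurable]: "\<phi> \<in> borel_measurable borel"
  shows "(\<integral>\<^sup>+p. w p * \<phi> (fst p) \<partial>(\<nu> \<Otimes>\<^sub>M iter_mu muR N)) = ennreal (R.mass ^ N) * (\<integral>\<^sup>+x. marginal muR N w x * \<phi> x \<partial>\<nu>)"
proof -
  interpret B: sigma_finite_measure "iter_mu muR N" by (rule sigma_finite_of_finite[OF finite_iter])
  have [measurable_cong]: "sets \<nu> = sets borel" by fact
  have Rp: "0 < R.mass ^ N" using R.mass_pos by simp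
  have "(\<integral>\<^sup>+p. w p * \<phi> (fst p) \<partial>(\<nu> \<Otimes>\<^sub>M iter_mu muR N)) = (\<integral>\<^sup>+x. \<integral>\<^sup>+z. w (x, z) * \<phi> x \<partial>iter_mu muR N \<partial>\<nu>)"
    by (subst B.nn_integral_fst[symmetric]) simp_all
  also have "\<dots> = (\<integral>\<^sup>+x. ennreal (R.mass ^ N) * (marginal muR N w x * \<phi> x) \<partial>\<nu>)"
  proof (intro nn_integral_cong)
    fix x
    have "(\<integral>\<^sup>+z. w (x, z) * \<phi> x \<partial>iter_mu muR N) = (\<integral>\<^sup>+z. w (x, z) \<partial>iter_mu muR N) * \<phi> x"
      by (rule nn_integral_multc) measurable
    also have "\<dots> = (ennreal (R.mass ^ N) * ennreal (1 / R.mass ^ N)) * ((\<integral>\<^sup>+z. w (x, z) \<partial>iter_mu muR N) * \<phi> x)"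
    proof -
      have "ennreal k * ennreal (1 / k) = 1" if "0 < k" for k :: real
        using that by (simp flip: ennreal_mult)
      from this[OF Rp] show ?thesis by simp
    qed
    also have "\<dots> = ennreal (R.mass ^ N) * (marginal muR N w x * \<phi> x)" by (simp only: marginal_eq mult_ac)
    finally show "(\<integral>\<^sup>+z. w (x, z) * \<phi> x \<partial>iter_mu muR N) = ennreal (R.mass ^ N) * (marginal muR N w x * \<phi> x)" .
  qed
  also have "\<dots> = ennreal (R.mass ^ N) * (\<integral>\<^sup>+x. marginal muR N w x * \<phi> x \<partial>\<nu>)"
    by (rule nn_integral_cmult) measurable
  finally show ?thesis .
qed

end

context product_system
begin

abbreviation "MC N \<equiv> M_class cmb_prod (comp_set P PR N) (comp_mu mu muR N) 1"

abbreviation "MSp N \<equiv> borel \<Otimes>\<^sub>M PiM {..<N} (\<lambda>_. borel) :: ('a \<times> (nat \<Rightarrow> 'b)) measure"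

lemma MC_iff: "w \<in> MC N \<longleftrightarrow> plc_on cmb_prod (comp_set P PR N) w \<and> w \<in> borel_measurable (MSp N) \<and>
    (\<integral>\<^sup>+p. w p \<partial>comp_mu mu muR N) = ennreal (zmass N)"
proof -
  have "w \<in> borel_measurable (comp_mu mu muR N) \<longleftrightarrow> w \<in> borel_measurable (MSp N)"
    using measurable_change_sets[OF _ sets_comp] measurable_change_sets[OF _ sets_comp[symmetric]] by blast
  then show ?thesis by (simp add: M_class_1_iff mass_comp)
qed

lemma coord_measure_muR: "coord_measure N i muR = iter_mu muR N"
  by (simp add: iter_mu_def)

lemma div_ennreal_eq: "0 < c \<Longrightarrow> a / ennreal c = ennreal (1 / c) * a"
  by (simp add: divide_ennreal_def inverse_ennreal mult.commute inverse_eq_divide)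

lemma ennreal_inverse_cancel: "0 < c \<Longrightarrow> ennreal c * a = b \<Longrightarrow> a = ennreal (1 / c) * b"
proof -
  assume c: "0 < c" and e: "ennreal c * a = b"
  have "ennreal (1 / c) * (ennreal c * a) = (ennreal (1 / c) * ennreal c) * a" by (simp only: mult.assoc)
  also have "ennreal (1 / c) * ennreal c = 1" using c by (simp flip: ennreal_mult)
  finally show "a = ennreal (1 / c) * b" using e by simp
qed

lemma AE_comp_fst:
  assumes "AE x in mu. Q x" shows "AE p in comp_mu mu muR N. Q (fst p)"
proof -
  obtain N0 where N0: "{x \<in> space mu. \<not> Q x} \<subseteq> N0" "emeasure mu N0 = 0" "N0 \<in> sets mu"
    using assms by (rule AE_E)
  have m: "indicator N0 \<in> borel_measurable borel" using N0(3) by (intro borel_measurable_indicator) simp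
  have "(\<integral>\<^sup>+p. 1 * indicator N0 (fst p) \<partial>comp_mu mu muR N) = ennreal (R.mass ^ N) * (\<integral>\<^sup>+x. marginal muR N (\<lambda>_. 1) x * indicator N0 x \<partial>mu)"
    unfolding comp_mu_def by (rule marginal_transfer[OF P.finite_measure_axioms P.sets_mu _ m]) simp
  also have "(\<integral>\<^sup>+x. marginal muR N (\<lambda>_. 1) x * indicator N0 x \<partial>mu) = (\<integral>\<^sup>+x. 0 \<partial>mu)"
    using AE_not_in[of N0 mu] N0(2,3) by (intro nn_integral_cong_AE) (auto elim!: eventually_mono simp: null_sets_def)
  finally have "(\<integral>\<^sup>+p. indicator N0 (fst p) \<partial>comp_mu mu muR N) = 0" by simp
  moreover have "(\<lambda>p. indicator N0 (fst p) :: ennreal) \<in> borel_measurable (comp_mu mu muR N)"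
    by (rule measurable_change_sets[OF measurable_compose[OF measurable_fst m] sets_comp])
  ultimately have "AE p in comp_mu mu muR N. indicator N0 (fst p) = (0::ennreal)"
    by (subst (asm) nn_integral_0_iff_AE) auto
  then show ?thesis by (rule eventually_mono) (use N0(1) in \<open>auto simp: indicator_eq_0_iff\<close>)
qed

lemma measurable_iter_coord:
  assumes "q \<in> borel_measurable borel" "j < N"
  shows "(\<lambda>z. q (z j)) \<in> borel_measurable (PiM {..<N} (\<lambda>_. borel))"
  by (rule measurable_compose[where f="\<lambda>z. z j" and N=borel])
    (use assms in \<open>auto intro!: measurable_component_singleton\<close>)

lemma measurable_coord: "i < N \<Longrightarrow> (\<lambda>p. snd p i) \<in> measurable (MSp N) borel"
  by (intro measurable_compose[OF measurable_snd]) (auto intro: measurable_component_singleton)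

lemma AE_comp_snd:
  assumes "AE y in muR. Q y" and i: "i < N" shows "AE p in comp_mu mu muR N. Q (snd p i)"
proof -
  obtain N0 where N0: "{x \<in> space muR. \<not> Q x} \<subseteq> N0" "emeasure muR N0 = 0" "N0 \<in> sets muR"
    using assms(1) by (rule AE_E)
  have m: "indicator N0 \<in> borel_measurable borel" using N0(3) by (intro borel_measurable_indicator) simp
  have "(\<integral>\<^sup>+p. 1 * indicator N0 (snd p i) \<partial>comp_mu mu muR N) = ennreal (zmass N / R.mass) * (\<integral>\<^sup>+y. margi N i (\<lambda>_. 1) y * indicator N0 y \<partial>muR)"
    using margi_transfer[OF i R.finite_measure_axioms R.sets_mu _ m, of "\<lambda>_. 1"]
    unfolding coord_measure_muR comp_mu_def by simp
  also have "(\<integral>\<^sup>+y. margi N i (\<lambda>_. 1) y * indicator N0 y \<partial>muR) = (\<integral>\<^sup>+y. 0 \<partial>muR)"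
    using AE_not_in[of N0 muR] N0(2,3) by (intro nn_integral_cong_AE) (auto elim!: eventually_mono simp: null_sets_def)
  finally have "(\<integral>\<^sup>+p. indicator N0 (snd p i) \<partial>comp_mu mu muR N) = 0" by simp
  moreover have "(\<lambda>p. indicator N0 (snd p i) :: ennreal) \<in> borel_measurable (comp_mu mu muR N)"
    by (rule measurable_change_sets[OF measurable_compose[OF measurable_coord[OF i] m] sets_comp])
  ultimately have "AE p in comp_mu mu muR N. indicator N0 (snd p i) = (0::ennreal)"
    by (subst (asm) nn_integral_0_iff_AE) auto
  then show ?thesis by (rule eventually_mono) (use N0(1) in \<open>auto simp: indicator_eq_0_iff\<close>)
qed

lemma AE_comp_set: "AE p in comp_mu mu muR N. p \<in> comp_set P PR N"
proof -
  have 1: "AE p in comp_mu mu muR N. fst p \<in> P" by (rule AE_comp_fst[OF P.AE_mu_P])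
  have 2: "AE p in comp_mu mu muR N. \<forall>i\<in>{..<N}. snd p i \<in> PR"
    by (rule AE_finite_allI) (auto intro: AE_comp_snd[OF R.AE_mu_P])
  have 3: "AE p in comp_mu mu muR N. snd p \<in> PiE {..<N} (\<lambda>_. UNIV)"
    by (rule AE_I2) (auto simp: comp_mu_def space_pair_measure space_iter)
  show ?thesis
    using 1 2 3
  proof eventually_elim
    case (elim p)
    then show ?case unfolding comp_set_def iter_set_def mem_Times_iff
      by (simp add: PiE_iff)
  qed
qed

text \<open>Slicing the corresponding statement for the composite: almost every \<open>x\<close>
  gives it, and since \<open>mu\<close> is not zero at least one does.\<close>

lemma AE_iter_set: "AE z in iter_mu muR N. z \<in> iter_set PR N"
proof -
  interpret B: sigma_finite_measure "iter_mu muR N" by (rule sigma_finite_of_finite[OF finite_iter])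
  interpret M: sigma_finite_measure mu by (rule sigma_finite_of_finite[OF P.finite_measure_axioms])
  interpret MB: pair_sigma_finite mu "iter_mu muR N" ..
  have "AE p in mu \<Otimes>\<^sub>M iter_mu muR N. snd p \<in> iter_set PR N"
    using AE_comp_set[of N] unfolding comp_mu_def by (rule eventually_mono) (auto simp: comp_set_def)
  then have "AE x in mu. AE z in iter_mu muR N. snd (x, z) \<in> iter_set PR N"
    by (rule MB.AE_pair)
  then have "AE x in mu. (AE z in iter_mu muR N. z \<in> iter_set PR N)" by simp
  moreover have "\<not> (AE x in mu. False)"
    using P.mass_pos P.total_mass_eq by (simp add: AE_iff_measurable[where N="space mu"] total_mass_def)
  ultimately show ?thesis by (auto elim: contrapos_np)
qed

lemma iter_mass_ne: "emeasure (iter_mu muR N) (space (iter_mu muR N)) \<noteq> 0"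
  using mass_iter[of N] R.mass_pos by (simp add: total_mass_def)

lemma comp_mass_ne: "emeasure (comp_mu mu muR N) (space (comp_mu mu muR N)) \<noteq> 0"
  using mass_comp[of N] zmass_pos[of N] by (simp add: total_mass_def)

text \<open>For almost every \<open>z\<close> the slice of \<open>w\<close> at \<open>z\<close> is
  its composition with an affine embedding of \<open>P\<close>, and integration over
  \<open>z\<close> preserves all pointwise conditions.\<close>

lemma marginal_MP:
  assumes w: "w \<in> MC N"
  shows "marginal muR N w \<in> P.MP"
  unfolding P.MP_iff
proof (intro conjI)
  have wD: "plc_on cmb_prod (comp_set P PR N) w" "w \<in> borel_measurable (MSp N)"
    "(\<integral>\<^sup>+p. w p \<partial>comp_mu mu muR N) = ennreal (zmass N)" using w by (auto simp: MC_iff)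
  show "marginal muR N w \<in> borel_measurable borel" by (rule marginal_measurable[OF wD(2)])
  have cl: "cmb_lin t x y \<in> P" if "x \<in> P" "y \<in> P" "t \<in> {0..1}" for x y t
    by (rule cmb_lin_closed[OF P.convex_P that])
  have "plc_on cmb_lin P (\<lambda>x. \<integral>\<^sup>+z. w (x, z) \<partial>iter_mu muR N)"
  proof (rule plc_on_nn_integral[OF _ _ iter_mass_ne cl])
    show "(\<lambda>z. w (x, z)) \<in> borel_measurable (iter_mu muR N)" for x
      using wD(2) by measurable
    show "AE z in iter_mu muR N. plc_on cmb_lin P (\<lambda>x. w (x, z))"
      using AE_iter_set
    proof eventually_elim
      case (elim z)
      show ?case
      proof (rule plc_on_compose[OF wD(1)])
        show "continuous_on UNIV (\<lambda>x. (x, z))" by (intro continuous_intros)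
        show "(x, z) \<in> comp_set P PR N" if "x \<in> P" for x using elim that by (simp add: comp_set_def)
        show "(cmb_lin t x y, z) = cmb_prod t (x, z) (y, z)" for x y t by (simp add: cmb_prod_def)
      qed
    qed
  qed auto
  then have "plc_on cmb_lin P (\<lambda>x. ennreal (1 / R.mass ^ N) * (\<integral>\<^sup>+z. w (x, z) \<partial>iter_mu muR N))"
    using R.mass_pos by (intro plc_on_cmult cl) (auto simp: ennreal_less_zero_iff)
  then show "plc_on cmb_lin P (marginal muR N w)" unfolding marginal_eq[abs_def] .
  have "ennreal (R.mass ^ N) * (\<integral>\<^sup>+x. marginal muR N w x \<partial>mu) = ennreal (zmass N)"
    using marginal_transfer[OF P.finite_measure_axioms P.sets_mu wD(2), of "\<lambda>_. 1"] wD(3) by (simp add: comp_mu_def)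
  then have "(\<integral>\<^sup>+x. marginal muR N w x \<partial>mu) = ennreal (1 / R.mass ^ N) * ennreal (zmass N)"
    using R.mass_pos by (intro ennreal_inverse_cancel) auto
  also have "\<dots> = ennreal (1 / R.mass ^ N * zmass N)"
    using R.mass_pos zmass_pos[of N] by (intro ennreal_mult[symmetric]) auto
  also have "1 / R.mass ^ N * zmass N = P.mass" using R.mass_pos by (simp add: zmass_def)
  finally show "(\<integral>\<^sup>+x. marginal muR N w x \<partial>mu) = total_mass mu" by (simp add: P.total_mass_eq)
qed

lemma margi_MP:
  assumes w: "w \<in> MC N" and i: "i < N"
  shows "margi N i w \<in> R.MP"
  unfolding R.MP_iff
proof (intro conjI)
  have wD: "plc_on cmb_prod (comp_set P PR N) w" "w \<in> borel_measurable (MSp N)"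
    "(\<integral>\<^sup>+p. w p \<partial>comp_mu mu muR N) = ennreal (zmass N)" using w by (auto simp: MC_iff)
  show "margi N i w \<in> borel_measurable borel" by (rule margi_measurable(1)[OF i wD(2)])
  have cl: "cmb_lin t x y \<in> PR" if "x \<in> PR" "y \<in> PR" "t \<in> {0..1}" for x y t
    by (rule cmb_lin_closed[OF R.convex_P that])
  have "plc_on cmb_lin PR (\<lambda>y. \<integral>\<^sup>+p. w (fst p, (snd p)(i := y)) \<partial>comp_mu mu muR N)"
  proof (rule plc_on_nn_integral[OF _ _ comp_mass_ne cl])
    show "(\<lambda>p. w (fst p, (snd p)(i := y))) \<in> borel_measurable (comp_mu mu muR N)" for y
      by (rule margi_measurable(2)[OF i wD(2)])
    show "AE p in comp_mu mu muR N. plc_on cmb_lin PR (\<lambda>y. w (fst p, (snd p)(i := y)))"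
      using AE_comp_set
    proof eventually_elim
      case (elim p)
      then have p: "fst p \<in> P" "snd p \<in> PiE {..<N} (\<lambda>_. PR)"
        unfolding comp_set_def iter_set_def mem_Times_iff by blast+
      show ?case
      proof (rule plc_on_compose[OF wD(1)])
        have "continuous_on UNIV (\<lambda>y. ((snd p)(i := y)) j)" for j
          by (cases "j = i") (auto intro: continuous_intros)
        then show "continuous_on UNIV (\<lambda>y. (fst p, (snd p)(i := y)))"
          by (intro continuous_on_Pair continuous_on_const continuous_on_coordinatewise_then_product)
        show "(fst p, (snd p)(i := y)) \<in> comp_set P PR N" if "y \<in> PR" for y
        proof -
          have "(snd p)(i := y) \<in> PiE (insert i {..<N}) (\<lambda>_. PR)" by (rule PiE_fun_upd[OF that p(2)])
          moreover have "insert i {..<N} = {..<N}" using i by auto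
          ultimately show ?thesis using p(1) by (simp add: comp_set_def iter_set_def)
        qed
        show "(fst p, (snd p)(i := cmb_lin t x y)) = cmb_prod t (fst p, (snd p)(i := x)) (fst p, (snd p)(i := y))" for x y t
          by (auto simp: cmb_prod_def fun_eq_iff)
      qed
    qed
  qed auto
  then have "plc_on cmb_lin PR (\<lambda>y. ennreal (1 / zmass N) * (\<integral>\<^sup>+p. w (fst p, (snd p)(i := y)) \<partial>comp_mu mu muR N))"
    using zmass_pos[of N] by (intro plc_on_cmult cl) (auto simp: ennreal_less_zero_iff)
  then show "plc_on cmb_lin PR (margi N i w)" unfolding margi_def[abs_def] .
  have "ennreal (zmass N / R.mass) * (\<integral>\<^sup>+y. margi N i w y \<partial>muR) = ennreal (zmass N)"
    using margi_transfer[OF i R.finite_measure_axioms R.sets_mu wD(2), of "\<lambda>_. 1"] wD(3)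
    unfolding coord_measure_muR by (simp add: comp_mu_def)
  then have "(\<integral>\<^sup>+y. margi N i w y \<partial>muR) = ennreal (1 / (zmass N / R.mass)) * ennreal (zmass N)"
    using R.mass_pos zmass_pos[of N] by (intro ennreal_inverse_cancel) auto
  also have "\<dots> = ennreal (1 / (zmass N / R.mass) * zmass N)"
    using R.mass_pos zmass_pos[of N] by (intro ennreal_mult[symmetric]) auto
  also have "1 / (zmass N / R.mass) * zmass N = R.mass" using zmass_pos[of N] by simp
  finally show "(\<integral>\<^sup>+y. margi N i w y \<partial>muR) = total_mass muR" by (simp add: R.total_mass_eq)
qed

text \<open>Averaging over the reservoir coordinates takes the place of a symmetry argument. The
  energy depends only on the sum of the marginals, and so does the logarithm of a product state
  integrated against \<open>w\<close>.\<close>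

definition avg :: "nat \<Rightarrow> ('a \<times> (nat \<Rightarrow> 'b) \<Rightarrow> ennreal) \<Rightarrow> 'b \<Rightarrow> ennreal" where
  "avg N w y = (\<Sum>i<N. ennreal (1 / real N) * margi N i w y)"

lemma nn_integral_avg:
  assumes \<phi>: "\<phi> \<in> borel_measurable borel" and w: "w \<in> borel_measurable (MSp N)" and N: "0 < N"
    and \<nu>: "sets \<nu> = sets borel"
  shows "(\<Sum>i<N. \<integral>\<^sup>+y. margi N i w y * \<phi> y \<partial>\<nu>) = ennreal (real N) * (\<integral>\<^sup>+y. avg N w y * \<phi> y \<partial>\<nu>)"
proof -
  have [measurable_cong]: "sets \<nu> = sets borel" by fact
  have m: "(\<lambda>y. margi N i w y * \<phi> y) \<in> borel_measurable \<nu>" if "i < N" for i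
    using margi_measurable(1)[OF that w] \<phi> by measurable
  have "(\<integral>\<^sup>+y. avg N w y * \<phi> y \<partial>\<nu>) = (\<integral>\<^sup>+y. (\<Sum>i<N. ennreal (1 / real N) * (margi N i w y * \<phi> y)) \<partial>\<nu>)"
    by (simp add: avg_def sum_distrib_right mult.assoc)
  also have "\<dots> = (\<Sum>i<N. \<integral>\<^sup>+y. ennreal (1 / real N) * (margi N i w y * \<phi> y) \<partial>\<nu>)"
    by (rule nn_integral_sum) (use m in auto)
  also have "\<dots> = (\<Sum>i<N. ennreal (1 / real N) * (\<integral>\<^sup>+y. margi N i w y * \<phi> y \<partial>\<nu>))"
    by (intro sum.cong refl nn_integral_cmult m) simp
  also have "\<dots> = ennreal (1 / real N) * (\<Sum>i<N. \<integral>\<^sup>+y. margi N i w y * \<phi> y \<partial>\<nu>)"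
    by (simp add: sum_distrib_left)
  finally have "ennreal (real N) * (\<integral>\<^sup>+y. avg N w y * \<phi> y \<partial>\<nu>)
     = (ennreal (real N) * ennreal (1 / real N)) * (\<Sum>i<N. \<integral>\<^sup>+y. margi N i w y * \<phi> y \<partial>\<nu>)"
    by (simp only: mult.assoc)
  also have "ennreal (real N) * ennreal (1 / real N) = 1"
    using N by (subst ennreal_mult[symmetric]) auto
  finally show ?thesis by simp
qed

lemma avg_MP:
  assumes w: "w \<in> MC N" and N: "0 < N"
  shows "avg N w \<in> R.MP"
  unfolding R.MP_iff
proof (intro conjI)
  have wm: "w \<in> borel_measurable (MSp N)" using w by (simp add: MC_iff)
  have cl: "cmb_lin t x y \<in> PR" if "x \<in> PR" "y \<in> PR" "t \<in> {0..1}" for x y t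
    by (rule cmb_lin_closed[OF R.convex_P that])
  show "plc_on cmb_lin PR (avg N w)"
    unfolding avg_def[abs_def]
  proof (rule plc_on_sum[OF _ _ _ cl])
    show "plc_on cmb_lin PR (\<lambda>y. ennreal (1 / real N) * margi N i w y)" if "i \<in> {..<N}" for i
      using margi_MP[OF w, of i] that N by (intro plc_on_cmult cl) (auto simp: R.MP_iff ennreal_less_zero_iff)
  qed (use N in auto)
  show "avg N w \<in> borel_measurable borel"
    unfolding avg_def[abs_def]
    by (intro borel_measurable_sum borel_measurable_times_ennreal borel_measurable_const margi_measurable(1)[OF _ wm]) simp
  have "ennreal (real N) * (\<integral>\<^sup>+y. avg N w y \<partial>muR) = (\<Sum>i<N. \<integral>\<^sup>+y. margi N i w y \<partial>muR)"
    using nn_integral_avg[OF _ wm N R.sets_mu, of "\<lambda>_. 1"] by simp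
  also have "\<dots> = (\<Sum>i<N. total_mass muR)"
    using margi_MP[OF w] by (intro sum.cong refl) (auto simp: R.MP_iff)
  also have "\<dots> = ennreal (real N) * total_mass muR" by (simp add: ennreal_of_nat_eq_real_of_nat)
  finally have e: "ennreal (real N) * (\<integral>\<^sup>+y. avg N w y \<partial>muR) = ennreal (real N) * total_mass muR" .
  have "(\<integral>\<^sup>+y. avg N w y \<partial>muR) = ennreal (1 / real N) * (ennreal (real N) * total_mass muR)"
    by (rule ennreal_inverse_cancel[OF _ e]) (use N in simp)
  also have "\<dots> = total_mass muR"
    by (rule ennreal_inverse_cancel[OF _ refl, symmetric]) (use N in simp)
  finally show "(\<integral>\<^sup>+y. avg N w y \<partial>muR) = total_mass muR" .
qed

text \<open>Each summand of the boundary measure places the boundary in a single factor and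
  integrates out the rest, so it sees only the marginal in that factor.\<close>

lemma energy_split:
  assumes w: "w \<in> borel_measurable (MSp N)"
  shows "int_energy (comp_mu mu muR N) (comp_sigma mu bd muR bdR N) w
    = int_energy mu bd (marginal muR N w) + (\<Sum>i<N. int_energy muR bdR (margi N i w))"
proof -
  have sc: "sets (coord_measure N i bdR) = sets (PiM {..<N} (\<lambda>_. borel))" for i by (rule sets_coord) simp
  have sc': "sets (coord_measure N i bdR) = sets (iter_mu muR N)" for i using sc sets_iter by simp
  have si: "sets (iter_sigma muR bdR N) = sets (iter_mu muR N)"
    unfolding iter_sigma_def by (rule sets_meas_sum) (use sc' in auto)
  have finc: "finite_measure (coord_measure N i bdR)" for i
  proof -
    interpret C0: product_sigma_finite "\<lambda>j. if j = i then bdR else muR" by (rule product_sigma_finite_coord[OF finite_bdR])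
    have "emeasure (coord_measure N i bdR) (PiE {..<N} (\<lambda>j. space (if j = i then bdR else muR)))
       = (\<Prod>j<N. emeasure (if j = i then bdR else muR) (space (if j = i then bdR else muR)))"
      by (rule C0.emeasure_PiM) auto
    also have "\<dots> < \<infinity>"
      using finite_bdR R.finite_measure_axioms
      by (auto simp: ennreal_prod_eq_top finite_measure.emeasure_finite less_top[symmetric])
    finally show ?thesis by (intro finite_measureI) (simp add: space_PiM)
  qed
  have fins: "finite_measure (iter_sigma muR bdR N)"
  proof (rule finite_measureI)
    have "emeasure (iter_sigma muR bdR N) (space (iter_sigma muR bdR N))
       = (\<Sum>i<N. emeasure (coord_measure N i bdR) (space (iter_sigma muR bdR N)))"
      unfolding iter_sigma_def by (rule emeasure_meas_sum) (use sc' si in \<open>auto simp: iter_sigma_def[symmetric]\<close>)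
    also have "\<dots> < \<infinity>"
      using finite_measure.emeasure_finite[OF finc] by (simp add: less_top)
    finally show "emeasure (iter_sigma muR bdR N) (space (iter_sigma muR bdR N)) \<noteq> \<infinity>" by simp
  qed
  interpret S: sigma_finite_measure "iter_sigma muR bdR N" by (rule sigma_finite_of_finite[OF fins])
  have si': "sets (iter_sigma muR bdR N) = sets (PiM {..<N} (\<lambda>_. borel))" using si sets_iter by simp
  have part2: "(\<integral>\<^sup>+p. w p \<partial>(mu \<Otimes>\<^sub>M iter_sigma muR bdR N)) = (\<Sum>i<N. ennreal (zmass N / R.mass) * (\<integral>\<^sup>+y. margi N i w y \<partial>bdR))"
  proof -
    have wm: "w \<in> borel_measurable (mu \<Otimes>\<^sub>M iter_sigma muR bdR N)"
      by (rule measurable_change_sets[OF w sets_pair_measure_cong[OF P.sets_mu si']])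
    have wx: "(\<lambda>z. w (x, z)) \<in> borel_measurable (PiM {..<N} (\<lambda>_. borel))" for x using w by measurable
    have "(\<integral>\<^sup>+p. w p \<partial>(mu \<Otimes>\<^sub>M iter_sigma muR bdR N)) = (\<integral>\<^sup>+x. (\<integral>\<^sup>+z. w (x, z) \<partial>iter_sigma muR bdR N) \<partial>mu)"
      by (rule S.nn_integral_fst[symmetric, OF wm])
    also have "\<dots> = (\<integral>\<^sup>+x. (\<Sum>i<N. \<integral>\<^sup>+z. w (x, z) \<partial>coord_measure N i bdR) \<partial>mu)"
      unfolding iter_sigma_def
      by (intro nn_integral_cong nn_integral_meas_sum) (use sc' measurable_change_sets[OF wx sets_iter] in auto)
    also have "\<dots> = (\<Sum>i<N. \<integral>\<^sup>+x. (\<integral>\<^sup>+z. w (x, z) \<partial>coord_measure N i bdR) \<partial>mu)"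
    proof (rule nn_integral_sum)
      fix i
      interpret C: sigma_finite_measure "coord_measure N i bdR" by (rule sigma_finite_of_finite[OF finc])
      have "w \<in> borel_measurable (mu \<Otimes>\<^sub>M coord_measure N i bdR)"
        by (rule measurable_change_sets[OF w sets_pair_measure_cong[OF P.sets_mu sc]])
      then show "(\<lambda>x. \<integral>\<^sup>+z. w (x, z) \<partial>coord_measure N i bdR) \<in> borel_measurable mu"
        by (rule C.borel_measurable_nn_integral_fst)
    qed
    also have "\<dots> = (\<Sum>i<N. ennreal (zmass N / R.mass) * (\<integral>\<^sup>+y. margi N i w y \<partial>bdR))"
    proof (intro sum.cong refl)
      fix i assume "i \<in> {..<N}"
      then have i: "i < N" by simp
      interpret C: sigma_finite_measure "coord_measure N i bdR" by (rule sigma_finite_of_finite[OF finc])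
      have "w \<in> borel_measurable (mu \<Otimes>\<^sub>M coord_measure N i bdR)"
        by (rule measurable_change_sets[OF w sets_pair_measure_cong[OF P.sets_mu sc]])
      then have "(\<integral>\<^sup>+x. (\<integral>\<^sup>+z. w (x, z) \<partial>coord_measure N i bdR) \<partial>mu) = (\<integral>\<^sup>+p. w p \<partial>(mu \<Otimes>\<^sub>M coord_measure N i bdR))"
        by (rule C.nn_integral_fst)
      also have "\<dots> = ennreal (zmass N / R.mass) * (\<integral>\<^sup>+y. margi N i w y \<partial>bdR)"
        using margi_transfer[OF i finite_bdR R.sets_bd w, of "\<lambda>_. 1"] by simp
      finally show "(\<integral>\<^sup>+x. (\<integral>\<^sup>+z. w (x, z) \<partial>coord_measure N i bdR) \<partial>mu) = ennreal (zmass N / R.mass) * (\<integral>\<^sup>+y. margi N i w y \<partial>bdR)" .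
    qed
    finally show ?thesis .
  qed
  have part1: "(\<integral>\<^sup>+p. w p \<partial>(bd \<Otimes>\<^sub>M iter_mu muR N)) = ennreal (R.mass ^ N) * (\<integral>\<^sup>+x. marginal muR N w x \<partial>bd)"
    using marginal_transfer[OF finite_bd P.sets_bd w, of "\<lambda>_. 1"] by simp
  have s01: "sets (if k = 0 then bd \<Otimes>\<^sub>M iter_mu muR N else mu \<Otimes>\<^sub>M iter_sigma muR bdR N) = sets (comp_mu mu muR N)" for k :: nat
    unfolding comp_mu_def by (cases "k = 0") (auto intro!: sets_pair_measure_cong simp: si)
  have "(\<integral>\<^sup>+p. w p \<partial>comp_sigma mu bd muR bdR N) = (\<Sum>k\<in>{0::nat, 1}. \<integral>\<^sup>+p. w p \<partial>(if k = 0 then bd \<Otimes>\<^sub>M iter_mu muR N else mu \<Otimes>\<^sub>M iter_sigma muR bdR N))"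
    unfolding comp_sigma_def by (rule nn_integral_meas_sum[OF _ s01 measurable_change_sets[OF w sets_comp]]) simp
  also have "\<dots> = ennreal (R.mass ^ N) * (\<integral>\<^sup>+x. marginal muR N w x \<partial>bd) + (\<Sum>i<N. ennreal (zmass N / R.mass) * (\<integral>\<^sup>+y. margi N i w y \<partial>bdR))"
    using part1 part2 by simp
  finally have tot: "(\<integral>\<^sup>+p. w p \<partial>comp_sigma mu bd muR bdR N)
    = ennreal (R.mass ^ N) * (\<integral>\<^sup>+x. marginal muR N w x \<partial>bd) + (\<Sum>i<N. ennreal (zmass N / R.mass) * (\<integral>\<^sup>+y. margi N i w y \<partial>bdR))" .
  have c1: "ennreal (1 / zmass N) * ennreal (R.mass ^ N) = ennreal (1 / P.mass)"
  proof -
    have "ennreal (1 / zmass N) * ennreal (R.mass ^ N) = ennreal (1 / zmass N * R.mass ^ N)"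
      using zmass_pos[of N] R.mass_pos by (intro ennreal_mult[symmetric]) auto
    also have "1 / zmass N * R.mass ^ N = 1 / P.mass" using R.mass_pos by (simp add: zmass_def)
    finally show ?thesis .
  qed
  have c2: "ennreal (1 / zmass N) * ennreal (zmass N / R.mass) = ennreal (1 / R.mass)"
  proof -
    have "ennreal (1 / zmass N) * ennreal (zmass N / R.mass) = ennreal (1 / zmass N * (zmass N / R.mass))"
      using zmass_pos[of N] R.mass_pos by (intro ennreal_mult[symmetric]) auto
    also have "1 / zmass N * (zmass N / R.mass) = 1 / R.mass" using zmass_pos[of N] by simp
    finally show ?thesis .
  qed
  show ?thesis
    unfolding int_energy_def mass_comp P.total_mass_eq R.total_mass_eq div_ennreal_eq[OF zmass_pos] div_ennreal_eq[OF P.mass_pos] div_ennreal_eq[OF R.mass_pos] tot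
    unfolding distrib_left sum_distrib_left mult.assoc[symmetric] c1 c2 ..
qed

section \<open>Product states, additivity and subadditivity of the entropy\<close>

definition prod_state :: "('a \<Rightarrow> ennreal) \<Rightarrow> ('b \<Rightarrow> ennreal) \<Rightarrow> nat \<Rightarrow> 'a \<times> (nat \<Rightarrow> 'b) \<Rightarrow> ennreal" where
  "prod_state u q N p = u (fst p) * (\<Prod>j<N. q (snd p j))"

lemma prod_state_measurable:
  assumes [measurable]: "u \<in> borel_measurable borel" and q: "q \<in> borel_measurable borel"
  shows "prod_state u q N \<in> borel_measurable (MSp N)"
  unfolding prod_state_def[abs_def]
  by (intro borel_measurable_times_ennreal borel_measurable_prod_ennreal measurable_compose[OF measurable_fst assms(1)]
     measurable_compose[OF measurable_coord q]) auto

lemma marginal_prod_state: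
  assumes q: "q \<in> R.MP" and u: "u \<in> borel_measurable borel"
  shows "marginal muR N (prod_state u q N) x = u x"
proof -
  have qm: "q \<in> borel_measurable borel" using q by (simp add: R.MP_iff)
  have "(\<integral>\<^sup>+z. prod_state u q N (x, z) \<partial>iter_mu muR N) = u x * (\<integral>\<^sup>+z. (\<Prod>j<N. q (z j)) \<partial>iter_mu muR N)"
    unfolding prod_state_def fst_conv snd_conv
  proof (rule nn_integral_cmult)
    have "(\<lambda>z. \<Prod>j<N. q (z j)) \<in> borel_measurable (PiM {..<N} (\<lambda>_. borel))"
      by (intro borel_measurable_prod_ennreal measurable_iter_coord[OF qm]) simp
    then show "(\<lambda>z. \<Prod>j<N. q (z j)) \<in> borel_measurable (iter_mu muR N)"
      by (rule measurable_change_sets[OF _ sets_iter])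
  qed
  also have "(\<integral>\<^sup>+z. (\<Prod>j<N. q (z j)) \<partial>iter_mu muR N) = ennreal (R.mass ^ N)"
    using nn_integral_iter_prod[of N "\<lambda>_. q"] qm q R.mass_pos by (simp add: R.MP_iff R.total_mass_eq ennreal_power)
  finally have e: "ennreal (R.mass ^ N) * u x = (\<integral>\<^sup>+z. prod_state u q N (x, z) \<partial>iter_mu muR N)"
    by (simp add: mult.commute)
  show ?thesis unfolding marginal_eq
    by (rule ennreal_inverse_cancel[OF _ e, symmetric]) (use R.mass_pos in simp)
qed

lemma margi_prod_state:
  assumes u: "u \<in> P.MP" and q: "q \<in> R.MP" and i: "i < N"
  shows "margi N i (prod_state u q N) y = q y"
proof -
  have um: "u \<in> borel_measurable borel" and qm: "q \<in> borel_measurable borel" using u q by (simp_all add: P.MP_iff R.MP_iff)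
  interpret B: sigma_finite_measure "iter_mu muR N" by (rule sigma_finite_of_finite[OF finite_iter])
  have f: "(\<lambda>p. prod_state u q N (fst p, (snd p)(i := y))) \<in> borel_measurable (mu \<Otimes>\<^sub>M iter_mu muR N)"
    using margi_measurable(2)[OF i prod_state_measurable[OF um qm]] by (simp add: comp_mu_def)
  \<comment> \<open>Overwriting coordinate \<open>i\<close> freezes its factor at the constant
    \<open>q y\<close>.\<close>
  define g where "g j = (if j = i then (\<lambda>_. q y) else q)" for j
  have gm: "g j \<in> borel_measurable borel" for j using qm by (simp add: g_def)
  have "(\<integral>\<^sup>+p. prod_state u q N (fst p, (snd p)(i := y)) \<partial>comp_mu mu muR N)
     = (\<integral>\<^sup>+x. (\<integral>\<^sup>+z. prod_state u q N (x, z(i := y)) \<partial>iter_mu muR N) \<partial>mu)"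
    unfolding comp_mu_def using B.nn_integral_fst[OF f] by simp
  also have "\<dots> = (\<integral>\<^sup>+x. u x * (q y * ennreal (R.mass ^ N)) \<partial>mu)"
  proof (rule nn_integral_cong)
    fix x
    have "(\<integral>\<^sup>+z. prod_state u q N (x, z(i := y)) \<partial>iter_mu muR N) = (\<integral>\<^sup>+z. u x * (\<Prod>j<N. g j (z j)) \<partial>iter_mu muR N)"
      unfolding prod_state_def fst_conv snd_conv
      by (intro nn_integral_cong arg_cong2[where f="(*)"] refl prod.cong) (simp add: g_def)
    also have "\<dots> = u x * (\<integral>\<^sup>+z. (\<Prod>j<N. g j (z j)) \<partial>iter_mu muR N)"
    proof (rule nn_integral_cmult)
      have "(\<lambda>z. \<Prod>j<N. g j (z j)) \<in> borel_measurable (PiM {..<N} (\<lambda>_. borel))"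
        by (intro borel_measurable_prod_ennreal measurable_iter_coord[OF gm]) simp
      then show "(\<lambda>z. \<Prod>j<N. g j (z j)) \<in> borel_measurable (iter_mu muR N)"
        by (rule measurable_change_sets[OF _ sets_iter])
    qed
    also have "(\<integral>\<^sup>+z. (\<Prod>j<N. g j (z j)) \<partial>iter_mu muR N) = (\<Prod>j<N. \<integral>\<^sup>+y. g j y \<partial>muR)"
      by (rule nn_integral_iter_prod) (rule gm)
    also have "\<dots> = (\<Prod>j<N. (if j = i then q y else 1) * ennreal R.mass)"
      using q R.total_mass_eq by (intro prod.cong refl) (auto simp: g_def R.MP_iff total_mass_def)
    also have "\<dots> = q y * ennreal (R.mass ^ N)"
      using i R.mass_pos by (simp add: prod.distrib prod.delta ennreal_power)
    finally show "(\<integral>\<^sup>+z. prod_state u q N (x, z(i := y)) \<partial>iter_mu muR N) = u x * (q y * ennreal (R.mass ^ N))" .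
  qed
  also have "\<dots> = total_mass mu * (q y * ennreal (R.mass ^ N))"
    using P.MP_D(4,5)[OF u] by (simp add: nn_integral_multc)
  also have "\<dots> = ennreal (zmass N) * q y"
    using P.mass_pos R.mass_pos by (simp add: P.total_mass_eq zmass_def ennreal_mult mult_ac)
  finally have e: "ennreal (zmass N) * q y = (\<integral>\<^sup>+p. prod_state u q N (fst p, (snd p)(i := y)) \<partial>comp_mu mu muR N)" by simp
  show ?thesis unfolding margi_def by (rule ennreal_inverse_cancel[OF zmass_pos e, symmetric])
qed

lemma prod_state_MC:
  assumes u: "u \<in> P.MP" and q: "q \<in> R.MP"
  shows "prod_state u q N \<in> MC N"
  unfolding MC_iff
proof (intro conjI)
  have um: "u \<in> borel_measurable borel" and qm: "q \<in> borel_measurable borel" using u q by (simp_all add: P.MP_iff R.MP_iff)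
  show m: "prod_state u q N \<in> borel_measurable (MSp N)" by (rule prod_state_measurable[OF um qm])
  have cl: "cmb_prod t p p' \<in> comp_set P PR N" if "p \<in> comp_set P PR N" "p' \<in> comp_set P PR N" "t \<in> {0..1}" for t p p'
    by (rule cmb_prod_closed[OF P.convex_P R.convex_P that])
  show "plc_on cmb_prod (comp_set P PR N) (prod_state u q N)"
    unfolding prod_state_def[abs_def]
  proof (intro plc_on_mult plc_on_prod cl)
    show "plc_on cmb_prod (comp_set P PR N) (\<lambda>p. u (fst p))"
      by (rule plc_on_compose[OF P.MP_D(1)[OF u]]) (auto intro: continuous_intros simp: comp_set_def cmb_prod_def)
    show "plc_on cmb_prod (comp_set P PR N) (\<lambda>p. q (snd p j))" if "j \<in> {..<N}" for j
    proof (rule plc_on_compose[OF R.MP_D(1)[OF q]])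
      show "continuous_on UNIV (\<lambda>p::'a \<times> (nat \<Rightarrow> 'b). snd p j)"
        by (rule continuous_on_product_then_coordinatewise[OF continuous_on_snd[OF continuous_on_id]])
      show "snd p j \<in> PR" if "p \<in> comp_set P PR N" for p
      proof -
        have "snd p \<in> PiE {..<N} (\<lambda>_. PR)" using that unfolding comp_set_def iter_set_def mem_Times_iff by blast
        then show ?thesis using \<open>j \<in> {..<N}\<close> by (rule PiE_mem)
      qed
    qed (simp add: cmb_prod_def)
  qed auto
  have "(\<integral>\<^sup>+p. prod_state u q N p \<partial>comp_mu mu muR N) = ennreal (R.mass ^ N) * (\<integral>\<^sup>+x. marginal muR N (prod_state u q N) x \<partial>mu)"
    using marginal_transfer[OF P.finite_measure_axioms P.sets_mu m, of "\<lambda>_. 1"] by (simp add: comp_mu_def)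
  also have "\<dots> = ennreal (R.mass ^ N) * ennreal P.mass"
    using P.MP_D(5)[OF u] by (simp add: marginal_prod_state[OF q um] P.total_mass_eq)
  also have "\<dots> = ennreal (zmass N)"
    using P.mass_pos R.mass_pos by (simp add: zmass_def ennreal_mult mult.commute)
  finally show "(\<integral>\<^sup>+p. prod_state u q N p \<partial>comp_mu mu muR N) = ennreal (zmass N)" .
qed

lemma AE_pos_finite:
  assumes "u \<in> P.MP" shows "AE x in mu. 0 < u x \<and> u x < \<infinity>"
  using P.AE_mu_P AE_finite_density[OF P.total_mass_eq P.mass_pos P.MP_D(4,5)[OF assms]]
  by eventually_elim (use P.MP_D(6)[OF assms] in auto)

lemma AE_pos_finite_R:
  assumes "q \<in> R.MP" shows "AE y in muR. 0 < q y \<and> q y < \<infinity>"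
  using R.AE_mu_P AE_finite_density[OF R.total_mass_eq R.mass_pos R.MP_D(4,5)[OF assms]]
  by eventually_elim (use R.MP_D(6)[OF assms] in auto)

lemma enn2real_prod_pos_ln:
  assumes "finite I" "\<And>i. i \<in> I \<Longrightarrow> 0 < f i \<and> f i < (\<infinity>::ennreal)"
  shows "0 < enn2real (\<Prod>i\<in>I. f i)" "ln (enn2real (\<Prod>i\<in>I. f i)) = (\<Sum>i\<in>I. ln (enn2real (f i)))"
proof -
  have p: "0 < enn2real (f i)" if "i \<in> I" for i using assms(2)[OF that] by (simp add: enn2real_positive_iff)
  have e: "enn2real (\<Prod>i\<in>I. f i) = (\<Prod>i\<in>I. enn2real (f i))" using assms(1)
    by (induction I rule: finite_induct) (auto simp: enn2real_mult)
  show "0 < enn2real (\<Prod>i\<in>I. f i)" unfolding e by (rule prod_pos) (rule p)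
  show "ln (enn2real (\<Prod>i\<in>I. f i)) = (\<Sum>i\<in>I. ln (enn2real (f i)))" unfolding e
    using assms(1) p by (intro ln_prod) (auto simp: less_imp_neq[symmetric])
qed

lemma prod_state_ln:
  assumes u: "u \<in> P.MP" and q: "q \<in> R.MP"
  shows "AE p in comp_mu mu muR N. 0 < enn2real (prod_state u q N p) \<and>
    ln (enn2real (prod_state u q N p)) = ln (enn2real (u (fst p))) + (\<Sum>j<N. ln (enn2real (q (snd p j))))"
proof -
  have 1: "AE p in comp_mu mu muR N. 0 < u (fst p) \<and> u (fst p) < \<infinity>" by (rule AE_comp_fst[OF AE_pos_finite[OF u]])
  have 2: "AE p in comp_mu mu muR N. \<forall>j\<in>{..<N}. 0 < q (snd p j) \<and> q (snd p j) < \<infinity>"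
  proof (rule AE_finite_allI)
    fix j assume "j \<in> {..<N}"
    then show "AE p in comp_mu mu muR N. 0 < q (snd p j) \<and> q (snd p j) < \<infinity>"
      using AE_comp_snd[OF AE_pos_finite_R[OF q], of j N] by (simp only: lessThan_iff)
  qed simp
  show ?thesis using 1 2
  proof eventually_elim
    case (elim p)
    have a: "0 < enn2real (u (fst p))" using elim by (simp add: enn2real_positive_iff)
    note b = enn2real_prod_pos_ln[OF finite_lessThan, of N "\<lambda>j. q (snd p j)"]
    have b1: "0 < enn2real (\<Prod>j<N. q (snd p j))" and b2: "ln (enn2real (\<Prod>j<N. q (snd p j))) = (\<Sum>j<N. ln (enn2real (q (snd p j))))"
      using b elim by auto
    show ?case unfolding prod_state_def enn2real_mult using a b1 b2 by (simp add: ln_mult)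
  qed
qed

text \<open>The logarithm of a product state is a sum over the factors, so its integral against
  \<open>w\<close> depends only on the marginals of \<open>w\<close>. The lemma is used twice: with
  \<open>w\<close> the product state itself it computes the entropy, and with an arbitrary state and
  its own marginals it computes the cross term in Gibbs' inequality.\<close>

lemma integral_ln_prod_state:
  assumes w: "w \<in> MC N" and u: "u \<in> P.MP" "H_fin mu u" and q: "q \<in> R.MP" "H_fin muR q"
    and mu_w: "\<And>x. marginal muR N w x = u x"
    and mi_w: "\<And>\<phi>. \<phi> \<in> borel_measurable borel \<Longrightarrow>
        (\<Sum>i<N. \<integral>\<^sup>+y. margi N i w y * \<phi> y \<partial>muR) = ennreal (real N) * (\<integral>\<^sup>+y. q y * \<phi> y \<partial>muR)"
  shows "integrable (comp_mu mu muR N) (\<lambda>p. enn2real (w p) * ln (enn2real (prod_state u q N p)))"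
    and "(\<integral>p. enn2real (w p) * ln (enn2real (prod_state u q N p)) \<partial>comp_mu mu muR N)
       = zmass N * (H_int mu u / P.mass + real N * (H_int muR q / R.mass))"
proof -
  let ?Z = "comp_mu mu muR N"
  have wD: "w \<in> borel_measurable (MSp N)" "(\<integral>\<^sup>+p. w p \<partial>?Z) = ennreal (zmass N)" using w by (auto simp: MC_iff)
  have wZ: "w \<in> borel_measurable ?Z" by (rule measurable_change_sets[OF wD(1) sets_comp])
  have wfin: "AE p in ?Z. w p < \<infinity>"
    by (rule AE_finite_density[OF mass_comp zmass_pos wZ]) (simp add: wD(2) mass_comp)
  have ufin: "AE x in mu. u x < \<infinity>" using AE_pos_finite[OF u(1)] by eventually_elim simp
  have qfin: "AE y in muR. q y < \<infinity>" using AE_pos_finite_R[OF q(1)] by eventually_elim simp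
  have tr1: "(\<Sum>i\<in>{0::nat}. \<integral>\<^sup>+p. w p * \<phi> (fst p) \<partial>?Z) = ennreal (R.mass ^ N) * (\<integral>\<^sup>+x. u x * \<phi> x \<partial>mu)"
    if "\<phi> \<in> borel_measurable mu" for \<phi>
    using marginal_transfer[OF P.finite_measure_axioms P.sets_mu wD(1) measurable_change_sets[OF that P.sets_mu[symmetric]]]
    by (simp add: comp_mu_def mu_w)
  have \<kappa>: "0 \<le> zmass N / R.mass * real N" using zmass_pos[of N] R.mass_pos by simp
  have tr2: "(\<Sum>i<N. \<integral>\<^sup>+p. w p * \<phi> (snd p i) \<partial>?Z) = ennreal (zmass N / R.mass * real N) * (\<integral>\<^sup>+y. q y * \<phi> y \<partial>muR)"
    if "\<phi> \<in> borel_measurable muR" for \<phi>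
  proof -
    have \<phi>: "\<phi> \<in> borel_measurable borel" by (rule measurable_change_sets[OF that R.sets_mu[symmetric]])
    have "(\<Sum>i<N. \<integral>\<^sup>+p. w p * \<phi> (snd p i) \<partial>?Z) = (\<Sum>i<N. ennreal (zmass N / R.mass) * (\<integral>\<^sup>+y. margi N i w y * \<phi> y \<partial>muR))"
      using margi_transfer[OF _ R.finite_measure_axioms R.sets_mu wD(1) \<phi>] unfolding coord_measure_muR comp_mu_def
      by (intro sum.cong refl) simp
    also have "\<dots> = ennreal (zmass N / R.mass) * (ennreal (real N) * (\<integral>\<^sup>+y. q y * \<phi> y \<partial>muR))"
      unfolding sum_distrib_left[symmetric] mi_w[OF \<phi>] ..
    also have "\<dots> = ennreal (zmass N / R.mass * real N) * (\<integral>\<^sup>+y. q y * \<phi> y \<partial>muR)"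
      using zmass_pos[of N] R.mass_pos by (subst ennreal_mult) (auto simp: mult.assoc)
    finally show ?thesis .
  qed
  have fm: "fst \<in> measurable ?Z mu" by (simp add: comp_mu_def)
  have sm: "(\<lambda>p. snd p i) \<in> measurable ?Z muR" if "i \<in> {..<N}" for i
    using measurable_change_sets[OF measurable_coord[of i N] sets_comp] that
    by (subst measurable_cong_sets[OF refl R.sets_mu]) simp
  have Rn: "0 \<le> R.mass ^ N" using R.mass_pos by simp
  have A: "integrable ?Z (\<lambda>p. enn2real (w p) * ln (enn2real (u (fst p))))"
      "(\<integral>p. enn2real (w p) * ln (enn2real (u (fst p))) \<partial>?Z) = R.mass ^ N * H_int mu u"
    using integral_ln_transfer[of "{0::nat}" "\<lambda>_. fst" ?Z mu w u "R.mass ^ N", OF _ fm wZ P.MP_D(4)[OF u(1)] wfin ufin tr1 Rn u(2)]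
    by simp_all
  have B: "integrable ?Z (\<lambda>p. enn2real (w p) * (\<Sum>i<N. ln (enn2real (q (snd p i)))))"
      "(\<integral>p. enn2real (w p) * (\<Sum>i<N. ln (enn2real (q (snd p i)))) \<partial>?Z) = zmass N / R.mass * real N * H_int muR q"
    using integral_ln_transfer[of "{..<N}" "\<lambda>i p. snd p i" ?Z muR w q "zmass N / R.mass * real N", OF _ sm wZ R.MP_D(4)[OF q(1)] wfin qfin tr2 \<kappa> q(2)]
    by simp_all
  let ?L = "\<lambda>p. enn2real (w p) * ln (enn2real (u (fst p))) + enn2real (w p) * (\<Sum>i<N. ln (enn2real (q (snd p i))))"
  have ae: "AE p in ?Z. enn2real (w p) * ln (enn2real (prod_state u q N p)) = ?L p"
    using prod_state_ln[OF u(1) q(1)] by eventually_elim (simp add: distrib_left)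
  have iL: "integrable ?Z ?L" using A(1) B(1) by simp
  have pm: "prod_state u q N \<in> borel_measurable ?Z"
    by (rule measurable_change_sets[OF prod_state_measurable sets_comp]) (use u q in \<open>auto simp: P.MP_iff R.MP_iff\<close>)
  have m1: "(\<lambda>p. enn2real (w p) * ln (enn2real (prod_state u q N p))) \<in> borel_measurable ?Z" using wZ pm by measurable
  have m2: "?L \<in> borel_measurable ?Z" using iL by (rule borel_measurable_integrable)
  show "integrable ?Z (\<lambda>p. enn2real (w p) * ln (enn2real (prod_state u q N p)))"
    using iL by (subst integrable_cong_AE[OF m1 m2 ae])
  have "(\<integral>p. enn2real (w p) * ln (enn2real (prod_state u q N p)) \<partial>?Z) = (\<integral>p. ?L p \<partial>?Z)"
    by (rule integral_cong_AE[OF m1 m2 ae])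
  also have "\<dots> = R.mass ^ N * H_int mu u + zmass N / R.mass * real N * H_int muR q"
    using A B by simp
  also have "\<dots> = zmass N * (H_int mu u / P.mass + real N * (H_int muR q / R.mass))"
    using P.mass_pos by (simp add: zmass_def distrib_left)
  finally show "(\<integral>p. enn2real (w p) * ln (enn2real (prod_state u q N p)) \<partial>?Z) = zmass N * (H_int mu u / P.mass + real N * (H_int muR q / R.mass))" .
qed

theorem composite_product:
  assumes u: "u \<in> P.MP" "int_energy mu bd u = ennreal e0" "0 \<le> e0"
    and q: "q \<in> R.MP" "int_energy muR bdR q = ennreal e1" "0 \<le> e1"
  shows "prod_state u q N \<in> MC N"
    and "int_energy (comp_mu mu muR N) (comp_sigma mu bd muR bdR N) (prod_state u q N) = ennreal (e0 + real N * e1)"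
    and "entropy (comp_mu mu muR N) (prod_state u q N) = ereal (- H_int mu u / P.mass + real N * (- H_int muR q / R.mass))"
proof -
  let ?Z = "comp_mu mu muR N" and ?w = "prod_state u q N"
  have um: "u \<in> borel_measurable borel" and qm: "q \<in> borel_measurable borel" using u q by (simp_all add: P.MP_iff R.MP_iff)
  show w: "?w \<in> MC N" by (rule prod_state_MC[OF u(1) q(1)])
  have m: "?w \<in> borel_measurable (MSp N)" by (rule prod_state_measurable[OF um qm])
  have marg: "marginal muR N ?w x = u x" for x by (rule marginal_prod_state[OF q(1) um])
  have mar: "marginal muR N ?w = u" by (rule ext) (rule marg)
  have margi: "margi N i ?w = q" if "i < N" for i by (rule ext) (rule margi_prod_state[OF u(1) q(1) that])
  have "int_energy ?Z (comp_sigma mu bd muR bdR N) ?w = int_energy mu bd u + (\<Sum>i<N. int_energy muR bdR q)"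
    unfolding energy_split[OF m] mar using margi by (intro arg_cong2[where f="(+)"] refl sum.cong) auto
  also have "\<dots> = ennreal e0 + ennreal (real N) * ennreal e1"
    by (simp add: u q ennreal_of_nat_eq_real_of_nat)
  also have "\<dots> = ennreal (e0 + real N * e1)"
    using u(3) q(3) by (simp add: ennreal_mult ennreal_plus)
  finally show "int_energy ?Z (comp_sigma mu bd muR bdR N) ?w = ennreal (e0 + real N * e1)" .
  have uH: "H_fin mu u" by (rule P.finite_energy_H(1)[OF u(1)]) (simp add: u)
  have qH: "H_fin muR q" by (rule R.finite_energy_H(1)[OF q(1)]) (simp add: q)
  have mi: "(\<Sum>i<N. \<integral>\<^sup>+y. margi N i ?w y * \<phi> y \<partial>muR) = ennreal (real N) * (\<integral>\<^sup>+y. q y * \<phi> y \<partial>muR)" for \<phi>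
    using margi by (simp add: ennreal_of_nat_eq_real_of_nat)
  note L = integral_ln_prod_state[OF w u(1) uH q(1) qH marg mi]
  have H: "H_fin ?Z ?w" and Hi: "H_int ?Z ?w = zmass N * (H_int mu u / P.mass + real N * (H_int muR q / R.mass))"
    using L by (simp_all add: H_fin_def H_int_def)
  have wZ: "?w \<in> borel_measurable ?Z" by (rule measurable_change_sets[OF m sets_comp])
  have "entropy ?Z ?w = ereal (- H_int ?Z ?w / zmass N)"
    by (rule entropy_eq[OF mass_comp zmass_pos wZ _ H]) (use w in \<open>simp add: MC_iff mass_comp\<close>)
  also have "- H_int ?Z ?w / zmass N = - H_int mu u / P.mass + real N * (- H_int muR q / R.mass)"
    unfolding Hi using zmass_pos[of N] by simp
  finally show "entropy ?Z ?w = ereal (- H_int mu u / P.mass + real N * (- H_int muR q / R.mass))" .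
qed

text \<open>Subadditivity of the entropy is Gibbs' inequality against the product of the marginal on \<open>P\<close> and the averaged
  marginal on \<open>PR\<close>.\<close>
theorem composite_marginals:
  assumes w: "w \<in> MC N" and N: "0 < N"
    and e: "int_energy (comp_mu mu muR N) (comp_sigma mu bd muR bdR N) w = ennreal e" "0 \<le> e"
  obtains e0 e1 where "0 \<le> e0" "0 \<le> e1" "e = e0 + real N * e1"
    "int_energy mu bd (marginal muR N w) = ennreal e0" "int_energy muR bdR (avg N w) = ennreal e1"
    "entropy (comp_mu mu muR N) w \<le> ereal (- H_int mu (marginal muR N w) / P.mass + real N * (- H_int muR (avg N w) / R.mass))"
proof -
  let ?Z = "comp_mu mu muR N" and ?u = "marginal muR N w" and ?q = "avg N w"
  have wD: "w \<in> borel_measurable (MSp N)" "(\<integral>\<^sup>+p. w p \<partial>?Z) = ennreal (zmass N)" using w by (auto simp: MC_iff)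
  have u: "?u \<in> P.MP" by (rule marginal_MP[OF w])
  have q: "?q \<in> R.MP" by (rule avg_MP[OF w N])
  have Rb [measurable_cong]: "sets bdR = sets borel" by simp
  have "(\<Sum>i<N. int_energy muR bdR (margi N i w)) = ennreal (real N) * int_energy muR bdR ?q"
  proof -
    have "(\<Sum>i<N. int_energy muR bdR (margi N i w)) = ennreal (1 / R.mass) * (\<Sum>i<N. \<integral>\<^sup>+y. margi N i w y \<partial>bdR)"
      by (simp add: int_energy_def R.total_mass_eq div_ennreal_eq[OF R.mass_pos] sum_distrib_left)
    also have "(\<Sum>i<N. \<integral>\<^sup>+y. margi N i w y \<partial>bdR) = ennreal (real N) * (\<integral>\<^sup>+y. ?q y \<partial>bdR)"
      using nn_integral_avg[OF _ wD(1) N Rb, of "\<lambda>_. 1"] by simp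
    finally show ?thesis by (simp add: int_energy_def R.total_mass_eq div_ennreal_eq[OF R.mass_pos] mult.left_commute)
  qed
  then have E: "ennreal e = int_energy mu bd ?u + ennreal (real N) * int_energy muR bdR ?q"
    using energy_split[OF wD(1)] e(1) by simp
  have "int_energy mu bd ?u \<le> ennreal e" unfolding E by simp
  then have "int_energy mu bd ?u < \<infinity>" by (rule order_le_less_trans) simp
  then obtain e0 where e0: "int_energy mu bd ?u = ennreal e0" "0 \<le> e0" by (rule ennreal_finiteE)
  have "ennreal (real N) * int_energy muR bdR ?q \<le> ennreal e" unfolding E by simp
  then have "ennreal (real N) * int_energy muR bdR ?q < \<infinity>" by (rule order_le_less_trans) simp
  then have "int_energy muR bdR ?q < \<infinity>" using N by (auto simp: ennreal_mult_less_top)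
  then obtain e1 where e1: "int_energy muR bdR ?q = ennreal e1" "0 \<le> e1" by (rule ennreal_finiteE)
  have "ennreal e = ennreal (e0 + real N * e1)"
    unfolding E e0 e1 using e0(2) e1(2) by (simp add: ennreal_mult ennreal_plus)
  moreover have "0 \<le> e0 + real N * e1" using e0(2) e1(2) by simp
  ultimately have ee: "e = e0 + real N * e1" using e(2) by (metis enn2real_ennreal)
  have uH: "H_fin mu ?u" by (rule P.finite_energy_H(1)[OF u]) (simp add: e0)
  have qH: "H_fin muR ?q" by (rule R.finite_energy_H(1)[OF q]) (simp add: e1)
  have mi: "(\<Sum>i<N. \<integral>\<^sup>+y. margi N i w y * \<phi> y \<partial>muR) = ennreal (real N) * (\<integral>\<^sup>+y. ?q y * \<phi> y \<partial>muR)"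
    if "\<phi> \<in> borel_measurable borel" for \<phi>
    by (rule nn_integral_avg[OF that wD(1) N R.sets_mu])
  note L = integral_ln_prod_state[OF w u uH q qH refl mi]
  have wZ: "w \<in> borel_measurable ?Z" by (rule measurable_change_sets[OF wD(1) sets_comp])
  have wi: "(\<integral>\<^sup>+p. w p \<partial>?Z) = total_mass ?Z" using wD(2) by (simp add: mass_comp)
  have "entropy ?Z w \<le> ereal (- H_int mu ?u / P.mass + real N * (- H_int muR ?q / R.mass))"
  proof (cases "H_fin ?Z w")
    case False
    then show ?thesis using entropy_eq_minus_infty[OF mass_comp zmass_pos wZ wi] by simp
  next
    case True
    let ?g = "prod_state ?u ?q N"
    have g: "?g \<in> MC N" by (rule prod_state_MC[OF u q])
    have gZ: "?g \<in> borel_measurable ?Z" using g by (auto simp: MC_iff intro: measurable_change_sets[OF _ sets_comp])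
    have gi: "(\<integral>\<^sup>+p. ?g p \<partial>?Z) = total_mass ?Z" using g by (simp add: MC_iff mass_comp)
    have "(\<integral>p. enn2real (w p) * ln (enn2real (?g p)) \<partial>?Z) \<le> (\<integral>p. enn2real (w p) * ln (enn2real (w p)) \<partial>?Z)"
    proof (rule Gibbs_inequality[OF _ _ _ L(1)])
      show "integrable ?Z (\<lambda>p. enn2real (w p))" by (rule density_integrable[OF mass_comp zmass_pos wZ wi])
      show "integrable ?Z (\<lambda>p. enn2real (?g p))" by (rule density_integrable[OF mass_comp zmass_pos gZ gi])
      show "integrable ?Z (\<lambda>p. enn2real (w p) * ln (enn2real (w p)))" using True by (simp add: H_fin_def)
      show "AE p in ?Z. 0 \<le> enn2real (w p)" by (rule AE_I2) simp
      \<comment> \<open>Product states are positive and finite almost everywhere, so the logarithm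
        in the cross term is a genuine one.\<close>
      show "AE p in ?Z. 0 < enn2real (?g p)" using prod_state_ln[OF u q] by eventually_elim simp
      show "(\<integral>p. enn2real (?g p) \<partial>?Z) \<le> (\<integral>p. enn2real (w p) \<partial>?Z)"
        by (simp add: density_integral[OF mass_comp zmass_pos wZ wi] density_integral[OF mass_comp zmass_pos gZ gi])
    qed
    then have "zmass N * (H_int mu ?u / P.mass + real N * (H_int muR ?q / R.mass)) \<le> H_int ?Z w"
      using L(2) unfolding H_int_def[of ?Z w] by (simp only:)
    then have "H_int mu ?u / P.mass + real N * (H_int muR ?q / R.mass) \<le> H_int ?Z w / zmass N"
      using zmass_pos[of N] by (simp add: pos_le_divide_eq mult.commute)
    then show ?thesis using entropy_eq[OF mass_comp zmass_pos wZ wi True] by simp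
  qed
  then show ?thesis by (intro that[OF e0(2) e1(2) ee e0(1) e1(1)])
qed

end

subsection \<open>Convergence to the canonical distribution\<close>

context system
begin

abbreviation mid :: "('a \<Rightarrow> ennreal) \<Rightarrow> ('a \<Rightarrow> ennreal) \<Rightarrow> 'a \<Rightarrow> ennreal" where
  "mid u v \<equiv> \<lambda>x. ennreal (1 - 1/2) * u x + ennreal (1/2) * v x"

lemma mid_MP:
  assumes u: "u \<in> MP" "int_energy mu bd u = ennreal e" "0 \<le> e"
    and v: "v \<in> MP" "int_energy mu bd v = ennreal e'" "0 \<le> e'"
  shows "mid u v \<in> MP" "int_energy mu bd (mid u v) = ennreal ((e + e') / 2)"
proof -
  show "mid u v \<in> MP" by (rule MP_mix(1)[OF u(1) v(1)]) auto
  have "int_energy mu bd (mid u v) = ennreal (1 - 1/2) * ennreal e + ennreal (1/2) * ennreal e'"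
    unfolding u(2)[symmetric] v(2)[symmetric] by (rule MP_mix(2)[OF u(1) v(1)]) auto
  also have "\<dots> = ennreal ((1 - 1/2) * e + (1/2) * e')"
  proof -
    have h: "0 \<le> (1 - 1/2 :: real)" "0 \<le> (1/2 :: real)" by simp_all
    show ?thesis
      unfolding ennreal_plus[OF mult_nonneg_nonneg[OF h(1) u(3)] mult_nonneg_nonneg[OF h(2) v(3)]]
        ennreal_mult[OF h(1) u(3)] ennreal_mult[OF h(2) v(3)] ..
  qed
  also have "(1 - 1/2) * e + (1/2) * e' = (e + e') / 2" by simp
  finally show "int_energy mu bd (mid u v) = ennreal ((e + e') / 2)" .
qed

text \<open>The energy bound supplies uniform L^q bounds for some \<open>q > p\<close>, and the
  vanishing midpoint defect gives L^1 convergence; interpolation does the rest.\<close>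

lemma Lp_convergence:
  fixes W :: "nat \<Rightarrow> 'a \<Rightarrow> ennreal"
  assumes W: "\<And>N. W N \<in> MP" and u: "u \<in> MP"
    and k: "0 \<le> k" "int_energy mu bd u \<le> ennreal k"
      "eventually (\<lambda>N. int_energy mu bd (W N) \<le> ennreal k) sequentially"
    and gap: "\<And>\<epsilon>. 0 < \<epsilon> \<Longrightarrow> eventually (\<lambda>N. (H_int mu (W N) + H_int mu u) / 2 - H_int mu (mid (W N) u) \<le> \<epsilon>) sequentially"
    and p: "1 \<le> p" "p < real DIM('a) / (real DIM('a) - 1)" and dim: "2 \<le> DIM('a)"
  shows "(\<lambda>N. Lp_dist_p mu p (W N) u) \<longlonglongrightarrow> 0"
proof -
  let ?n = "real DIM('a)"
  have n: "0 < ?n - 1" using dim by simp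
  \<comment> \<open>Halfway between \<open>p\<close> and the critical exponent, hence above
    \<open>p\<close> and still admissible for \<open>energy_Lq_bound\<close>.\<close>
  define q where "q = (p + ?n / (?n - 1)) / 2"
  have q: "p < q" "q < ?n / (?n - 1)" 
  proof -
    have "p < (p + r) / 2 \<and> (p + r) / 2 < r" if "p < r" for r :: real using that by simp
    from this[OF p(2)] show "p < q" "q < ?n / (?n - 1)" unfolding q_def by blast+
  qed
  have q1: "1 < q" using q p by simp
  have "(q - 1) * (?n - 1) < 1"
  proof -
    have "q * (?n - 1) < ?n" using q(2) n by (simp add: pos_less_divide_eq)
    then show ?thesis by (simp add: algebra_simps)
  qed
  then have q2: "(?n - 1) * (q - 1) < 1" by (simp add: mult.commute)
  have km: "0 \<le> k * mass" using k mass_pos by simp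
  obtain C where C: "0 \<le> C" "\<And>u. u \<in> borel_measurable borel \<Longrightarrow> log_convex_on cmb_lin P u \<Longrightarrow>
     (\<integral>\<^sup>+y. u y \<partial>bd) \<le> ennreal (k * mass) \<Longrightarrow> (\<integral>\<^sup>+x. ennreal (enn2real (u x) powr q) \<partial>mu) \<le> ennreal C"
    by (fact energy_Lq_bound[OF q1 q2 km])
  have Cb: "(\<integral>\<^sup>+x. ennreal (enn2real (v x) powr q) \<partial>mu) \<le> ennreal C"
    if v: "v \<in> MP" and e: "int_energy mu bd v \<le> ennreal k" for v
  proof (rule C(2)[OF MP_D(3,2)[OF v]])
    show "(\<integral>\<^sup>+y. v y \<partial>bd) \<le> ennreal (k * mass)"
      unfolding boundary_integral_eq using e k(1) mass_pos by (simp add: ennreal_mult mult_right_mono)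
  qed
  have fin: "H_fin mu v" if v: "v \<in> MP" and e: "int_energy mu bd v \<le> ennreal k" for v
    by (rule finite_energy_H(1)[OF v]) (use e in \<open>simp add: order_le_less_trans\<close>)
  have uH: "H_fin mu u" by (rule fin[OF u k(2)])
  have int: "integrable mu (\<lambda>x. enn2real (v x))" if "v \<in> MP" for v
    by (rule density_integrable[OF total_mass_eq mass_pos MP_D(4,5)[OF that]])
  have L1: "(\<lambda>N. \<integral>\<^sup>+x. ennreal \<bar>enn2real (W N x) - enn2real (u x)\<bar> \<partial>mu) \<longlonglongrightarrow> 0"
  proof (rule order_tendstoI)
    fix c :: ennreal assume "0 < c"
    then obtain r where r: "0 < r" "ennreal r < c"
      by (metis dense ennreal_cases ennreal_less_zero_iff infinity_ennreal_def less_irrefl not_less top_greatest)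
    \<comment> \<open>The error is split evenly: \<open>2 * \<eta> * mass = r / 2\<close>, and a
      defect of at most \<open>\<eta> * r / 4\<close> contributes another \<open>r / 2\<close> after
      multiplication by \<open>2 / \<eta>\<close>.\<close>
    define \<eta> where "\<eta> = r / (4 * mass)"
    have eta: "0 < \<eta>" using r mass_pos by (simp add: \<eta>_def)
    have em: "2 * \<eta> * mass = r / 2" using mass_pos by (simp add: \<eta>_def)
    have "0 < \<eta> * r / 4" using eta r by simp
    from gap[OF this] k(3) show "eventually (\<lambda>N. (\<integral>\<^sup>+x. ennreal \<bar>enn2real (W N x) - enn2real (u x)\<bar> \<partial>mu) < c) sequentially"
    proof eventually_elim
      case (elim N)
      have "(\<integral>x. \<bar>enn2real (W N x) - enn2real (u x)\<bar> \<partial>mu)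
        \<le> (2 / \<eta>) * ((H_int mu (W N) + H_int mu u) / 2 - H_int mu (mid (W N) u)) + 2 * \<eta> * mass"
        by (rule H_int_mid_gap[OF W fin[OF W elim(2)] u uH eta order_refl])
      also have "(2 / \<eta>) * ((H_int mu (W N) + H_int mu u) / 2 - H_int mu (mid (W N) u)) \<le> (2 / \<eta>) * (\<eta> * r / 4)"
        using elim(1) eta by (intro mult_left_mono) auto
      also have "(2 / \<eta>) * (\<eta> * r / 4) = r / 2" using eta by simp
      finally have le: "(\<integral>x. \<bar>enn2real (W N x) - enn2real (u x)\<bar> \<partial>mu) \<le> r" using em by simp
      have "(\<integral>\<^sup>+x. ennreal \<bar>enn2real (W N x) - enn2real (u x)\<bar> \<partial>mu) = ennreal (\<integral>x. \<bar>enn2real (W N x) - enn2real (u x)\<bar> \<partial>mu)"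
        by (intro nn_integral_eq_integral integrable_abs Bochner_Integration.integrable_diff int W u) auto
      also have "\<dots> \<le> ennreal r" by (rule ennreal_leI[OF le])
      finally show ?case using r(2) by simp
    qed
  qed auto
  show ?thesis
    unfolding Lp_dist_p_def
  proof (rule Lp_dist_tendsto_interpolation[OF _ _ _ _ p(1) q(1) _ Cb[OF u k(2)] L1])
    show "eventually (\<lambda>N. (\<integral>\<^sup>+x. ennreal (enn2real (W N x) powr q) \<partial>mu) \<le> ennreal C) sequentially"
      using k(3) by eventually_elim (rule Cb[OF W])
    show "(\<lambda>x. enn2real (W N x)) \<in> borel_measurable mu" for N using MP_D(4)[OF W[of N]] by measurable
    show "(\<lambda>x. enn2real (u x)) \<in> borel_measurable mu" using MP_D(4)[OF u] by measurable
  qed auto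
qed

text \<open>Comparison with the constant state 1. For positive temperature, finite free energy
  forces a real entropy, so infinite energy could not be compensated.\<close>

lemma canonical_finite_energy:
  assumes can: "is_canonical cmb_lin P mu bd T u" and T: "0 \<le> T"
  shows "u \<in> MP" "int_energy mu bd u < \<infinity>"
proof -
  show u: "u \<in> MP" using can by (simp add: is_canonical_def)
  show "int_energy mu bd u < \<infinity>"
  proof (cases "0 < T")
    case False
    then have "int_energy mu bd u \<le> int_energy mu bd (\<lambda>_. 1)" using can one_MP by (simp add: is_canonical_def)
    then show ?thesis using int_energy_one_finite by (rule order_le_less_trans)
  next
    case True
    have le: "free_energy mu bd T u \<le> free_energy mu bd T (\<lambda>_. 1)" using can True one_MP by (simp add: is_canonical_def)
    obtain e where e: "int_energy mu bd (\<lambda>_. 1) = ennreal e" "0 \<le> e" by (rule ennreal_finiteE[OF int_energy_one_finite])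
    have "free_energy mu bd T (\<lambda>_. 1) < \<infinity>"
      using finite_energy_H(3)[OF one_MP int_energy_one_finite] e
      by (simp add: free_energy_def enn2ereal_ennreal)
    with le have fin: "free_energy mu bd T u < \<infinity>" by (rule order_le_less_trans)
    show ?thesis
    proof (rule ccontr)
      assume "\<not> int_energy mu bd u < \<infinity>"
      then have inf: "int_energy mu bd u = \<infinity>" by (metis infinity_ennreal_def less_top)
      have ne: "entropy mu u \<noteq> - \<infinity>" using fin by (auto simp: free_energy_def)
      then have "H_fin mu u" using entropy_eq_minus_infty[OF total_mass_eq mass_pos MP_D(4,5)[OF u]] by blast
      then obtain s where "entropy mu u = ereal s" using entropy_eq[OF total_mass_eq mass_pos MP_D(4,5)[OF u]] by blast
      then have "free_energy mu bd T u = \<infinity>" using inf by (simp add: free_energy_def)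
      then show False using fin by simp
    qed
  qed
qed

end

section \<open>Asymptotics of the marginals of the equilibria\<close>

locale bath_system = product_system P mu bd PR muR bdR + B: mild_system PR muR bdR T UR
  for P :: "'a::euclidean_space set" and mu bd and PR :: "'b::euclidean_space set" and muR bdR and T UR :: real +
  fixes E :: real and ut :: "nat \<Rightarrow> 'a \<times> (nat \<Rightarrow> 'b) \<Rightarrow> ennreal" and ucan :: "'a \<Rightarrow> ennreal"
  assumes E: "E \<in> U_star cmb_lin P mu bd"
    and eq: "\<And>N. is_equilibrium cmb_prod (comp_set P PR N) (comp_mu mu muR N)
                   (comp_sigma mu bd muR bdR N) (E + real N * UR) (ut N)"
    and can: "is_canonical cmb_lin P mu bd T ucan"
begin

abbreviation "W N \<equiv> marginal muR N (ut N)"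

lemma W_MP: "W N \<in> P.MP"
  by (rule marginal_MP) (use eq in \<open>simp add: is_equilibrium_def\<close>)

lemma ucan_MP: "ucan \<in> P.MP" and ucan_energy: "int_energy mu bd ucan < \<infinity>"
  using P.canonical_finite_energy[OF can B.T] by auto

definition ec :: real where "ec = enn2real (int_energy mu bd ucan)"

lemma ec: "int_energy mu bd ucan = ennreal ec" "0 \<le> ec"
  using ucan_energy by (auto simp: ec_def)

definition sP :: "('a \<Rightarrow> ennreal) \<Rightarrow> real" where "sP u = - H_int mu u / P.mass"

lemma sP_nonpos: "u \<in> P.MP \<Longrightarrow> int_energy mu bd u = ennreal e \<Longrightarrow> sP u \<le> 0"
  using P.finite_energy_H(2)[of u] P.mass_pos by (simp add: sP_def)

lemma E_nonneg: "0 \<le> E"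
  using E by (simp add: U_star_def)

text \<open>By maximality against the product states \<open>ucan \<otimes> q\<^sup>N\<close> of the same energy.\<close>
lemma equilibrium_comparison:
  assumes N: "0 < N"
  obtains e0 e1 s1 where "0 \<le> e0" "int_energy mu bd (W N) = ennreal e0" "(e1, s1) \<in> R.ES"
    "e1 = UR + (E - e0) / real N"
    "\<And>s'. (UR + (E - ec) / real N, s') \<in> R.ES \<Longrightarrow> sP ucan + real N * s' \<le> sP (W N) + real N * s1"
proof -
  have ut: "ut N \<in> MC N"
    "int_energy (comp_mu mu muR N) (comp_sigma mu bd muR bdR N) (ut N) = ennreal (E + real N * UR)"
    "\<And>v. v \<in> MC N \<Longrightarrow> int_energy (comp_mu mu muR N) (comp_sigma mu bd muR bdR N) v = ennreal (E + real N * UR)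
      \<Longrightarrow> entropy (comp_mu mu muR N) v \<le> entropy (comp_mu mu muR N) (ut N)"
    using eq[of N] by (auto simp: is_equilibrium_def)
  have nn: "0 \<le> E + real N * UR" using E_nonneg B.UR_bounds by simp
  obtain e0 e1 where e: "0 \<le> e0" "0 \<le> e1" "E + real N * UR = e0 + real N * e1"
    "int_energy mu bd (W N) = ennreal e0" "int_energy muR bdR (avg N (ut N)) = ennreal e1"
    "entropy (comp_mu mu muR N) (ut N) \<le> ereal (- H_int mu (W N) / P.mass + real N * (- H_int muR (avg N (ut N)) / R.mass))"
    by (fact composite_marginals[OF ut(1) N ut(2) nn])
  define s1 where "s1 = - H_int muR (avg N (ut N)) / R.mass"
  show ?thesis
  proof (rule that[OF e(1,4)])
    show "(e1, s1) \<in> R.ES" unfolding s1_def by (rule R.ES_I[OF avg_MP[OF ut(1) N] e(2,5)])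
    show "e1 = UR + (E - e0) / real N" using e(3) N by (simp add: field_simps)
    fix s' assume "(UR + (E - ec) / real N, s') \<in> R.ES"
    then obtain q where q: "q \<in> R.MP" "int_energy muR bdR q = ennreal (UR + (E - ec) / real N)" "0 \<le> UR + (E - ec) / real N"
      "s' = - H_int muR q / R.mass" by (auto simp: R.ES_def)
    have "ec + real N * (UR + (E - ec) / real N) = E + real N * UR" using N by (simp add: field_simps)
    then have "entropy (comp_mu mu muR N) (prod_state ucan q N) \<le> entropy (comp_mu mu muR N) (ut N)"
      using composite_product(1,2)[OF ucan_MP ec q(1-3), of N] by (intro ut(3)) simp_all
    also have "\<dots> \<le> ereal (sP (W N) + real N * s1)" using e(6) by (simp add: sP_def s1_def)
    finally have "ereal (sP ucan + real N * s') \<le> ereal (sP (W N) + real N * s1)"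
      unfolding composite_product(3)[OF ucan_MP ec q(1-3), of N] by (simp add: sP_def q(4))
    then show "sP ucan + real N * s' \<le> sP (W N) + real N * s1" by simp
  qed
qed

lemma gap_eq:
  "(H_int mu u + H_int mu v) / 2 - H_int mu w = P.mass * (sP w - (sP u + sP v) / 2)"
  using P.mass_pos by (simp add: sP_def field_simps)

text \<open>The tangent line bounds the reservoir entropy of the equilibrium from above by its
  linear part \<open>(E - e0) / T\<close>, while the competitor built on \<open>ucan\<close> has
  almost \<open>(E - ec) / T\<close>. In the comparison the terms of order \<open>N\<close> cancel
  and the free energies on \<open>P\<close> remain.\<close>

lemma positive_temperature_asymptotics:
  assumes T: "0 < T" and \<epsilon>: "0 < \<epsilon>"
  shows "eventually (\<lambda>N. \<exists>e0\<ge>0. int_energy mu bd (W N) = ennreal e0 \<and> e0 - T * sP (W N) \<le> ec - T * sP ucan + \<epsilon>) sequentially"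
proof -
  have "0 < \<epsilon> / T" using T \<epsilon> by simp
  from B.tangent(2)[OF T this, of "E - ec"] eventually_gt_at_top[of 0] show ?thesis
  proof eventually_elim
    case (elim N)
    then obtain s where s: "(UR + (E - ec) / real N, s) \<in> R.ES" "(E - ec) / T - \<epsilon> / T \<le> real N * (s - R.sv UR)" by blast
    have N: "0 < N" by (rule elim(2))
    obtain e0 e1 s1 where e: "0 \<le> e0" "int_energy mu bd (W N) = ennreal e0" "(e1, s1) \<in> R.ES"
      "e1 = UR + (E - e0) / real N"
      "\<And>s'. (UR + (E - ec) / real N, s') \<in> R.ES \<Longrightarrow> sP ucan + real N * s' \<le> sP (W N) + real N * s1"
      by (fact equilibrium_comparison[OF N])
    have "s1 \<le> R.sv UR + (e1 - UR) / T" by (rule B.tangent(1)[OF T e(3)])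
    then have "real N * (s1 - R.sv UR) \<le> real N * ((e1 - UR) / T)" by (intro mult_left_mono) auto
    also have "\<dots> = (E - e0) / T" using N by (simp add: e(4))
    finally have 1: "real N * s1 - real N * R.sv UR \<le> (E - e0) / T" by (simp add: right_diff_distrib)
    have 2: "(E - ec) / T - \<epsilon> / T \<le> real N * s - real N * R.sv UR" using s(2) by (simp add: right_diff_distrib)
    have "sP ucan + (E - ec) / T - \<epsilon> / T \<le> sP (W N) + (E - e0) / T"
      using e(5)[OF s(1)] 1 2 by linarith
    then have "T * (sP ucan + (E - ec) / T - \<epsilon> / T) \<le> T * (sP (W N) + (E - e0) / T)"
      using T by (intro mult_left_mono) auto
    moreover have "T * (x / T) = x" for x using T by simp
    ultimately have "T * sP ucan + (E - ec) - \<epsilon> \<le> T * sP (W N) + (E - e0)"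
      by (simp only: distrib_left right_diff_distrib)
    then have "e0 - T * sP (W N) \<le> ec - T * sP ucan + \<epsilon>" by linarith
    then show ?case using e(1,2) by blast
  qed
qed

text \<open>Energy kept in \<open>P\<close> above the minimum is missing in the reservoir, whose
  entropy has infinite slope there. Hence returning the excess \<open>e0 - ec\<close> gains at least
  \<open>K\<close> times as much entropy, for arbitrarily large \<open>K\<close>. The conclusion
  contains both facts needed later: the excess is small, and the entropy of the marginal is at least
  that of \<open>ucan\<close>.\<close>

lemma zero_temperature_asymptotics:
  assumes T: "T = 0" and K: "0 < K"
  shows "eventually (\<lambda>N. \<exists>e0\<ge>ec. int_energy mu bd (W N) = ennreal e0 \<and> K * (e0 - ec) \<le> sP (W N) - sP ucan) sequentially"
proof -
  have min: "int_energy mu bd ucan \<le> int_energy mu bd v" if "v \<in> P.MP" for v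
    using can T that by (simp add: is_canonical_def)
  have ec_E: "ec \<le> E"
  proof -
    have "int_energy mu bd ucan \<le> min_energy cmb_lin P mu bd"
      unfolding min_energy_def by (rule INF_greatest) (rule min)
    also have "\<dots> \<le> ennreal E" using E by (simp add: U_star_def)
    finally show ?thesis using ec E_nonneg by simp
  qed
  have UR: "UR = B.emin" by (rule B.zero_temperature(1)[OF T])
  obtain h \<eta> s3 where h: "0 < h" "0 < \<eta>" "(B.emin + h, s3) \<in> R.ES"
    "\<And>e s. (e, s) \<in> R.ES \<Longrightarrow> e \<le> B.emin + \<eta> \<Longrightarrow> K * (B.emin + h - e) \<le> s3 - s"
    using B.zero_temperature(2)[OF T K] by blast
  have "(\<lambda>N. (E - ec) / real N) \<longlonglongrightarrow> 0" by (rule lim_const_over_n)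
  then have "eventually (\<lambda>N. (E - ec) / real N < min h \<eta>) sequentially" using h by (intro order_tendstoD) auto
  then show ?thesis
    using eventually_gt_at_top[of 0]
  proof eventually_elim
    case (elim N)
    have N: "0 < N" by (rule elim(2))
    obtain e0 e1 s1 where e: "0 \<le> e0" "int_energy mu bd (W N) = ennreal e0" "(e1, s1) \<in> R.ES"
      "e1 = UR + (E - e0) / real N"
      "\<And>s'. (UR + (E - ec) / real N, s') \<in> R.ES \<Longrightarrow> sP ucan + real N * s' \<le> sP (W N) + real N * s1"
      by (fact equilibrium_comparison[OF N])
    have ec_e0: "ec \<le> e0" using min[OF W_MP[of N]] ec e(1,2) by simp
    have "(E - e0) / real N \<le> (E - ec) / real N" using ec_e0 by (intro divide_right_mono) auto
    then have e1: "e1 \<le> B.emin + \<eta>" "e1 < B.emin + h" "e1 \<le> UR + (E - ec) / real N" using elim(1) e(4) UR by auto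
    have slope: "K * (B.emin + h - e1) \<le> s3 - s1" by (rule h(4)[OF e(3) e1(1)])
    \<comment> \<open>The pair \<open>(e1, s1)\<close> of the averaged reservoir marginal is mixed
      with the fixed pair at \<open>emin + h\<close> so as to hit exactly the energy per copy of the
      competitor.\<close>
    define t where "t = (UR + (E - ec) / real N - e1) / (B.emin + h - e1)"
    have d: "0 < B.emin + h - e1" using e1(2) by simp
    have t: "0 \<le> t" "t \<le> 1" using e1 elim(1) UR d by (auto simp: t_def divide_le_eq_1)
    have td: "t * (B.emin + h - e1) = UR + (E - ec) / real N - e1" using d by (simp add: t_def)
    then have te: "(1 - t) * e1 + t * (B.emin + h) = UR + (E - ec) / real N" by (simp add: algebra_simps)
    from R.ES_mix[OF e(3) h(3) t] obtain s where s: "(UR + (E - ec) / real N, s) \<in> R.ES" "(1 - t) * s1 + t * s3 \<le> s"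
      unfolding te by blast
    have "K * (t * (B.emin + h - e1)) \<le> t * (s3 - s1)"
      using mult_left_mono[OF slope t(1)] by (simp add: mult.left_commute)
    then have "K * (UR + (E - ec) / real N - e1) \<le> s - s1"
      using s(2) unfolding td by (simp add: algebra_simps)
    then have "real N * (K * (UR + (E - ec) / real N - e1)) \<le> real N * (s - s1)" by (intro mult_left_mono) auto
    moreover have "real N * (K * (UR + (E - ec) / real N - e1)) = K * (e0 - ec)"
      using N by (simp add: e(4) field_simps)
    ultimately have "K * (e0 - ec) \<le> real N * s - real N * s1" by (simp add: right_diff_distrib)
    then have "K * (e0 - ec) \<le> sP (W N) - sP ucan" using e(5)[OF s(1)] by linarith
    then show ?case using ec_e0 e(2) by blast
  qed
qed

text \<open>Entropies are nonpositive, so the asymptotic inequalities bound the energies. The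
  midpoint defect is bounded by testing the optimality of \<open>ucan\<close> against the midpoint
  itself: directly in terms of free energy if \<open>T > 0\<close>, and through semicontinuity at
  the minimal energy if \<open>T = 0\<close>.\<close>

lemma bounded_energy_and_gap:
  shows "\<exists>k\<ge>0. int_energy mu bd ucan \<le> ennreal k \<and> eventually (\<lambda>N. int_energy mu bd (W N) \<le> ennreal k) sequentially"
    and "0 < \<epsilon> \<Longrightarrow> eventually (\<lambda>N. (H_int mu (W N) + H_int mu ucan) / 2 - H_int mu (P.mid (W N) ucan) \<le> \<epsilon>) sequentially"
proof -
  consider "0 < T" | "T = 0" using B.T by linarith
  then show "\<exists>k\<ge>0. int_energy mu bd ucan \<le> ennreal k \<and> eventually (\<lambda>N. int_energy mu bd (W N) \<le> ennreal k) sequentially"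
  proof cases
    case 1
    have sc: "sP ucan \<le> 0" by (rule sP_nonpos[OF ucan_MP ec(1)])
    define k where "k = ec - T * sP ucan + 1"
    have k: "ec \<le> k" using mult_nonneg_nonpos[of T "sP ucan"] 1 sc by (simp add: k_def)
    have "eventually (\<lambda>N. int_energy mu bd (W N) \<le> ennreal k) sequentially"
      using positive_temperature_asymptotics[OF 1 zero_less_one]
    proof eventually_elim
      case (elim N)
      then obtain e0 where e0: "0 \<le> e0" "int_energy mu bd (W N) = ennreal e0" "e0 - T * sP (W N) \<le> k"
        by (auto simp: k_def)
      have "T * sP (W N) \<le> 0" using 1 sP_nonpos[OF W_MP e0(2)] by (simp add: mult_le_0_iff)
      then have "e0 \<le> k" using e0(3) by linarith
      then show ?case unfolding e0(2) by (rule ennreal_leI)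
    qed
    then show ?thesis using k ec by (intro exI[of _ k]) (auto intro: ennreal_leI)
  next
    case 2
    have "eventually (\<lambda>N. int_energy mu bd (W N) \<le> ennreal (ec - sP ucan)) sequentially"
      using zero_temperature_asymptotics[OF 2 zero_less_one]
    proof eventually_elim
      case (elim N)
      then obtain e0 where e0: "int_energy mu bd (W N) = ennreal e0" "e0 - ec \<le> sP (W N) - sP ucan" by auto
      have "e0 \<le> ec - sP ucan" using e0(2) sP_nonpos[OF W_MP e0(1)] by linarith
      then show ?case unfolding e0(1) by (rule ennreal_leI)
    qed
    moreover have "ec \<le> ec - sP ucan" using sP_nonpos[OF ucan_MP ec(1)] by simp
    ultimately show ?thesis using ec by (intro exI[of _ "ec - sP ucan"]) (auto intro: ennreal_leI)
  qed
  show "eventually (\<lambda>N. (H_int mu (W N) + H_int mu ucan) / 2 - H_int mu (P.mid (W N) ucan) \<le> \<epsilon>) sequentially"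
    if \<epsilon>: "0 < \<epsilon>" for \<epsilon>
  proof -
    consider "0 < T" | "T = 0" using B.T by linarith
    then show ?thesis
    proof cases
      case 1
      \<comment> \<open>The midpoint takes half of the excess free energy, and passing from entropy
        to \<open>H_int\<close> costs the factor \<open>P.mass\<close>; this choice therefore ends
        in exactly \<open>\<epsilon>\<close>.\<close>
      have "0 < 2 * T * \<epsilon> / P.mass" using 1 \<epsilon> P.mass_pos by simp
      from positive_temperature_asymptotics[OF 1 this] show ?thesis
      proof eventually_elim
        case (elim N)
        then obtain e0 where e0: "0 \<le> e0" "int_energy mu bd (W N) = ennreal e0"
          "e0 - T * sP (W N) \<le> ec - T * sP ucan + 2 * T * \<epsilon> / P.mass" by blast
        define um where "um = P.mid (W N) ucan"
        note m = P.mid_MP[OF W_MP e0(2,1) ucan_MP ec, folded um_def]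
        have "entropy mu um = ereal (sP um)" unfolding sP_def by (rule P.finite_energy_H(3)[OF m(1)]) (simp add: m(2))
        moreover have "entropy mu ucan = ereal (sP ucan)" unfolding sP_def by (rule P.finite_energy_H(3)[OF ucan_MP ucan_energy])
        moreover have "free_energy mu bd T ucan \<le> free_energy mu bd T um" using can 1 m(1) by (simp add: is_canonical_def)
        ultimately have F: "ec - T * sP ucan \<le> (e0 + ec) / 2 - T * sP um"
          using ec e0(1) m(2) by (simp add: free_energy_def enn2ereal_ennreal)
        have "T * (sP um - (sP (W N) + sP ucan) / 2) = T * sP um - (T * sP (W N) + T * sP ucan) / 2"
          by (simp add: algebra_simps add_divide_distrib)
        also have "\<dots> \<le> T * \<epsilon> / P.mass" using F e0(3) by (simp add: field_simps)
        finally have "T * (sP um - (sP (W N) + sP ucan) / 2) \<le> T * (\<epsilon> / P.mass)" by simp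
        then have "sP um - (sP (W N) + sP ucan) / 2 \<le> \<epsilon> / P.mass" using 1 by (rule mult_left_le_imp_le)
        then have "P.mass * (sP um - (sP (W N) + sP ucan) / 2) \<le> \<epsilon>"
          using P.mass_pos by (simp add: pos_le_divide_eq mult.commute)
        then show ?case unfolding gap_eq um_def .
      qed
    next
      case 2
      have min: "int_energy mu bd ucan \<le> int_energy mu bd v" if "v \<in> P.MP" for v
        using can 2 that by (simp add: is_canonical_def)
      have ec_min: "min_energy cmb_lin P mu bd = ennreal ec"
      proof (rule antisym)
        show "min_energy cmb_lin P mu bd \<le> ennreal ec" using P.min_energy_le[OF ucan_MP] ec by simp
        show "ennreal ec \<le> min_energy cmb_lin P mu bd"
          unfolding min_energy_def ec(1)[symmetric] by (rule INF_greatest) (rule min)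
      qed
      obtain w where w: "w \<in> P.MP" "int_energy mu bd w = min_energy cmb_lin P mu bd"
        "\<forall>\<epsilon>>0. \<exists>\<eta>>0. \<forall>u\<in>P.MP. int_energy mu bd u \<le> min_energy cmb_lin P mu bd + ennreal \<eta>
          \<longrightarrow> H_int mu w \<le> H_int mu u + \<epsilon>"
        by (rule bexE[OF P.usc_at_min], elim conjE, rule that)
      from w(3)[rule_format, OF \<epsilon>] obtain \<eta> where eta: "0 < \<eta>"
        "\<And>u. u \<in> P.MP \<Longrightarrow> int_energy mu bd u \<le> min_energy cmb_lin P mu bd + ennreal \<eta> \<Longrightarrow> H_int mu w \<le> H_int mu u + \<epsilon>" by blast
      \<comment> \<open>\<open>ucan\<close> and \<open>w\<close> both minimize the energy, and
        \<open>ucan\<close> has maximal entropy among such states; so the semicontinuity estimate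
        for \<open>w\<close> carries over to \<open>ucan\<close>.\<close>
      have Hw: "H_int mu ucan \<le> H_int mu w"
      proof -
        have wmin: "int_energy mu bd w \<le> int_energy mu bd v" if "v \<in> P.MP" for v
          unfolding w(2) by (rule P.min_energy_le[OF that])
        then have "entropy mu w \<le> entropy mu ucan" using can 2 w(1) by (simp add: is_canonical_def)
        moreover have "entropy mu w = ereal (- H_int mu w / P.mass)"
          by (rule P.finite_energy_H(3)[OF w(1)]) (simp add: w(2) ec_min)
        moreover have "entropy mu ucan = ereal (- H_int mu ucan / P.mass)"
          by (rule P.finite_energy_H(3)[OF ucan_MP ucan_energy])
        ultimately show ?thesis using P.mass_pos by (simp add: divide_le_cancel)
      qed
      \<comment> \<open>As \<open>sP (W N) \<le> 0\<close>, the asymptotics give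
        \<open>K * (e0 - ec) \<le> - sP ucan\<close>; this \<open>K\<close> makes the excess at most
        \<open>\<eta>\<close>. The 1 only ensures that \<open>K\<close> is positive.\<close>
      define K where "K = (1 - sP ucan) / \<eta>"
      have sc: "sP ucan \<le> 0" by (rule sP_nonpos[OF ucan_MP ec(1)])
      have K: "0 < K" using sc eta(1) by (simp add: K_def)
      from zero_temperature_asymptotics[OF 2 K] show ?thesis
      proof eventually_elim
        case (elim N)
        then obtain e0 where e0: "ec \<le> e0" "int_energy mu bd (W N) = ennreal e0" "K * (e0 - ec) \<le> sP (W N) - sP ucan" by blast
        have e00: "0 \<le> e0" using e0(1) ec(2) by simp
        define um where "um = P.mid (W N) ucan"
        note m = P.mid_MP[OF W_MP e0(2) e00 ucan_MP ec, folded um_def]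
        have s0: "sP (W N) \<le> 0" by (rule sP_nonpos[OF W_MP e0(2)])
        have "K * (e0 - ec) \<le> K * \<eta>"
        proof -
          have "K * \<eta> = 1 - sP ucan" using eta(1) by (simp add: K_def)
          then show ?thesis using e0(3) s0 by linarith
        qed
        then have "e0 - ec \<le> \<eta>" using K by simp
        then have "(e0 + ec) / 2 \<le> ec + \<eta>" using eta(1) by simp
        then have "int_energy mu bd um \<le> min_energy cmb_lin P mu bd + ennreal \<eta>"
          unfolding m(2) ec_min using ec(2) eta(1) by (simp add: ennreal_leI flip: ennreal_plus)
        then have "H_int mu w \<le> H_int mu um + \<epsilon>" by (rule eta(2)[OF m(1)])
        then have 1: "H_int mu ucan \<le> H_int mu um + \<epsilon>" using Hw by simp
        have "0 \<le> K * (e0 - ec)" using K e0(1) by simp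
        then have "sP ucan \<le> sP (W N)" using e0(3) by simp
        then have "H_int mu (W N) \<le> H_int mu ucan" using P.mass_pos by (simp add: sP_def divide_le_cancel)
        moreover have "(a + c) / 2 - b \<le> \<epsilon>" if "a \<le> c" "c \<le> b + \<epsilon>" for a b c :: real
          using that by (simp add: field_simps)
        ultimately show ?case using 1 unfolding um_def by blast
      qed
    qed
  qed
qed

end

theorem mainTheorem20:
  fixes P :: "'a::euclidean_space set" and mu bd :: "'a measure"
    and PR :: "'b::euclidean_space set" and muR bdR :: "'b measure"
    and E TR UR :: real
    and ut :: "nat \<Rightarrow> 'a \<times> (nat \<Rightarrow> 'b) \<Rightarrow> ennreal"
    and ucan :: "'a \<Rightarrow> ennreal"
  assumes sysP: "is_system P mu bd" and dim: "DIM('a) \<ge> 2"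
    and unstP: "K_unstable cmb_lin P mu bd"
    and sysR: "is_system PR muR bdR" and mildR: "mild cmb_lin PR muR bdR"
    and E: "E \<in> U_star cmb_lin P mu bd"
    and TR: "0 \<le> TR"
    and UR: "UR \<in> U_star cmb_lin PR muR bdR" "ereal TR \<in> T_eq cmb_lin PR muR bdR UR"
    and eq: "\<And>N. is_equilibrium cmb_prod (comp_set P PR N) (comp_mu mu muR N)
                   (comp_sigma mu bd muR bdR N) (E + real N * UR) (ut N)"
    and can: "is_canonical cmb_lin P mu bd TR ucan"
  shows "(\<forall>N. marginal muR N (ut N) \<in> M_class cmb_lin P mu 1) \<and>
         (\<forall>p. 1 \<le> p \<and> p < real DIM('a) / (real DIM('a) - 1) \<longrightarrow>
              ((\<lambda>N. Lp_dist_p mu p (marginal muR N (ut N)) ucan) \<longlongrightarrow> 0) sequentially)"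
proof -
  interpret P: system P mu bd using sysP by unfold_locales
  interpret R: system PR muR bdR using sysR by unfold_locales
  interpret bath_system P mu bd PR muR bdR TR UR E ut ucan
    using sysP sysR mildR E TR UR eq can by unfold_locales
  obtain k where k: "0 \<le> k" "int_energy mu bd ucan \<le> ennreal k"
    "eventually (\<lambda>N. int_energy mu bd (marginal muR N (ut N)) \<le> ennreal k) sequentially"
    using bounded_energy_and_gap(1) by blast
  show ?thesis
    using W_MP P.Lp_convergence[OF W_MP ucan_MP k bounded_energy_and_gap(2) _ _ dim] by blast
qed

end
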